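(* Suppose that $f(X)\in L^2$, $\tilde f(X_1,\dots,X_{\tilde d})\in L^2$, $\mu>0$, and $f(X)\ge0$ a.s. For either choice of sign $\pm$ let $$\tilde V_\pm(x):=\frac{\tilde U_{N_\pm(x)}-\mu^{-\tilde d}\,\tilde\mu\,(\tilde d!)^{-1}x^{\tilde d}}{x^{\tilde d-1/2}}.$$ (i) If $f(X)$ is nonarithmetic, then $\tilde V_\pm(x)\overset{\mathrm d}{\longrightarrow}N(0,\gamma^2)$ and $R(x)\overset{\mathrm d}{\longrightarrow}R_\infty$ hold jointly as $x\to\infty$ (i.e., the pair $(\tilde V_\pm(x),R(x))$ converges in distribution, with these marginal limits). (ii) If $f(X)$ has span $h>0$, then $\tilde V_\pm(x)\overset{\mathrm d}{\longrightarrow}N(0,\gamma^2)$ and $R(x)\overset{\mathrm d}{\longrightarrow}R_\infty$ hold jointly as $x\to\infty$ with $x\in h\mathbb Z$. (iii) If $f(X)$ is integer-valued, then for every fixed integer $k\ge1$, $\tilde V_\pm(x)\overset{\mathrm d}{\longrightarrow}N(0,\gamma^2)$ holds also conditioned on $R(x)=k$, as $x\to\infty$ through the integers. Moreover, $\tilde V_\pm(x)\overset{\mathrm d}{\longrightarrow}N(0,\gamma^2)$ holds also conditioned on $U_{N_-(x)}=x$, as $x\to\infty$ through the integers. (In both cases only those $x$ are considered for which the conditioning event has positive probability.)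
   Context: $X,X_1,X_2,\dots$ is an i.i.d. sequence of random variables with values in an arbitrary measurable space $(S,\mathcal S)$; $\tilde d\ge1$ is a fixed integer, and $f:S\to\mathbb R$, $\tilde f:S^{\tilde d}\to\mathbb R$ are measurable (no symmetry assumed). For $n\ge0$, $U_n:=\sum_{i=1}^nf(X_i)$ and $\tilde U_n:=\sum_{1\le i_1<\dots<i_{\tilde d}\le n}\tilde f(X_{i_1},\dots,X_{i_{\tilde d}})$; $\mu:=\mathbb Ef(X)$, $\tilde\mu:=\mathbb E\tilde f(X_1,\dots,X_{\tilde d})$, and $\tilde f_i(x):=\mathbb E\tilde f(X_1,\dots,X_{i-1},x,X_{i+1},\dots,X_{\tilde d})-\tilde\mu$ for $1\le i\le\tilde d$. For $x>0$, $N_-(x):=\sup\{n\ge0:U_n\le x\}$, $N_+(x):=\inf\{n\ge0:U_n>x\}$ (a.s. finite when $\mu>0$), and the overshoot is $R(x):=U_{N_+(x)}-x>0$. The constant $\gamma^2$ is $$\gamma^2:=\mu^{1-2\tilde d}\sum_{i,j=1}^{\tilde d}\frac{(i+j-2)!\,(2\tilde d-i-j)!}{(i-1)!\,(j-1)!\,(\tilde d-i)!\,(\tilde d-j)!\,(2\tilde d-1)!}\operatorname{Cov}\bigl(\tilde f_i(X),\tilde f_j(X)\bigr)-2\frac{\mu^{-2\tilde d}\tilde\mu}{(\tilde d-1)!\,\tilde d!}\sum_{i=1}^{\tilde d}\operatorname{Cov}\bigl(f(X),\tilde f_i(X)\bigr)+\frac{\mu^{-2\tilde d-1}\tilde\mu^2}{(\tilde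 d-1)!^2}\operatorname{Var}\bigl(f(X)\bigr),$$ and $N(0,0)$ is the point mass at $0$. A random variable $Y$ has span $h>0$ if $Y\in h\mathbb Z$ a.s. and $h$ is maximal with this property; $Y$ is nonarithmetic if no such $h$ exists. $R_\infty$ is a random variable with the following distribution: if $f(X)$ is nonarithmetic, $\mathbb P(R_\infty\le y)=\frac1\mu\int_0^y\mathbb P(f(X)>s)\,\mathrm ds$, $y\ge0$; if $f(X)$ has span $h>0$, $\mathbb P(R_\infty=kh)=\frac h\mu\,\mathbb P(f(X)\ge kh)$, $k=1,2,\dots$. *)

theory Defs
  imports "HOL-Probability.Probability"
begin

text \<open>
  Conventions. The process \<open>X :: nat \<Rightarrow> 'w \<Rightarrow> 's\<close> lists the sequence \<open>X, X\<^sub>1, X\<^sub>2, \<dots>\<close>, with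
  \<open>X 0\<close> as the generic copy, so that sums run over indices \<open>\<ge> 1\<close>.
  A point of \<open>S\<^sup>d\<close> is an element of \<open>\<Pi>\<^sub>E j\<in>{1..d}. S\<close>.
\<close>

section \<open>The processes\<close>

definition renewal_sum :: "('s \<Rightarrow> real) \<Rightarrow> (nat \<Rightarrow> 'w \<Rightarrow> 's) \<Rightarrow> nat \<Rightarrow> 'w \<Rightarrow> real" where
  "renewal_sum f X n \<omega> = (\<Sum>i=1..n. f (X i \<omega>))"

definition increasing_tuples :: "nat \<Rightarrow> nat \<Rightarrow> (nat \<Rightarrow> nat) set" where
  "increasing_tuples d n = {i \<in> {1..d} \<rightarrow>\<^sub>E {1..n}. strict_mono_on {1..d} i}"

definition ustat ::
  "nat \<Rightarrow> ((nat \<Rightarrow> 's) \<Rightarrow> real) \<Rightarrow> (nat \<Rightarrow> 'w \<Rightarrow> 's) \<Rightarrow> nat \<Rightarrow> 'w \<Rightarrow> real" where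
  "ustat d g X n \<omega> = (\<Sum>i\<in>increasing_tuples d n. g (\<lambda>j\<in>{1..d}. X (i j) \<omega>))"

text \<open>
  In the setting of interest the supremum (over \<open>nat\<close>) is taken over a set that is almost surely
  finite and the infimum over a set that is almost surely nonempty; on the exceptional null event
  the values are irrelevant.
\<close>

definition N_minus :: "('s \<Rightarrow> real) \<Rightarrow> (nat \<Rightarrow> 'w \<Rightarrow> 's) \<Rightarrow> real \<Rightarrow> 'w \<Rightarrow> nat" where
  "N_minus f X x \<omega> = Sup {n. renewal_sum f X n \<omega> \<le> x}"

definition N_plus :: "('s \<Rightarrow> real) \<Rightarrow> (nat \<Rightarrow> 'w \<Rightarrow> 's) \<Rightarrow> real \<Rightarrow> 'w \<Rightarrow> nat" where
  "N_plus f X x \<omega> = Inf {n. renewal_sum f X n \<omega> > x}"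

definition overshoot :: "('s \<Rightarrow> real) \<Rightarrow> (nat \<Rightarrow> 'w \<Rightarrow> 's) \<Rightarrow> real \<Rightarrow> 'w \<Rightarrow> real" where
  "overshoot f X x \<omega> = renewal_sum f X (N_plus f X x \<omega>) \<omega> - x"

section \<open>The constants\<close>

definition mean_f :: "'w measure \<Rightarrow> ('s \<Rightarrow> real) \<Rightarrow> (nat \<Rightarrow> 'w \<Rightarrow> 's) \<Rightarrow> real" where
  "mean_f M f X = (\<integral>\<omega>. f (X 0 \<omega>) \<partial>M)"

definition mean_kernel ::
  "'w measure \<Rightarrow> nat \<Rightarrow> ((nat \<Rightarrow> 's) \<Rightarrow> real) \<Rightarrow> (nat \<Rightarrow> 'w \<Rightarrow> 's) \<Rightarrow> real" where
  "mean_kernel M d g X = (\<integral>\<omega>. g (\<lambda>j\<in>{1..d}. X j \<omega>) \<partial>M)"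

definition kernel_proj ::
  "'w measure \<Rightarrow> nat \<Rightarrow> ((nat \<Rightarrow> 's) \<Rightarrow> real) \<Rightarrow> (nat \<Rightarrow> 'w \<Rightarrow> 's) \<Rightarrow> nat \<Rightarrow> 's \<Rightarrow> real" where
  "kernel_proj M d g X i x =
     (\<integral>\<omega>. g (\<lambda>j\<in>{1..d}. if j = i then x else X j \<omega>) \<partial>M) - mean_kernel M d g X"

definition covar :: "'w measure \<Rightarrow> ('w \<Rightarrow> real) \<Rightarrow> ('w \<Rightarrow> real) \<Rightarrow> real" where
  "covar M Y Z = (\<integral>\<omega>. (Y \<omega> - (\<integral>\<omega>'. Y \<omega>' \<partial>M)) * (Z \<omega> - (\<integral>\<omega>'. Z \<omega>' \<partial>M)) \<partial>M)"

definition gamma_sq ::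
  "'w measure \<Rightarrow> nat \<Rightarrow> ('s \<Rightarrow> real) \<Rightarrow> ((nat \<Rightarrow> 's) \<Rightarrow> real) \<Rightarrow> (nat \<Rightarrow> 'w \<Rightarrow> 's) \<Rightarrow> real" where
  "gamma_sq M d f g X =
    (let \<mu> = mean_f M f X;
         \<mu>' = mean_kernel M d g X;
         fX = (\<lambda>\<omega>. f (X 0 \<omega>));
         gX = (\<lambda>i \<omega>. kernel_proj M d g X i (X 0 \<omega>))
     in \<mu> powi (1 - 2 * int d) *
          (\<Sum>i=1..d. \<Sum>j=1..d.
             fact (i + j - 2) * fact (2 * d - i - j) /
             (fact (i - 1) * fact (j - 1) * fact (d - i) * fact (d - j) * fact (2 * d - 1)) *
             covar M (gX i) (gX j))
        - 2 * (\<mu> powi (- 2 * int d) * \<mu>' / (fact (d - 1) * fact d)) *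
          (\<Sum>i=1..d. covar M fX (gX i))
        + \<mu> powi (- 2 * int d - 1) * \<mu>'^2 / (fact (d - 1))^2 * covar M fX fX)"

text \<open>The stopping index \<open>N x \<omega>\<close> is a parameter, to be instantiated with \<open>N_minus\<close> or \<open>N_plus\<close>.\<close>

definition V_stat ::
  "'w measure \<Rightarrow> nat \<Rightarrow> ('s \<Rightarrow> real) \<Rightarrow> ((nat \<Rightarrow> 's) \<Rightarrow> real) \<Rightarrow> (nat \<Rightarrow> 'w \<Rightarrow> 's) \<Rightarrow>
    (real \<Rightarrow> 'w \<Rightarrow> nat) \<Rightarrow> real \<Rightarrow> 'w \<Rightarrow> real" where
  "V_stat M d f g X N x \<omega> =
     (ustat d g X (N x \<omega>) \<omega>
       - mean_f M f X powi (- int d) * mean_kernel M d g X / fact d * x ^ d)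
     / x powr (real d - 1/2)"

section \<open>Span and limit laws\<close>

definition multiples :: "real \<Rightarrow> real set" where
  "multiples h = range (\<lambda>k::int. of_int k * h)"

definition has_span :: "'w measure \<Rightarrow> ('w \<Rightarrow> real) \<Rightarrow> real \<Rightarrow> bool" where
  "has_span M Y h \<longleftrightarrow> h > 0 \<and> (AE \<omega> in M. Y \<omega> \<in> multiples h) \<and>
     (\<forall>h'>0. (AE \<omega> in M. Y \<omega> \<in> multiples h') \<longrightarrow> h' \<le> h)"

definition nonarithmetic :: "'w measure \<Rightarrow> ('w \<Rightarrow> real) \<Rightarrow> bool" where
  "nonarithmetic M Y \<longleftrightarrow> \<not> (\<exists>h. has_span M Y h)"

text \<open>The law \<open>N(0,v)\<close> for \<open>v \<ge> 0\<close>; note that \<open>normal_density\<close> takes the standard deviation.\<close>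

definition centered_normal :: "real \<Rightarrow> real measure" where
  "centered_normal v =
     (if v = 0 then return borel 0 else density lborel (normal_density 0 (sqrt v)))"

definition overshoot_limit_nonarith ::
  "'w measure \<Rightarrow> ('s \<Rightarrow> real) \<Rightarrow> (nat \<Rightarrow> 'w \<Rightarrow> 's) \<Rightarrow> real measure \<Rightarrow> bool" where
  "overshoot_limit_nonarith M f X \<rho> \<longleftrightarrow> real_distribution \<rho> \<and>
     (\<forall>y\<ge>0. cdf \<rho> y =
        1 / mean_f M f X * (LBINT s:{0..y}. measure M {\<omega> \<in> space M. f (X 0 \<omega>) > s}))"

definition overshoot_limit_span ::
  "'w measure \<Rightarrow> ('s \<Rightarrow> real) \<Rightarrow> (nat \<Rightarrow> 'w \<Rightarrow> 's) \<Rightarrow> real \<Rightarrow> real measure \<Rightarrow> bool" where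
  "overshoot_limit_span M f X h \<rho> \<longleftrightarrow> real_distribution \<rho> \<and>
     (\<forall>k::nat. k \<ge> 1 \<longrightarrow> measure \<rho> {real k * h} =
        h / mean_f M f X * measure M {\<omega> \<in> space M. f (X 0 \<omega>) \<ge> real k * h})"

section \<open>Convergence in distribution\<close>

text \<open>
  The library's \<open>weak_conv_m\<close> covers only sequences of laws on the real line. Here the parameter
  runs along an arbitrary filter and laws on any topological space are allowed.
\<close>

definition weak_conv_along ::
  "('i \<Rightarrow> 'a::topological_space measure) \<Rightarrow> 'a measure \<Rightarrow> 'i filter \<Rightarrow> bool" where
  "weak_conv_along L \<nu> F \<longleftrightarrow>
     (\<forall>\<phi>::'a \<Rightarrow> real. continuous_on UNIV \<phi> \<and> bounded (range \<phi>) \<longrightarrow>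
        ((\<lambda>i. \<integral>y. \<phi> y \<partial>L i) \<longlongrightarrow> (\<integral>y. \<phi> y \<partial>\<nu>)) F)"

lemma weak_conv_along_sequentially_iff:
  assumes "\<And>n. real_distribution (L n)" and "real_distribution \<nu>"
  shows "weak_conv_along L \<nu> sequentially \<longleftrightarrow> weak_conv_m L \<nu>"
proof
  assume *: "weak_conv_along L \<nu> sequentially"
  show "weak_conv_m L \<nu>"
  proof (rule integral_bdd_continuous_conv_imp_weak_conv[OF assms])
    fix \<phi> :: "real \<Rightarrow> real" assume "\<And>x. isCont \<phi> x" "\<And>x. \<bar>\<phi> x\<bar> \<le> 1"
    then have "continuous_on UNIV \<phi>" "bounded (range \<phi>)"
      by (auto simp: continuous_on_eq_continuous_at bounded_iff)
    with * show "(\<lambda>n. integral\<^sup>L (L n) \<phi>) \<longlonglongrightarrow> integral\<^sup>L \<nu> \<phi>"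
      by (auto simp: weak_conv_along_def)
  qed
next
  assume *: "weak_conv_m L \<nu>"
  show "weak_conv_along L \<nu> sequentially"
    unfolding weak_conv_along_def
  proof (intro allI impI, elim conjE)
    fix \<phi> :: "real \<Rightarrow> real" assume "continuous_on UNIV \<phi>" "bounded (range \<phi>)"
    then obtain B where "\<And>x. isCont \<phi> x" "\<And>x. norm (\<phi> x) \<le> B"
      by (auto simp: continuous_on_eq_continuous_at bounded_iff)
    then show "(\<lambda>n. integral\<^sup>L (L n) \<phi>) \<longlonglongrightarrow> integral\<^sup>L \<nu> \<phi>"
      by (intro weak_conv_imp_integral_bdd_continuous_conv[OF assms *])
  qed
qed

text \<open>
  The pair \<open>(V\<^sub>x, R\<^sub>x)\<close> converges in distribution along \<open>F\<close> to some law on the plane whose first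
  marginal is \<open>\<mu>\<close> and whose second marginal satisfies \<open>Q\<close>.
\<close>

definition joint_conv ::
  "'w measure \<Rightarrow> ('i \<Rightarrow> 'w \<Rightarrow> real) \<Rightarrow> ('i \<Rightarrow> 'w \<Rightarrow> real) \<Rightarrow> real measure \<Rightarrow>
    (real measure \<Rightarrow> bool) \<Rightarrow> 'i filter \<Rightarrow> bool" where
  "joint_conv M V R \<mu> Q F \<longleftrightarrow>
     (\<exists>\<nu> :: (real \<times> real) measure. prob_space \<nu> \<and> sets \<nu> = sets borel \<and>
        distr \<nu> borel fst = \<mu> \<and> Q (distr \<nu> borel snd) \<and>
        weak_conv_along (\<lambda>x. distr M borel (\<lambda>\<omega>. (V x \<omega>, R x \<omega>))) \<nu> F)"

text \<open>
  \<open>V\<^sub>x\<close> converges in distribution to \<open>\<mu>\<close> conditioned on the event \<open>A\<^sub>x\<close>, as \<open>x \<rightarrow> \<infinity>\<close> through those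
  integers with \<open>P(A\<^sub>x) > 0\<close>; for such \<open>x\<close>, \<open>uniform_measure M (A x)\<close> is \<open>P(\<cdot> | A\<^sub>x)\<close>.
\<close>

definition cond_conv_integers ::
  "'w measure \<Rightarrow> (real \<Rightarrow> 'w \<Rightarrow> real) \<Rightarrow> (real \<Rightarrow> 'w set) \<Rightarrow> real measure \<Rightarrow> bool" where
  "cond_conv_integers M V A \<mu> \<longleftrightarrow>
     weak_conv_along (\<lambda>x. distr (uniform_measure M (A x)) borel (V x)) \<mu>
       (at_top \<sqinter> principal {x \<in> \<int>. measure M (A x) > 0})"

end

(*
Renewal part: the expected value E psi(R(x)) solves a renewal equation. A bounded solution of the
equation flattens out along x -> infinity because the oscillations over a step of the walk decay in
quadratic mean, and its constant limit is identified by integrating the equation over a half-line.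

U-statistic part: at a deterministic index n slightly below x/mu (by about x^(3/5)), the centred
U-statistic is approximated in L2 by its Hajek projection, a weighted sum of independent terms
whose characteristic functions are compared with the normal one. Monotonicity on a coarse grid shows that the statistic, corrected
by a multiple of U_n - mu n, hardly changes between n and N(x).

Joint convergence: the resulting linear statistic depends on the first n steps only, whereas after
step n the walk still has to cover a distance tending to infinity; given the first n steps, the law of
the overshoot is therefore close to its limit, which makes the two limits independent. In the lattice
case the conditioning events of (iii) coincide almost surely with events R(y) = j h at a nearby
lattice point y.
*)

theory Submission
 imports Defs "HOL-Real_Asymp.Real_Asymp"
begin

section \<open>A convolution equation on the line\<close>

text \<open>The index N(x) depends on the whole path, while independence is available only at a
  deterministic time; hence a window of indices. It must be longer than sqrt x, to contain N(x) with
  probability tending to 1, and the statistic must hardly move over it. With p of order x^(1/5), a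
  window of length 2 p^3 and a grid of mesh p^2, the increments over the grid have relative mean
  square of order p^4 / x, which tends to 0, while p^3 exceeds sqrt x. The correction by U_n - \<mu>
  n comes from linearising \<open>N choose d\<close> at x / \<mu>, where N - x / \<mu> is close to
  -(U_n - \<mu> n) / \<mu>. It produces the terms of the limit variance that involve f; the
  factorials of the double sum come from sums of products of binomial weights. In the renewal part
  squares help because one-step mean square increments of a solution telescope. A solution may be
  discontinuous, so for a nonarithmetic step only averages over short intervals of levels are
  reached at first; the averaging is undone by comparing overshoots at neighbouring levels.\<close>

lemma (in prob_space) square_integral_le:
 fixes h :: "'a \<Rightarrow> real"
 assumes "integrable M h" "integrable M (\<lambda>s. (h s)\<^sup>2)"
 shows "(\<integral>s. h s \<partial>M)\<^sup>2 \<le> (\<integral>s. (h s)\<^sup>2 \<partial>M)"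
 using variance_eq[OF assms] variance_positive[of h] by simp

definition bdd_borel :: "(real \<Rightarrow> real) \<Rightarrow> bool" where
 "bdd_borel w \<longleftrightarrow> w \<in> borel_measurable borel \<and> (\<exists>B. \<forall>x. \<bar>w x\<bar> \<le> B)"

lemma bdd_borelD [measurable_dest]: "bdd_borel w \<Longrightarrow> w \<in> borel_measurable borel"
 by (simp add: bdd_borel_def)

lemma bdd_borelE:
 assumes "bdd_borel w"
 obtains B where "\<And>x. \<bar>w x\<bar> \<le> B"
 using assms unfolding bdd_borel_def by blast

lemma bdd_borelI: "w \<in> borel_measurable borel \<Longrightarrow> (\<And>x. \<bar>w x\<bar> \<le> B) \<Longrightarrow> bdd_borel w"
 by (auto simp: bdd_borel_def)

lemma bdd_borel_add: assumes "bdd_borel u" "bdd_borel v" shows "bdd_borel (\<lambda>x. u x + v x)"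
proof -
 obtain A where A: "\<And>x. \<bar>u x\<bar> \<le> A" using bdd_borelE[OF assms(1)] by blast
 obtain B where B: "\<And>x. \<bar>v x\<bar> \<le> B" using bdd_borelE[OF assms(2)] by blast
 show ?thesis
 proof (rule bdd_borelI)
  show "(\<lambda>x. u x + v x) \<in> borel_measurable borel" using assms[THEN bdd_borelD] by simp
  show "\<bar>u x + v x\<bar> \<le> A + B" for x using A[of x] B[of x] by linarith
 qed
qed

lemma bdd_borel_mult: assumes "bdd_borel u" "bdd_borel v" shows "bdd_borel (\<lambda>x. u x * v x)"
proof -
 obtain A where A: "\<And>x. \<bar>u x\<bar> \<le> A" using bdd_borelE[OF assms(1)] by blast
 obtain B where B: "\<And>x. \<bar>v x\<bar> \<le> B" using bdd_borelE[OF assms(2)] by blast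
 show ?thesis
 proof (rule bdd_borelI)
  show "(\<lambda>x. u x * v x) \<in> borel_measurable borel" using assms[THEN bdd_borelD] by simp
  show "\<bar>u x * v x\<bar> \<le> A * B" for x
   unfolding abs_mult using A[of x] B[of x] by (intro mult_mono) auto
 qed
qed

lemma bdd_borel_const: "bdd_borel (\<lambda>x. c)"
 by (rule bdd_borelI[where B="\<bar>c\<bar>"]) auto

lemma bdd_borel_diff: assumes "bdd_borel u" "bdd_borel v" shows "bdd_borel (\<lambda>x. u x - v x)"
 using bdd_borel_add[OF assms(1) bdd_borel_mult[OF bdd_borel_const[of "-1"] assms(2)]] by simp

lemma bdd_borel_power2: "bdd_borel u \<Longrightarrow> bdd_borel (\<lambda>x. (u x)\<^sup>2)"
 unfolding power2_eq_square by (rule bdd_borel_mult)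

lemma bdd_borel_sum: "(\<And>i. i \<in> I \<Longrightarrow> bdd_borel (u i)) \<Longrightarrow> bdd_borel (\<lambda>x. \<Sum>i\<in>I. u i x)"
 by (induction I rule: infinite_finite_induct) (auto intro: bdd_borel_add bdd_borel_const)

section \<open>Backward averaging along a nonnegative step and its mean square oscillation\<close>

locale nonneg_step = prob_space K for K :: "'s measure" +
 fixes Y :: "'s \<Rightarrow> real"
 assumes Y_measurable [measurable]: "Y \<in> borel_measurable K"
  and Y_nonneg: "\<And>s. Y s \<ge> 0"
  and Y_integrable: "integrable K Y"
  and Y_mean_pos: "(\<integral>s. Y s \<partial>K) > 0"
begin

text \<open>Transition operator of the walk run downwards: \<open>(step ^^ n) w x\<close> is the
  mean of \<open>w\<close> at x minus a sum of n independent steps.\<close>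

definition step :: "(real \<Rightarrow> real) \<Rightarrow> real \<Rightarrow> real" where
 "step w x = (\<integral>s. w (x - Y s) \<partial>K)"

text \<open>If \<open>step w = w\<close>, this is \<open>step\<close> of the square minus the
  square, so its sums along the iterates telescope.\<close>

definition osc :: "(real \<Rightarrow> real) \<Rightarrow> real \<Rightarrow> real" where
 "osc w x = (\<integral>s. (w (x - Y s) - w x)\<^sup>2 \<partial>K)"

lemma step_integrable: assumes w: "bdd_borel w" shows "integrable K (\<lambda>s. w (x - Y s))"
proof -
 obtain B where "\<And>x. \<bar>w x\<bar> \<le> B" using bdd_borelE[OF w] by blast
 moreover have [measurable]: "w \<in> borel_measurable borel" using w by (rule bdd_borelD)
 ultimately show ?thesis by (intro integrable_const_bound[where B=B]) auto
qed

lemma step_abs_le: assumes w: "bdd_borel w" and B: "\<And>x. \<bar>w x\<bar> \<le> B" shows "\<bar>step w x\<bar> \<le> B"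
proof -
 have "\<bar>step w x\<bar> \<le> (\<integral>s. \<bar>w (x - Y s)\<bar> \<partial>K)" unfolding step_def by (rule integral_abs_bound)
 also have "\<dots> \<le> (\<integral>s. B \<partial>K)" using B step_integrable[OF w] by (intro integral_mono) auto
 finally show ?thesis by (simp add: prob_space)
qed

lemma step_le: assumes w: "bdd_borel w" and B: "\<And>x. w x \<le> B" shows "step w x \<le> B"
proof -
 have "step w x \<le> (\<integral>s. B \<partial>K)" unfolding step_def using B step_integrable[OF w] by (intro integral_mono) auto
 then show ?thesis by (simp add: prob_space)
qed

lemma bdd_borel_step: assumes w: "bdd_borel w" shows "bdd_borel (step w)"
proof -
 obtain B where B: "\<And>x. \<bar>w x\<bar> \<le> B" using bdd_borelE[OF w] by blast
 have [measurable]: "w \<in> borel_measurable borel" using w by (rule bdd_borelD)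
 show ?thesis
  by (rule bdd_borelI[where B=B]) (auto simp: step_abs_le[OF w B], unfold step_def[abs_def], measurable)
qed

lemma bdd_borel_step_pow: "bdd_borel w \<Longrightarrow> bdd_borel ((step ^^ n) w)"
 by (induction n) (auto intro: bdd_borel_step)

lemma step_add: assumes "bdd_borel u" "bdd_borel v"
 shows "step (\<lambda>x. u x + v x) = (\<lambda>x. step u x + step v x)"
 using assms by (auto simp: step_def fun_eq_iff step_integrable)

lemma step_diff: assumes "bdd_borel u" "bdd_borel v"
 shows "step (\<lambda>x. u x - v x) = (\<lambda>x. step u x - step v x)"
 using assms by (auto simp: step_def fun_eq_iff step_integrable)

lemma step_mono: assumes "bdd_borel u" "bdd_borel v" "\<And>x. u x \<le> v x"
 shows "step u x \<le> step v x"
 unfolding step_def using assms by (intro integral_mono) (auto simp: step_integrable)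

lemma osc_eq: assumes w: "bdd_borel w"
 shows "osc w x = step (\<lambda>x. (w x)\<^sup>2) x - 2 * w x * step w x + (w x)\<^sup>2"
proof -
 have "osc w x = (\<integral>s. (w (x - Y s))\<^sup>2 - 2 * w x * w (x - Y s) + (w x)\<^sup>2 \<partial>K)"
  unfolding osc_def by (intro Bochner_Integration.integral_cong) (auto simp: power2_diff algebra_simps)
 also have "\<dots> = step (\<lambda>x. (w x)\<^sup>2) x - 2 * w x * step w x + (w x)\<^sup>2"
  using step_integrable[OF w] step_integrable[OF bdd_borel_power2[OF w]]
  by (simp add: step_def prob_space)
 finally show ?thesis .
qed

lemma bdd_borel_osc: assumes w: "bdd_borel w" shows "bdd_borel (osc w)"
proof -
 have "osc w = (\<lambda>x. step (\<lambda>x. (w x)\<^sup>2) x - 2 * w x * step w x + (w x)\<^sup>2)"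
  using osc_eq[OF w] by (simp add: fun_eq_iff)
 then show ?thesis using w
  by (auto intro!: bdd_borel_add bdd_borel_diff bdd_borel_mult bdd_borel_const bdd_borel_step bdd_borel_power2)
qed

lemma osc_nonneg: "osc w x \<ge> 0"
 unfolding osc_def by simp

lemma osc_integrable: assumes w: "bdd_borel w" shows "integrable K (\<lambda>s. (w (x - Y s) - w x)\<^sup>2)"
proof -
 have "bdd_borel (\<lambda>z. (w z - w x)\<^sup>2)"
  by (intro bdd_borel_power2 bdd_borel_diff w bdd_borel_const)
 from step_integrable[OF this] show ?thesis .
qed

lemma osc_add_le: assumes u: "bdd_borel u" and v: "bdd_borel v"
 shows "osc (\<lambda>x. u x + v x) x \<le> 2 * osc u x + 2 * osc v x"
proof -
 have "osc (\<lambda>x. u x + v x) x \<le> (\<integral>s. 2 * (u (x - Y s) - u x)\<^sup>2 + 2 * (v (x - Y s) - v x)\<^sup>2 \<partial>K)"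
  unfolding osc_def
 proof (rule integral_mono)
  show "integrable K (\<lambda>s. (u (x - Y s) + v (x - Y s) - (u x + v x))\<^sup>2)"
   using osc_integrable[OF bdd_borel_add[OF u v]] by simp
  show "integrable K (\<lambda>s. 2 * (u (x - Y s) - u x)\<^sup>2 + 2 * (v (x - Y s) - v x)\<^sup>2)"
   using osc_integrable[OF u] osc_integrable[OF v] by simp
  fix s
  have "(a + b)\<^sup>2 \<le> 2 * a\<^sup>2 + 2 * b\<^sup>2" for a b :: real
   using sum_squares_bound[of a b] by (simp add: power2_sum)
  from this[of "u (x - Y s) - u x" "v (x - Y s) - v x"]
  show "(u (x - Y s) + v (x - Y s) - (u x + v x))\<^sup>2 \<le> 2 * (u (x - Y s) - u x)\<^sup>2 + 2 * (v (x - Y s) - v x)\<^sup>2"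
   by (simp add: algebra_simps)
 qed
 also have "\<dots> = 2 * osc u x + 2 * osc v x"
  using osc_integrable[OF u] osc_integrable[OF v] by (simp add: osc_def)
 finally show ?thesis .
qed

text \<open>Averaging over one step commutes with the increment by a second, independent step;
  Jensen in the averaging variable and Fubini do the rest.\<close>

lemma osc_step_le: assumes w: "bdd_borel w"
 shows "osc (step w) x \<le> step (osc w) x"
proof -
 interpret KK: pair_prob_space K K ..
 have [measurable]: "w \<in> borel_measurable borel" using w by (rule bdd_borelD)
 obtain B where B: "\<And>x. \<bar>w x\<bar> \<le> B" using bdd_borelE[OF w] by blast
 have inc: "step w (x - Y s) - step w x = (\<integral>t. w (x - Y t - Y s) - w (x - Y t) \<partial>K)" for s
  using step_integrable[OF w, of x] step_integrable[OF w, of "x - Y s"]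
  by (simp add: step_def algebra_simps)
 have b2: "\<bar>(w (x - Y t - Y s) - w (x - Y t))\<^sup>2\<bar> \<le> (2 * B)\<^sup>2" for s t
 proof -
  have "\<bar>w (x - Y t - Y s) - w (x - Y t)\<bar> \<le> 2 * B" using B[of "x - Y t - Y s"] B[of "x - Y t"] by linarith
  then have "\<bar>w (x - Y t - Y s) - w (x - Y t)\<bar>\<^sup>2 \<le> (2 * B)\<^sup>2" by (rule power_mono) simp
  then show ?thesis by simp
 qed
 have int2: "integrable (K \<Otimes>\<^sub>M K) (\<lambda>(t, s). (w (x - Y t - Y s) - w (x - Y t))\<^sup>2)"
  using b2 by (intro KK.integrable_const_bound[where B="(2*B)\<^sup>2"]) auto
 have int1: "integrable K (\<lambda>t. (w (x - Y t - Y s) - w (x - Y t))\<^sup>2)" for s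
  using b2 by (intro integrable_const_bound[where B="(2*B)\<^sup>2"]) auto
 have int0: "integrable K (\<lambda>t. w (x - Y t - Y s) - w (x - Y t))" for s
  by (rule square_integrable_imp_integrable[OF _ int1]) auto
 have "osc (step w) x \<le> (\<integral>s. (\<integral>t. (w (x - Y t - Y s) - w (x - Y t))\<^sup>2 \<partial>K) \<partial>K)"
  unfolding osc_def inc
 proof (rule integral_mono)
  show "integrable K (\<lambda>s. (\<integral>t. w (x - Y t - Y s) - w (x - Y t) \<partial>K)\<^sup>2)"
   using osc_integrable[OF bdd_borel_step[OF w], of x] unfolding inc .
  show "integrable K (\<lambda>s. \<integral>t. (w (x - Y t - Y s) - w (x - Y t))\<^sup>2 \<partial>K)"
   by (rule KK.integrable_snd[OF int2])
  show "(\<integral>t. w (x - Y t - Y s) - w (x - Y t) \<partial>K)\<^sup>2 \<le> (\<integral>t. (w (x - Y t - Y s) - w (x - Y t))\<^sup>2 \<partial>K)" for s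
   by (rule square_integral_le[OF int0 int1])
 qed
 also have "\<dots> = (\<integral>t. (\<integral>s. (w (x - Y t - Y s) - w (x - Y t))\<^sup>2 \<partial>K) \<partial>K)"
  by (rule KK.Fubini_integral[OF int2, simplified])
 also have "\<dots> = step (osc w) x" by (simp add: step_def osc_def)
 finally show ?thesis .
qed

lemma osc_step_pow_le: assumes w: "bdd_borel w"
 shows "osc ((step ^^ n) w) x \<le> (step ^^ n) (osc w) x"
proof (induction n arbitrary: x)
 case (Suc n)
 have "osc ((step ^^ Suc n) w) x \<le> step (osc ((step ^^ n) w)) x"
  using osc_step_le[OF bdd_borel_step_pow[OF w, of n]] by simp
 also have "\<dots> \<le> step ((step ^^ n) (osc w)) x"
  by (rule step_mono[OF bdd_borel_osc[OF bdd_borel_step_pow[OF w]] bdd_borel_step_pow[OF bdd_borel_osc[OF w]] Suc.IH])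
 finally show ?case by simp
qed simp

lemma step_tendsto_0: assumes w: "bdd_borel w" and lim: "(w \<longlongrightarrow> 0) at_top"
 shows "(step w \<longlongrightarrow> 0) at_top"
proof -
 obtain B where B: "\<And>x. \<bar>w x\<bar> \<le> B" using bdd_borelE[OF w] by blast
 have [measurable]: "w \<in> borel_measurable borel" using w by (rule bdd_borelD)
 have "((\<lambda>x. \<integral>s. w (x - Y s) \<partial>K) \<longlongrightarrow> (\<integral>s. 0 \<partial>K)) at_top"
 proof (rule integral_dominated_convergence_at_top[where w="\<lambda>_. B"])
  have "filterlim (\<lambda>x. x - c) at_top at_top" for c :: real
   using filterlim_tendsto_add_at_top[OF tendsto_const[of "-c"] filterlim_ident] by simp
  from filterlim_compose[OF lim this]
  show "AE s in K. ((\<lambda>x. w (x - Y s)) \<longlongrightarrow> 0) at_top" by auto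
 qed (use B in auto)
 then show ?thesis unfolding step_def[abs_def] by simp
qed

lemma step_pow_tendsto_0: "bdd_borel w \<Longrightarrow> (w \<longlongrightarrow> 0) at_top \<Longrightarrow> ((step ^^ n) w \<longlongrightarrow> 0) at_top"
 by (induction n) (auto intro: step_tendsto_0 bdd_borel_step_pow)

lemma osc_tendsto_0: assumes w: "bdd_borel w" and lim: "(w \<longlongrightarrow> 0) at_top"
 shows "(osc w \<longlongrightarrow> 0) at_top"
proof -
 have "((\<lambda>x. step (\<lambda>x. (w x)\<^sup>2) x - 2 * w x * step w x + (w x)\<^sup>2) \<longlongrightarrow> 0 - 2 * 0 * 0 + 0\<^sup>2) at_top"
  using tendsto_power[OF lim, of 2]
  by (intro tendsto_intros lim step_tendsto_0 w bdd_borel_power2) auto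
 moreover have "osc w = (\<lambda>x. step (\<lambda>x. (w x)\<^sup>2) x - 2 * w x * step w x + (w x)\<^sup>2)"
  by (simp add: fun_eq_iff osc_eq[OF w])
 ultimately show ?thesis by simp
qed

text \<open>If \<open>osc w x\<close> is large, then by \<open>osc_step_pow_le\<close> so are all
  \<open>(step ^^ n) (osc w) x\<close> with n < m, up to errors that vanish at infinity for fixed m.
  But the sum of these telescopes and is at most B^2 plus a vanishing term. So m times
  \<open>osc w x\<close> is bounded by 2 B^2 plus a vanishing term, for every m.\<close>

lemma osc_solution_tendsto_0:
 assumes w: "bdd_borel w" and q: "bdd_borel q" and lim: "(q \<longlongrightarrow> 0) at_top"
  and eq: "\<And>x. w x = q x + step w x"
 shows "(osc w \<longlongrightarrow> 0) at_top"
proof -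
 obtain B0 where B0: "\<And>x. \<bar>w x\<bar> \<le> B0" using bdd_borelE[OF w] by blast
 define B where "B = max B0 1"
 have B: "\<bar>w x\<bar> \<le> B" for x using B0[of x] by (simp add: B_def)
 have Bpos: "B > 0" by (simp add: B_def)
 define e where "e n x = (\<Sum>k<n. (step ^^ k) q x)" for n x
 define r where "r n x = (\<Sum>k<n. (step ^^ k) (\<lambda>x. w x * q x) x)" for n x
 have be: "bdd_borel (e n)" for n
  unfolding e_def[abs_def] by (intro bdd_borel_sum bdd_borel_step_pow q)
 have wq: "bdd_borel (\<lambda>x. w x * q x)" by (intro bdd_borel_mult w q)
 have wqlim: "((\<lambda>x. w x * q x) \<longlongrightarrow> 0) at_top"
 proof (rule tendsto_0_le[where K=B, OF lim])
  show "\<forall>\<^sub>F x in at_top. norm (w x * q x) \<le> norm (q x) * B"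
   using mult_right_mono[OF B abs_ge_zero]
   by (intro always_eventually allI) (simp add: abs_mult mult.commute)
 qed
 have elim: "(e n \<longlongrightarrow> 0) at_top" for n
  unfolding e_def[abs_def] by (intro tendsto_null_sum step_pow_tendsto_0 q lim)
 have rlim: "(r n \<longlongrightarrow> 0) at_top" for n
  unfolding r_def[abs_def] by (intro tendsto_null_sum step_pow_tendsto_0 wq wqlim)
 \<comment> \<open>The equation iterated n times; one more iteration changes
   \<open>(step ^^ n) w\<close> by exactly \<open>(step ^^ n) q\<close>.\<close>
 have wstep: "w x = (step ^^ n) w x + e n x" for n x
 proof (induction n)
  case (Suc n)
  have "(step ^^ n) w x = (step ^^ Suc n) w x + (step ^^ n) q x" for x
  proof (induction n arbitrary: x)
   case (Suc n)
   have "(step ^^ n) w = (\<lambda>x. (step ^^ Suc n) w x + (step ^^ n) q x)" using Suc by (simp add: fun_eq_iff)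
   then have "step ((step ^^ n) w) = (\<lambda>x. step ((step ^^ Suc n) w) x + step ((step ^^ n) q) x)"
    using step_add[OF bdd_borel_step_pow[OF w, of "Suc n"] bdd_borel_step_pow[OF q, of n]] by metis
   then show ?case by (simp add: fun_eq_iff)
  qed (use eq in simp)
  from this[of x] show ?case using Suc by (simp add: e_def)
 qed (simp add: e_def)
 \<comment> \<open>Substituting \<open>step w = w - q\<close> leaves a difference of squares, which
   telescopes under \<open>step\<close>, and a term with q, which vanishes at infinity.\<close>
 have osc_w: "osc w = (\<lambda>x. (step (\<lambda>x. (w x)\<^sup>2) x - (w x)\<^sup>2) + 2 * (w x * q x))"
 proof
  fix x
  have st: "step w x = w x - q x" using eq[of x] by simp
  show "osc w x = (step (\<lambda>x. (w x)\<^sup>2) x - (w x)\<^sup>2) + 2 * (w x * q x)"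
   unfolding osc_eq[OF w] st by (simp add: power2_eq_square algebra_simps)
 qed
 have w2: "bdd_borel (\<lambda>x. (w x)\<^sup>2)" by (rule bdd_borel_power2[OF w])
 have powosc: "(step ^^ n) (osc w) x = (step ^^ Suc n) (\<lambda>x. (w x)\<^sup>2) x - (step ^^ n) (\<lambda>x. (w x)\<^sup>2) x
    + 2 * (step ^^ n) (\<lambda>x. w x * q x) x" for n x
 proof (induction n arbitrary: x)
  case 0 then show ?case by (simp add: osc_w)
 next
  case (Suc n)
  have *: "(step ^^ n) (osc w) = (\<lambda>x. ((step ^^ Suc n) (\<lambda>x. (w x)\<^sup>2) x - (step ^^ n) (\<lambda>x. (w x)\<^sup>2) x)
    + ((step ^^ n) (\<lambda>x. w x * q x) x + (step ^^ n) (\<lambda>x. w x * q x) x))"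
   using Suc by (auto simp add: fun_eq_iff)
  note p1 = bdd_borel_step_pow[OF w2, of n] and p2 = bdd_borel_step_pow[OF w2, of "Suc n"]
   and pq = bdd_borel_step_pow[OF wq, of n]
  from * have "step ((step ^^ n) (osc w)) = (\<lambda>x. (step ((step ^^ Suc n) (\<lambda>x. (w x)\<^sup>2)) x - step ((step ^^ n) (\<lambda>x. (w x)\<^sup>2)) x)
    + (step ((step ^^ n) (\<lambda>x. w x * q x)) x + step ((step ^^ n) (\<lambda>x. w x * q x)) x))"
   by (simp only: step_add[OF bdd_borel_diff[OF p2 p1] bdd_borel_add[OF pq pq]] step_diff[OF p2 p1] step_add[OF pq pq])
  then show ?case by (simp add: fun_eq_iff)
 qed
 have sumosc: "(\<Sum>n<m. (step ^^ n) (osc w) x) = (step ^^ m) (\<lambda>x. (w x)\<^sup>2) x - (w x)\<^sup>2 + 2 * r m x" for m x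
 proof (induction m)
  case 0 show ?case by (simp add: r_def)
 next
  case (Suc m)
  then show ?case by (simp add: r_def powosc)
 qed
 have bound: "real m * osc w x \<le> 2 * B\<^sup>2 + 4 * r m x + 2 * (\<Sum>n<m. osc (e n) x)" for m x
 proof -
  have "osc w x \<le> 2 * (step ^^ n) (osc w) x + 2 * osc (e n) x" for n
  proof -
   have "osc w x \<le> 2 * osc ((step ^^ n) w) x + 2 * osc (e n) x"
   proof -
    have "osc w x = osc (\<lambda>x. (step ^^ n) w x + e n x) x"
     by (rule arg_cong[where f="\<lambda>v. osc v x"]) (rule ext, rule wstep)
    then show ?thesis using osc_add_le[OF bdd_borel_step_pow[OF w] be, of n n x] by simp
   qed
   then show ?thesis using osc_step_pow_le[OF w, of n x] by linarith
  qed
  then have "(\<Sum>n<m. osc w x) \<le> (\<Sum>n<m. 2 * (step ^^ n) (osc w) x + 2 * osc (e n) x)" by (intro sum_mono)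
  also have "\<dots> = 2 * (\<Sum>n<m. (step ^^ n) (osc w) x) + 2 * (\<Sum>n<m. osc (e n) x)"
   by (simp add: sum.distrib sum_distrib_left)
  also have "\<dots> \<le> 2 * B\<^sup>2 + 4 * r m x + 2 * (\<Sum>n<m. osc (e n) x)"
  proof -
   have "(w x)\<^sup>2 \<le> B\<^sup>2" for x using power_mono[OF B[of x], of 2] by simp
   then have "(step ^^ m) (\<lambda>x. (w x)\<^sup>2) x \<le> B\<^sup>2"
    by (induction m arbitrary: x) (auto intro!: step_le bdd_borel_step_pow w2)
   moreover have "2 * (a - b + 2 * c) + 2 * s \<le> 2 * B\<^sup>2 + 4 * c + 2 * s" if "a \<le> B\<^sup>2" "0 \<le> b" for a b c s :: real
    using that by (simp add: algebra_simps)
   ultimately show ?thesis unfolding sumosc using zero_le_power2 by blast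
  qed
  finally show ?thesis by simp
 qed
 show ?thesis
 proof (rule tendstoI)
  fix \<epsilon> :: real assume \<epsilon>: "\<epsilon> > 0"
  \<comment> \<open>With this m the constant \<open>2 * B^2\<close> uses up less than half of
    \<open>m * \<epsilon>\<close>; the vanishing terms take the other half.\<close>
  obtain m :: nat where m: "real m > 4 * B\<^sup>2 / \<epsilon>" using reals_Archimedean2 by blast
  have "4 * B\<^sup>2 / \<epsilon> > 0" using Bpos \<epsilon> by simp
  then have mpos: "real m > 0" using m by linarith
  have "((\<lambda>x. 4 * r m x + 2 * (\<Sum>n<m. osc (e n) x)) \<longlongrightarrow> 4 * 0 + 2 * 0) at_top"
   by (intro tendsto_add tendsto_mult tendsto_const rlim tendsto_null_sum osc_tendsto_0 be elim)
  then have "((\<lambda>x. 4 * r m x + 2 * (\<Sum>n<m. osc (e n) x)) \<longlongrightarrow> 0) at_top" by simp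
  moreover have "m * \<epsilon> / 2 > 0" using mpos \<epsilon> by simp
  ultimately have "\<forall>\<^sub>F x in at_top. 4 * r m x + 2 * (\<Sum>n<m. osc (e n) x) < m * \<epsilon> / 2"
   by (rule order_tendstoD)
  then show "\<forall>\<^sub>F x in at_top. dist (osc w x) 0 < \<epsilon>"
  proof eventually_elim
   case (elim x)
   have "2 * B\<^sup>2 < m * \<epsilon> / 2" using m \<epsilon> by (simp add: field_simps)
   then have "real m * osc w x < m * \<epsilon>" using bound[of m x] elim by linarith
   then have "osc w x < \<epsilon>" using mpos by simp
   then show ?case using osc_nonneg[of w x] by (simp add: dist_real_def)
  qed
 qed
qed

end

section \<open>Closed subgroups of the real line\<close>

lemma closed_additive_subgroup_cases:
 fixes G :: "real set"
 assumes cl: "closed G" and zero: "0 \<in> G" and diff: "\<And>a b. a \<in> G \<Longrightarrow> b \<in> G \<Longrightarrow> a - b \<in> G"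
 shows "G = UNIV \<or> (\<exists>c\<ge>0. G = multiples c)"
proof -
 have neg: "- a \<in> G" if "a \<in> G" for a using diff[OF zero that] by simp
 have add: "a + b \<in> G" if "a \<in> G" "b \<in> G" for a b using diff[OF that(1) neg[OF that(2)]] by simp
 have natm: "of_nat n * a \<in> G" if "a \<in> G" for n a
  by (induction n) (use zero that add in \<open>auto simp: algebra_simps\<close>)
 have intm: "of_int k * a \<in> G" if "a \<in> G" for k :: int and a
 proof (cases "k \<ge> 0")
  case True then show ?thesis using natm[OF that, of "nat k"] by simp
 next
  case False then show ?thesis using neg[OF natm[OF that, of "nat (- k)"]] by simp
 qed
 have red: "a - of_int \<lfloor>a / g\<rfloor> * g \<ge> 0 \<and> a - of_int \<lfloor>a / g\<rfloor> * g < g" if "g > 0" for a g :: real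
 proof -
  have "of_int \<lfloor>a / g\<rfloor> * g \<le> (a / g) * g" "(a / g) * g < (of_int \<lfloor>a / g\<rfloor> + 1) * g"
   using that by (intro mult_right_mono mult_strict_right_mono; linarith)+
  then show ?thesis using that by (simp add: algebra_simps)
 qed
 show ?thesis
 \<comment> \<open>Arbitrarily small positive elements make the group dense, hence everything;
   otherwise there is a least positive element (or none), and division with remainder shows that it
   generates.\<close>
 proof (cases "\<forall>e>0. \<exists>g\<in>G. 0 < g \<and> g < e")
  case True
  have "a \<in> G" for a
  proof -
   have "a \<in> closure G"
    unfolding closure_approachable
   proof (intro allI impI)
    fix e :: real assume "e > 0"
    then obtain g where g: "g \<in> G" "0 < g" "g < e" using True by blast
    from red[OF g(2), of a] g have "dist (of_int \<lfloor>a / g\<rfloor> * g) a < e" by (simp add: dist_real_def)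
    then show "\<exists>y\<in>G. dist y a < e" using intm[OF g(1)] by blast
   qed
   then show ?thesis using cl by simp
  qed
  then show ?thesis by blast
 next
  case False
  then obtain e where e: "e > 0" "\<And>g. g \<in> G \<Longrightarrow> 0 < g \<Longrightarrow> e \<le> g" by force
  show ?thesis
  proof (cases "\<exists>g\<in>G. g > 0")
   case False
   have "g = 0" if "g \<in> G" for g using False that neg[OF that] by (cases "g > 0"; cases "g < 0"; force)
   then have "G = multiples 0" using zero by (auto simp: multiples_def)
   then show ?thesis by blast
  next
   case True
   \<comment> \<open>Cutting at e loses no positive element but makes the set closed, so that its
     infimum is attained.\<close>
   define Gp where "Gp = G \<inter> {e..}"
   have Gp: "Gp = {g\<in>G. 0 < g}" using e by (force simp: Gp_def)
   have ne: "Gp \<noteq> {}" using True Gp by blast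
   have bdd: "bdd_below Gp" by (auto simp: Gp_def intro: bdd_belowI[of _ e])
   define c where "c = Inf Gp"
   have "c \<in> Gp" unfolding c_def
    by (rule closed_contains_Inf[OF ne bdd]) (simp add: Gp_def cl closed_Int)
   then have c: "c \<in> G" "c > 0" using Gp by auto
   have "a \<in> multiples c" if "a \<in> G" for a
   proof -
    define r where "r = a - of_int \<lfloor>a / c\<rfloor> * c"
    have r: "0 \<le> r" "r < c" using red[OF c(2), of a] by (auto simp: r_def)
    have "r \<in> G" unfolding r_def by (rule diff[OF that intm[OF c(1)]])
    have "r = 0"
    proof (rule ccontr)
     assume "r \<noteq> 0"
     then have "r \<in> Gp" using r \<open>r \<in> G\<close> Gp by auto
     then have "c \<le> r" unfolding c_def by (rule cInf_lower[OF _ bdd])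
     then show False using r by simp
    qed
    then have "a = of_int \<lfloor>a / c\<rfloor> * c" by (simp add: r_def)
    then show ?thesis by (auto simp: multiples_def)
   qed
   then have "G = multiples c" using intm[OF c(1)] by (auto simp: multiples_def)
   then show ?thesis using c by (intro disjI2 exI[of _ c]) auto
  qed
 qed
qed

section \<open>The value of the limit of a solution that flattens out\<close>

context nonneg_step
begin

lemma indicator_pair_measurable [measurable]:
 "(\<lambda>(u, s). indicator {0..<Y s} u :: real) \<in> borel_measurable (lborel \<Otimes>\<^sub>M K)"
proof -
 have "(indicator {0..<Y s} u :: real) = (if 0 \<le> u \<and> u < Y s then 1 else 0)" for u s by (auto simp: indicator_def)
 then show ?thesis by simp
qed

text \<open>The region below the graph of \<open>Y\<close> has the finite mean of \<open>Y\<close>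
  as its mass. This justifies every later exchange of integrals with tail probabilities.\<close>

lemma indicator_pair_integrable: "integrable (lborel \<Otimes>\<^sub>M K) (\<lambda>(u, s). indicator {0..<Y s} u :: real)"
proof -
 interpret lK: pair_sigma_finite lborel K ..
 note m = indicator_pair_measurable
  have "(\<integral>\<^sup>+ p. ennreal (norm (indicator {0..<Y (snd p)} (fst p) :: real)) \<partial>(lborel \<Otimes>\<^sub>M K))
    = (\<integral>\<^sup>+ s. (\<integral>\<^sup>+ u. ennreal (norm (indicator {0..<Y s} u :: real)) \<partial>lborel) \<partial>K)"
   using m by (subst lK.nn_integral_snd[symmetric]) (auto simp: case_prod_unfold)
  also have "\<dots> = (\<integral>\<^sup>+ s. ennreal (Y s) \<partial>K)"
   using Y_nonneg by (intro nn_integral_cong) (simp add: ennreal_indicator emeasure_lborel_Ico)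
  also have "\<dots> < \<infinity>"
   using Y_integrable Y_nonneg by (simp add: nn_integral_eq_integral)
  finally show ?thesis
   using m by (intro integrableI_bounded) (auto simp: case_prod_unfold)
qed

text \<open>The solution \<open>w\<close> of \<open>w = q + step w\<close> is integrated over \<open>(-\<infinity>, T]\<close>.\<close>

lemma solution_limit:
 fixes F :: "real filter"
 assumes w: "bdd_borel w" and q: "q \<in> borel_measurable borel" "integrable lborel q"
  and eq: "\<And>x. w x = q x + step w x"
  and vanish: "\<And>x. x < - b \<Longrightarrow> w x = 0"
  and flat: "\<And>s. s \<ge> 0 \<Longrightarrow> ((\<lambda>x. w (x - s) - w x) \<longlongrightarrow> 0) at_top"
 shows "(w \<longlongrightarrow> (\<integral>x. q x \<partial>lborel) / (\<integral>s. Y s \<partial>K)) at_top"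
proof -
 define \<mu> where "\<mu> = (\<integral>s. Y s \<partial>K)"
 have \<mu>: "\<mu> > 0" using Y_mean_pos by (simp add: \<mu>_def)
 interpret lK: pair_sigma_finite lborel K ..
 have [measurable]: "w \<in> borel_measurable borel" using w by (rule bdd_borelD)
 note [measurable] = q(1)
 obtain B where B: "\<And>x. \<bar>w x\<bar> \<le> B" using bdd_borelE[OF w] by blast
 have B0: "B \<ge> 0" using B[of 0] by linarith
 \<comment> \<open>Layer cake formula: the tail probabilities integrate to \<mu>.\<close>
 have tail: "integrable lborel (\<lambda>u. indicator {0..} u * prob {s \<in> space K. Y s > u})"
    "(\<integral>u. indicator {0..} u * prob {s \<in> space K. Y s > u} \<partial>lborel) = \<mu>"
  and tailK: "integrable (lborel \<Otimes>\<^sub>M K) (\<lambda>(u, s). indicator {0..<Y s} u :: real)"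
 proof -
  have sec: "(\<integral>u. (indicator {0..<Y s} u :: real) \<partial>lborel) = Y s" for s using Y_nonneg[of s] by simp
  note tK = indicator_pair_integrable
  show "integrable (lborel \<Otimes>\<^sub>M K) (\<lambda>(u, s). indicator {0..<Y s} u :: real)" by (rule tK)
  have inner: "(\<integral>s. (indicator {0..<Y s} u :: real) \<partial>K) = indicator {0..} u * prob {s \<in> space K. Y s > u}" for u
  proof -
   have "(\<integral>s. (indicator {0..<Y s} u :: real) \<partial>K) = (\<integral>s. (indicator {0..} u * indicator {s \<in> space K. Y s > u} s :: real) \<partial>K)"
    by (intro Bochner_Integration.integral_cong) (auto simp: indicator_def)
   then show ?thesis by simp
  qed
  from lK.integrable_fst[OF tK] show "integrable lborel (\<lambda>u. indicator {0..} u * prob {s \<in> space K. Y s > u})"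
   unfolding inner .
  have "(\<integral>s. (\<integral>u. (indicator {0..<Y s} u :: real) \<partial>lborel) \<partial>K) = (\<integral>u. (\<integral>s. (indicator {0..<Y s} u :: real) \<partial>K) \<partial>lborel)"
   using lK.Fubini_integral[OF tK] by simp
  then show "(\<integral>u. indicator {0..} u * prob {s \<in> space K. Y s > u} \<partial>lborel) = \<mu>"
   unfolding inner sec \<mu>_def by simp
 qed
 \<comment> \<open>For a fixed step s, the integrals up to T of \<open>w\<close> and of its
   translate by \<open>Y s\<close> differ by the integral of \<open>w\<close> over the last stretch
   of length \<open>Y s\<close> before T. Averaging over s turns this stretch into a weight by tail
   probabilities. All integrals exist because \<open>w\<close> is bounded and vanishes far to the
   left.\<close>
 have identity: "(\<integral>u. w (T - u) * (indicator {0..} u * prob {s \<in> space K. Y s > u}) \<partial>lborel) = (\<integral>x. indicator {..T} x * q x \<partial>lborel)" for T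
 proof -
  have ib: "integrable lborel (indicator {- b..T} :: real \<Rightarrow> real)"
   by (rule integrable_real_indicator) (auto simp: emeasure_lborel_Icc_eq)
  have i1: "integrable lborel (\<lambda>x. indicator {..T} x * w x)"
  proof (rule Bochner_Integration.integrable_bound[where f="\<lambda>x. indicator {-b..T} x * B"])
   show "AE x in lborel. norm (indicator {..T} x * w x) \<le> norm (indicator {- b..T} x * B)"
   proof (rule AE_I2)
    show "norm (indicator {..T} x * w x) \<le> norm (indicator {- b..T} x * B)" for x
     using B[of x] vanish[of x] B0 by (cases "x < - b") (auto simp: indicator_def)
   qed
  qed (auto simp: ib)
  have i1s: "integrable lborel (\<lambda>x. indicator {..T} x * w (x - Y s))"
    "(\<integral>x. indicator {..T} x * w (x - Y s) \<partial>lborel) = (\<integral>x. indicator {..T - Y s} x * w x \<partial>lborel)"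
    "integrable lborel (\<lambda>x. indicator {..T - Y s} x * w x)" for s
  proof -
   show i: "integrable lborel (\<lambda>x. indicator {..T - Y s} x * w x)"
   proof (rule Bochner_Integration.integrable_bound[OF i1])
    show "AE x in lborel. norm (indicator {..T - Y s} x * w x) \<le> norm (indicator {..T} x * w x)"
     using Y_nonneg[of s] by (intro AE_I2) (auto simp: indicator_def)
   qed auto
   have ind: "(indicator {..T} x :: real) = indicator {..T - Y s} (- Y s + 1 * x)" for x by (auto simp: indicator_def)
   from lborel_integrable_real_affine[OF i, of 1 "- Y s"]
   show "integrable lborel (\<lambda>x. indicator {..T} x * w (x - Y s))" unfolding ind by (simp add: algebra_simps)
   from lborel_integral_real_affine[of 1 "\<lambda>x. indicator {..T - Y s} x * w x" "- Y s"]
   show "(\<integral>x. indicator {..T} x * w (x - Y s) \<partial>lborel) = (\<integral>x. indicator {..T - Y s} x * w x \<partial>lborel)"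
    unfolding ind by (simp add: algebra_simps)
  qed
  have i2: "integrable (lborel \<Otimes>\<^sub>M K) (\<lambda>(x, s). indicator {..T} x * w (x - Y s))"
  proof (rule Bochner_Integration.integrable_bound[where f="\<lambda>(x, s). indicator {-b..T} x * B"])
   show "integrable (lborel \<Otimes>\<^sub>M K) (\<lambda>(x, s). indicator {- b..T} x * B)"
   proof (rule lK.Fubini_integrable)
    show "integrable lborel (\<lambda>x. \<integral>s. norm (case (x, s) of (x, s) \<Rightarrow> indicator {- b..T} x * B) \<partial>K)"
     by (simp add: prob_space abs_mult ib)
   qed auto
   show "AE p in lborel \<Otimes>\<^sub>M K. norm (case p of (x, s) \<Rightarrow> indicator {..T} x * w (x - Y s)) \<le> norm (case p of (x, s) \<Rightarrow> indicator {- b..T} x * B)"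
   proof (rule AE_I2, clarify)
    fix x s
    show "norm (indicator {..T} x * w (x - Y s)) \<le> norm (indicator {- b..T} x * B)"
     using B[of "x - Y s"] vanish[of "x - Y s"] Y_nonneg[of s] B0 by (cases "x < - b") (auto simp: indicator_def)
   qed
  qed auto
  have i3: "integrable (lborel \<Otimes>\<^sub>M K) (\<lambda>(u, s). w (T - u) * indicator {0..<Y s} u)"
  proof (rule Bochner_Integration.integrable_bound[where f="\<lambda>(u, s). B * indicator {0..<Y s} u"])
   show "integrable (lborel \<Otimes>\<^sub>M K) (\<lambda>(u, s). B * indicator {0..<Y s} u)"
    using integrable_mult_right[OF tailK, of B] by (simp add: case_prod_unfold)
   show "AE p in lborel \<Otimes>\<^sub>M K. norm (case p of (u, s) \<Rightarrow> w (T - u) * indicator {0..<Y s} u) \<le> norm (case p of (u, s) \<Rightarrow> B * indicator {0..<Y s} u)"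
    using B B0 by (intro AE_I2) (auto simp: indicator_def abs_mult)
   show "(\<lambda>(u, s). w (T - u) * indicator {0..<Y s} u) \<in> borel_measurable (lborel \<Otimes>\<^sub>M K)"
    by measurable
  qed
  have qw: "q x = w x - (\<integral>s. w (x - Y s) \<partial>K)" for x using eq[of x] by (simp add: step_def)
  have "(\<integral>x. indicator {..T} x * q x \<partial>lborel)
    = (\<integral>x. indicator {..T} x * w x - (\<integral>s. indicator {..T} x * w (x - Y s) \<partial>K) \<partial>lborel)"
   by (intro Bochner_Integration.integral_cong) (auto simp: qw algebra_simps)
  also have "\<dots> = (\<integral>x. indicator {..T} x * w x \<partial>lborel) - (\<integral>x. (\<integral>s. indicator {..T} x * w (x - Y s) \<partial>K) \<partial>lborel)"
   using lK.integrable_fst[OF i2] by (intro Bochner_Integration.integral_diff i1) simp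
  also have "(\<integral>x. (\<integral>s. indicator {..T} x * w (x - Y s) \<partial>K) \<partial>lborel) = (\<integral>s. (\<integral>x. indicator {..T} x * w (x - Y s) \<partial>lborel) \<partial>K)"
   using lK.Fubini_integral[OF i2] by simp
  also have "(\<integral>x. indicator {..T} x * w x \<partial>lborel) - \<dots> = (\<integral>s. (\<integral>x. indicator {..T} x * w x \<partial>lborel) - (\<integral>x. indicator {..T} x * w (x - Y s) \<partial>lborel) \<partial>K)"
   using lK.integrable_snd[OF i2] by (simp add: prob_space)
  also have "\<dots> = (\<integral>s. (\<integral>u. w (T - u) * indicator {0..<Y s} u \<partial>lborel) \<partial>K)"
  proof (intro Bochner_Integration.integral_cong refl)
   fix s
   have "(\<integral>x. indicator {..T} x * w x \<partial>lborel) - (\<integral>x. indicator {..T} x * w (x - Y s) \<partial>lborel)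
     = (\<integral>x. indicator {..T} x * w x - indicator {..T - Y s} x * w x \<partial>lborel)"
    unfolding i1s(2) by (intro Bochner_Integration.integral_diff[symmetric] i1 i1s)
   also have "\<dots> = (\<integral>x. indicator {T - Y s<..T} x * w x \<partial>lborel)"
    using Y_nonneg[of s] by (intro Bochner_Integration.integral_cong) (auto simp: indicator_def)
   also have "\<dots> = (\<integral>u. indicator {T - Y s<..T} (T + (-1) * u) * w (T + (-1) * u) \<partial>lborel)"
    using lborel_integral_real_affine[of "-1" "\<lambda>x. indicator {T - Y s<..T} x * w x" T] by simp
   also have "\<dots> = (\<integral>u. w (T - u) * indicator {0..<Y s} u \<partial>lborel)"
    by (intro Bochner_Integration.integral_cong) (auto simp: indicator_def)
   finally show "(\<integral>x. indicator {..T} x * w x \<partial>lborel) - (\<integral>x. indicator {..T} x * w (x - Y s) \<partial>lborel) = (\<integral>u. w (T - u) * indicator {0..<Y s} u \<partial>lborel)" .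
  qed
  also have "\<dots> = (\<integral>u. (\<integral>s. w (T - u) * indicator {0..<Y s} u \<partial>K) \<partial>lborel)"
   using lK.Fubini_integral[OF i3] by simp
  also have "\<dots> = (\<integral>u. w (T - u) * (indicator {0..} u * prob {s \<in> space K. Y s > u}) \<partial>lborel)"
  proof (intro Bochner_Integration.integral_cong refl)
   fix u
   have "(\<integral>s. w (T - u) * indicator {0..<Y s} u \<partial>K) = (\<integral>s. w (T - u) * (indicator {0..} u * indicator {s \<in> space K. Y s > u} s :: real) \<partial>K)"
    by (intro Bochner_Integration.integral_cong) (auto simp: indicator_def)
   then show "(\<integral>s. w (T - u) * indicator {0..<Y s} u \<partial>K) = w (T - u) * (indicator {0..} u * prob {s \<in> space K. Y s > u})"
    by simp
  qed
  finally show ?thesis by simp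
 qed
 let ?p = "\<lambda>u. indicator {0..} u * prob {s \<in> space K. Y s > u}"
 have "((\<lambda>T. \<integral>x. indicator {..T} x * q x \<partial>lborel) \<longlongrightarrow> (\<integral>x. q x \<partial>lborel)) at_top"
 proof (rule integral_dominated_convergence_at_top[where w="\<lambda>x. \<bar>q x\<bar>"])
  show "AE x in lborel. ((\<lambda>T. indicator {..T} x * q x) \<longlongrightarrow> q x) at_top"
  proof (rule AE_I2)
   fix x
   have "\<forall>\<^sub>F T in at_top. q x = indicator {..T} x * q x"
    using eventually_ge_at_top[of x] by eventually_elim auto
   then show "((\<lambda>T. indicator {..T} x * q x) \<longlongrightarrow> q x) at_top"
    by (rule Lim_transform_eventually[OF tendsto_const])
  qed
  show "\<forall>\<^sub>F T in at_top. AE x in lborel. norm (indicator {..T} x * q x) \<le> \<bar>q x\<bar>"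
   by (intro always_eventually allI AE_I2) (auto simp: indicator_def)
 qed (use q in auto)
 then have L1: "((\<lambda>T. \<integral>u. w (T - u) * ?p u \<partial>lborel) \<longlongrightarrow> (\<integral>x. q x \<partial>lborel)) at_top"
  unfolding identity .
 have i4: "integrable lborel (\<lambda>u. w (T - u) * ?p u)" for T
 proof (rule Bochner_Integration.integrable_bound[where f="\<lambda>u. B * ?p u"])
  show "integrable lborel (\<lambda>u. B * ?p u)" by (intro integrable_mult_right tail)
  show "AE u in lborel. norm (w (T - u) * ?p u) \<le> norm (B * ?p u)"
   using B B0 by (intro AE_I2) (auto simp: abs_mult indicator_def intro!: mult_right_mono)
 qed auto
 \<comment> \<open>Flatness allows \<open>w (T - u)\<close> to be replaced by \<open>w T\<close>
   under the tail weight of total mass \<mu>, so \<open>w T * \<mu>\<close> inherits the limit of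
   the identity.\<close>
 have "((\<lambda>T. \<integral>u. (w (T - u) - w T) * ?p u \<partial>lborel) \<longlongrightarrow> (\<integral>u. 0 \<partial>(lborel :: real measure))) at_top"
 proof (rule integral_dominated_convergence_at_top[where w="\<lambda>u. 2 * B * ?p u"])
  show "AE u in lborel. ((\<lambda>T. (w (T - u) - w T) * ?p u) \<longlongrightarrow> 0) at_top"
  proof (rule AE_I2)
   show "((\<lambda>T. (w (T - u) - w T) * ?p u) \<longlongrightarrow> 0) at_top" for u
    using tendsto_mult_left_zero[OF flat[of u]] by (cases "u \<ge> 0") auto
  qed
  show "\<forall>\<^sub>F T in at_top. AE u in lborel. norm ((w (T - u) - w T) * ?p u) \<le> 2 * B * ?p u"
  proof (intro always_eventually allI AE_I2)
   fix T u
   have "\<bar>w (T - u) - w T\<bar> \<le> 2 * B" using B[of "T - u"] B[of T] by linarith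
   then show "norm ((w (T - u) - w T) * ?p u) \<le> 2 * B * ?p u"
    by (auto simp: abs_mult indicator_def intro!: mult_right_mono)
  qed
  show "integrable lborel (\<lambda>u. 2 * B * ?p u)" by (intro integrable_mult_right tail)
 qed auto
 moreover have "(\<integral>u. (w (T - u) - w T) * ?p u \<partial>lborel) = (\<integral>u. w (T - u) * ?p u \<partial>lborel) - w T * \<mu>" for T
  unfolding left_diff_distrib tail(2)[symmetric]
  by (subst Bochner_Integration.integral_diff[OF i4]) (use tail(1) in auto)
 ultimately have "((\<lambda>T. (\<integral>u. w (T - u) * ?p u \<partial>lborel) - w T * \<mu>) \<longlongrightarrow> 0) at_top" by simp
 from tendsto_divide[OF tendsto_diff[OF L1 this] tendsto_const[of \<mu>]] \<mu>
 show ?thesis by (simp add: \<mu>_def)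
qed

end

section \<open>Asymptotic periods of a solution and the renewal limits\<close>

lemma filterlim_shift_at_top: "filterlim (\<lambda>x. x + c) at_top (at_top :: real filter)"
 using filterlim_tendsto_add_at_top[OF tendsto_const[of c] filterlim_ident] by (simp add: add.commute)

text \<open>Both hypotheses are read at x + b. Thus the shifts that leave \<open>w\<close>
  asymptotically unchanged form a group.\<close>

lemma flat_diff:
 fixes w :: "real \<Rightarrow> real"
 assumes a: "((\<lambda>x. w (x - a) - w x) \<longlongrightarrow> 0) at_top" and b: "((\<lambda>x. w (x - b) - w x) \<longlongrightarrow> 0) at_top"
 shows "((\<lambda>x. w (x - (a - b)) - w x) \<longlongrightarrow> 0) at_top"
proof -
 have "((\<lambda>x. w (x + b - a) - w (x + b) - (w (x + b - b) - w (x + b))) \<longlongrightarrow> 0 - 0) at_top"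
  by (intro tendsto_diff filterlim_compose[OF a filterlim_shift_at_top] filterlim_compose[OF b filterlim_shift_at_top])
 then show ?thesis by (simp add: algebra_simps)
qed

context nonneg_step
begin

text \<open>An increment of size e at the shift a forces increments of at least e / 2 on the whole
  event \<open>A\<close>, hence an oscillation bounded away from 0.\<close>

lemma flat_of_osc:
 assumes w: "bdd_borel w" and osc: "(osc w \<longlongrightarrow> 0) at_top"
  and A: "\<And>e. e > 0 \<Longrightarrow> \<exists>A\<in>sets K. prob A > 0 \<and> (\<forall>s\<in>A. \<forall>x. \<bar>w (x - Y s) - w (x - a)\<bar> \<le> e / 2)"
 shows "((\<lambda>x. w (x - a) - w x) \<longlongrightarrow> 0) at_top"
proof (rule tendstoI)
 fix e :: real assume e: "e > 0"
 from A[OF e] obtain A where A: "A \<in> sets K" "prob A > 0" "\<And>s x. s \<in> A \<Longrightarrow> \<bar>w (x - Y s) - w (x - a)\<bar> \<le> e / 2" by blast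
 have "e\<^sup>2 / 4 * prob A > 0" using e A(2) by simp
 with osc have "\<forall>\<^sub>F x in at_top. osc w x < e\<^sup>2 / 4 * prob A" by (rule order_tendstoD)
 then show "\<forall>\<^sub>F x in at_top. dist (w (x - a) - w x) 0 < e"
 proof eventually_elim
  case (elim x)
  show ?case
  proof (rule ccontr)
   assume "\<not> ?case"
   then have ge: "\<bar>w (x - a) - w x\<bar> \<ge> e" by (simp add: dist_real_def)
   have "(\<integral>s. e\<^sup>2 / 4 * indicator A s \<partial>K) \<le> osc w x"
    unfolding osc_def
   proof (rule integral_mono)
    show "integrable K (\<lambda>s. e\<^sup>2 / 4 * indicator A s)"
     using A(1) by (intro integrable_mult_right integrable_real_indicator) (auto simp: emeasure_eq_measure)
    show "integrable K (\<lambda>s. (w (x - Y s) - w x)\<^sup>2)" by (rule osc_integrable[OF w])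
    fix s
    show "e\<^sup>2 / 4 * indicator A s \<le> (w (x - Y s) - w x)\<^sup>2"
    proof (cases "s \<in> A")
     case True
     have "e / 2 \<le> \<bar>w (x - Y s) - w x\<bar>" using A(3)[OF True, of x] ge by linarith
     then have "(e / 2)\<^sup>2 \<le> \<bar>w (x - Y s) - w x\<bar>\<^sup>2" using e by (intro power_mono) auto
     then show ?thesis using True by (simp add: power_divide)
    qed simp
   qed
   then show False using elim A(1) by simp
  qed
 qed
qed

lemma not_AE_zero: "\<not> (AE s in K. Y s \<in> multiples 0)"
proof
 assume "AE s in K. Y s \<in> multiples 0"
 then have "AE s in K. Y s = 0" by (auto simp: multiples_def)
 then have "(\<integral>s. Y s \<partial>K) = 0" by (subst integral_cong_AE[where g="\<lambda>_. 0"]) auto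
 then show False using Y_mean_pos by simp
qed

text \<open>Almost every value of the step is an atom, and an atom is an asymptotic period: the
  event in \<open>flat_of_osc\<close> is that the step takes this value. So the periods in the
  lattice form a group that contains the step almost surely, and maximality of h excludes a proper
  subgroup.\<close>

lemma flat_lattice:
 assumes w: "bdd_borel w" and osc: "(osc w \<longlongrightarrow> 0) at_top" and h: "h > 0"
  and lat: "AE s in K. Y s \<in> multiples h" and max: "\<And>c. c > 0 \<Longrightarrow> AE s in K. Y s \<in> multiples c \<Longrightarrow> c \<le> h"
 shows "((\<lambda>x. w (x - of_int k * h) - w x) \<longlongrightarrow> 0) at_top"
proof -
 define G where "G = {a \<in> multiples h. ((\<lambda>x. w (x - a) - w x) \<longlongrightarrow> 0) at_top}"
 have diff: "a - b \<in> G" if "a \<in> G" "b \<in> G" for a b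
 proof -
  have "a - b \<in> multiples h"
  proof -
   from that obtain i j :: int where "a = i * h" "b = j * h" by (auto simp: G_def multiples_def)
   then have "a - b = of_int (i - j) * h" by (simp add: algebra_simps)
   then show ?thesis unfolding multiples_def by (intro range_eqI[where x="i - j"])
  qed
  then show ?thesis using that flat_diff by (auto simp: G_def)
 qed
 have zero: "0 \<in> G" by (auto simp: G_def multiples_def intro: image_eqI[of _ _ 0])
 \<comment> \<open>Distinct points of G are at distance at least h.\<close>
 have "closed G"
 proof (rule discrete_imp_closed[OF h], intro ballI impI)
  fix a b assume ab: "a \<in> G" "b \<in> G" "dist b a < h"
  then obtain i j :: int where ij: "a = i * h" "b = j * h" by (auto simp: G_def multiples_def)
  have "\<bar>of_int (j - i)\<bar> * h < 1 * h" using ab(3) h by (simp add: ij dist_real_def left_diff_distrib[symmetric] abs_mult)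
  then have "\<bar>real_of_int (j - i)\<bar> < 1" using h by (simp only: mult_less_cancel_right_pos)
  then have "j = i" by linarith
  then show "b = a" by (simp add: ij)
 qed
 from closed_additive_subgroup_cases[OF this zero diff]
 consider "G = UNIV" | c where "c \<ge> 0" "G = multiples c" by blast
 then have "h \<in> G"
 proof cases
  case 2
  \<comment> \<open>Lattice values of probability zero make up a countable union of null
    events.\<close>
  have "AE s in K. \<forall>j::int. Y s = of_int j * h \<longrightarrow> prob {s \<in> space K. Y s = of_int j * h} > 0"
   unfolding AE_all_countable
  proof
   fix j :: int
   show "AE s in K. Y s = of_int j * h \<longrightarrow> prob {s \<in> space K. Y s = of_int j * h} > 0"
   proof (cases "prob {s \<in> space K. Y s = of_int j * h} > 0")
    case False
    then have "prob {s \<in> space K. Y s = of_int j * h} = 0" using measure_nonneg[of K] by (simp add: order.not_eq_order_implies_strict less_le)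
    then have "AE s in K. \<not> Y s = of_int j * h" by (subst (asm) prob_eq_0) auto
    then show ?thesis by eventually_elim blast
   qed simp
  qed
  with lat have "AE s in K. Y s \<in> G"
  proof eventually_elim
   case (elim s)
   have "((\<lambda>x. w (x - Y s) - w x) \<longlongrightarrow> 0) at_top"
   proof (rule flat_of_osc[OF w osc])
    fix e :: real assume e: "e > 0"
    have "prob {t \<in> space K. Y t = Y s} > 0" using elim by (auto simp: multiples_def)
    then show "\<exists>A\<in>sets K. 0 < prob A \<and> (\<forall>t\<in>A. \<forall>x. \<bar>w (x - Y t) - w (x - Y s)\<bar> \<le> e / 2)"
     using e by (intro bexI[of _ "{t \<in> space K. Y t = Y s}"]) auto
   qed
   then show ?case using elim by (simp add: G_def)
  qed
  then have AEc: "AE s in K. Y s \<in> multiples c" by (simp add: 2)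
  then have cpos: "c > 0" using 2(1) not_AE_zero by (cases "c = 0") auto
  \<comment> \<open>c is at most h by maximality, and a positive multiple of h because G lies in the
    lattice; hence c = h.\<close>
  have "c \<le> h" by (rule max[OF cpos AEc])
  have "c \<in> multiples c" by (auto simp: multiples_def intro: image_eqI[of _ _ 1])
  then have "c \<in> multiples h" using 2(2) by (auto simp: G_def)
  then obtain m :: int where m: "c = m * h" by (auto simp: multiples_def)
  have "m > 0" using cpos h m by (simp add: zero_less_mult_iff)
  then have "1 * h \<le> m * h" using h by (intro mult_right_mono) auto
  then have "c = h" using \<open>c \<le> h\<close> m by simp
  then show ?thesis using \<open>c \<in> multiples c\<close> 2 by simp
 qed simp
 have "of_nat n * h \<in> G" for n
 proof (induction n)
  case (Suc n)
  have "0 - h \<in> G" by (rule diff[OF zero \<open>h \<in> G\<close>])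
  from diff[OF Suc this] show ?case by (simp add: algebra_simps)
 qed (use zero in simp)
 then have nat: "of_nat n * h \<in> G" for n .
 have "of_int k * h \<in> G"
 proof (cases "k \<ge> 0")
  case True then show ?thesis using nat[of "nat k"] by simp
 next
  case False then show ?thesis using diff[OF zero nat[of "nat (-k)"]] by simp
 qed
 then show ?thesis by (simp add: G_def)
qed

text \<open>Single values may now have probability zero. Almost every value still lies in the
  support of the step, and the Lipschitz bound lets a short interval around it serve as the event of
  \<open>flat_of_osc\<close>. The same bound makes the set of periods closed, so only the whole line
  remains possible.\<close>

lemma flat_nonarithmetic:
 assumes w: "bdd_borel w" and osc: "(osc w \<longlongrightarrow> 0) at_top"
  and lip: "\<And>x y. \<bar>w x - w y\<bar> \<le> L * \<bar>x - y\<bar>" and L: "L > 0"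
  and nonar: "\<And>c. c > 0 \<Longrightarrow> \<not> (AE s in K. Y s \<in> multiples c)"
 shows "((\<lambda>x. w (x - a) - w x) \<longlongrightarrow> 0) at_top"
proof -
 define G where "G = {a. ((\<lambda>x. w (x - a) - w x) \<longlongrightarrow> 0) at_top}"
 have diff: "a - b \<in> G" if "a \<in> G" "b \<in> G" for a b using that flat_diff by (auto simp: G_def)
 have zero: "0 \<in> G" by (simp add: G_def)
 have "closed G"
  unfolding closed_sequential_limits
 proof (intro allI impI, elim conjE)
  fix g l assume g: "\<forall>n. g n \<in> G" and l: "g \<longlonglongrightarrow> l"
  have "((\<lambda>x. w (x - l) - w x) \<longlongrightarrow> 0) at_top"
  proof (rule tendstoI)
   fix e :: real assume e: "e > 0"
   from l have "\<forall>\<^sub>F n in sequentially. dist (g n) l < e / (2 * L)" using e L by (intro tendstoD) auto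
   then obtain n where n: "\<bar>g n - l\<bar> < e / (2 * L)" by (auto simp: eventually_sequentially dist_real_def)
   have "((\<lambda>x. w (x - g n) - w x) \<longlongrightarrow> 0) at_top" using g by (auto simp: G_def)
   then have "\<forall>\<^sub>F x in at_top. dist (w (x - g n) - w x) 0 < e / 2" using e by (intro tendstoD) auto
   then show "\<forall>\<^sub>F x in at_top. dist (w (x - l) - w x) 0 < e"
   proof eventually_elim
    case (elim x)
    have "\<bar>w (x - l) - w (x - g n)\<bar> \<le> L * \<bar>g n - l\<bar>" using lip[of "x - l" "x - g n"] by simp
    also have "\<dots> < L * (e / (2 * L))" using n L by (intro mult_strict_left_mono) auto
    also have "\<dots> = e / 2" using L by simp
    finally show ?case using elim unfolding dist_real_def by linarith
   qed
  qed
  then show "l \<in> G" by (simp add: G_def)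
 qed
 from closed_additive_subgroup_cases[OF this zero diff]
 consider "G = UNIV" | c where "c \<ge> 0" "G = multiples c" by blast
 then have "a \<in> G"
 proof cases
  case 2
  \<comment> \<open>Intervals with rational endpoints are countably many, so almost no value lies in
    one of probability zero.\<close>
  have "AE s in K. \<forall>p::rat. \<forall>r::rat. of_rat p < Y s \<and> Y s < of_rat r \<longrightarrow> prob {s \<in> space K. of_rat p < Y s \<and> Y s < of_rat r} > 0"
   unfolding AE_all_countable
  proof (intro allI)
   fix p r :: rat
   show "AE s in K. of_rat p < Y s \<and> Y s < of_rat r \<longrightarrow> prob {s \<in> space K. of_rat p < Y s \<and> Y s < of_rat r} > 0"
   proof (cases "prob {s \<in> space K. of_rat p < Y s \<and> Y s < of_rat r} > 0")
    case False
    then have "prob {s \<in> space K. of_rat p < Y s \<and> Y s < of_rat r} = 0" using measure_nonneg[of K] by (simp add: order.not_eq_order_implies_strict less_le)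
    then have "AE s in K. \<not> (of_rat p < Y s \<and> Y s < of_rat r)" by (subst (asm) prob_eq_0) auto
    then show ?thesis by eventually_elim blast
   qed simp
  qed
  then have "AE s in K. Y s \<in> G"
  proof eventually_elim
   case (elim s)
   have "((\<lambda>x. w (x - Y s) - w x) \<longlongrightarrow> 0) at_top"
   proof (rule flat_of_osc[OF w osc])
    fix e :: real assume e: "e > 0"
    define \<epsilon> where "\<epsilon> = e / (2 * L)"
    have \<epsilon>: "\<epsilon> > 0" using e L by (simp add: \<epsilon>_def)
    obtain p where p: "Y s - \<epsilon> < of_rat p" "of_rat p < Y s" using of_rat_dense[of "Y s - \<epsilon>" "Y s"] \<epsilon> by auto
    obtain r where r: "Y s < of_rat r" "of_rat r < Y s + \<epsilon>" using of_rat_dense[of "Y s" "Y s + \<epsilon>"] \<epsilon> by auto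
    show "\<exists>A\<in>sets K. 0 < prob A \<and> (\<forall>t\<in>A. \<forall>x. \<bar>w (x - Y t) - w (x - Y s)\<bar> \<le> e / 2)"
    proof (intro bexI[of _ "{t \<in> space K. of_rat p < Y t \<and> Y t < of_rat r}"] conjI ballI allI)
     show "0 < prob {t \<in> space K. of_rat p < Y t \<and> Y t < of_rat r}" using elim p r by blast
     fix t x assume "t \<in> {t \<in> space K. of_rat p < Y t \<and> Y t < of_rat r}"
     then have "\<bar>Y t - Y s\<bar> \<le> \<epsilon>" using p r by auto
     then have "L * \<bar>Y t - Y s\<bar> \<le> L * \<epsilon>" using L by (intro mult_left_mono) auto
     moreover have "\<bar>w (x - Y t) - w (x - Y s)\<bar> \<le> L * \<bar>Y t - Y s\<bar>" using lip[of "x - Y t" "x - Y s"] by (simp add: abs_minus_commute)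
     moreover have "L * \<epsilon> = e / 2" using L by (simp add: \<epsilon>_def)
     ultimately show "\<bar>w (x - Y t) - w (x - Y s)\<bar> \<le> e / 2" by linarith
    qed auto
   qed
   then show ?case by (simp add: G_def)
  qed
  then have "AE s in K. Y s \<in> multiples c" by (simp add: 2)
  then have False using 2(1) not_AE_zero nonar by (cases "c = 0") auto
  then show ?thesis ..
 qed simp
 then show ?thesis by (simp add: G_def)
qed

text \<open>Only lattice shifts are known to be periods. By \<open>cell\<close>, \<open>w\<close> is
  constant on the cells of the lattice, so an arbitrary shift acts like one of the two neighbouring
  lattice shifts.\<close>

theorem renewal_limit_lattice:
 assumes w: "bdd_borel w" and q: "bdd_borel q" "integrable lborel q" "(q \<longlongrightarrow> 0) at_top"
  and eq: "\<And>x. w x = q x + step w x" and vanish: "\<And>x. x < - b \<Longrightarrow> w x = 0"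
  and h: "h > 0" and lat: "AE s in K. Y s \<in> multiples h"
  and max: "\<And>c. c > 0 \<Longrightarrow> AE s in K. Y s \<in> multiples c \<Longrightarrow> c \<le> h"
  and cell: "\<And>x. w x = w (of_int \<lfloor>x / h\<rfloor> * h)"
 shows "(w \<longlongrightarrow> (\<integral>x. q x \<partial>lborel) / (\<integral>s. Y s \<partial>K)) at_top"
proof (rule solution_limit[OF w bdd_borelD[OF q(1)] q(2) eq vanish])
 note osc = osc_solution_tendsto_0[OF w q(1) q(3) eq]
 note fl = flat_lattice[OF w osc h lat max]
 fix s :: real assume "s \<ge> 0"
 define j where "j = \<lfloor>s / h\<rfloor>"
 show "((\<lambda>x. w (x - s) - w x) \<longlongrightarrow> 0) at_top"
 proof (rule Lim_null_comparison)
  show "((\<lambda>x. \<bar>w (x - of_int j * h) - w x\<bar> + \<bar>w (x - of_int (j + 1) * h) - w x\<bar>) \<longlongrightarrow> 0) at_top"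
   by (intro tendsto_add_zero tendsto_rabs_zero fl)
  show "\<forall>\<^sub>F x in at_top. norm (w (x - s) - w x) \<le> \<bar>w (x - of_int j * h) - w x\<bar> + \<bar>w (x - of_int (j + 1) * h) - w x\<bar>"
  proof (intro always_eventually allI)
   fix x
   have fr: "\<lfloor>(x - of_int i * h) / h\<rfloor> = \<lfloor>x / h\<rfloor> - i" for i
    using h by (simp add: diff_divide_distrib)
   have "\<lfloor>x / h - s / h\<rfloor> = \<lfloor>x / h\<rfloor> - j \<or> \<lfloor>x / h - s / h\<rfloor> = \<lfloor>x / h\<rfloor> - (j + 1)"
    unfolding j_def by linarith
   then have "w (x - s) = w (x - of_int j * h) \<or> w (x - s) = w (x - of_int (j + 1) * h)"
    using cell[of "x - s"] cell[of "x - of_int j * h"] cell[of "x - of_int (j + 1) * h"]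
    unfolding fr by (auto simp: diff_divide_distrib)
   then show "norm (w (x - s) - w x) \<le> \<bar>w (x - of_int j * h) - w x\<bar> + \<bar>w (x - of_int (j + 1) * h) - w x\<bar>"
    by auto
  qed
 qed
qed auto

text \<open>Averaging over an interval of length \<delta> makes the solution Lipschitz. It commutes
  with \<open>step\<close>, so the average solves the equation for the averaged q, which has the
  same integral as q.\<close>

theorem renewal_limit_nonarithmetic:
 assumes w: "bdd_borel w" and q: "bdd_borel q" "integrable lborel q" "(q \<longlongrightarrow> 0) at_top"
  and eq: "\<And>x. w x = q x + step w x" and vanish: "\<And>x. x < - b \<Longrightarrow> w x = 0"
  and nonar: "\<And>c. c > 0 \<Longrightarrow> \<not> (AE s in K. Y s \<in> multiples c)"
  and \<delta>: "\<delta> > 0"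
 shows "((\<lambda>x. (\<integral>u. indicator {0..\<delta>} u * w (x + u) \<partial>lborel) / \<delta>) \<longlongrightarrow> (\<integral>x. q x \<partial>lborel) / (\<integral>s. Y s \<partial>K)) at_top"
proof -
 define U where "U = density lborel (\<lambda>u. ennreal (indicator {0..\<delta>} u / \<delta>))"
 have [measurable_cong, simp]: "sets U = sets borel" "space U = UNIV" by (auto simp: U_def)
 interpret U: prob_space U
 proof
  have "(\<integral>\<^sup>+ u. ennreal (indicator {0..\<delta>} u / \<delta>) \<partial>lborel) = (\<integral>\<^sup>+ u. ennreal (1 / \<delta>) * indicator {0..\<delta>} u \<partial>lborel)"
   by (intro nn_integral_cong) (auto simp: indicator_def)
  also have "\<dots> = ennreal (1 / \<delta>) * ennreal \<delta>" using \<delta> by (simp add: nn_integral_cmult_indicator)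
  also have "\<dots> = 1" using \<delta> by (simp flip: ennreal_mult)
  finally show "emeasure U (space U) = 1" by (simp add: U_def emeasure_density)
 qed
 have pU: "measure U UNIV = 1" using U.prob_space by simp
 interpret UK: pair_prob_space U K ..
 interpret Ul: pair_sigma_finite U lborel ..
 define sm where "sm v x = (\<integral>u. v (x + u) \<partial>U)" for v :: "real \<Rightarrow> real" and x
 have sm_eq: "sm v x = (\<integral>u. indicator {0..\<delta>} u * v (x + u) \<partial>lborel) / \<delta>" if "v \<in> borel_measurable borel" for v x
  unfolding sm_def U_def using that \<delta> by (subst integral_density) auto
 have sm_meas: "sm v \<in> borel_measurable borel" if [measurable]: "v \<in> borel_measurable borel" for v
  unfolding sm_def[abs_def] by measurable
 have sm_int: "integrable U (\<lambda>u. v (x + u))" if vb: "bdd_borel v" for v x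
 proof -
  obtain B where B: "\<And>x. \<bar>v x\<bar> \<le> B" using bdd_borelE[OF vb] by blast
  have [measurable]: "v \<in> borel_measurable borel" using vb by (rule bdd_borelD)
  show ?thesis using B by (intro U.integrable_const_bound[where B=B]) auto
 qed
 have sm_bd: "bdd_borel (sm v)" if v: "bdd_borel v" for v
 proof -
  obtain B where B: "\<And>x. \<bar>v x\<bar> \<le> B" using bdd_borelE[OF v] by blast
  have "\<bar>sm v x\<bar> \<le> B" for x
  proof -
   have "\<bar>sm v x\<bar> \<le> (\<integral>u. \<bar>v (x + u)\<bar> \<partial>U)" unfolding sm_def by (rule integral_abs_bound)
   also have "\<dots> \<le> (\<integral>u. B \<partial>U)" using B sm_int[OF v] by (intro integral_mono) auto
   finally show ?thesis by (simp add: pU)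
  qed
  then show ?thesis by (intro bdd_borelI sm_meas bdd_borelD[OF v])
 qed
 obtain B0 where B0: "\<And>x. \<bar>w x\<bar> \<le> B0" using bdd_borelE[OF w] by blast
 define B where "B = max B0 1"
 have B: "\<bar>w x\<bar> \<le> B" for x using B0[of x] by (simp add: B_def)
 have Bpos: "B > 0" by (simp add: B_def)
 have wm [measurable]: "w \<in> borel_measurable borel" using w by (rule bdd_borelD)
 have qm [measurable]: "q \<in> borel_measurable borel" using q(1) by (rule bdd_borelD)
 \<comment> \<open>The two averaging intervals differ only within two intervals of length y - x, on
   which \<open>w\<close> is at most B.\<close>
 have lip1: "\<bar>sm w x - sm w y\<bar> \<le> 2 * B / \<delta> * \<bar>x - y\<bar>" if "x \<le> y" for x y
 proof -
  have int: "integrable lborel (\<lambda>z. indicator {a..b} z * w z)" for a b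
  proof (rule Bochner_Integration.integrable_bound[where f="\<lambda>z. B * indicator {a..b} z"])
   show "AE z in lborel. norm (indicator {a..b} z * w z) \<le> norm (B * indicator {a..b} z)"
    using B Bpos by (intro AE_I2) (auto simp: indicator_def)
  qed (auto intro!: integrable_mult_right integrable_real_indicator simp: emeasure_lborel_Icc_eq)
  have ii: "integrable lborel (indicator {a..b} :: real \<Rightarrow> real)" for a b
   by (rule integrable_real_indicator) (auto simp: emeasure_lborel_Icc_eq)
  have s: "sm w x = (\<integral>z. indicator {x..x + \<delta>} z * w z \<partial>lborel) / \<delta>" for x
  proof -
   have "(\<integral>z. indicator {x..x + \<delta>} z * w z \<partial>lborel) = (\<integral>u. indicator {x..x + \<delta>} (x + 1 * u) * w (x + 1 * u) \<partial>lborel)"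
    using lborel_integral_real_affine[of 1 "\<lambda>z. indicator {x..x + \<delta>} z * w z" x] by simp
   also have "\<dots> = (\<integral>u. indicator {0..\<delta>} u * w (x + u) \<partial>lborel)"
    by (intro Bochner_Integration.integral_cong) (auto simp: indicator_def)
   finally show ?thesis by (simp add: sm_eq)
  qed
  have "sm w x - sm w y = (\<integral>z. indicator {x..x + \<delta>} z * w z - indicator {y..y + \<delta>} z * w z \<partial>lborel) / \<delta>"
   unfolding s by (subst Bochner_Integration.integral_diff[OF int int]) (simp add: diff_divide_distrib)
  then have *: "\<bar>sm w x - sm w y\<bar> = \<bar>\<integral>z. indicator {x..x + \<delta>} z * w z - indicator {y..y + \<delta>} z * w z \<partial>lborel\<bar> / \<delta>"
   using \<delta> by simp
  have "\<bar>\<integral>z. indicator {x..x + \<delta>} z * w z - indicator {y..y + \<delta>} z * w z \<partial>lborel\<bar>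
    \<le> (\<integral>z. \<bar>indicator {x..x + \<delta>} z * w z - indicator {y..y + \<delta>} z * w z\<bar> \<partial>lborel)"
   by (rule integral_abs_bound)
  also have "\<dots> \<le> (\<integral>z. B * indicator {x..y} z + B * indicator {x + \<delta>..y + \<delta>} z \<partial>lborel)"
  proof (rule integral_mono)
   show "integrable lborel (\<lambda>z. \<bar>indicator {x..x + \<delta>} z * w z - indicator {y..y + \<delta>} z * w z\<bar>)"
    by (rule integrable_abs[OF Bochner_Integration.integrable_diff[OF int int]])
   show "integrable lborel (\<lambda>z. B * indicator {x..y} z + B * indicator {x + \<delta>..y + \<delta>} z)"
    by (simp add: ii)
   show "\<bar>indicator {x..x + \<delta>} z * w z - indicator {y..y + \<delta>} z * w z\<bar> \<le> B * indicator {x..y} z + B * indicator {x + \<delta>..y + \<delta>} z" for z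
   proof -
    have "\<bar>indicator {x..x + \<delta>} z - indicator {y..y + \<delta>} z\<bar> \<le> (indicator {x..y} z + indicator {x + \<delta>..y + \<delta>} z :: real)"
     using that by (auto split: split_indicator)
    then have "\<bar>indicator {x..x + \<delta>} z - indicator {y..y + \<delta>} z\<bar> * \<bar>w z\<bar> \<le> (indicator {x..y} z + indicator {x + \<delta>..y + \<delta>} z) * B"
     using B[of z] by (intro mult_mono) auto
    moreover have "\<bar>indicator {x..x + \<delta>} z * w z - indicator {y..y + \<delta>} z * w z\<bar> = \<bar>indicator {x..x + \<delta>} z - indicator {y..y + \<delta>} z\<bar> * \<bar>w z\<bar>"
     by (simp only: left_diff_distrib[symmetric] abs_mult)
    moreover have "(i + j) * B = B * i + B * j" for i j :: real by algebra
    ultimately show ?thesis by simp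
   qed
  qed
  also have "\<dots> = 2 * B * \<bar>x - y\<bar>"
   using that by (subst Bochner_Integration.integral_add) (auto simp: ii algebra_simps)
  finally show ?thesis using \<delta> unfolding * by (simp add: divide_right_mono)
 qed
 have lip: "\<bar>sm w x - sm w y\<bar> \<le> 2 * B / \<delta> * \<bar>x - y\<bar>" for x y
  using lip1[of x y] lip1[of y x] by (cases "x \<le> y") (auto simp: abs_minus_commute)
 have eq': "sm w x = sm q x + step (sm w) x" for x
 proof -
  have i: "integrable (U \<Otimes>\<^sub>M K) (\<lambda>(u, s). w (x + u - Y s))"
   using B by (intro UK.integrable_const_bound[where B=B]) auto
  have "(\<integral>s. (\<integral>u. w (x + u - Y s) \<partial>U) \<partial>K) = (\<integral>u. (\<integral>s. w (x + u - Y s) \<partial>K) \<partial>U)"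
   using UK.Fubini_integral[OF i] by simp
  then have "step (sm w) x = sm (step w) x"
   by (simp add: step_def sm_def algebra_simps)
  moreover have "sm w x = sm q x + sm (step w) x"
   unfolding sm_def by (subst eq, rule Bochner_Integration.integral_add) (intro sm_int q bdd_borel_step w)+
  ultimately show ?thesis by simp
 qed
 have qi: "integrable (U \<Otimes>\<^sub>M lborel) (\<lambda>(u, x). q (x + u))"
 proof (rule Ul.Fubini_integrable)
  have "(\<integral>x. norm (q (x + u)) \<partial>lborel) = (\<integral>x. norm (q x) \<partial>lborel)" for u
   using lborel_integral_real_affine[of 1 "\<lambda>x. norm (q x)" u] by (simp add: add.commute)
  then show "integrable U (\<lambda>u. \<integral>x. norm (case (u, x) of (u, x) \<Rightarrow> q (x + u)) \<partial>lborel)" by simp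
  show "AE u in U. integrable lborel (\<lambda>x. case (u, x) of (u, x) \<Rightarrow> q (x + u))"
   using lborel_integrable_real_affine[OF q(2), of 1] by (simp add: add.commute)
 qed auto
 have smq_int: "integrable lborel (sm q)"
  using Ul.integrable_snd[OF qi] by (simp add: sm_def[abs_def])
 have smq: "(\<integral>x. sm q x \<partial>lborel) = (\<integral>x. q x \<partial>lborel)"
 proof -
  have "(\<integral>x. sm q x \<partial>lborel) = (\<integral>u. (\<integral>x. q (x + u) \<partial>lborel) \<partial>U)"
   using Ul.Fubini_integral[OF qi] by (simp add: sm_def)
  also have "\<dots> = (\<integral>u. (\<integral>x. q x \<partial>lborel) \<partial>U)"
   using lborel_integral_real_affine[of 1 q] by (simp add: add.commute)
  finally show ?thesis by (simp add: pU)
 qed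
 have lim: "(sm q \<longlongrightarrow> 0) at_top"
 proof -
  obtain C where C: "\<And>x. \<bar>q x\<bar> \<le> C" using bdd_borelE[OF q(1)] by blast
  have "((\<lambda>x. \<integral>u. q (x + u) \<partial>U) \<longlongrightarrow> (\<integral>u. 0 \<partial>U)) at_top"
  proof (rule integral_dominated_convergence_at_top[where w="\<lambda>_. C"])
   show "AE u in U. ((\<lambda>x. q (x + u)) \<longlongrightarrow> 0) at_top"
    using filterlim_compose[OF q(3) filterlim_shift_at_top] by simp
  qed (use C in auto)
  then show ?thesis by (simp add: sm_def[abs_def])
 qed
 \<comment> \<open>The average looks ahead by up to \<delta>, which lowers the point below which it
   is known to vanish.\<close>
 have van: "sm w x = 0" if "x < - (b + \<delta>)" for x
 proof -
  have "(\<integral>u. indicator {0..\<delta>} u * w (x + u) \<partial>lborel) = (\<integral>u. 0 \<partial>(lborel :: real measure))"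
   using that by (intro Bochner_Integration.integral_cong) (auto simp: indicator_def intro!: vanish)
  then show ?thesis by (simp add: sm_eq)
 qed
 have "(sm w \<longlongrightarrow> (\<integral>x. sm q x \<partial>lborel) / (\<integral>s. Y s \<partial>K)) at_top"
 proof (rule solution_limit[where b="b + \<delta>", OF sm_bd[OF w] sm_meas[OF qm] smq_int eq' van])
  show "((\<lambda>x. sm w (x - s) - sm w x) \<longlongrightarrow> 0) at_top" for s
   using \<delta> Bpos by (intro flat_nonarithmetic[OF sm_bd[OF w] osc_solution_tendsto_0[OF sm_bd[OF w] sm_bd[OF q(1)] lim eq'] lip _ nonar]) auto
 qed auto
 then show ?thesis by (simp add: smq sm_eq[OF wm, abs_def] flip: fun_eq_iff)
qed

end

section \<open>Independent sequences\<close>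

locale iid_space = prob_space K for K :: "'s measure"
begin

abbreviation P :: "(nat \<Rightarrow> 's) measure" where
 "P \<equiv> PiM UNIV (\<lambda>_. K)"

sublocale pp: product_prob_space "\<lambda>_::nat. K" UNIV ..

sublocale PP: pair_prob_space P P ..

text \<open>Coordinates in A are taken from a second, independent sequence. With different A and
  \<open>\<pi>\<close> this restarts the walk after time n, resamples a set of indices, or freezes
  one argument of a kernel.\<close>

definition splice :: "nat set \<Rightarrow> (nat \<Rightarrow> nat) \<Rightarrow> (nat \<Rightarrow> 's) \<Rightarrow> (nat \<Rightarrow> 's) \<Rightarrow> nat \<Rightarrow> 's" where
 "splice A \<pi> x y = (\<lambda>j. if j \<in> A then y (\<pi> j) else x j)"

lemma measurable_splice [measurable]:
 "(\<lambda>(x, y). splice A \<pi> x y) \<in> measurable (P \<Otimes>\<^sub>M P) P"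
proof (rule measurable_PiM_single')
 show "(\<lambda>p. (case p of (x, y) \<Rightarrow> splice A \<pi> x y) i) \<in> measurable (P \<Otimes>\<^sub>M P) K" for i
  by (cases "i \<in> A") (auto simp: splice_def case_prod_unfold)
 show "(\<lambda>p i. (case p of (x, y) \<Rightarrow> splice A \<pi> x y) i) \<in> space (P \<Otimes>\<^sub>M P) \<rightarrow> UNIV \<rightarrow>\<^sub>E space K"
  by (auto simp: splice_def space_pair_measure space_PiM PiE_iff)
qed

lemma measurable_splice_snd: "x \<in> space P \<Longrightarrow> splice A \<pi> x \<in> measurable P P"
 using measurable_Pair2[OF measurable_splice] by (simp add: measurable_compose_Pair1[OF _ measurable_splice])

text \<open>On a cylinder the event splits into one about \<open>x\<close> outside A and one about
  \<open>y\<close>; injectivity of \<open>\<pi>\<close> makes the coordinates of \<open>y\<close> in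
  use distinct, hence independent.\<close>

lemma distr_splice:
 assumes inj: "inj_on \<pi> A"
 shows "distr (P \<Otimes>\<^sub>M P) P (\<lambda>(x, y). splice A \<pi> x y) = P"
proof (rule pp.PiM_eq)
 fix J :: "nat set" and F assume J: "finite J" "J \<subseteq> UNIV" and F: "\<And>j. j \<in> J \<Longrightarrow> F j \<in> sets K"
 define E1 where "E1 = {x \<in> space P. \<forall>j\<in>J - A. x j \<in> F j}"
 define E2 where "E2 = {y \<in> space P. \<forall>i\<in>\<pi> ` (J \<inter> A). y i \<in> F (the_inv_into A \<pi> i)}"
 have inv: "the_inv_into A \<pi> (\<pi> j) = j" if "j \<in> A" for j using inj that by (rule the_inv_into_f_f)
 have cyl: "{y \<in> space P. \<forall>i\<in>I. y i \<in> G i} \<in> sets P" if "finite I" "\<And>i. i \<in> I \<Longrightarrow> G i \<in> sets K" for I :: "nat set" and G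
 proof -
  have "{y \<in> space P. \<forall>i\<in>I. y i \<in> G i} = prod_emb UNIV (\<lambda>_. K) I (Pi\<^sub>E I G)"
   by (auto simp: prod_emb_def space_PiM PiE_iff)
  then show ?thesis using that by (auto intro!: sets_PiM_I)
 qed
 have F': "F (the_inv_into A \<pi> i) \<in> sets K" if "i \<in> \<pi> ` (J \<inter> A)" for i using that inv F by auto
 have m1: "E1 \<in> sets P" unfolding E1_def using J F by (intro cyl) auto
 have m2: "E2 \<in> sets P" unfolding E2_def using J F' by (intro cyl) auto
 let ?X = "prod_emb UNIV (\<lambda>_. K) J (Pi\<^sub>E J F)"
 have "?X \<in> sets P" using J F by (intro sets_PiM_I) auto
 moreover have "(\<lambda>(x, y). splice A \<pi> x y) -` ?X \<inter> space (P \<Otimes>\<^sub>M P) = E1 \<times> E2"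
  by (auto simp: prod_emb_def splice_def space_pair_measure space_PiM PiE_iff E1_def E2_def inv split: if_splits)
 ultimately have "emeasure (distr (P \<Otimes>\<^sub>M P) P (\<lambda>(x, y). splice A \<pi> x y)) ?X = emeasure (P \<Otimes>\<^sub>M P) (E1 \<times> E2)"
  by (simp add: emeasure_distr)
 also have "\<dots> = emeasure P E1 * emeasure P E2" by (rule pp.P.emeasure_pair_measure_Times[OF m1 m2])
 also have "emeasure P E1 = (\<Prod>j\<in>J - A. emeasure K (F j))"
  unfolding E1_def using J F by (intro pp.emeasure_PiM_Collect) auto
 also have "emeasure P E2 = (\<Prod>i\<in>\<pi> ` (J \<inter> A). emeasure K (F (the_inv_into A \<pi> i)))"
  unfolding E2_def using J F' by (intro pp.emeasure_PiM_Collect) auto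
 also have "\<dots> = (\<Prod>j\<in>J \<inter> A. emeasure K (F j))"
  using inj inv by (subst prod.reindex) (auto intro: inj_on_subset prod.cong)
 also have "(\<Prod>j\<in>J - A. emeasure K (F j)) * \<dots> = (\<Prod>j\<in>J. emeasure K (F j))"
  using J by (subst prod.union_disjoint[symmetric]) (auto intro: prod.cong)
 finally show "emeasure (distr (P \<Otimes>\<^sub>M P) P (\<lambda>(x, y). splice A \<pi> x y)) ?X = (\<Prod>j\<in>J. emeasure K (F j))" .
qed simp

text \<open>This plays the role of conditional expectation: the inner integral averages over the
  replaced coordinates while the others stay fixed.\<close>

lemma integral_splice:
 fixes h :: "(nat \<Rightarrow> 's) \<Rightarrow> real"
 assumes inj: "inj_on \<pi> A" and h: "integrable P h"
 shows "integrable (P \<Otimes>\<^sub>M P) (\<lambda>(x, y). h (splice A \<pi> x y))"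
  and "(\<integral>x. h x \<partial>P) = (\<integral>x. (\<integral>y. h (splice A \<pi> x y) \<partial>P) \<partial>P)"
proof -
 have "integrable (distr (P \<Otimes>\<^sub>M P) P (\<lambda>(x, y). splice A \<pi> x y)) h" using h by (simp add: distr_splice[OF inj])
 then show i: "integrable (P \<Otimes>\<^sub>M P) (\<lambda>(x, y). h (splice A \<pi> x y))"
  by (subst (asm) integrable_distr_eq) (auto simp: case_prod_unfold borel_measurable_integrable[OF h])
 have "(\<integral>x. h x \<partial>P) = (\<integral>p. h (case p of (x, y) \<Rightarrow> splice A \<pi> x y) \<partial>(P \<Otimes>\<^sub>M P))"
  by (subst distr_splice[OF inj, symmetric], rule integral_distr) (use borel_measurable_integrable[OF h] in auto)
 also have "\<dots> = (\<integral>x. (\<integral>y. h (splice A \<pi> x y) \<partial>P) \<partial>P)"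
  using PP.integral_fst'[OF i] by (simp add: case_prod_unfold)
 finally show "(\<integral>x. h x \<partial>P) = (\<integral>x. (\<integral>y. h (splice A \<pi> x y) \<partial>P) \<partial>P)" .
qed

lemma distr_coord: "distr P K (\<lambda>x. x i) = K"
 using pp.PiM_component[of i] by simp

lemma integral_coord: "h \<in> borel_measurable K \<Longrightarrow> (\<integral>x. h (x i) \<partial>P) = (\<integral>s. (h s :: real) \<partial>K)"
 by (subst (2) distr_coord[of i, symmetric], subst integral_distr) auto

lemma integrable_coord: "integrable K (h :: 's \<Rightarrow> real) \<Longrightarrow> integrable P (\<lambda>x. h (x i))"
 by (subst (asm) distr_coord[of i, symmetric]) (auto dest: integrable_distr[rotated])

lemma AE_coord: "AE s in K. Q s \<Longrightarrow> AE x in P. Q (x i)"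
 by (rule pp.AE_component) auto

lemma distr_tuple:
 assumes "inj_on i D"
 shows "distr P (PiM D (\<lambda>_. K)) (\<lambda>x. \<lambda>j\<in>D. x (i j)) = PiM D (\<lambda>_. K)"
 using distr_PiM_reindex[of UNIV "\<lambda>_. K" i D] assms prob_space_axioms by auto

end

abbreviation (input) coord :: "nat \<Rightarrow> (nat \<Rightarrow> 'a) \<Rightarrow> 'a" where
 "coord \<equiv> \<lambda>i \<omega>. \<omega> i"

section \<open>Second moments of sums of coordinate functions\<close>

context iid_space
begin

lemma integral_coord_mult:
 fixes u v :: "'s \<Rightarrow> real"
 assumes u: "u \<in> borel_measurable K" "integrable K (\<lambda>s. (u s)\<^sup>2)" and v: "v \<in> borel_measurable K" "integrable K (\<lambda>s. (v s)\<^sup>2)"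
 shows "integrable P (\<lambda>\<omega>. u (\<omega> i) * v (\<omega> j))"
  and "i \<noteq> j \<Longrightarrow> (\<integral>\<omega>. u (\<omega> i) * v (\<omega> j) \<partial>P) = (\<integral>s. u s \<partial>K) * (\<integral>s. v s \<partial>K)"
proof -
 note [measurable] = u(1) v(1)
 show int: "integrable P (\<lambda>\<omega>. u (\<omega> i) * v (\<omega> j))"
 proof (rule Bochner_Integration.integrable_bound)
  show "integrable P (\<lambda>\<omega>. (u (\<omega> i))\<^sup>2 + (v (\<omega> j))\<^sup>2)"
   using integrable_coord[OF u(2), of i] integrable_coord[OF v(2), of j] by simp
  show "AE \<omega> in P. norm (u (\<omega> i) * v (\<omega> j)) \<le> norm ((u (\<omega> i))\<^sup>2 + (v (\<omega> j))\<^sup>2)"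
  proof (rule AE_I2)
   fix \<omega>
   have "2 * \<bar>u (\<omega> i)\<bar> * \<bar>v (\<omega> j)\<bar> \<le> (u (\<omega> i))\<^sup>2 + (v (\<omega> j))\<^sup>2"
    using sum_squares_bound[of "\<bar>u (\<omega> i)\<bar>" "\<bar>v (\<omega> j)\<bar>"] by simp
   moreover have "0 \<le> \<bar>u (\<omega> i)\<bar> * \<bar>v (\<omega> j)\<bar>" by simp
   moreover have "norm (u (\<omega> i) * v (\<omega> j)) = \<bar>u (\<omega> i)\<bar> * \<bar>v (\<omega> j)\<bar>" by (simp add: abs_mult)
   moreover have "norm ((u (\<omega> i))\<^sup>2 + (v (\<omega> j))\<^sup>2) = (u (\<omega> i))\<^sup>2 + (v (\<omega> j))\<^sup>2" by simp
   ultimately show "norm (u (\<omega> i) * v (\<omega> j)) \<le> norm ((u (\<omega> i))\<^sup>2 + (v (\<omega> j))\<^sup>2)" by linarith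
  qed
 qed auto
 assume ij: "i \<noteq> j"
 have "(\<integral>\<omega>. u (\<omega> i) * v (\<omega> j) \<partial>P) = (\<integral>x. (\<integral>y. u (x i) * v (y j) \<partial>P) \<partial>P)"
  using integral_splice(2)[OF _ int, of "\<lambda>j. j" "{j}"] ij by (simp add: splice_def inj_on_def)
 also have "\<dots> = (\<integral>s. u s \<partial>K) * (\<integral>s. v s \<partial>K)"
  by (simp add: integral_coord)
 finally show "(\<integral>\<omega>. u (\<omega> i) * v (\<omega> j) \<partial>P) = (\<integral>s. u s \<partial>K) * (\<integral>s. v s \<partial>K)" .
qed

lemma centered_sum_square:
 fixes u :: "'s \<Rightarrow> real"
 assumes u: "u \<in> borel_measurable K" "integrable K (\<lambda>s. (u s)\<^sup>2)" "(\<integral>s. u s \<partial>K) = 0" and J: "finite J"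
 shows "integrable P (\<lambda>\<omega>. (\<Sum>j\<in>J. u (\<omega> j))\<^sup>2)"
  and "(\<integral>\<omega>. (\<Sum>j\<in>J. u (\<omega> j))\<^sup>2 \<partial>P) = card J * (\<integral>s. (u s)\<^sup>2 \<partial>K)"
proof -
 have eq: "(\<Sum>j\<in>J. u (\<omega> j))\<^sup>2 = (\<Sum>i\<in>J. \<Sum>j\<in>J. u (\<omega> i) * u (\<omega> j))" for \<omega> :: "nat \<Rightarrow> 's"
  by (simp add: power2_eq_square sum_product)
 note int = integral_coord_mult(1)[OF u(1,2) u(1,2)]
 show "integrable P (\<lambda>\<omega>. (\<Sum>j\<in>J. u (\<omega> j))\<^sup>2)" unfolding eq using int by simp
 have "(\<integral>\<omega>. (\<Sum>j\<in>J. u (\<omega> j))\<^sup>2 \<partial>P) = (\<Sum>i\<in>J. \<Sum>j\<in>J. \<integral>\<omega>. u (\<omega> i) * u (\<omega> j) \<partial>P)"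
  unfolding eq using int by (simp add: Bochner_Integration.integral_sum)
 also have "\<dots> = (\<Sum>i\<in>J. \<Sum>j\<in>J. if i = j then (\<integral>s. (u s)\<^sup>2 \<partial>K) else 0)"
 proof (intro sum.cong refl)
  fix i j
  show "(\<integral>\<omega>. u (\<omega> i) * u (\<omega> j) \<partial>P) = (if i = j then (\<integral>s. (u s)\<^sup>2 \<partial>K) else 0)"
   using integral_coord_mult(2)[OF u(1,2) u(1,2), of i j] integral_coord[of "\<lambda>s. (u s)\<^sup>2" j] u
   by (auto simp: power2_eq_square)
 qed
 also have "\<dots> = card J * (\<integral>s. (u s)\<^sup>2 \<partial>K)" using J by simp
 finally show "(\<integral>\<omega>. (\<Sum>j\<in>J. u (\<omega> j))\<^sup>2 \<partial>P) = card J * (\<integral>s. (u s)\<^sup>2 \<partial>K)" .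
qed

end

section \<open>The overshoot\<close>

locale renewal_process = iid_space K for K :: "'s measure" +
 fixes f :: "'s \<Rightarrow> real"
 assumes f_measurable [measurable]: "f \<in> borel_measurable K"
  and f_nonneg: "AE s in K. f s \<ge> 0"
  and f_square: "integrable K (\<lambda>s. (f s)\<^sup>2)"
  and f_mean_pos: "(\<integral>s. f s \<partial>K) > 0"
begin

definition \<mu> :: real where "\<mu> = (\<integral>s. f s \<partial>K)"

abbreviation U :: "nat \<Rightarrow> (nat \<Rightarrow> 's) \<Rightarrow> real" where "U \<equiv> renewal_sum f coord"
abbreviation Np :: "real \<Rightarrow> (nat \<Rightarrow> 's) \<Rightarrow> nat" where "Np \<equiv> N_plus f coord"
abbreviation Nm :: "real \<Rightarrow> (nat \<Rightarrow> 's) \<Rightarrow> nat" where "Nm \<equiv> N_minus f coord"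
abbreviation R :: "real \<Rightarrow> (nat \<Rightarrow> 's) \<Rightarrow> real" where "R \<equiv> overshoot f coord"

lemma \<mu>_pos: "\<mu> > 0" using f_mean_pos by (simp add: \<mu>_def)

lemma f_integrable: "integrable K f"
 by (rule square_integrable_imp_integrable[OF f_measurable f_square])

lemma U_0 [simp]: "U 0 \<omega> = 0" by (simp add: renewal_sum_def)

lemma U_Suc: "U (Suc n) \<omega> = U n \<omega> + f (\<omega> (Suc n))" by (simp add: renewal_sum_def)

lemma U_measurable [measurable]: "U n \<in> borel_measurable P"
 unfolding renewal_sum_def[abs_def] by measurable

text \<open>The paths on which passage indices exist and the sums are monotone; \<open>f\<close> is
  nonnegative only almost surely, so this has to be carried along as a null-set condition.\<close>

definition regular :: "(nat \<Rightarrow> 's) \<Rightarrow> bool" where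
 "regular \<omega> \<longleftrightarrow> (\<forall>i. f (\<omega> i) \<ge> 0) \<and> (\<forall>z. \<exists>n. U n \<omega> > z)"

lemma regular_mono: "regular \<omega> \<Longrightarrow> m \<le> n \<Longrightarrow> U m \<omega> \<le> U n \<omega>"
 by (rule lift_Suc_mono_le[of "\<lambda>n. U n \<omega>"]) (auto simp: U_Suc regular_def)

lemma centered_square: "integrable K (\<lambda>s. (f s - \<mu>)\<^sup>2)" "(\<integral>s. f s - \<mu> \<partial>K) = 0"
 using f_square f_integrable by (auto simp: power2_diff \<mu>_def prob_space)

text \<open>Chebyshev's inequality for a lower deviation.\<close>

lemma prob_U_le:
 assumes z: "z < n * \<mu>"
 shows "pp.P.prob {\<omega>\<in>space P. U n \<omega> \<le> z} \<le> n * (\<integral>s. (f s - \<mu>)\<^sup>2 \<partial>K) / (n * \<mu> - z)\<^sup>2"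
proof -
 let ?D = "\<lambda>\<omega>. \<Sum>j\<in>{1..n}. (f (\<omega> j) - \<mu>)"
 have D: "?D \<omega> = U n \<omega> - n * \<mu>" for \<omega> by (simp add: renewal_sum_def sum_subtractf)
 have c: "integrable P (\<lambda>\<omega>. (?D \<omega>)\<^sup>2)" "(\<integral>\<omega>. (?D \<omega>)\<^sup>2 \<partial>P) = n * (\<integral>s. (f s - \<mu>)\<^sup>2 \<partial>K)"
  using centered_sum_square[of "\<lambda>s. f s - \<mu>" "{1..n}"] centered_square by auto
 have "pp.P.prob {\<omega>\<in>space P. U n \<omega> \<le> z} \<le> pp.P.prob {\<omega>\<in>space P. (?D \<omega>)\<^sup>2 \<ge> (n * \<mu> - z)\<^sup>2}"
 proof (rule pp.P.finite_measure_mono)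
  show "{\<omega>\<in>space P. U n \<omega> \<le> z} \<subseteq> {\<omega>\<in>space P. (?D \<omega>)\<^sup>2 \<ge> (n * \<mu> - z)\<^sup>2}"
  proof (rule subsetI)
   fix \<omega> assume "\<omega> \<in> {\<omega>\<in>space P. U n \<omega> \<le> z}"
   then have \<omega>: "\<omega> \<in> space P" "U n \<omega> \<le> z" by auto
   then have "n * \<mu> - z \<le> \<bar>?D \<omega>\<bar>" unfolding D by linarith
   then have "(n * \<mu> - z)\<^sup>2 \<le> \<bar>?D \<omega>\<bar>\<^sup>2" using z by (intro power_mono) auto
   then have "(n * \<mu> - z)\<^sup>2 \<le> (?D \<omega>)\<^sup>2" by (simp only: power2_abs)
   then show "\<omega> \<in> {\<omega>\<in>space P. (?D \<omega>)\<^sup>2 \<ge> (n * \<mu> - z)\<^sup>2}" using \<omega> by blast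
  qed
 qed measurable
 also have "\<dots> \<le> (\<integral>\<omega>. (?D \<omega>)\<^sup>2 \<partial>P) / (n * \<mu> - z)\<^sup>2"
  using z by (intro integral_Markov_inequality_measure[OF c(1), where A="{}"]) (auto simp del: sum_subtractf)
 finally show ?thesis unfolding c(2) .
qed

lemma AE_regular: "AE \<omega> in P. regular \<omega>"
proof -
 have 1: "AE \<omega> in P. \<forall>i. f (\<omega> i) \<ge> 0" unfolding AE_all_countable using AE_coord[OF f_nonneg] by simp
 have 2: "AE \<omega> in P. \<forall>k::nat. \<exists>n. U n \<omega> > real k"
  unfolding AE_all_countable
 proof
  fix k :: nat
  define B where "B = {\<omega>\<in>space P. \<forall>n. U n \<omega> \<le> real k}"
  define v where "v = (\<integral>s. (f s - \<mu>)\<^sup>2 \<partial>K)"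
  have B: "B \<in> sets P" unfolding B_def by measurable
  \<comment> \<open>B is contained in the event that U n is at most k, for every n, and the
    Chebyshev bound for the latter is of order 1/n.\<close>
  have "pp.P.prob B \<le> 0"
  proof (rule tendsto_lowerbound)
   have "filterlim (\<lambda>n. real n * \<mu>) at_top sequentially"
    using \<mu>_pos by (auto intro: filterlim_at_top_mult_tendsto_pos[OF tendsto_const _ filterlim_real_sequentially])
   then have "\<forall>\<^sub>F n in sequentially. real k < n * \<mu>" unfolding filterlim_at_top_dense by blast
   then show "\<forall>\<^sub>F n in sequentially. pp.P.prob B \<le> n * v / (n * \<mu> - k)\<^sup>2"
   proof eventually_elim
    case (elim n)
    have "pp.P.prob B \<le> pp.P.prob {\<omega>\<in>space P. U n \<omega> \<le> k}"
     by (rule pp.P.finite_measure_mono) (auto simp: B_def)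
    also have "\<dots> \<le> n * v / (n * \<mu> - k)\<^sup>2" unfolding v_def by (rule prob_U_le[OF elim])
    finally show ?case .
   qed
   have "(\<lambda>n. real n / (n * m - c)\<^sup>2) \<longlonglongrightarrow> 0" if "m > 0" for m c :: real using that by real_asymp
   from this[OF \<mu>_pos, of k] have "(\<lambda>n. real n / (n * \<mu> - k)\<^sup>2) \<longlonglongrightarrow> 0" .
   from tendsto_mult_right_zero[OF this, of v]
   show "(\<lambda>n. n * v / (n * \<mu> - k)\<^sup>2) \<longlonglongrightarrow> 0" by (simp add: mult.commute)
  qed simp
  then have "pp.P.prob B = 0" using measure_nonneg[of P B] by linarith
  then have "AE \<omega> in P. \<not> (\<forall>n. U n \<omega> \<le> real k)" using B unfolding B_def by (subst (asm) pp.P.prob_eq_0) auto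
  then show "AE \<omega> in P. \<exists>n. U n \<omega> > real k" by (simp add: not_le)
 qed
 from 1 2 show ?thesis
 proof eventually_elim
  case (elim \<omega>)
  have "\<exists>n. U n \<omega> > z" for z
  proof -
   obtain k :: nat where "z < k" using reals_Archimedean2 by blast
   then show ?thesis using elim(2) by (meson less_trans)
  qed
  then show ?case using elim by (simp add: regular_def)
 qed
qed

lemma Np_eq: "Np z \<omega> = (LEAST n. U n \<omega> > z)"
 by (simp add: N_plus_def Inf_nat_def)

lemma Np_props:
 assumes "regular \<omega>"
 shows "U (Np z \<omega>) \<omega> > z" and "n < Np z \<omega> \<Longrightarrow> U n \<omega> \<le> z" and "U n \<omega> > z \<Longrightarrow> Np z \<omega> \<le> n"
proof -
 from assms obtain n0 where n: "U n0 \<omega> > z" by (auto simp: regular_def)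
 show "U (Np z \<omega>) \<omega> > z" unfolding Np_eq by (rule LeastI[where P="\<lambda>n. U n \<omega> > z", OF n])
 show "n < Np z \<omega> \<Longrightarrow> U n \<omega> \<le> z" unfolding Np_eq using not_less_Least[of n "\<lambda>n. U n \<omega> > z"] by auto
 show "U n \<omega> > z \<Longrightarrow> Np z \<omega> \<le> n" unfolding Np_eq by (rule Least_le)
qed

lemma Np_eqI:
 assumes "U n \<omega> > z" "\<And>m. m < n \<Longrightarrow> U m \<omega> \<le> z"
 shows "Np z \<omega> = n"
 unfolding Np_eq using assms by (intro Least_equality) (auto simp: not_less[symmetric])

text \<open>By monotonicity the indices with sum at most z form an initial segment; since
  \<open>U 0 = 0\<close>, a level z \<ge> 0 keeps the index 0 in it.\<close>

lemma Nm_eq: assumes r: "regular \<omega>" and z: "z \<ge> 0" shows "Suc (Nm z \<omega>) = Np z \<omega>"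
proof -
 have pos: "Np z \<omega> > 0" using Np_props(1)[OF r, of z] z by (cases "Np z \<omega>") auto
 have "{n. U n \<omega> \<le> z} = {..<Np z \<omega>}"
 proof (rule set_eqI)
  fix n show "n \<in> {n. U n \<omega> \<le> z} \<longleftrightarrow> n \<in> {..<Np z \<omega>}"
   using Np_props(1)[OF r, of z] Np_props(2)[OF r, of n z] regular_mono[OF r, of "Np z \<omega>" n]
   by (cases "n < Np z \<omega>") auto
 qed
 also have "\<dots> = {..Np z \<omega> - 1}" using pos by (auto simp: Suc_le_eq)
 finally have "Nm z \<omega> = Np z \<omega> - 1" by (simp add: N_minus_def cSup_eq_maximum)
 then show ?thesis using pos by simp
qed

lemma U_split: "U (n + m) (splice {n<..} (\<lambda>j. j - n) x y) = U n x + U m y"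
proof (induction m)
 case 0
 show ?case by (auto simp: renewal_sum_def splice_def intro!: sum.cong)
next
 case (Suc m) then show ?case by (simp add: U_Suc splice_def)
qed

text \<open>Only the sums strictly before time n must respect the level. If the sum at time n has
  already passed it, the remaining level is negative, the restarted walk passes it at index 0, and
  the formula still holds.\<close>

lemma R_split:
 assumes below: "\<And>k. k < n \<Longrightarrow> U k x \<le> z" and y: "regular y"
 shows "R z (splice {n<..} (\<lambda>j. j - n) x y) = R (z - U n x) y"
proof -
 let ?\<omega> = "splice {n<..} (\<lambda>j. j - n) x y"
 have "Np z ?\<omega> = n + Np (z - U n x) y"
 proof (rule Np_eqI)
  show "U (n + Np (z - U n x) y) ?\<omega> > z" using Np_props(1)[OF y, of "z - U n x"] unfolding U_split by simp
  fix m assume m: "m < n + Np (z - U n x) y"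
  show "U m ?\<omega> \<le> z"
  proof (cases "m < n")
   case True
   have "U m ?\<omega> = U m x" using True by (auto simp: renewal_sum_def splice_def intro!: sum.cong)
   then show ?thesis using below[OF True] by simp
  next
   case False
   then obtain k where k: "m = n + k" by (auto simp: not_less le_iff_add)
   then have "k < Np (z - U n x) y" using m by simp
   then have "U k y \<le> z - U n x" by (rule Np_props(2)[OF y])
   then show ?thesis unfolding k U_split by simp
  qed
 qed
 then show ?thesis by (simp add: overshoot_def U_split)
qed

text \<open>Joint measurability in level and path is needed because the level that remains after a
  restart is random.\<close>

lemma Np_measurable [measurable]: "(\<lambda>(z, \<omega>). Np z \<omega>) \<in> measurable (borel \<Otimes>\<^sub>M P) (count_space UNIV)"
 unfolding Np_eq by measurable

lemma R_measurable_pair [measurable]: "(\<lambda>(z, \<omega>). R z \<omega>) \<in> borel_measurable (borel \<Otimes>\<^sub>M P)"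
proof -
 have "(\<lambda>p. U (case p of (z, \<omega>) \<Rightarrow> Np z \<omega>) (snd p)) \<in> borel_measurable (borel \<Otimes>\<^sub>M P)"
  by (rule measurable_compose_countable[where f="\<lambda>n p. U n (snd p)"]) measurable
 then show ?thesis unfolding overshoot_def by (simp add: case_prod_unfold)
qed

lemma R_measurable [measurable]: "R z \<in> borel_measurable P"
 using measurable_Pair2[OF R_measurable_pair, of z] by simp

end

section \<open>The renewal equation for functionals of the overshoot\<close>

context renewal_process
begin

text \<open>The equation on the line wants a step that is nonnegative everywhere; the positive part
  of \<open>f\<close> equals \<open>f\<close> almost surely.\<close>

sublocale Y: nonneg_step K "\<lambda>s. max 0 (f s)"
proof
 have e: "AE s in K. max 0 (f s) = f s" using f_nonneg by eventually_elim auto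
 show "integrable K (\<lambda>s. max 0 (f s))" by (subst integrable_cong_AE[OF _ _ e]) (auto simp: f_integrable)
 have "(\<integral>s. max 0 (f s) \<partial>K) = (\<integral>s. f s \<partial>K)" by (rule integral_cong_AE[OF _ _ e]) auto
 then show "0 < (\<integral>s. max 0 (f s) \<partial>K)" using f_mean_pos by simp
qed auto

lemma AE_max_eq: "AE s in K. max 0 (f s) = f s" using f_nonneg by eventually_elim auto

lemma Y_mean: "(\<integral>s. max 0 (f s) \<partial>K) = \<mu>"
 unfolding \<mu>_def by (rule integral_cong_AE[OF _ _ AE_max_eq]) auto

text \<open>Cut off at negative levels, because a solution must vanish on a left half-line.\<close>

definition level_mean :: "(real \<Rightarrow> real) \<Rightarrow> real \<Rightarrow> real" where
 "level_mean \<psi> z = (if 0 \<le> z then \<integral>\<omega>. \<psi> (R z \<omega>) \<partial>P else 0)"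

text \<open>The part of the expectation on which the very first step passes the level.\<close>

definition jump_mean :: "(real \<Rightarrow> real) \<Rightarrow> real \<Rightarrow> real" where
 "jump_mean \<psi> z = (\<integral>s. indicator {0..<max 0 (f s)} z * \<psi> (max 0 (f s) - z) \<partial>K)"

text \<open>The limit law in the nonarithmetic case. The event that f is at least u replaces that f
  exceeds u, which changes the density only on a null set. In this version the density of a lattice
  step is constant on the cells ((k-1) h, k h], so that rounding up gives the lattice limit.\<close>

definition density_law :: "real measure" where
 "density_law = density lborel (\<lambda>u. ennreal (indicator {0<..} u * prob {s \<in> space K. f s \<ge> u} / \<mu>))"

lemma R_bounded_integrable: "bdd_borel \<psi> \<Longrightarrow> integrable P (\<lambda>\<omega>. \<psi> (R z \<omega>))"
proof -
 assume b: "bdd_borel \<psi>"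
 obtain B where B: "\<And>x. \<bar>\<psi> x\<bar> \<le> B" using bdd_borelE[OF b] by blast
 have [measurable]: "\<psi> \<in> borel_measurable borel" using b by (rule bdd_borelD)
 show ?thesis using B by (intro pp.P.integrable_const_bound[where B=B]) auto
qed

lemma bdd_borel_R_mean: assumes b: "bdd_borel \<psi>" shows "bdd_borel (\<lambda>z. \<integral>\<omega>. \<psi> (R z \<omega>) \<partial>P)"
proof -
 obtain B where B: "\<And>x. \<bar>\<psi> x\<bar> \<le> B" using bdd_borelE[OF b] by blast
 have [measurable]: "\<psi> \<in> borel_measurable borel" using b by (rule bdd_borelD)
 show ?thesis
 proof (rule bdd_borelI)
  show "(\<lambda>z. \<integral>\<omega>. \<psi> (R z \<omega>) \<partial>P) \<in> borel_measurable borel" by measurable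
  show "\<bar>\<integral>\<omega>. \<psi> (R z \<omega>) \<partial>P\<bar> \<le> B" for z
  proof -
   have "\<bar>\<integral>\<omega>. \<psi> (R z \<omega>) \<partial>P\<bar> \<le> (\<integral>\<omega>. \<bar>\<psi> (R z \<omega>)\<bar> \<partial>P)" by (rule integral_abs_bound)
   also have "\<dots> \<le> (\<integral>\<omega>. B \<partial>P)" using B R_bounded_integrable[OF b] by (intro integral_mono) auto
   finally show ?thesis by (simp add: pp.P.prob_space)
  qed
 qed
qed

lemma bdd_borel_level_mean: assumes "bdd_borel \<psi>" shows "bdd_borel (level_mean \<psi>)"
proof -
 have "level_mean \<psi> = (\<lambda>z. indicator {0..} z * (\<integral>\<omega>. \<psi> (R z \<omega>) \<partial>P))"
  by (auto simp: level_mean_def fun_eq_iff)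
 moreover have "bdd_borel (indicator {0..})" by (rule bdd_borelI[where B=1]) (auto simp: indicator_def)
 ultimately show ?thesis using bdd_borel_mult[OF _ bdd_borel_R_mean[OF assms]] by simp
qed

lemma jump_pair_measurable:
 fixes \<psi> :: "real \<Rightarrow> real"
 assumes [measurable]: "\<psi> \<in> borel_measurable borel"
 shows "(\<lambda>(z, s). indicator {0..<max 0 (f s)} z * \<psi> (max 0 (f s) - z)) \<in> borel_measurable (lborel \<Otimes>\<^sub>M K)"
  and "(\<lambda>s. indicator {0..<max 0 (f s)} z * \<psi> (max 0 (f s) - z)) \<in> borel_measurable K"
proof -
 show m: "(\<lambda>(z, s). indicator {0..<max 0 (f s)} z * \<psi> (max 0 (f s) - z)) \<in> borel_measurable (lborel \<Otimes>\<^sub>M K)"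
 proof -
  have "indicator {0..<max 0 (f s)} z * \<psi> (max 0 (f s) - z) = (if 0 \<le> z \<and> z < max 0 (f s) then \<psi> (max 0 (f s) - z) else 0)" for z s
   by (auto simp: indicator_def)
  then show ?thesis by simp
 qed
 show "(\<lambda>s. indicator {0..<max 0 (f s)} z * \<psi> (max 0 (f s) - z)) \<in> borel_measurable K"
  using measurable_Pair2[OF m, of z] by simp
qed

lemma jump_integrable:
 assumes b: "bdd_borel \<psi>"
 shows "integrable K (\<lambda>s. indicator {0..<max 0 (f s)} z * \<psi> (max 0 (f s) - z))"
proof -
 obtain B where B: "\<And>x. \<bar>\<psi> x\<bar> \<le> B" using bdd_borelE[OF b] by blast
 show ?thesis
 proof (rule integrable_const_bound[where B=B])
  show "AE s in K. norm (indicator {0..<max 0 (f s)} z * \<psi> (max 0 (f s) - z)) \<le> B"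
  proof (rule AE_I2)
   fix s
   show "norm (indicator {0..<max 0 (f s)} z * \<psi> (max 0 (f s) - z)) \<le> B"
    using B[of "max 0 (f s) - z"] by (cases "z \<in> {0..<max 0 (f s)}") auto
  qed
 qed (rule jump_pair_measurable(2)[OF bdd_borelD[OF b]])
qed

text \<open>Condition on the first step: either it passes the level z, or a fresh walk faces the
  level z minus this step.\<close>

lemma renewal_equation:
 assumes b: "bdd_borel \<psi>"
 shows "level_mean \<psi> z = jump_mean \<psi> z + Y.step (level_mean \<psi>) z"
proof (cases "z \<ge> 0")
 case False
 then show ?thesis by (auto simp: level_mean_def jump_mean_def Y.step_def)
next
 case z: True
 define G where "G v = (\<integral>\<omega>. \<psi> (R v \<omega>) \<partial>P)" for v
 have bG: "bdd_borel G" unfolding G_def[abs_def] by (rule bdd_borel_R_mean[OF b])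
 have [measurable]: "G \<in> borel_measurable borel" by (rule bdd_borelD[OF bG])
 have [measurable]: "\<psi> \<in> borel_measurable borel" by (rule bdd_borelD[OF b])
 \<comment> \<open>The sums start at index 1: the restart keeps the coordinates 0 and 1 and draws
   those from 2 on from the fresh path at indices 1, 2, and so on.\<close>
 have inj: "inj_on (\<lambda>j. j - 1) {1::nat<..}" by (auto simp: inj_on_def)
 have "level_mean \<psi> z = (\<integral>x. (\<integral>y. \<psi> (R z (splice {1<..} (\<lambda>j. j - 1) x y)) \<partial>P) \<partial>P)"
  using z integral_splice(2)[OF inj R_bounded_integrable[OF b], of z]
  by (simp only: level_mean_def if_True)
 also have "\<dots> = (\<integral>x. G (z - f (x 1)) \<partial>P)"
 proof (intro Bochner_Integration.integral_cong refl)
  fix x assume x: "x \<in> space P"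
  show "(\<integral>y. \<psi> (R z (splice {1<..} (\<lambda>j. j - 1) x y)) \<partial>P) = G (z - f (x 1))"
   unfolding G_def
  proof (rule integral_cong_AE)
   show "AE y in P. \<psi> (R z (splice {1<..} (\<lambda>j. j - 1) x y)) = \<psi> (R (z - f (x 1)) y)"
    using AE_regular
   proof eventually_elim
    case (elim y)
    show ?case using R_split[OF _ elim, of 1 x z] z by (simp add: renewal_sum_def)
   qed
   have "splice {1<..} (\<lambda>j. j - 1) x \<in> measurable P P" using x by (rule measurable_splice_snd)
   then show "(\<lambda>y. \<psi> (R z (splice {1<..} (\<lambda>j. j - 1) x y))) \<in> borel_measurable P" by measurable
  qed measurable
 qed
 also have "\<dots> = (\<integral>s. G (z - f s) \<partial>K)" by (rule integral_coord) measurable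
 also have "\<dots> = (\<integral>s. indicator {0..<max 0 (f s)} z * \<psi> (max 0 (f s) - z) + level_mean \<psi> (z - max 0 (f s)) \<partial>K)"
 proof (rule integral_cong_AE)
  \<comment> \<open>A negative level is passed at index 0 with overshoot -v; this is where the jump
    term comes from.\<close>
  have G_neg: "G v = \<psi> (- v)" if "v < 0" for v
  proof -
   have "Np v \<omega> = 0" for \<omega> using that by (intro Np_eqI) auto
   then have "R v \<omega> = - v" for \<omega> by (simp add: overshoot_def)
   then show ?thesis by (simp add: G_def pp.P.prob_space)
  qed
  show "AE s in K. G (z - f s) = indicator {0..<max 0 (f s)} z * \<psi> (max 0 (f s) - z) + level_mean \<psi> (z - max 0 (f s))"
   using AE_max_eq
  proof eventually_elim
   case (elim s)
   show ?case
   proof (cases "f s \<le> z")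
    case True then show ?thesis unfolding elim using z by (simp add: level_mean_def G_def)
   next
    case False then show ?thesis unfolding elim using z G_neg[of "z - f s"] by (simp add: level_mean_def)
   qed
  qed
  have [measurable]: "level_mean \<psi> \<in> borel_measurable borel" by (rule bdd_borelD[OF bdd_borel_level_mean[OF b]])
  show "(\<lambda>s. indicator {0..<max 0 (f s)} z * \<psi> (max 0 (f s) - z) + level_mean \<psi> (z - max 0 (f s))) \<in> borel_measurable K"
   by (intro borel_measurable_add jump_pair_measurable(2)) measurable
 qed measurable
 also have "\<dots> = jump_mean \<psi> z + Y.step (level_mean \<psi>) z"
  unfolding jump_mean_def Y.step_def
  by (rule Bochner_Integration.integral_add[OF jump_integrable[OF b] Y.step_integrable[OF bdd_borel_level_mean[OF b]]])
 finally show ?thesis .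
qed

text \<open>What the renewal limits demand of q, and the integral in their limit: for a fixed step,
  u = f - z turns the integral over levels into one over overshoot sizes u, and Fubini leaves the
  tail probability at u.\<close>

lemma jump_mean_props:
 assumes b: "bdd_borel \<psi>"
 shows "bdd_borel (jump_mean \<psi>)" "(jump_mean \<psi> \<longlongrightarrow> 0) at_top" "integrable lborel (jump_mean \<psi>)"
  and "integrable lborel (\<lambda>u. indicator {0<..} u * prob {s \<in> space K. f s \<ge> u} * \<psi> u)"
  and "(\<integral>z. jump_mean \<psi> z \<partial>lborel) = (\<integral>u. indicator {0<..} u * prob {s \<in> space K. f s \<ge> u} * \<psi> u \<partial>lborel)"
proof -
 obtain B where B: "\<And>x. \<bar>\<psi> x\<bar> \<le> B" using bdd_borelE[OF b] by blast
 have B0: "B \<ge> 0" using order_trans[OF abs_ge_zero B] .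
 have m [measurable]: "\<psi> \<in> borel_measurable borel" by (rule bdd_borelD[OF b])
 interpret lK: pair_sigma_finite lborel K ..
 note jm = jump_pair_measurable[OF m]
 have le: "\<bar>indicator {0..<max 0 (f s)} z * \<psi> (max 0 (f s) - z)\<bar> \<le> B * indicator {0..<max 0 (f s)} z" for z s
  using B[of "max 0 (f s) - z"] B0 by (cases "z \<in> {0..<max 0 (f s)}") auto
 have le': "\<bar>indicator {0..<max 0 (f s)} z * \<psi> (max 0 (f s) - z)\<bar> \<le> B" for z s
  using B[of "max 0 (f s) - z"] B0 by (cases "z \<in> {0..<max 0 (f s)}") auto
 show "bdd_borel (jump_mean \<psi>)"
 proof (rule bdd_borelI)
  show "jump_mean \<psi> \<in> borel_measurable borel"
   unfolding jump_mean_def[abs_def] using borel_measurable_lebesgue_integral[OF jm(1)] by simp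
  show "\<bar>jump_mean \<psi> z\<bar> \<le> B" for z
  proof -
   have "\<bar>jump_mean \<psi> z\<bar> \<le> (\<integral>s. \<bar>indicator {0..<max 0 (f s)} z * \<psi> (max 0 (f s) - z)\<bar> \<partial>K)"
    unfolding jump_mean_def by (rule integral_abs_bound)
   also have "\<dots> \<le> (\<integral>s. B \<partial>K)"
    using le' jump_integrable[OF b] by (intro integral_mono integrable_abs) auto
   finally show ?thesis by (simp add: prob_space)
  qed
 qed
 show "(jump_mean \<psi> \<longlongrightarrow> 0) at_top"
 proof -
  have "((\<lambda>z. \<integral>s. indicator {0..<max 0 (f s)} z * \<psi> (max 0 (f s) - z) \<partial>K) \<longlongrightarrow> (\<integral>s. 0 \<partial>K)) at_top"
  proof (rule integral_dominated_convergence_at_top[where w="\<lambda>_. B"])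
   show "AE s in K. ((\<lambda>z. indicator {0..<max 0 (f s)} z * \<psi> (max 0 (f s) - z)) \<longlongrightarrow> 0) at_top"
   proof (rule AE_I2)
    fix s
    have "\<forall>\<^sub>F z in at_top. 0 = indicator {0..<max 0 (f s)} z * \<psi> (max 0 (f s) - z)"
     using eventually_ge_at_top[of "max 0 (f s)"] by eventually_elim auto
    then show "((\<lambda>z. indicator {0..<max 0 (f s)} z * \<psi> (max 0 (f s) - z)) \<longlongrightarrow> 0) at_top"
     by (rule Lim_transform_eventually[OF tendsto_const])
   qed
   show "\<forall>\<^sub>F z in at_top. AE s in K. norm (indicator {0..<max 0 (f s)} z * \<psi> (max 0 (f s) - z)) \<le> B"
    using le' by (intro always_eventually allI AE_I2) simp
  qed (use jm(2) in auto)
  then show ?thesis by (simp add: jump_mean_def[abs_def])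
 qed
 have i1: "integrable (lborel \<Otimes>\<^sub>M K) (\<lambda>(z, s). indicator {0..<max 0 (f s)} z * \<psi> (max 0 (f s) - z))"
 proof (rule Bochner_Integration.integrable_bound)
  show "integrable (lborel \<Otimes>\<^sub>M K) (\<lambda>p. B * (case p of (u, s) \<Rightarrow> indicator {0..<max 0 (f s)} u))"
   by (rule integrable_mult_right) (rule Y.indicator_pair_integrable)
  show "AE p in lborel \<Otimes>\<^sub>M K. norm (case p of (z, s) \<Rightarrow> indicator {0..<max 0 (f s)} z * \<psi> (max 0 (f s) - z))
    \<le> norm (B * (case p of (u, s) \<Rightarrow> indicator {0..<max 0 (f s)} u))"
  proof (rule AE_I2, clarify)
   fix z s
   show "norm (indicator {0..<max 0 (f s)} z * \<psi> (max 0 (f s) - z)) \<le> norm (B * (indicator {0..<max 0 (f s)} z :: real))"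
    using le[of s z] B0 by simp
  qed
 qed (rule jm(1))
 show "integrable lborel (jump_mean \<psi>)"
  using lK.integrable_fst[OF i1] by (simp add: jump_mean_def[abs_def])
 let ?h = "\<lambda>u s. indicator {0<..max 0 (f s)} u * \<psi> u"
 have aff: "(\<integral>z. indicator {0..<max 0 (f s)} z * \<psi> (max 0 (f s) - z) \<partial>lborel) = (\<integral>u. ?h u s \<partial>lborel)"
   and affi: "integrable lborel (\<lambda>u. ?h u s) \<longleftrightarrow> integrable lborel (\<lambda>z. indicator {0..<max 0 (f s)} z * \<psi> (max 0 (f s) - z))" for s
 proof -
  have ind: "?h (max 0 (f s) + (-1) * z) s = indicator {0..<max 0 (f s)} z * \<psi> (max 0 (f s) - z)" for z
   by (auto simp: indicator_def)
  show "(\<integral>z. indicator {0..<max 0 (f s)} z * \<psi> (max 0 (f s) - z) \<partial>lborel) = (\<integral>u. ?h u s \<partial>lborel)"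
   using lborel_integral_real_affine[of "-1" "\<lambda>u. ?h u s" "max 0 (f s)"] unfolding ind by simp
  show "integrable lborel (\<lambda>u. ?h u s) \<longleftrightarrow> integrable lborel (\<lambda>z. indicator {0..<max 0 (f s)} z * \<psi> (max 0 (f s) - z))"
   using lborel_integrable_real_affine_iff[of "-1" "\<lambda>u. ?h u s" "max 0 (f s)"] unfolding ind by simp
 qed
 have hm: "(\<lambda>(u, s). ?h u s) \<in> borel_measurable (lborel \<Otimes>\<^sub>M K)"
 proof -
  have "?h u s = (if 0 < u \<and> u \<le> max 0 (f s) then \<psi> u else 0)" for u s by (auto simp: indicator_def)
  then show ?thesis by simp
 qed
 have i2: "integrable (lborel \<Otimes>\<^sub>M K) (\<lambda>(u, s). ?h u s)"
 proof -
  have "(\<integral>\<^sup>+ p. ennreal (norm (?h (fst p) (snd p))) \<partial>(lborel \<Otimes>\<^sub>M K)) = (\<integral>\<^sup>+ s. (\<integral>\<^sup>+ u. ennreal (norm (?h u s)) \<partial>lborel) \<partial>K)"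
   using hm by (subst lK.nn_integral_snd[symmetric]) (auto simp: case_prod_unfold)
  also have "\<dots> \<le> (\<integral>\<^sup>+ s. ennreal (B * max 0 (f s)) \<partial>K)"
  proof (rule nn_integral_mono)
   fix s
   have "(\<integral>\<^sup>+ u. ennreal (norm (?h u s)) \<partial>lborel) \<le> (\<integral>\<^sup>+ u. ennreal B * indicator {0<..max 0 (f s)} u \<partial>lborel)"
    using B by (intro nn_integral_mono) (auto simp: indicator_def intro: ennreal_leI)
   also have "\<dots> = ennreal (B * max 0 (f s))" using B0 by (simp add: nn_integral_cmult_indicator ennreal_mult)
   finally show "(\<integral>\<^sup>+ u. ennreal (norm (?h u s)) \<partial>lborel) \<le> ennreal (B * max 0 (f s))" .
  qed
  also have "\<dots> < \<infinity>"
   using B0 Y.Y_integrable by (subst nn_integral_eq_integral) auto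
  finally show ?thesis using hm by (intro integrableI_bounded) (auto simp: case_prod_unfold)
 qed
 have inner: "(\<integral>s. ?h u s \<partial>K) = indicator {0<..} u * prob {s \<in> space K. f s \<ge> u} * \<psi> u" for u
 proof -
  have "(\<integral>s. ?h u s \<partial>K) = (\<integral>s. indicator {0<..} u * \<psi> u * indicator {s \<in> space K. f s \<ge> u} s \<partial>K)"
   by (intro Bochner_Integration.integral_cong) (auto simp: indicator_def)
  then show ?thesis by simp
 qed
 show "integrable lborel (\<lambda>u. indicator {0<..} u * prob {s \<in> space K. f s \<ge> u} * \<psi> u)"
  using lK.integrable_fst[OF i2] unfolding inner .
 have "(\<integral>z. jump_mean \<psi> z \<partial>lborel) = (\<integral>s. (\<integral>z. indicator {0..<max 0 (f s)} z * \<psi> (max 0 (f s) - z) \<partial>lborel) \<partial>K)"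
  using lK.Fubini_integral[OF i1] by (simp add: jump_mean_def)
 also have "\<dots> = (\<integral>u. (\<integral>s. ?h u s \<partial>K) \<partial>lborel)"
  unfolding aff using lK.Fubini_integral[OF i2] by simp
 finally show "(\<integral>z. jump_mean \<psi> z \<partial>lborel) = (\<integral>u. indicator {0<..} u * prob {s \<in> space K. f s \<ge> u} * \<psi> u \<partial>lborel)"
  unfolding inner .
qed

lemma overshoot_density_measurable [measurable]:
 "(\<lambda>u. indicator {0<..} u * prob {s \<in> space K. f s \<ge> u} / \<mu>) \<in> borel_measurable borel"
proof -
 have "(\<lambda>u. prob {s \<in> space K. f s \<ge> u}) \<in> borel_measurable borel" by measurable
 then show ?thesis by measurable
qed

lemma jump_mean_limit:
 assumes b: "bdd_borel \<psi>"
 shows "(\<integral>z. jump_mean \<psi> z \<partial>lborel) / \<mu> = (\<integral>u. \<psi> u \<partial>density_law)"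
proof -
 have [measurable]: "\<psi> \<in> borel_measurable borel" by (rule bdd_borelD[OF b])
 have "(\<integral>u. \<psi> u \<partial>density_law) = (\<integral>u. indicator {0<..} u * prob {s \<in> space K. f s \<ge> u} / \<mu> * \<psi> u \<partial>lborel)"
  unfolding density_law_def using \<mu>_pos by (subst integral_density) auto
 also have "\<dots> = (\<integral>u. indicator {0<..} u * prob {s \<in> space K. f s \<ge> u} * \<psi> u / \<mu> \<partial>lborel)" by simp
 finally show ?thesis unfolding jump_mean_props(5)[OF b] by simp
qed

lemma real_distribution_density_law: "real_distribution density_law"
proof -
 have 1: "(\<integral>z. jump_mean (\<lambda>_. 1) z \<partial>lborel) = \<mu>"
 proof -
  interpret lK: pair_sigma_finite lborel K ..
  have "(\<integral>z. jump_mean (\<lambda>_. 1) z \<partial>lborel) = (\<integral>s. (\<integral>z. (indicator {0..<max 0 (f s)} z :: real) \<partial>lborel) \<partial>K)"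
   using lK.Fubini_integral[OF Y.indicator_pair_integrable] by (simp add: jump_mean_def)
  also have "\<dots> = \<mu>" by (simp add: Y_mean)
  finally show ?thesis .
 qed
 have "emeasure density_law UNIV = (\<integral>\<^sup>+ u. ennreal (indicator {0<..} u * prob {s \<in> space K. f s \<ge> u} / \<mu>) \<partial>lborel)"
  by (simp add: density_law_def emeasure_density)
 also have "\<dots> = ennreal (\<integral>u. indicator {0<..} u * prob {s \<in> space K. f s \<ge> u} / \<mu> \<partial>lborel)"
  using jump_mean_props(4)[OF bdd_borel_const[of 1]] \<mu>_pos by (intro nn_integral_eq_integral) auto
 also have "\<dots> = 1" using jump_mean_props(5)[OF bdd_borel_const[of 1]] 1 \<mu>_pos by simp
 finally have "emeasure density_law (space density_law) = 1" by (simp add: density_law_def)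
 then show ?thesis by (auto intro!: real_distribution.intro prob_spaceI real_distribution_axioms.intro simp: density_law_def)
qed

lemma level_mean_limit_nonarithmetic:
 assumes b: "bdd_borel \<psi>" and \<delta>: "\<delta> > 0"
  and nonar: "\<And>c. c > 0 \<Longrightarrow> \<not> (AE s in K. f s \<in> multiples c)"
 shows "((\<lambda>z. (\<integral>u. indicator {0..\<delta>} u * level_mean \<psi> (z + u) \<partial>lborel) / \<delta>) \<longlongrightarrow> (\<integral>u. \<psi> u \<partial>density_law)) at_top"
proof -
 note j = jump_mean_props[OF b]
 have "((\<lambda>z. (\<integral>u. indicator {0..\<delta>} u * level_mean \<psi> (z + u) \<partial>lborel) / \<delta>) \<longlongrightarrow> (\<integral>z. jump_mean \<psi> z \<partial>lborel) / (\<integral>s. max 0 (f s) \<partial>K)) at_top"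
 proof (rule Y.renewal_limit_nonarithmetic[OF bdd_borel_level_mean[OF b] j(1,3,2) renewal_equation[OF b] _ _ \<delta>])
  show "level_mean \<psi> x = 0" if "x < - 0" for x using that by (simp add: level_mean_def)
  fix c :: real assume "c > 0"
  from nonar[OF this] show "\<not> (AE s in K. max 0 (f s) \<in> multiples c)"
   using AE_max_eq by (auto elim!: contrapos_nn)
 qed
 then show ?thesis by (simp add: Y_mean jump_mean_limit[OF b])
qed

lemma level_mean_limit_lattice:
 assumes b: "bdd_borel \<psi>" and h: "h > 0" and lat: "AE s in K. f s \<in> multiples h"
  and max: "\<And>c. c > 0 \<Longrightarrow> AE s in K. f s \<in> multiples c \<Longrightarrow> c \<le> h"
  and cell: "\<And>z. level_mean \<psi> z = level_mean \<psi> (of_int \<lfloor>z / h\<rfloor> * h)"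
 shows "(level_mean \<psi> \<longlongrightarrow> (\<integral>u. \<psi> u \<partial>density_law)) at_top"
proof -
 note j = jump_mean_props[OF b]
 have "(level_mean \<psi> \<longlongrightarrow> (\<integral>z. jump_mean \<psi> z \<partial>lborel) / (\<integral>s. max 0 (f s) \<partial>K)) at_top"
 proof (rule Y.renewal_limit_lattice[OF bdd_borel_level_mean[OF b] j(1,3,2) renewal_equation[OF b] _ h _ _ cell])
  show "level_mean \<psi> x = 0" if "x < - 0" for x using that by (simp add: level_mean_def)
  show "AE s in K. max 0 (f s) \<in> multiples h" using lat AE_max_eq by eventually_elim simp
  fix c :: real assume "c > 0" "AE s in K. max 0 (f s) \<in> multiples c"
  from this(2) AE_max_eq have "AE s in K. f s \<in> multiples c" by eventually_elim simp
  with \<open>c > 0\<close> show "c \<le> h" by (rule max)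
 qed
 then show ?thesis by (simp add: Y_mean jump_mean_limit[OF b])
qed

end

lemma average_ge:
 fixes h :: "real \<Rightarrow> real"
 assumes b: "bdd_borel h" and \<delta>: "\<delta> > 0" and ge: "\<And>u. 0 \<le> u \<Longrightarrow> u \<le> \<delta> \<Longrightarrow> c \<le> h u"
 shows "c \<le> (\<integral>u. indicator {0..\<delta>} u * h u \<partial>lborel) / \<delta>"
proof -
 obtain B where B: "\<And>x. \<bar>h x\<bar> \<le> B" using bdd_borelE[OF b] by blast
 have B0: "B \<ge> 0" using order_trans[OF abs_ge_zero B[of 0]] .
 have [measurable]: "h \<in> borel_measurable borel" by (rule bdd_borelD[OF b])
 have ii: "integrable lborel (indicator {0..\<delta>} :: real \<Rightarrow> real)"
  by (rule integrable_real_indicator) (auto simp: emeasure_lborel_Icc_eq)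
 have "(\<integral>u. c * indicator {0..\<delta>} u \<partial>lborel) \<le> (\<integral>u. indicator {0..\<delta>} u * h u \<partial>lborel)"
 proof (rule integral_mono)
  show "integrable lborel (\<lambda>u. indicator {0..\<delta>} u * h u)"
  proof (rule Bochner_Integration.integrable_bound)
   show "integrable lborel (\<lambda>u. B * indicator {0..\<delta>} u)" by (simp add: ii)
   show "AE u in lborel. norm (indicator {0..\<delta>} u * h u) \<le> norm (B * indicator {0..\<delta>} u)"
   proof (rule AE_I2)
    fix u show "norm (indicator {0..\<delta>} u * h u) \<le> norm (B * indicator {0..\<delta>} u)"
     using B[of u] B0 by (cases "u \<in> {0..\<delta>}") auto
   qed
  qed auto
  show "c * indicator {0..\<delta>} u \<le> indicator {0..\<delta>} u * h u" for u using ge[of u] by (cases "u \<in> {0..\<delta>}") auto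
 qed (simp add: ii)
 then show ?thesis using \<delta> by (simp add: field_simps)
qed

lemma average_dist:
 fixes h :: "real \<Rightarrow> real"
 assumes b: "bdd_borel h" and \<delta>: "\<delta> > 0" and le: "\<And>u. 0 \<le> u \<Longrightarrow> u \<le> \<delta> \<Longrightarrow> \<bar>h u - c\<bar> \<le> e"
 shows "\<bar>(\<integral>u. indicator {0..\<delta>} u * h u \<partial>lborel) / \<delta> - c\<bar> \<le> e"
proof -
 have "c - e \<le> (\<integral>u. indicator {0..\<delta>} u * h u \<partial>lborel) / \<delta>"
  using le by (intro average_ge[OF b \<delta>]) (force simp: abs_le_iff)
 moreover have "- c - e \<le> (\<integral>u. indicator {0..\<delta>} u * (0 - h u) \<partial>lborel) / \<delta>"
  using le by (intro average_ge[OF bdd_borel_diff[OF bdd_borel_const b] \<delta>]) (force simp: abs_le_iff)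
 ultimately show ?thesis by simp
qed

lemma bdd_borel_shift: assumes "bdd_borel h" shows "bdd_borel (\<lambda>u. h (z + u))"
proof -
 obtain B where B: "\<And>x. \<bar>h x\<bar> \<le> B" using bdd_borelE[OF assms] by blast
 have [measurable]: "h \<in> borel_measurable borel" by (rule bdd_borelD[OF assms])
 show ?thesis by (rule bdd_borelI[OF _ B]) measurable
qed

lemma bdd_borel_lipschitz:
 fixes \<psi> :: "real \<Rightarrow> real"
 assumes B: "\<And>x. \<bar>\<psi> x\<bar> \<le> B" and L: "\<And>x y. \<bar>\<psi> x - \<psi> y\<bar> \<le> L * \<bar>x - y\<bar>"
 shows "bdd_borel \<psi>"
proof (rule bdd_borelI[OF _ B])
 have "L \<ge> 0" using L[of 1 0] by auto
 then have "L-lipschitz_on UNIV \<psi>" using L by (auto intro!: lipschitz_onI simp: dist_real_def)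
 then have "continuous_on UNIV \<psi>" by (rule lipschitz_on_continuous_on)
 then show "\<psi> \<in> borel_measurable borel" by (rule borel_measurable_continuous_onI)
qed

section \<open>From averaged levels to every level; explicit limit laws\<close>

context renewal_process
begin

text \<open>A lower level is passed no later, so its overshoot is at most the old one plus the
  shift.\<close>

lemma R_shift_down: assumes r: "regular \<omega>" and "R z \<omega> \<le> \<delta>" "0 \<le> v" "v \<le> \<delta>" shows "R (z - v) \<omega> \<le> 2 * \<delta>"
proof -
 have "U (Np z \<omega>) \<omega> > z - v" using Np_props(1)[OF r, of z] assms by linarith
 then have "Np (z - v) \<omega> \<le> Np z \<omega>" by (rule Np_props(3)[OF r])
 then have "U (Np (z - v) \<omega>) \<omega> \<le> U (Np z \<omega>) \<omega>" by (rule regular_mono[OF r])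
 then show ?thesis using assms by (simp add: overshoot_def)
qed

text \<open>A level raised by less than the overshoot is passed at the same index.\<close>

lemma R_shift_up: assumes r: "regular \<omega>" and "R z \<omega> > u" "0 \<le> u" shows "R (z + u) \<omega> = R z \<omega> - u"
proof -
 have "Np (z + u) \<omega> = Np z \<omega>"
 proof (rule Np_eqI)
  show "U (Np z \<omega>) \<omega> > z + u" using assms(2) by (simp add: overshoot_def)
  show "U m \<omega> \<le> z + u" if "m < Np z \<omega>" for m using Np_props(2)[OF r that] assms(3) by linarith
 qed
 then show ?thesis by (simp add: overshoot_def)
qed

lemma integral_overshoot_law_indicator:
 assumes "A \<in> sets borel"
 shows "measure density_law A = (\<integral>u. indicator {0<..} u * prob {s \<in> space K. f s \<ge> u} / \<mu> * indicator A u \<partial>lborel)"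
proof -
 interpret \<rho>: real_distribution density_law by (rule real_distribution_density_law)
 have "measure density_law A = (\<integral>u. indicator A u \<partial>density_law)" using assms by simp
 also have "\<dots> = (\<integral>u. indicator {0<..} u * prob {s \<in> space K. f s \<ge> u} / \<mu> * indicator A u \<partial>lborel)"
  unfolding density_law_def using \<mu>_pos assms by (subst integral_density) auto
 finally show ?thesis .
qed

text \<open>An overshoot of at most \<delta> at z forces overshoots of at most 2 \<delta> at all
  levels in [z - \<delta>, z], so the averaged limit applies; the limiting density is at most 1 /
  \<mu>.\<close>

lemma prob_small_overshoot:
 fixes e :: real
 assumes \<delta>: "\<delta> > 0" and nonar: "\<And>c. c > 0 \<Longrightarrow> \<not> (AE s in K. f s \<in> multiples c)" and e: "e > 0"
 shows "\<forall>\<^sub>F z in at_top. (\<integral>\<omega>. indicator {..\<delta>} (R z \<omega>) \<partial>P) \<le> 2 * \<delta> / \<mu> + e"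
proof -
 define \<kappa> :: "real \<Rightarrow> real" where "\<kappa> = indicator {..2 * \<delta>}"
 have b: "bdd_borel \<kappa>" by (rule bdd_borelI[where B=1]) (auto simp: \<kappa>_def indicator_def)
 have bd: "bdd_borel (indicator {..\<delta>})" by (rule bdd_borelI[where B=1]) (auto simp: indicator_def)
 have le: "(\<integral>u. \<kappa> u \<partial>density_law) \<le> 2 * \<delta> / \<mu>"
 proof -
  have "(\<integral>u. \<kappa> u \<partial>density_law) = (\<integral>u. indicator {0<..} u * prob {s \<in> space K. f s \<ge> u} / \<mu> * \<kappa> u \<partial>lborel)"
   unfolding density_law_def \<kappa>_def using \<mu>_pos by (subst integral_density) auto
  also have "\<dots> \<le> (\<integral>u. indicator {0..2 * \<delta>} u / \<mu> \<partial>lborel)"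
  proof (rule integral_mono')
   show "integrable lborel (\<lambda>u. indicator {0..2 * \<delta>} u / \<mu>)"
    by (intro integrable_divide integrable_real_indicator) (auto simp: emeasure_lborel_Icc_eq)
   show "indicator {0<..} u * prob {s \<in> space K. f s \<ge> u} / \<mu> * \<kappa> u \<le> indicator {0..2 * \<delta>} u / \<mu>" for u
    using \<mu>_pos by (auto simp: \<kappa>_def indicator_def intro!: divide_right_mono)
  qed (use \<mu>_pos in \<open>auto simp: \<kappa>_def\<close>)
  also have "\<dots> = 2 * \<delta> / \<mu>" using \<delta> by simp
  finally show ?thesis .
 qed
 have "((\<lambda>z. (\<integral>u. indicator {0..\<delta>} u * level_mean \<kappa> (z - \<delta> + u) \<partial>lborel) / \<delta>) \<longlongrightarrow> (\<integral>u. \<kappa> u \<partial>density_law)) at_top"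
  using filterlim_compose[OF level_mean_limit_nonarithmetic[OF b \<delta> nonar] filterlim_shift_at_top[of "- \<delta>"]] by simp
 then have "\<forall>\<^sub>F z in at_top. (\<integral>u. indicator {0..\<delta>} u * level_mean \<kappa> (z - \<delta> + u) \<partial>lborel) / \<delta> < 2 * \<delta> / \<mu> + e"
  by (rule order_tendstoD) (use le e in linarith)
 then show ?thesis using eventually_ge_at_top[of \<delta>]
 proof eventually_elim
  case (elim z)
  have "(\<integral>\<omega>. indicator {..\<delta>} (R z \<omega>) \<partial>P) \<le> (\<integral>u. indicator {0..\<delta>} u * level_mean \<kappa> (z - \<delta> + u) \<partial>lborel) / \<delta>"
  proof (rule average_ge[OF bdd_borel_shift[OF bdd_borel_level_mean[OF b]] \<delta>])
   fix u assume u: "0 \<le> u" "u \<le> \<delta>"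
   have "(\<integral>\<omega>. indicator {..\<delta>} (R z \<omega>) \<partial>P) \<le> (\<integral>\<omega>. \<kappa> (R (z - \<delta> + u) \<omega>) \<partial>P)"
   proof (rule integral_mono_AE)
    show "AE \<omega> in P. indicator {..\<delta>} (R z \<omega>) \<le> \<kappa> (R (z - \<delta> + u) \<omega>)"
     using AE_regular
    proof eventually_elim
     case (elim \<omega>)
     show ?case using R_shift_down[OF elim, of z \<delta> "\<delta> - u"] u by (auto simp: \<kappa>_def indicator_def algebra_simps)
    qed
   qed (intro R_bounded_integrable b bd)+
   then show "(\<integral>\<omega>. indicator {..\<delta>} (R z \<omega>) \<partial>P) \<le> level_mean \<kappa> (z - \<delta> + u)" using u elim by (simp add: level_mean_def)
  qed
  then show ?case using elim by linarith
 qed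
qed

text \<open>Raising the level by u \<le> \<delta> lowers the overshoot by exactly u unless the
  overshoot is at most \<delta>, an event of probability of order \<delta>. Hence the expectation at
  z is close to its average over [z, z + \<delta>].\<close>

theorem overshoot_limit_nonarithmetic:
 assumes B: "\<And>x. \<bar>\<psi> x\<bar> \<le> B" and L: "\<And>x y. \<bar>\<psi> x - \<psi> y\<bar> \<le> L * \<bar>x - y\<bar>"
  and nonar: "\<And>c. c > 0 \<Longrightarrow> \<not> (AE s in K. f s \<in> multiples c)"
 shows "((\<lambda>z. \<integral>\<omega>. \<psi> (R z \<omega>) \<partial>P) \<longlongrightarrow> (\<integral>u. \<psi> u \<partial>density_law)) at_top"
proof (rule tendstoI)
 fix e :: real assume e: "e > 0"
 have b: "bdd_borel \<psi>" by (rule bdd_borel_lipschitz[OF B L])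
 have B0: "B \<ge> 0" using order_trans[OF abs_ge_zero B[of 0]] .
 have L0: "L \<ge> 0" using L[of 1 0] by auto
 \<comment> \<open>The errors per unit of \<delta>: L from the Lipschitz bound, and 2 B times 2 /
   \<mu> from small overshoots; the 1 makes C positive.\<close>
 define C where "C = L + 4 * B / \<mu> + 1"
 have C: "C > 0" using B0 L0 \<mu>_pos by (simp add: C_def add_nonneg_pos)
 define \<delta> where "\<delta> = e / (4 * C)"
 have \<delta>: "\<delta> > 0" using e C by (simp add: \<delta>_def)
 have Cd: "C * \<delta> = e / 4" using C by (simp add: \<delta>_def)
 define e' where "e' = e / (8 * B + 1)"
 have e': "e' > 0" "2 * B * e' \<le> e / 4" using e B0 by (auto simp: e'_def field_simps)
 define I where "I = (\<integral>u. \<psi> u \<partial>density_law)"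
 define A where "A z = (\<integral>u. indicator {0..\<delta>} u * level_mean \<psi> (z + u) \<partial>lborel) / \<delta>" for z
 have "(A \<longlongrightarrow> I) at_top" unfolding A_def[abs_def] I_def by (rule level_mean_limit_nonarithmetic[OF b \<delta> nonar])
 then have "\<forall>\<^sub>F z in at_top. dist (A z) I < e / 4" using e by (intro tendstoD) auto
 moreover have "\<forall>\<^sub>F z in at_top. (\<integral>\<omega>. indicator {..\<delta>} (R z \<omega>) \<partial>P) \<le> 2 * \<delta> / \<mu> + e'"
  by (rule prob_small_overshoot[OF \<delta> nonar e'(1)])
 ultimately show "\<forall>\<^sub>F z in at_top. dist (\<integral>\<omega>. \<psi> (R z \<omega>) \<partial>P) (\<integral>u. \<psi> u \<partial>density_law) < e"
  using eventually_ge_at_top[of 0]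
 proof eventually_elim
  case (elim z)
  define p :: real where "p = (\<integral>\<omega>. indicator {..\<delta>} (R z \<omega>) \<partial>P)"
  have bd: "bdd_borel (indicator {..\<delta>})" by (rule bdd_borelI[where B=1]) (auto simp: indicator_def)
  have "\<bar>A z - (\<integral>\<omega>. \<psi> (R z \<omega>) \<partial>P)\<bar> \<le> L * \<delta> + 2 * B * p"
   unfolding A_def
  proof (rule average_dist[OF bdd_borel_shift[OF bdd_borel_level_mean[OF b]] \<delta>])
   fix u assume u: "0 \<le> u" "u \<le> \<delta>"
   have "level_mean \<psi> (z + u) - (\<integral>\<omega>. \<psi> (R z \<omega>) \<partial>P) = (\<integral>\<omega>. \<psi> (R (z + u) \<omega>) - \<psi> (R z \<omega>) \<partial>P)"
    using u elim by (simp add: level_mean_def R_bounded_integrable[OF b])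
   also have "\<bar>\<dots>\<bar> \<le> (\<integral>\<omega>. \<bar>\<psi> (R (z + u) \<omega>) - \<psi> (R z \<omega>)\<bar> \<partial>P)" by (rule integral_abs_bound)
   also have "\<dots> \<le> (\<integral>\<omega>. L * \<delta> + 2 * B * indicator {..\<delta>} (R z \<omega>) \<partial>P)"
   proof (rule integral_mono_AE)
    show "integrable P (\<lambda>\<omega>. \<bar>\<psi> (R (z + u) \<omega>) - \<psi> (R z \<omega>)\<bar>)" by (simp add: R_bounded_integrable[OF b])
    show "integrable P (\<lambda>\<omega>. L * \<delta> + 2 * B * indicator {..\<delta>} (R z \<omega>))" using R_bounded_integrable[OF bd] by simp
    show "AE \<omega> in P. \<bar>\<psi> (R (z + u) \<omega>) - \<psi> (R z \<omega>)\<bar> \<le> L * \<delta> + 2 * B * indicator {..\<delta>} (R z \<omega>)"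
     using AE_regular
    proof eventually_elim
     case (elim \<omega>)
     show ?case
     proof (cases "R z \<omega> \<le> \<delta>")
      case True
      have "\<bar>\<psi> (R (z + u) \<omega>) - \<psi> (R z \<omega>)\<bar> \<le> 2 * B" using B[of "R (z + u) \<omega>"] B[of "R z \<omega>"] by linarith
      then show ?thesis using True mult_nonneg_nonneg[OF L0, of \<delta>] \<delta> by simp
     next
      case False
      then have "R (z + u) \<omega> = R z \<omega> - u" using R_shift_up[OF elim, of u z] u by simp
      then have "\<bar>\<psi> (R (z + u) \<omega>) - \<psi> (R z \<omega>)\<bar> \<le> L * u" using L[of "R (z + u) \<omega>" "R z \<omega>"] u by simp
      also have "\<dots> \<le> L * \<delta>" using u L0 by (rule_tac mult_left_mono) auto
      finally show ?thesis using False by simp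
     qed
    qed
   qed
   also have "\<dots> = L * \<delta> + 2 * B * p"
    using R_bounded_integrable[OF bd] by (simp add: p_def pp.P.prob_space)
   finally show "\<bar>level_mean \<psi> (z + u) - (\<integral>\<omega>. \<psi> (R z \<omega>) \<partial>P)\<bar> \<le> L * \<delta> + 2 * B * p" .
  qed
  moreover have "2 * B * p \<le> 2 * B * (2 * \<delta> / \<mu> + e')" using elim B0 unfolding p_def by (intro mult_left_mono) auto
  moreover have "L * \<delta> + 2 * B * (2 * \<delta> / \<mu> + e') \<le> C * \<delta> + 2 * B * e'"
   using \<delta> by (simp add: C_def algebra_simps)
  ultimately have "\<bar>A z - (\<integral>\<omega>. \<psi> (R z \<omega>) \<partial>P)\<bar> \<le> e / 4 + e / 4" using Cd e'(2) by linarith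
  then show ?case using elim e unfolding dist_real_def I_def by linarith
 qed
qed

text \<open>Rounding up collects on k h the mass of a whole cell, on which the density of a lattice
  step is constant.\<close>

definition lattice_law :: "real \<Rightarrow> real measure" where
 "lattice_law h = distr density_law borel (\<lambda>u. of_int \<lceil>u / h\<rceil> * h)"

lemma AE_U_lattice:
 assumes lat: "AE s in K. f s \<in> multiples h"
 shows "AE \<omega> in P. \<forall>n. U n \<omega> \<in> multiples h"
proof -
 have "AE \<omega> in P. \<forall>i. f (\<omega> i) \<in> multiples h" unfolding AE_all_countable using AE_coord[OF lat] by simp
 then show ?thesis
 proof eventually_elim
  case (elim \<omega>)
  show ?case
  proof
   fix n show "U n \<omega> \<in> multiples h"
   proof (induction n)
    case 0 show ?case unfolding multiples_def by (intro range_eqI[where x=0]) simp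
   next
    case (Suc n)
    then obtain i where i: "U n \<omega> = of_int i * h" by (auto simp: multiples_def)
    obtain j where j: "f (\<omega> (Suc n)) = of_int j * h" using elim by (fastforce simp: multiples_def)
    show ?case unfolding multiples_def U_Suc i j by (intro range_eqI[where x="i + j"]) (simp add: algebra_simps)
   qed
  qed
 qed
qed

text \<open>The test function is composed with rounding up to the lattice. This makes the
  expectation constant on cells of levels, as \<open>level_mean_limit_lattice\<close> demands, and
  changes nothing at lattice levels, where the overshoot is almost surely a multiple of h.\<close>

theorem overshoot_limit_lattice:
 assumes b: "bdd_borel \<psi>" and h: "h > 0" and lat: "AE s in K. f s \<in> multiples h"
  and max: "\<And>c. c > 0 \<Longrightarrow> AE s in K. f s \<in> multiples c \<Longrightarrow> c \<le> h"
 shows "((\<lambda>z. \<integral>\<omega>. \<psi> (R z \<omega>) \<partial>P) \<longlongrightarrow> (\<integral>u. \<psi> u \<partial>lattice_law h)) (at_top \<sqinter> principal (multiples h))"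
proof -
 define \<psi>' where "\<psi>' u = \<psi> (of_int \<lceil>u / h\<rceil> * h)" for u
 have [measurable]: "\<psi> \<in> borel_measurable borel" by (rule bdd_borelD[OF b])
 have b': "bdd_borel \<psi>'"
 proof -
  obtain B where B: "\<And>x. \<bar>\<psi> x\<bar> \<le> B" using bdd_borelE[OF b] by blast
  show ?thesis
  proof (rule bdd_borelI)
   show "\<bar>\<psi>' x\<bar> \<le> B" for x by (simp add: \<psi>'_def B)
   show "\<psi>' \<in> borel_measurable borel" unfolding \<psi>'_def[abs_def] by measurable
  qed
 qed
 have cl: "\<lceil>(of_int i * h - z) / h\<rceil> = i - \<lfloor>z / h\<rfloor>" for i z
  using h by (simp add: diff_divide_distrib ceiling_def)
 have R_cell: "AE \<omega> in P. \<psi>' (R z \<omega>) = \<psi>' (R (of_int \<lfloor>z / h\<rfloor> * h) \<omega>)" for z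
  using AE_U_lattice[OF lat]
 proof eventually_elim
  case (elim \<omega>)
  have "U n \<omega> > z \<longleftrightarrow> U n \<omega> > of_int \<lfloor>z / h\<rfloor> * h" for n
  proof -
   obtain i where i: "U n \<omega> = of_int i * h" using elim by (fastforce simp: multiples_def)
   have "z < of_int i * h \<longleftrightarrow> z / h < of_int i" using h by (simp add: field_simps)
   also have "\<dots> \<longleftrightarrow> \<lfloor>z / h\<rfloor> < i" by (simp add: floor_less_iff)
   also have "\<dots> \<longleftrightarrow> of_int \<lfloor>z / h\<rfloor> * h < of_int i * h" using h by simp
   finally show ?thesis unfolding i .
  qed
  then have N: "Np z \<omega> = Np (of_int \<lfloor>z / h\<rfloor> * h) \<omega>" unfolding Np_eq by simp
  obtain i where i: "U (Np z \<omega>) \<omega> = of_int i * h" using elim by (fastforce simp: multiples_def)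
  then have i': "U (Np (of_int \<lfloor>z / h\<rfloor> * h) \<omega>) \<omega> = of_int i * h" unfolding N .
  show ?case using h by (simp add: \<psi>'_def overshoot_def i i' cl)
 qed
 have cell: "level_mean \<psi>' z = level_mean \<psi>' (of_int \<lfloor>z / h\<rfloor> * h)" for z
 proof -
  have "(\<integral>\<omega>. \<psi>' (R z \<omega>) \<partial>P) = (\<integral>\<omega>. \<psi>' (R (of_int \<lfloor>z / h\<rfloor> * h) \<omega>) \<partial>P)"
   by (rule integral_cong_AE[OF _ _ R_cell]) (intro borel_measurable_integrable[OF R_bounded_integrable[OF b']])+
  moreover have "0 \<le> z \<longleftrightarrow> 0 \<le> of_int \<lfloor>z / h\<rfloor> * h"
   using h by (simp add: zero_le_mult_iff zero_le_divide_iff)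
  ultimately show ?thesis by (simp add: level_mean_def)
 qed
 have "(level_mean \<psi>' \<longlongrightarrow> (\<integral>u. \<psi>' u \<partial>density_law)) at_top"
  by (rule level_mean_limit_lattice[OF b' h lat max cell])
 moreover have "(\<integral>u. \<psi>' u \<partial>density_law) = (\<integral>u. \<psi> u \<partial>lattice_law h)"
  unfolding lattice_law_def \<psi>'_def by (subst integral_distr) (auto simp: density_law_def)
 ultimately have lim: "(level_mean \<psi>' \<longlongrightarrow> (\<integral>u. \<psi> u \<partial>lattice_law h)) (at_top \<sqinter> principal (multiples h))"
  using tendsto_mono[OF inf_le1] by metis
 show ?thesis
 proof (rule Lim_transform_eventually[OF lim])
  show "\<forall>\<^sub>F z in at_top \<sqinter> principal (multiples h). level_mean \<psi>' z = (\<integral>\<omega>. \<psi> (R z \<omega>) \<partial>P)"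
   unfolding eventually_inf_principal using eventually_ge_at_top[of 0]
  proof eventually_elim
   case z: (elim z)
   show ?case
   proof
    assume "z \<in> multiples h"
    then obtain j where j: "z = of_int j * h" by (auto simp: multiples_def)
    have "(\<integral>\<omega>. \<psi>' (R z \<omega>) \<partial>P) = (\<integral>\<omega>. \<psi> (R z \<omega>) \<partial>P)"
    proof (rule integral_cong_AE)
     show "AE \<omega> in P. \<psi>' (R z \<omega>) = \<psi> (R z \<omega>)"
      using AE_U_lattice[OF lat]
     proof eventually_elim
      case (elim \<omega>)
      obtain i where i: "U (Np z \<omega>) \<omega> = of_int i * h" using elim by (fastforce simp: multiples_def)
      have "\<lfloor>z / h\<rfloor> = j" using h by (simp add: j)
      then show ?case using cl[of i z] by (simp add: \<psi>'_def overshoot_def i) (simp add: j left_diff_distrib)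
     qed
    qed (intro borel_measurable_integrable[OF R_bounded_integrable] b b')+
    then show "level_mean \<psi>' z = (\<integral>\<omega>. \<psi> (R z \<omega>) \<partial>P)" using z by (simp add: level_mean_def)
   qed
  qed
 qed
qed

lemma real_distribution_lattice_law: "real_distribution (lattice_law h)"
proof -
 interpret \<rho>: real_distribution density_law by (rule real_distribution_density_law)
 have "(\<lambda>u. of_int \<lceil>u / h\<rceil> * h :: real) \<in> borel_measurable borel" by measurable
 then show ?thesis unfolding lattice_law_def by (intro \<rho>.real_distribution_distr) simp
qed

text \<open>The weak and the strict tail probability differ only at the countably many atoms of
  \<open>f\<close>.\<close>

lemma cdf_density_law:
 assumes y: "y \<ge> 0"
 shows "cdf density_law y = 1 / \<mu> * (LBINT s:{0..y}. prob {t \<in> space K. f t > s})"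
proof -
 interpret D: prob_space "distr K borel f" by (rule prob_space_distr) simp
 have "countable {x. measure (distr K borel f) {x} \<noteq> 0}" by (rule D.countable_support)
 then have "AE x in lborel. x \<notin> {x. measure (distr K borel f) {x} \<noteq> 0}"
  by (intro AE_not_in countable_imp_null_set_lborel)
 then have "AE u in lborel. indicator {0<..} u * prob {s \<in> space K. f s \<ge> u} / \<mu> * indicator {..y} u
   = 1 / \<mu> * (indicator {0..y} u * prob {t \<in> space K. f t > u})"
  using AE_lborel_singleton[of 0]
 proof eventually_elim
  case (elim u)
  have "prob {s \<in> space K. f s = u} = 0" using elim by (simp add: measure_distr vimage_def Int_def conj_commute)
  moreover have "prob {s \<in> space K. f s \<ge> u} = prob ({t \<in> space K. f t > u} \<union> {s \<in> space K. f s = u})"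
   by (rule arg_cong[where f=prob]) auto
  moreover have "\<dots> = prob {t \<in> space K. f t > u} + prob {s \<in> space K. f s = u}"
   by (rule finite_measure_Union) auto
  ultimately have "prob {s \<in> space K. f s \<ge> u} = prob {t \<in> space K. f t > u}" by simp
  then show ?case using elim y by (auto simp: indicator_def)
 qed
 then have "(\<integral>u. indicator {0<..} u * prob {s \<in> space K. f s \<ge> u} / \<mu> * indicator {..y} u \<partial>lborel)
   = (\<integral>u. 1 / \<mu> * (indicator {0..y} u * prob {t \<in> space K. f t > u}) \<partial>lborel)"
  by (rule integral_cong_AE[rotated 2]) measurable
 then show ?thesis
  by (simp add: cdf_def integral_overshoot_law_indicator set_lebesgue_integral_def)
qed

lemma measure_lattice_law:
 assumes h: "h > 0" and lat: "AE s in K. f s \<in> multiples h" and k: "k \<ge> 1"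
 shows "measure (lattice_law h) {real k * h} = h / \<mu> * prob {s \<in> space K. f s \<ge> real k * h}"
proof -
 have m: "(\<lambda>u. of_int \<lceil>u / h\<rceil> * h :: real) \<in> borel_measurable borel" by measurable
 have vim: "(\<lambda>u. of_int \<lceil>u / h\<rceil> * h) -` {real k * h} = {real (k - 1) * h<..real k * h}"
 proof -
  have "of_int \<lceil>u / h\<rceil> * h = real k * h \<longleftrightarrow> real (k - 1) * h < u \<and> u \<le> real k * h" for u
  proof -
   have "of_int \<lceil>u / h\<rceil> * h = real k * h \<longleftrightarrow> \<lceil>u / h\<rceil> = int k" using h by simp linarith
   also have "\<dots> \<longleftrightarrow> real k - 1 < u / h \<and> u / h \<le> real k" by linarith
   also have "\<dots> \<longleftrightarrow> real (k - 1) * h < u \<and> u \<le> real k * h" using h k by (simp add: field_simps of_nat_diff)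
   finally show ?thesis .
  qed
  then show ?thesis by (intro set_eqI) (simp only: vimage_singleton_eq greaterThanAtMost_iff)
 qed
 have "measure (lattice_law h) {real k * h} = measure density_law {real (k - 1) * h<..real k * h}"
  unfolding lattice_law_def using m
  by (subst measure_distr) (auto simp: density_law_def vim)
 also have "\<dots> = (\<integral>u. indicator {0<..} u * prob {s \<in> space K. f s \<ge> u} / \<mu> * indicator {real (k - 1) * h<..real k * h} u \<partial>lborel)"
  by (rule integral_overshoot_law_indicator) simp
 also have "\<dots> = (\<integral>u. prob {s \<in> space K. f s \<ge> real k * h} / \<mu> * indicator {real (k - 1) * h<..real k * h} u \<partial>lborel)"
 proof (intro Bochner_Integration.integral_cong refl)
  fix u
  have "prob {s \<in> space K. f s \<ge> u} = prob {s \<in> space K. f s \<ge> real k * h}" if u: "real (k - 1) * h < u" "u \<le> real k * h"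
  proof (rule finite_measure_eq_AE)
   show "AE s in K. s \<in> {s \<in> space K. f s \<ge> u} \<longleftrightarrow> s \<in> {s \<in> space K. f s \<ge> real k * h}"
    using lat
   proof eventually_elim
    case (elim s)
    then obtain i where i: "f s = of_int i * h" by (auto simp: multiples_def)
    have "of_int i * h \<ge> real k * h" if "of_int i * h \<ge> u"
    proof -
     have "real (k - 1) * h < of_int i * h" using that u by linarith
     then have "real (k - 1) < of_int i" using h by simp
     moreover have "real (k - 1) = real k - 1" using k by (simp add: of_nat_diff)
     ultimately have "int k - 1 < i" by linarith
     then have "real k \<le> of_int i" by linarith
     then show ?thesis using h by simp
    qed
    then show ?case using u i by auto
   qed
  qed auto
  moreover have "u > 0" if "real (k - 1) * h < u" using that h by (smt (verit) mult_nonneg_nonneg of_nat_0_le_iff)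
  ultimately show "indicator {0<..} u * prob {s \<in> space K. f s \<ge> u} / \<mu> * indicator {real (k - 1) * h<..real k * h} u
   = prob {s \<in> space K. f s \<ge> real k * h} / \<mu> * indicator {real (k - 1) * h<..real k * h} u"
   by (cases "u \<in> {real (k - 1) * h<..real k * h}") auto
 qed
 also have "\<dots> = h / \<mu> * prob {s \<in> space K. f s \<ge> real k * h}"
  using h k by (simp add: of_nat_diff algebra_simps)
 finally show ?thesis .
qed

end

section \<open>Increasing tuples\<close>

lemma increasing_tuples_finite [simp]: "finite (increasing_tuples d n)"
 unfolding increasing_tuples_def by (rule finite_subset[of _ "{1..d} \<rightarrow>\<^sub>E {1..n}"]) (auto intro: finite_PiE)

lemma increasing_tuples_sub: "increasing_tuples d n \<subseteq> {1..d} \<rightarrow>\<^sub>E {1..n}"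
 by (auto simp: increasing_tuples_def)

lemma increasing_tuples_range: "i \<in> increasing_tuples d n \<Longrightarrow> a \<in> {1..d} \<Longrightarrow> i a \<in> {1..n}"
 by (auto simp: increasing_tuples_def PiE_iff)

lemma increasing_tuples_inj: "i \<in> increasing_tuples d n \<Longrightarrow> inj_on i {1..d}"
 by (auto simp: increasing_tuples_def intro: strict_mono_on_imp_inj_on)

lemma increasing_tuples_mono: "n \<le> m \<Longrightarrow> increasing_tuples d n \<subseteq> increasing_tuples d m"
 by (fastforce simp: increasing_tuples_def PiE_iff)

text \<open>Pascal's rule: either \<open>Suc n\<close> is the last entry or it does not
  occur.\<close>

lemma increasing_tuples_Suc:
 "increasing_tuples (Suc d) (Suc n) = increasing_tuples (Suc d) n \<union> (\<lambda>i. i(Suc d := Suc n)) ` increasing_tuples d n"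
proof (intro equalityI subsetI)
 fix i assume i: "i \<in> increasing_tuples (Suc d) (Suc n)"
 then have r: "\<And>a. a \<in> {1..Suc d} \<Longrightarrow> i a \<in> {1..Suc n}" and e: "i \<in> extensional {1..Suc d}" and m: "strict_mono_on {1..Suc d} i"
  by (auto simp: increasing_tuples_def PiE_iff extensional_def)
 have lt: "i a < i (Suc d)" if "a \<in> {1..d}" for a
  using strict_mono_onD[OF m, of a "Suc d"] that by auto
 show "i \<in> increasing_tuples (Suc d) n \<union> (\<lambda>i. i(Suc d := Suc n)) ` increasing_tuples d n"
 proof (cases "i (Suc d) = Suc n")
  case True
  have "restrict i {1..d} \<in> increasing_tuples d n"
   unfolding increasing_tuples_def
  proof (intro CollectI conjI)
   have "i a \<in> {1..n}" if "a \<in> {1..d}" for a using r[of a] lt[OF that] True that by auto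
   then show "restrict i {1..d} \<in> {1..d} \<rightarrow>\<^sub>E {1..n}" by (auto simp: PiE_iff)
   show "strict_mono_on {1..d} (restrict i {1..d})"
    using m by (auto simp: strict_mono_on_def)
  qed
  moreover have "i = (restrict i {1..d})(Suc d := Suc n)"
   using e True by (auto simp: fun_eq_iff extensional_def)
  ultimately show ?thesis by blast
 next
  case False
  have "i (Suc d) \<le> n" using r[of "Suc d"] False by auto
  then have "i a \<in> {1..n}" if "a \<in> {1..Suc d}" for a
   using r[OF that] lt[of a] that by (cases "a = Suc d") force+
  then show ?thesis using e m by (auto simp: increasing_tuples_def PiE_iff)
 qed
next
 fix i assume "i \<in> increasing_tuples (Suc d) n \<union> (\<lambda>i. i(Suc d := Suc n)) ` increasing_tuples d n"
 then show "i \<in> increasing_tuples (Suc d) (Suc n)"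
 proof
  assume "i \<in> increasing_tuples (Suc d) n" then show ?thesis using increasing_tuples_mono[of n "Suc n"] by auto
 next
  assume "i \<in> (\<lambda>i. i(Suc d := Suc n)) ` increasing_tuples d n"
  then obtain k where k: "k \<in> increasing_tuples d n" "i = k(Suc d := Suc n)" by blast
  then have r: "\<And>a. a \<in> {1..d} \<Longrightarrow> k a \<in> {1..n}" and e: "k \<in> extensional {1..d}" and m: "strict_mono_on {1..d} k"
   by (auto simp: increasing_tuples_def PiE_iff extensional_def)
  show ?thesis
   unfolding increasing_tuples_def
  proof (intro CollectI conjI)
   show "i \<in> {1..Suc d} \<rightarrow>\<^sub>E {1..Suc n}"
   proof (rule PiE_I)
    fix a assume "a \<in> {1..Suc d}"
    then show "i a \<in> {1..Suc n}" using r[of a] k(2) by (cases "a = Suc d") auto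
   next
    fix a assume "a \<notin> {1..Suc d}"
    then show "i a = undefined" using e k(2) by (auto simp: extensional_def)
   qed
   show "strict_mono_on {1..Suc d} i"
   proof (rule strict_mono_onI)
    fix a b assume "a \<in> {1..Suc d}" "b \<in> {1..Suc d}" "a < b"
    then show "i a < i b" using strict_mono_onD[OF m, of a b] r[of a] k(2) by (cases "b = Suc d") auto
   qed
  qed
 qed
qed

text \<open>The predicate lets one recursion serve both the total count and the count with a
  prescribed entry.\<close>

lemma card_increasing_tuples_filter_Suc:
 "card {i \<in> increasing_tuples (Suc d) (Suc n). Q i}
  = card {i \<in> increasing_tuples (Suc d) n. Q i} + card {i \<in> increasing_tuples d n. Q (i(Suc d := Suc n))}"
proof -
 let ?u = "\<lambda>i. i(Suc d := Suc n)"
 have inj: "inj_on ?u (increasing_tuples d n)"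
 proof (rule inj_onI)
  fix i k assume a: "i \<in> increasing_tuples d n" "k \<in> increasing_tuples d n" "?u i = ?u k"
  show "i = k"
  proof (rule ext)
   fix x show "i x = k x" using fun_cong[OF a(3), of x] a(1,2) by (cases "x = Suc d") (auto simp: increasing_tuples_def PiE_iff extensional_def)
  qed
 qed
 have "{i \<in> increasing_tuples (Suc d) (Suc n). Q i} = {i \<in> increasing_tuples (Suc d) n. Q i} \<union> ?u ` {i \<in> increasing_tuples d n. Q (?u i)}"
  unfolding increasing_tuples_Suc by auto
 moreover have "{i \<in> increasing_tuples (Suc d) n. Q i} \<inter> ?u ` {i \<in> increasing_tuples d n. Q (?u i)} = {}"
  using increasing_tuples_range[of _ "Suc d" n "Suc d"] by force
 ultimately have "card {i \<in> increasing_tuples (Suc d) (Suc n). Q i} = card {i \<in> increasing_tuples (Suc d) n. Q i} + card (?u ` {i \<in> increasing_tuples d n. Q (?u i)})"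
  by (simp add: card_Un_disjoint)
 then show ?thesis using inj by (simp add: card_image inj_on_def)
qed

lemma increasing_tuples_zero: "increasing_tuples 0 n = {\<lambda>_. undefined}"
 by (auto simp: increasing_tuples_def strict_mono_on_def)

lemma increasing_tuples_empty: "increasing_tuples (Suc d) 0 = {}"
 by (auto simp: increasing_tuples_def)

lemma card_increasing_tuples: "card (increasing_tuples d n) = n choose d"
proof (induction n arbitrary: d)
 case 0 then show ?case by (cases d) (auto simp: increasing_tuples_zero increasing_tuples_empty)
next
 case (Suc n)
 show ?case
 proof (cases d)
  case 0 then show ?thesis by (simp add: increasing_tuples_zero)
 next
  case (Suc d')
  then show ?thesis using card_increasing_tuples_filter_Suc[of d' n "\<lambda>_. True"] Suc.IH by simp
 qed
qed

text \<open>The a - 1 earlier entries are chosen below j and the d - a later ones above j,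
  independently of each other.\<close>

lemma card_increasing_tuples_coordinate:
 assumes "1 \<le> a" "a \<le> d" "1 \<le> j"
 shows "card {i \<in> increasing_tuples d n. i a = j} = (if j \<le> n then ((j - 1) choose (a - 1)) * ((n - j) choose (d - a)) else 0)"
 using assms
proof (induction n arbitrary: d a)
 case 0 then show ?case by (cases d) (auto simp: increasing_tuples_empty)
next
 case (Suc n)
 then obtain d' where d': "d = Suc d'" by (cases d) auto
 have step: "card {i \<in> increasing_tuples d (Suc n). i a = j} = card {i \<in> increasing_tuples d n. i a = j}
   + card {i \<in> increasing_tuples d' n. (i(Suc d' := Suc n)) a = j}"
  unfolding d' by (rule card_increasing_tuples_filter_Suc)
 note IH = Suc.IH[of a d]
 show ?case
 proof (cases "a = Suc d'")
  case True
  have "card {i \<in> increasing_tuples d' n. (i(Suc d' := Suc n)) a = j} = (if j = Suc n then n choose d' else 0)"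
   using True by (auto simp: card_increasing_tuples)
  then show ?thesis unfolding step using IH Suc.prems True d' by auto
 next
  case False
  then have a: "a \<le> d'" using Suc.prems d' by simp
  have e: "{i \<in> increasing_tuples d' n. (i(Suc d' := Suc n)) a = j} = {i \<in> increasing_tuples d' n. i a = j}"
   using False by auto
  have "card {i \<in> increasing_tuples d' n. i a = j} = (if j \<le> n then ((j - 1) choose (a - 1)) * ((n - j) choose (d' - a)) else 0)"
   using Suc.IH[of a d'] Suc.prems a by simp
  moreover have "Suc n - j choose (Suc d' - a) = (n - j choose (Suc d' - a)) + (n - j choose (d' - a))" if "j \<le> n"
   using that a by (simp add: Suc_diff_le)
  moreover have "Suc d' - a > 0" using a by simp
  ultimately show ?thesis unfolding step e using IH Suc.prems d'
   by (cases "j \<le> n"; cases "j = Suc n") (auto simp: algebra_simps binomial_eq_0)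
 qed
qed

lemma card_tuples_coordinate_le:
 assumes b: "b \<in> {1..d}" shows "card {i \<in> increasing_tuples d n. i b = v} \<le> n ^ (d - 1)"
proof -
 have "{i \<in> increasing_tuples d n. i b = v} \<subseteq> PiE {1..d} (\<lambda>j. if j = b then {v} else {1..n})"
  by (auto simp: increasing_tuples_def PiE_iff extensional_def)
 then have "card {i \<in> increasing_tuples d n. i b = v} \<le> card (PiE {1..d} (\<lambda>j. if j = b then {v} else {1..n}))"
  by (intro card_mono finite_PiE) auto
 also have "\<dots> = (\<Prod>j\<in>{1..d}. if j = b then 1 else n)"
  by (subst card_PiE) (auto intro!: prod.cong)
 also have "\<dots> = (\<Prod>j\<in>{1..d} - {b}. n)" using b by (subst prod.remove[of _ b]) (auto intro!: prod.cong)
 also have "\<dots> = n ^ (d - 1)" using b by simp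
 finally show ?thesis .
qed

lemma card_tuples_two_coordinates_le:
 assumes b: "b \<in> {1..d}" "b' \<in> {1..d}" "b \<noteq> b'" shows "card {i \<in> increasing_tuples d n. i b = v \<and> i b' = v'} \<le> n ^ (d - 2)"
proof -
 have "{i \<in> increasing_tuples d n. i b = v \<and> i b' = v'} \<subseteq> PiE {1..d} (\<lambda>j. if j = b then {v} else if j = b' then {v'} else {1..n})"
  by (auto simp: increasing_tuples_def PiE_iff extensional_def)
 then have "card {i \<in> increasing_tuples d n. i b = v \<and> i b' = v'} \<le> card (PiE {1..d} (\<lambda>j. if j = b then {v} else if j = b' then {v'} else {1..n}))"
  by (intro card_mono finite_PiE) auto
 also have "\<dots> = (\<Prod>j\<in>{1..d}. if j = b then 1 else if j = b' then 1 else n)"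
  by (subst card_PiE) (auto intro!: prod.cong)
 also have "\<dots> = (\<Prod>j\<in>{1..d} - {b, b'}. n)" using b by (intro prod.mono_neutral_cong_right) auto
 also have "\<dots> = n ^ (d - 2)" using b by (simp add: card_Diff_subset numeral_2_eq_2)
 finally show ?thesis .
qed

lemma card_increasing_tuples_le: "card (increasing_tuples d n) \<le> n ^ d"
proof -
 have "card (increasing_tuples d n) \<le> card ({1..d} \<rightarrow>\<^sub>E {1..n})"
  by (intro card_mono finite_PiE increasing_tuples_sub) auto
 then show ?thesis by (simp add: card_PiE)
qed

text \<open>A tuple that is new at m has an entry beyond n: choose its position, its value, and
  crudely the rest.\<close>

lemma card_increasing_tuples_diff_le:
 "card (increasing_tuples d m - increasing_tuples d n) \<le> d * (m - n) * m ^ (d - 1)"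
proof -
 have "increasing_tuples d m - increasing_tuples d n \<subseteq> (\<Union>b\<in>{1..d}. \<Union>v\<in>{n<..m}. {i \<in> increasing_tuples d m. i b = v})"
 proof
  fix i assume i: "i \<in> increasing_tuples d m - increasing_tuples d n"
  then obtain b where "b \<in> {1..d}" "i b \<notin> {1..n}" by (auto simp: increasing_tuples_def PiE_iff)
  moreover from this have "i b \<in> {1..m}" using i increasing_tuples_range by blast
  ultimately have "b \<in> {1..d}" "i b \<in> {n<..m}" by auto
  then show "i \<in> (\<Union>b\<in>{1..d}. \<Union>v\<in>{n<..m}. {i \<in> increasing_tuples d m. i b = v})" using i by auto
 qed
 then have "card (increasing_tuples d m - increasing_tuples d n) \<le> card (\<Union>b\<in>{1..d}. \<Union>v\<in>{n<..m}. {i \<in> increasing_tuples d m. i b = v})"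
  by (rule card_mono[rotated]) auto
 also have "\<dots> \<le> (\<Sum>b\<in>{1..d}. \<Sum>v\<in>{n<..m}. card {i \<in> increasing_tuples d m. i b = v})"
  by (intro order_trans[OF card_UN_le] sum_mono card_UN_le) auto
 also have "\<dots> \<le> (\<Sum>b\<in>{1..d}. \<Sum>v\<in>{n<..m}. m ^ (d - 1))"
  by (intro sum_mono card_tuples_coordinate_le) auto
 finally show ?thesis by simp
qed

lemma card_sharing_one_le:
 assumes "I \<subseteq> increasing_tuples d n"
 shows "card {(i, k) \<in> I \<times> I. i ` {1..d} \<inter> k ` {1..d} \<noteq> {}} \<le> card I * (d ^ 2 * n ^ (d - 1))"
proof -
 have fin: "finite I" using assms increasing_tuples_finite by (rule finite_subset)
 have "{(i, k) \<in> I \<times> I. i ` {1..d} \<inter> k ` {1..d} \<noteq> {}}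
   \<subseteq> Sigma I (\<lambda>i. \<Union>a\<in>{1..d}. \<Union>b\<in>{1..d}. {k \<in> increasing_tuples d n. k b = i a})"
  using assms by fastforce
 then have "card {(i, k) \<in> I \<times> I. i ` {1..d} \<inter> k ` {1..d} \<noteq> {}}
   \<le> card (Sigma I (\<lambda>i. \<Union>a\<in>{1..d}. \<Union>b\<in>{1..d}. {k \<in> increasing_tuples d n. k b = i a}))"
  by (rule card_mono[rotated]) (use fin in auto)
 also have "\<dots> = (\<Sum>i\<in>I. card (\<Union>a\<in>{1..d}. \<Union>b\<in>{1..d}. {k \<in> increasing_tuples d n. k b = i a}))"
  using fin by (subst card_SigmaI) auto
 also have "\<dots> \<le> (\<Sum>i\<in>I. d ^ 2 * n ^ (d - 1))"
 proof (rule sum_mono)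
  fix i
  have "card (\<Union>a\<in>{1..d}. \<Union>b\<in>{1..d}. {k \<in> increasing_tuples d n. k b = i a})
    \<le> (\<Sum>a\<in>{1..d}. \<Sum>b\<in>{1..d}. card {k \<in> increasing_tuples d n. k b = i a})"
   by (intro order_trans[OF card_UN_le] sum_mono card_UN_le) auto
  also have "\<dots> \<le> (\<Sum>a\<in>{1..d}. \<Sum>b\<in>{1..d}. n ^ (d - 1))" by (intro sum_mono card_tuples_coordinate_le) auto
  finally show "card (\<Union>a\<in>{1..d}. \<Union>b\<in>{1..d}. {k \<in> increasing_tuples d n. k b = i a}) \<le> d ^ 2 * n ^ (d - 1)"
   by (simp add: power2_eq_square)
 qed
 finally show ?thesis by simp
qed

text \<open>Two positions in each tuple, at most d^4 choices, determine two entries of k from those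
  of i. The exponent is one below that for pairs sharing one index, which is what makes the
  projection error negligible.\<close>

lemma card_sharing_two_le:
 "card {(i, k) \<in> increasing_tuples d n \<times> increasing_tuples d n. \<exists>x y. x \<noteq> y \<and> {x, y} \<subseteq> i ` {1..d} \<inter> k ` {1..d}}
  \<le> d ^ 4 * n ^ (2 * d - 2)"
proof -
 let ?I = "increasing_tuples d n"
 define B where "B = {(b, b') \<in> {1..d} \<times> {1..d}. b \<noteq> b'}"
 have finB: "finite B" unfolding B_def by (rule finite_subset[of _ "{1..d} \<times> {1..d}"]) auto
 have cB: "card B \<le> d ^ 2"
 proof -
  have "card B \<le> card ({1..d} \<times> {1..d})" by (rule card_mono) (auto simp: B_def)
  then show ?thesis by (simp add: power2_eq_square)
 qed
 have sub: "{(i, k) \<in> ?I \<times> ?I. \<exists>x y. x \<noteq> y \<and> {x, y} \<subseteq> i ` {1..d} \<inter> k ` {1..d}}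
   \<subseteq> Sigma ?I (\<lambda>i. \<Union>p\<in>B. \<Union>q\<in>B. {k \<in> ?I. k (fst q) = i (fst p) \<and> k (snd q) = i (snd p)})"
  by (fastforce simp: B_def)
 show ?thesis
 \<comment> \<open>For d < 2 truncated subtraction breaks d + (d - 2) = 2 d - 2, but then there are
   no two distinct positions to share.\<close>
 proof (cases "d \<ge> 2")
  case False
  have "B = {}" using False by (auto simp: B_def)
  then have "Sigma ?I (\<lambda>i. \<Union>p\<in>B. \<Union>q\<in>B. {k \<in> ?I. k (fst q) = i (fst p) \<and> k (snd q) = i (snd p)}) = {}" by simp
  with sub have "{(i, k) \<in> ?I \<times> ?I. \<exists>x y. x \<noteq> y \<and> {x, y} \<subseteq> i ` {1..d} \<inter> k ` {1..d}} = {}"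
   by (simp only: subset_empty)
  then show ?thesis by (simp only: card.empty le0)
 next
  case True
  from sub have "card {(i, k) \<in> ?I \<times> ?I. \<exists>x y. x \<noteq> y \<and> {x, y} \<subseteq> i ` {1..d} \<inter> k ` {1..d}}
    \<le> card (Sigma ?I (\<lambda>i. \<Union>p\<in>B. \<Union>q\<in>B. {k \<in> ?I. k (fst q) = i (fst p) \<and> k (snd q) = i (snd p)}))"
   by (rule card_mono[rotated]) (use finB in auto)
  also have "\<dots> = (\<Sum>i\<in>?I. card (\<Union>p\<in>B. \<Union>q\<in>B. {k \<in> ?I. k (fst q) = i (fst p) \<and> k (snd q) = i (snd p)}))"
   using finB by (subst card_SigmaI) auto
  also have "\<dots> \<le> (\<Sum>i\<in>?I. d ^ 4 * n ^ (d - 2))"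
  proof (rule sum_mono)
   fix i
   have "card (\<Union>p\<in>B. \<Union>q\<in>B. {k \<in> ?I. k (fst q) = i (fst p) \<and> k (snd q) = i (snd p)})
     \<le> (\<Sum>p\<in>B. \<Sum>q\<in>B. card {k \<in> ?I. k (fst q) = i (fst p) \<and> k (snd q) = i (snd p)})"
    by (intro order_trans[OF card_UN_le] sum_mono card_UN_le finB)
   also have "\<dots> \<le> (\<Sum>p\<in>B. \<Sum>q\<in>B. n ^ (d - 2))"
    by (intro sum_mono card_tuples_two_coordinates_le) (auto simp: B_def)
   also have "\<dots> = card B * card B * n ^ (d - 2)" by simp
   also have "\<dots> \<le> d ^ 2 * d ^ 2 * n ^ (d - 2)" by (intro mult_mono cB) auto
   finally show "card (\<Union>p\<in>B. \<Union>q\<in>B. {k \<in> ?I. k (fst q) = i (fst p) \<and> k (snd q) = i (snd p)}) \<le> d ^ 4 * n ^ (d - 2)"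
    by (simp flip: power_add)
  qed
  also have "\<dots> = card ?I * (d ^ 4 * n ^ (d - 2))" by simp
  also have "\<dots> \<le> n ^ d * (d ^ 4 * n ^ (d - 2))" by (intro mult_right_mono card_increasing_tuples_le) simp
  also have "\<dots> = d ^ 4 * n ^ (d + (d - 2))" by (simp add: power_add)
  also have "d + (d - 2) = 2 * d - 2" using True by simp
  finally show ?thesis .
 qed
qed

section \<open>Orthogonality of kernels\<close>

declare One_nat_def [simp del]

locale iid_kernel = iid_space K for K :: "'s measure" +
 fixes d :: nat
 assumes d_pos: "d \<ge> 1"
begin

abbreviation Q :: "(nat \<Rightarrow> 's) measure" where "Q \<equiv> PiM {1..d} (\<lambda>_. K)"

definition tup :: "(nat \<Rightarrow> nat) \<Rightarrow> (nat \<Rightarrow> 's) \<Rightarrow> nat \<Rightarrow> 's" where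
 "tup i \<omega> = (\<lambda>j\<in>{1..d}. \<omega> (i j))"

text \<open>A square integrable kernel is also integrable, \<open>P\<close> being a probability measure.\<close>

definition L2 :: "((nat \<Rightarrow> 's) \<Rightarrow> real) \<Rightarrow> bool" where
 "L2 \<phi> \<longleftrightarrow> \<phi> \<in> borel_measurable Q \<and> integrable Q (\<lambda>z. (\<phi> z)\<^sup>2)"

definition mean :: "((nat \<Rightarrow> 's) \<Rightarrow> real) \<Rightarrow> real" where "mean \<phi> = (\<integral>z. \<phi> z \<partial>Q)"

definition degenerate :: "((nat \<Rightarrow> 's) \<Rightarrow> real) \<Rightarrow> bool" where
 "degenerate \<phi> \<longleftrightarrow> (\<forall>a\<in>{1..d}. \<forall>j. AE x in P. (\<integral>y. \<phi> ((tup id y)(a := x j)) \<partial>P) = 0)"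

lemma tup_measurable [measurable]: "tup i \<in> measurable P Q"
 unfolding tup_def[abs_def] by measurable

lemma distr_tup: "inj_on i {1..d} \<Longrightarrow> distr P Q (tup i) = Q"
 unfolding tup_def[abs_def] by (rule distr_tuple)

lemma integral_tup:
 fixes \<phi> :: "(nat \<Rightarrow> 's) \<Rightarrow> real"
 assumes inj: "inj_on i {1..d}" and [measurable]: "\<phi> \<in> borel_measurable Q"
 shows "(\<integral>\<omega>. \<phi> (tup i \<omega>) \<partial>P) = (\<integral>z. \<phi> z \<partial>Q)"
proof -
 have "(\<integral>z. \<phi> z \<partial>distr P Q (tup i)) = (\<integral>\<omega>. \<phi> (tup i \<omega>) \<partial>P)" by (rule integral_distr) measurable
 then show ?thesis by (simp only: distr_tup[OF inj])
qed

lemma integrable_tup: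
 fixes \<phi> :: "(nat \<Rightarrow> 's) \<Rightarrow> real"
 assumes inj: "inj_on i {1..d}" and int: "integrable Q \<phi>"
 shows "integrable P (\<lambda>\<omega>. \<phi> (tup i \<omega>))"
proof -
 have "integrable (distr P Q (tup i)) \<phi>" using int by (simp only: distr_tup[OF inj])
 then show ?thesis by (rule integrable_distr[OF tup_measurable])
qed

lemma Q_prob: "prob_space Q"
 by (intro prob_space_PiM prob_space_axioms)

lemma L2_integrable: "L2 \<phi> \<Longrightarrow> integrable Q \<phi>"
proof -
 interpret Q: prob_space Q by (rule Q_prob)
 show "L2 \<phi> \<Longrightarrow> integrable Q \<phi>" unfolding L2_def using Q.square_integrable_imp_integrable by blast
qed

lemma L2_measurable [measurable_dest]: "L2 \<phi> \<Longrightarrow> \<phi> \<in> borel_measurable Q" by (simp add: L2_def)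

lemma L2_add: assumes "L2 \<phi>" "L2 \<psi>" shows "L2 (\<lambda>z. \<phi> z + \<psi> z)"
proof -
 have [measurable]: "\<phi> \<in> borel_measurable Q" "\<psi> \<in> borel_measurable Q" using assms by (auto simp: L2_def)
 have "integrable Q (\<lambda>z. (\<phi> z + \<psi> z)\<^sup>2)"
 proof (rule Bochner_Integration.integrable_bound)
  show "integrable Q (\<lambda>z. 2 * (\<phi> z)\<^sup>2 + 2 * (\<psi> z)\<^sup>2)" using assms by (simp add: L2_def)
  show "AE z in Q. norm ((\<phi> z + \<psi> z)\<^sup>2) \<le> norm (2 * (\<phi> z)\<^sup>2 + 2 * (\<psi> z)\<^sup>2)"
  proof (rule AE_I2)
   fix z
   have "(\<phi> z + \<psi> z)\<^sup>2 \<le> 2 * (\<phi> z)\<^sup>2 + 2 * (\<psi> z)\<^sup>2"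
    using sum_squares_bound[of "\<phi> z" "\<psi> z"] by (simp add: power2_sum)
   then show "norm ((\<phi> z + \<psi> z)\<^sup>2) \<le> norm (2 * (\<phi> z)\<^sup>2 + 2 * (\<psi> z)\<^sup>2)" by simp
  qed
 qed measurable
 then show ?thesis by (simp add: L2_def)
qed

lemma L2_cmult: "L2 \<phi> \<Longrightarrow> L2 (\<lambda>z. c * \<phi> z)"
 by (auto simp: L2_def power_mult_distrib)

lemma L2_const: "L2 (\<lambda>_. c)"
proof -
 interpret Q: prob_space Q by (rule Q_prob)
 show ?thesis by (simp add: L2_def)
qed

lemma L2_diff: assumes "L2 \<phi>" "L2 \<psi>" shows "L2 (\<lambda>z. \<phi> z - \<psi> z)"
 using L2_add[OF assms(1) L2_cmult[OF assms(2), of "-1"]] by simp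

lemma L2_sum: "(\<And>i. i \<in> I \<Longrightarrow> L2 (\<phi> i)) \<Longrightarrow> L2 (\<lambda>z. \<Sum>i\<in>I. \<phi> i z)"
 by (induction I rule: infinite_finite_induct) (auto intro: L2_add L2_const)

lemma product_integrable:
 assumes "L2 \<phi>" "L2 \<psi>" "inj_on i {1..d}" "inj_on k {1..d}"
 shows "integrable P (\<lambda>\<omega>. \<phi> (tup i \<omega>) * \<psi> (tup k \<omega>))"
  and "\<bar>\<integral>\<omega>. \<phi> (tup i \<omega>) * \<psi> (tup k \<omega>) \<partial>P\<bar> \<le> ((\<integral>z. (\<phi> z)\<^sup>2 \<partial>Q) + (\<integral>z. (\<psi> z)\<^sup>2 \<partial>Q)) / 2"
proof -
 have [measurable]: "\<phi> \<in> borel_measurable Q" "\<psi> \<in> borel_measurable Q" using assms by (auto simp: L2_def)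
 have i1: "integrable P (\<lambda>\<omega>. (\<phi> (tup i \<omega>))\<^sup>2)" and i2: "integrable P (\<lambda>\<omega>. (\<psi> (tup k \<omega>))\<^sup>2)"
  using assms integrable_tup[of _ "\<lambda>z. (\<phi> z)\<^sup>2"] integrable_tup[of _ "\<lambda>z. (\<psi> z)\<^sup>2"] by (auto simp: L2_def)
 have le: "\<bar>\<phi> (tup i \<omega>) * \<psi> (tup k \<omega>)\<bar> \<le> ((\<phi> (tup i \<omega>))\<^sup>2 + (\<psi> (tup k \<omega>))\<^sup>2) / 2" for \<omega>
  using sum_squares_bound[of "\<bar>\<phi> (tup i \<omega>)\<bar>" "\<bar>\<psi> (tup k \<omega>)\<bar>"] by (simp add: abs_mult)
 show i3: "integrable P (\<lambda>\<omega>. \<phi> (tup i \<omega>) * \<psi> (tup k \<omega>))"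
 proof (rule Bochner_Integration.integrable_bound)
  show "integrable P (\<lambda>\<omega>. ((\<phi> (tup i \<omega>))\<^sup>2 + (\<psi> (tup k \<omega>))\<^sup>2) / 2)" using i1 i2 by simp
  show "AE \<omega> in P. norm (\<phi> (tup i \<omega>) * \<psi> (tup k \<omega>)) \<le> norm (((\<phi> (tup i \<omega>))\<^sup>2 + (\<psi> (tup k \<omega>))\<^sup>2) / 2)"
   using le by (intro AE_I2) simp
 qed measurable
 have "\<bar>\<integral>\<omega>. \<phi> (tup i \<omega>) * \<psi> (tup k \<omega>) \<partial>P\<bar> \<le> (\<integral>\<omega>. \<bar>\<phi> (tup i \<omega>) * \<psi> (tup k \<omega>)\<bar> \<partial>P)" by (rule integral_abs_bound)
 also have "\<dots> \<le> (\<integral>\<omega>. ((\<phi> (tup i \<omega>))\<^sup>2 + (\<psi> (tup k \<omega>))\<^sup>2) / 2 \<partial>P)"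
  using i1 i2 by (intro integral_mono integrable_abs i3 le) simp
 also have "\<dots> = ((\<integral>z. (\<phi> z)\<^sup>2 \<partial>Q) + (\<integral>z. (\<psi> z)\<^sup>2 \<partial>Q)) / 2"
  using i1 i2 integral_tup[OF assms(3), of "\<lambda>z. (\<phi> z)\<^sup>2"] integral_tup[OF assms(4), of "\<lambda>z. (\<psi> z)\<^sup>2"] by simp
 finally show "\<bar>\<integral>\<omega>. \<phi> (tup i \<omega>) * \<psi> (tup k \<omega>) \<partial>P\<bar> \<le> ((\<integral>z. (\<phi> z)\<^sup>2 \<partial>Q) + (\<integral>z. (\<psi> z)\<^sup>2 \<partial>Q)) / 2" .
qed

text \<open>Resample the coordinates used by the first factor only; the second factor does not notice.\<close>

lemma product_integral_resample:
 assumes L: "L2 \<phi>" "L2 \<psi>" and inj: "inj_on i {1..d}" "inj_on k {1..d}"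
  and A: "A \<inter> k ` {1..d} = {}"
 shows "(\<integral>\<omega>. \<phi> (tup i \<omega>) * \<psi> (tup k \<omega>) \<partial>P) = (\<integral>x. (\<integral>y. \<phi> (tup i (splice A id x y)) \<partial>P) * \<psi> (tup k x) \<partial>P)"
proof -
 have "tup k (splice A id x y) = tup k x" for x y
  using A by (auto simp: tup_def splice_def restrict_def fun_eq_iff)
 then show ?thesis
  using integral_splice(2)[OF _ product_integrable(1)[OF L inj], of id A] by simp
qed

text \<open>Without a common index the first factor can be resampled completely, and its inner
  integral is its mean.\<close>

lemma orthogonal_disjoint:
 assumes L: "L2 \<phi>" "L2 \<psi>" and inj: "inj_on i {1..d}" "inj_on k {1..d}"
  and mean: "mean \<phi> = 0" and disj: "i ` {1..d} \<inter> k ` {1..d} = {}"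
 shows "(\<integral>\<omega>. \<phi> (tup i \<omega>) * \<psi> (tup k \<omega>) \<partial>P) = 0"
proof -
 have "tup i (splice (i ` {1..d}) id x y) = tup i y" for x y
  by (auto simp: tup_def splice_def restrict_def fun_eq_iff)
 then show ?thesis
  using product_integral_resample[OF L inj disj] integral_tup[OF inj(1) L2_measurable[OF L(1)]] mean
  by (simp add: mean_def)
qed

text \<open>All indices of the first factor except the shared one are resampled; the inner integral
  is then a conditional mean given one argument.\<close>

lemma orthogonal_share_one:
 assumes L: "L2 \<phi>" "L2 \<psi>" and inj: "inj_on i {1..d}" "inj_on k {1..d}"
  and deg: "degenerate \<phi>" and a: "a \<in> {1..d}" and share: "i ` {1..d} \<inter> k ` {1..d} = {i a}"
 shows "(\<integral>\<omega>. \<phi> (tup i \<omega>) * \<psi> (tup k \<omega>) \<partial>P) = 0"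
proof -
 define A where "A = i ` {1..d} - {i a}"
 have A: "A \<inter> k ` {1..d} = {}" using share by (auto simp: A_def)
 have t: "tup i (splice A id x y) = (tup i y)(a := x (i a))" for x y
 proof (rule ext)
  fix l
  show "tup i (splice A id x y) l = ((tup i y)(a := x (i a))) l"
  proof (cases "l \<in> {1..d}")
   case True
   have "i l = i a \<longleftrightarrow> l = a" using inj_on_eq_iff[OF inj(1) True a] .
   then show ?thesis using True a by (cases "l = a") (simp_all add: tup_def splice_def A_def)
  next
   case False
   then have "l \<noteq> a" using a by blast
   then show ?thesis using False by (simp only: tup_def restrict_apply fun_upd_apply if_False)
  qed
 qed
 have [measurable]: "\<phi> \<in> borel_measurable Q" by (rule L2_measurable[OF L(1)])
 \<comment> \<open>The law of the resampled tuple is the same for all choices of distinct indices,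
   so the identity tuple in \<open>degenerate\<close> is as good as \<open>i\<close>.\<close>
 have swap: "(\<integral>y. \<phi> ((tup i y)(a := u)) \<partial>P) = (\<integral>y. \<phi> ((tup id y)(a := u)) \<partial>P)" if u: "u \<in> space K" for u
 proof -
  have m: "(\<lambda>z. \<phi> (z(a := u))) \<in> borel_measurable Q"
  proof -
   have "(\<lambda>z. z(a := u)) \<in> measurable Q Q"
    by (rule measurable_fun_upd[of _ "{1..d}"]) (use u a in auto)
   then show ?thesis by measurable
  qed
  show ?thesis using integral_tup[OF inj(1) m] integral_tup[OF _ m, of id] by simp
 qed
 have "(\<integral>\<omega>. \<phi> (tup i \<omega>) * \<psi> (tup k \<omega>) \<partial>P) = (\<integral>x. (\<integral>y. \<phi> ((tup i y)(a := x (i a))) \<partial>P) * \<psi> (tup k x) \<partial>P)"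
  unfolding product_integral_resample[OF L inj A] t ..
 also have "\<dots> = (\<integral>x. (\<integral>y. \<phi> ((tup id y)(a := x (i a))) \<partial>P) * \<psi> (tup k x) \<partial>P)"
  by (intro Bochner_Integration.integral_cong refl) (subst swap, auto simp: space_PiM)
 also have "\<dots> = 0"
 proof (rule integral_eq_zero_AE)
  from deg a have "AE x in P. (\<integral>y. \<phi> ((tup id y)(a := x (i a))) \<partial>P) = 0" by (auto simp: degenerate_def)
  then show "AE x in P. (\<integral>y. \<phi> ((tup id y)(a := x (i a))) \<partial>P) * \<psi> (tup k x) = 0" by eventually_elim simp
 qed
 finally show ?thesis .
qed

text \<open>In the expanded square only pairs related by \<open>rel\<close> survive, each
  contributing at most the second moment. With \<open>rel\<close> as sharing one or sharing two
  indices, this reduces both variance bounds to counting.\<close>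

lemma sum_square_le:
 assumes L: "L2 \<phi>" and I: "finite I" "\<And>i. i \<in> I \<Longrightarrow> inj_on i {1..d}"
  and orth: "\<And>i k. i \<in> I \<Longrightarrow> k \<in> I \<Longrightarrow> \<not> rel i k \<Longrightarrow> (\<integral>\<omega>. \<phi> (tup i \<omega>) * \<phi> (tup k \<omega>) \<partial>P) = 0"
 shows "integrable P (\<lambda>\<omega>. (\<Sum>i\<in>I. \<phi> (tup i \<omega>))\<^sup>2)"
  and "(\<integral>\<omega>. (\<Sum>i\<in>I. \<phi> (tup i \<omega>))\<^sup>2 \<partial>P) \<le> card {(i, k) \<in> I \<times> I. rel i k} * (\<integral>z. (\<phi> z)\<^sup>2 \<partial>Q)"
proof -
 have eq: "(\<Sum>i\<in>I. \<phi> (tup i \<omega>))\<^sup>2 = (\<Sum>p\<in>I \<times> I. \<phi> (tup (fst p) \<omega>) * \<phi> (tup (snd p) \<omega>))" for \<omega>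
  by (simp add: power2_eq_square sum_product sum.cartesian_product case_prod_unfold)
 have int: "integrable P (\<lambda>\<omega>. \<phi> (tup (fst p) \<omega>) * \<phi> (tup (snd p) \<omega>))" if "p \<in> I \<times> I" for p
  using that I(2) by (intro product_integrable L) auto
 show "integrable P (\<lambda>\<omega>. (\<Sum>i\<in>I. \<phi> (tup i \<omega>))\<^sup>2)"
  unfolding eq by (intro Bochner_Integration.integrable_sum int)
 have "(\<integral>\<omega>. (\<Sum>i\<in>I. \<phi> (tup i \<omega>))\<^sup>2 \<partial>P) = (\<Sum>p\<in>I \<times> I. \<integral>\<omega>. \<phi> (tup (fst p) \<omega>) * \<phi> (tup (snd p) \<omega>) \<partial>P)"
  unfolding eq by (intro Bochner_Integration.integral_sum int)
 also have "\<dots> = (\<Sum>p\<in>{(i, k) \<in> I \<times> I. rel i k}. \<integral>\<omega>. \<phi> (tup (fst p) \<omega>) * \<phi> (tup (snd p) \<omega>) \<partial>P)"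
  using I(1) by (intro sum.mono_neutral_right ballI) (auto intro!: orth)
 also have "\<dots> \<le> (\<Sum>p\<in>{(i, k) \<in> I \<times> I. rel i k}. \<integral>z. (\<phi> z)\<^sup>2 \<partial>Q)"
 proof (rule sum_mono)
  fix p assume "p \<in> {(i, k) \<in> I \<times> I. rel i k}"
  then have "inj_on (fst p) {1..d}" "inj_on (snd p) {1..d}" using I(2) by auto
  from product_integrable(2)[OF L L this]
  show "(\<integral>\<omega>. \<phi> (tup (fst p) \<omega>) * \<phi> (tup (snd p) \<omega>) \<partial>P) \<le> (\<integral>z. (\<phi> z)\<^sup>2 \<partial>Q)" by (simp add: abs_le_iff)
 qed
 finally show "(\<integral>\<omega>. (\<Sum>i\<in>I. \<phi> (tup i \<omega>))\<^sup>2 \<partial>P) \<le> card {(i, k) \<in> I \<times> I. rel i k} * (\<integral>z. (\<phi> z)\<^sup>2 \<partial>Q)" by simp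
qed

definition centered_sum :: "((nat \<Rightarrow> 's) \<Rightarrow> real) \<Rightarrow> nat \<Rightarrow> (nat \<Rightarrow> 's) \<Rightarrow> real" where
 "centered_sum \<phi> n \<omega> = (\<Sum>i\<in>increasing_tuples d n. \<phi> (tup i \<omega>) - mean \<phi>)"

lemma centered_sum_measurable: assumes "L2 \<phi>" shows "centered_sum \<phi> n \<in> borel_measurable P"
proof -
 have [measurable]: "\<phi> \<in> borel_measurable Q" by (rule L2_measurable[OF assms])
 show ?thesis unfolding centered_sum_def[abs_def] by measurable
qed

lemma mean_diff_const: "L2 \<phi> \<Longrightarrow> mean (\<lambda>z. \<phi> z - c) = mean \<phi> - c"
proof -
 interpret Q: prob_space Q by (rule Q_prob)
 show "L2 \<phi> \<Longrightarrow> mean (\<lambda>z. \<phi> z - c) = mean \<phi> - c" using L2_integrable[of \<phi>] by (simp add: mean_def Q.prob_space)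
qed

text \<open>Disjoint tuples are orthogonal, and every tuple in the increment has an entry in (n, m],
  which makes the bound linear in m - n.\<close>

lemma centered_increment_square:
 assumes L: "L2 \<phi>" and nm: "n \<le> m"
 shows "integrable P (\<lambda>\<omega>. (centered_sum \<phi> m \<omega> - centered_sum \<phi> n \<omega>)\<^sup>2)"
  and "(\<integral>\<omega>. (centered_sum \<phi> m \<omega> - centered_sum \<phi> n \<omega>)\<^sup>2 \<partial>P)
   \<le> (\<integral>z. (\<phi> z - mean \<phi>)\<^sup>2 \<partial>Q) * (real d ^ 3 * real (m - n) * real m ^ (2 * d - 2))"
proof -
 define I where "I = increasing_tuples d m - increasing_tuples d n"
 define c where "c = (\<lambda>z. \<phi> z - mean \<phi>)"
 have Lc: "L2 c" unfolding c_def by (intro L2_diff L L2_const)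
 have c0: "mean c = 0" unfolding c_def by (simp add: mean_diff_const[OF L])
 have I: "finite I" "\<And>i. i \<in> I \<Longrightarrow> inj_on i {1..d}" unfolding I_def by (auto intro: increasing_tuples_inj)
 have eq: "centered_sum \<phi> m \<omega> - centered_sum \<phi> n \<omega> = (\<Sum>i\<in>I. c (tup i \<omega>))" for \<omega>
  unfolding centered_sum_def I_def c_def by (rule sum_diff[OF increasing_tuples_finite increasing_tuples_mono[OF nm], symmetric])
 have orth: "(\<integral>\<omega>. c (tup i \<omega>) * c (tup k \<omega>) \<partial>P) = 0" if "i \<in> I" "k \<in> I" "\<not> i ` {1..d} \<inter> k ` {1..d} \<noteq> {}" for i k
  using that by (intro orthogonal_disjoint Lc c0 I) auto
 note S = sum_square_le[where rel="\<lambda>i k. i ` {1..d} \<inter> k ` {1..d} \<noteq> {}", OF Lc I orth]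
 show "integrable P (\<lambda>\<omega>. (centered_sum \<phi> m \<omega> - centered_sum \<phi> n \<omega>)\<^sup>2)" unfolding eq by (rule S(1))
 have "card {(i, k) \<in> I \<times> I. i ` {1..d} \<inter> k ` {1..d} \<noteq> {}} \<le> card I * (d ^ 2 * m ^ (d - 1))"
  by (rule card_sharing_one_le) (auto simp: I_def)
 also have "\<dots> \<le> (d * (m - n) * m ^ (d - 1)) * (d ^ 2 * m ^ (d - 1))"
  unfolding I_def by (intro mult_right_mono card_increasing_tuples_diff_le) simp
 also have "\<dots> = d ^ 3 * (m - n) * m ^ ((d - 1) + (d - 1))" by (simp add: power_add power2_eq_square power3_eq_cube)
 also have "(d - 1) + (d - 1) = 2 * d - 2" by simp
 finally have "real (card {(i, k) \<in> I \<times> I. i ` {1..d} \<inter> k ` {1..d} \<noteq> {}}) \<le> real (d ^ 3 * (m - n) * m ^ (2 * d - 2))"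
  by (simp only: of_nat_le_iff)
 then have "real (card {(i, k) \<in> I \<times> I. i ` {1..d} \<inter> k ` {1..d} \<noteq> {}}) * (\<integral>z. (c z)\<^sup>2 \<partial>Q) \<le> real (d ^ 3 * (m - n) * m ^ (2 * d - 2)) * (\<integral>z. (c z)\<^sup>2 \<partial>Q)"
  by (rule mult_right_mono) simp
 with S(2) have "(\<integral>\<omega>. (\<Sum>i\<in>I. c (tup i \<omega>))\<^sup>2 \<partial>P) \<le> real (d ^ 3 * (m - n) * m ^ (2 * d - 2)) * (\<integral>z. (c z)\<^sup>2 \<partial>Q)"
  by (rule order_trans)
 also have "\<dots> = (\<integral>z. (\<phi> z - mean \<phi>)\<^sup>2 \<partial>Q) * (real d ^ 3 * real (m - n) * real m ^ (2 * d - 2))"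
  by (simp only: c_def of_nat_mult of_nat_power mult.commute)
 finally show "(\<integral>\<omega>. (centered_sum \<phi> m \<omega> - centered_sum \<phi> n \<omega>)\<^sup>2 \<partial>P)
   \<le> (\<integral>z. (\<phi> z - mean \<phi>)\<^sup>2 \<partial>Q) * (real d ^ 3 * real (m - n) * real m ^ (2 * d - 2))"
  unfolding eq .
qed

end

section \<open>First-order projections and the degenerate remainder\<close>

context iid_kernel
begin

text \<open>The first-order Hoeffding term in the a-th argument. As the kernel need not be
  symmetric, each a has its own.\<close>

definition proj :: "((nat \<Rightarrow> 's) \<Rightarrow> real) \<Rightarrow> nat \<Rightarrow> 's \<Rightarrow> real" where
 "proj \<phi> a u = (\<integral>y. \<phi> ((tup id y)(a := u)) \<partial>P) - mean \<phi>"

definition residual :: "((nat \<Rightarrow> 's) \<Rightarrow> real) \<Rightarrow> (nat \<Rightarrow> 's) \<Rightarrow> real" where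
 "residual \<phi> z = \<phi> z - mean \<phi> - (\<Sum>a\<in>{1..d}. proj \<phi> a (z a))"

text \<open>The number of increasing d-tuples in {1..n} with a-th entry j, for j in {1..n}.\<close>

definition weight :: "nat \<Rightarrow> nat \<Rightarrow> nat \<Rightarrow> real" where
 "weight n a j = real ((j - 1 choose (a - 1)) * (n - j choose (d - a)))"

lemma freeze_measurable:
 assumes a: "a \<in> {1..d}"
 shows "(\<lambda>(u, y). (tup id y)(a := u)) \<in> measurable (K \<Otimes>\<^sub>M P) Q"
proof -
 have "(\<lambda>p. (tup id (snd p))(a := fst p)) \<in> measurable (K \<Otimes>\<^sub>M P) Q"
  by (rule measurable_fun_upd[of _ "{1..d}"]) (use a in auto)
 then show ?thesis by (simp add: case_prod_unfold)
qed

lemma proj_measurable [measurable]: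
 assumes "L2 \<phi>" "a \<in> {1..d}" shows "proj \<phi> a \<in> borel_measurable K"
proof -
 have [measurable]: "\<phi> \<in> borel_measurable Q" by (rule L2_measurable[OF assms(1)])
 have "(\<lambda>p. \<phi> (case p of (u, y) \<Rightarrow> (tup id y)(a := u))) \<in> borel_measurable (K \<Otimes>\<^sub>M P)"
  by (rule measurable_compose[OF freeze_measurable[OF assms(2)]]) measurable
 then have "(\<lambda>(u, y). \<phi> ((tup id y)(a := u))) \<in> borel_measurable (K \<Otimes>\<^sub>M P)"
  by (simp add: case_prod_unfold)
 then have "(\<lambda>u. \<integral>y. \<phi> ((tup id y)(a := u)) \<partial>P) \<in> borel_measurable K"
  by (rule pp.P.borel_measurable_lebesgue_integral)
 then show ?thesis unfolding proj_def[abs_def] by measurable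
qed

text \<open>Freezing the a-th argument is a splice at the single coordinate a, fed from coordinate j
  of the other sequence; a constant index map is injective on a singleton.\<close>

lemma freeze_integral:
 assumes h: "integrable Q h" and a: "a \<in> {1..d}"
 shows "AE y in P. integrable P (\<lambda>x. h ((tup id x)(a := y j)) :: real)"
  and "integrable P (\<lambda>y. \<integral>x. h ((tup id x)(a := y j)) \<partial>P)"
  and "(\<integral>y. (\<integral>x. h ((tup id x)(a := y j)) \<partial>P) \<partial>P) = (\<integral>z. h z \<partial>Q)"
proof -
 have i: "integrable P (\<lambda>\<omega>. h (tup id \<omega>))" by (rule integrable_tup[OF _ h]) simp
 have inj: "inj_on (\<lambda>_::nat. j) {a}" by simp
 have t: "tup id (splice {a} (\<lambda>_. j) x y) = (tup id x)(a := y j)" for x y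
  using a by (auto simp: tup_def splice_def restrict_def fun_eq_iff)
 note S = integral_splice[OF inj i, unfolded t]
 show "AE y in P. integrable P (\<lambda>x. h ((tup id x)(a := y j)))" using PP.AE_integrable_snd[OF S(1)] .
 show "integrable P (\<lambda>y. \<integral>x. h ((tup id x)(a := y j)) \<partial>P)" using PP.integrable_snd[OF S(1)] .
 have "(\<integral>y. (\<integral>x. h ((tup id x)(a := y j)) \<partial>P) \<partial>P) = (\<integral>\<omega>. h (tup id \<omega>) \<partial>P)"
  unfolding S(2) using PP.Fubini_integral[OF S(1)] by simp
 also have "\<dots> = (\<integral>z. h z \<partial>Q)" by (rule integral_tup) (use h in auto)
 finally show "(\<integral>y. (\<integral>x. h ((tup id x)(a := y j)) \<partial>P) \<partial>P) = (\<integral>z. h z \<partial>Q)" .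
qed

text \<open>Jensen for the conditional mean given the a-th argument; coordinate 0 of a path supplies
  the law \<open>K\<close>.\<close>

lemma proj_square_integrable:
 assumes L: "L2 \<phi>" and a: "a \<in> {1..d}"
 shows "integrable K (\<lambda>u. (proj \<phi> a u)\<^sup>2)"
proof -
 note [measurable] = proj_measurable[OF L a]
 have L1: "integrable Q \<phi>" by (rule L2_integrable[OF L])
 have L2: "integrable Q (\<lambda>z. (\<phi> z)\<^sup>2)" using L by (simp add: L2_def)
 let ?m = "mean \<phi>"
 have "integrable P (\<lambda>y. (proj \<phi> a (y 0))\<^sup>2)"
 proof (rule Bochner_Integration.integrable_bound)
  show "integrable P (\<lambda>y. 2 * (\<integral>x. (\<phi> ((tup id x)(a := y 0)))\<^sup>2 \<partial>P) + 2 * ?m\<^sup>2)"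
   using freeze_integral(2)[OF L2 a, of 0] by simp
  show "AE y in P. norm ((proj \<phi> a (y 0))\<^sup>2) \<le> norm (2 * (\<integral>x. (\<phi> ((tup id x)(a := y 0)))\<^sup>2 \<partial>P) + 2 * ?m\<^sup>2)"
   using freeze_integral(1)[OF L1 a, of 0] freeze_integral(1)[OF L2 a, of 0]
  proof eventually_elim
   case (elim y)
   let ?q = "\<integral>x. \<phi> ((tup id x)(a := y 0)) \<partial>P"
   have "?q\<^sup>2 \<le> (\<integral>x. (\<phi> ((tup id x)(a := y 0)))\<^sup>2 \<partial>P)" by (rule pp.P.square_integral_le[OF elim])
   moreover have "(?q - ?m)\<^sup>2 \<le> 2 * ?q\<^sup>2 + 2 * ?m\<^sup>2" using sum_squares_bound[of ?q "- ?m"] by (simp add: power2_diff)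
   ultimately have "(?q - ?m)\<^sup>2 \<le> 2 * (\<integral>x. (\<phi> ((tup id x)(a := y 0)))\<^sup>2 \<partial>P) + 2 * ?m\<^sup>2" by linarith
   then show ?case by (simp add: proj_def)
  qed
 qed measurable
 then have "integrable (distr P K (\<lambda>x. x 0)) (\<lambda>u. (proj \<phi> a u)\<^sup>2)"
  by (subst integrable_distr_eq) auto
 then show ?thesis by (simp add: distr_coord)
qed

lemma proj_mean: assumes L: "L2 \<phi>" and a: "a \<in> {1..d}" shows "(\<integral>u. proj \<phi> a u \<partial>K) = 0"
proof -
 have "(\<integral>u. proj \<phi> a u \<partial>K) = (\<integral>y. proj \<phi> a (y 0) \<partial>P)"
  using integral_coord[OF proj_measurable[OF L a]] by simp
 also have "\<dots> = (\<integral>y. (\<integral>x. \<phi> ((tup id x)(a := y 0)) \<partial>P) \<partial>P) - mean \<phi>"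
  unfolding proj_def using freeze_integral(2)[OF L2_integrable[OF L] a, of 0] by (simp add: pp.P.prob_space)
 also have "\<dots> = 0" by (simp add: freeze_integral(3)[OF L2_integrable[OF L] a] mean_def)
 finally show ?thesis .
qed

lemma proj_integrable: assumes L: "L2 \<phi>" and a: "a \<in> {1..d}" shows "integrable K (proj \<phi> a)"
 by (rule square_integrable_imp_integrable[OF proj_measurable[OF L a] proj_square_integrable[OF L a]])

lemma L2_component:
 assumes a: "a \<in> {1..d}" and h: "h \<in> borel_measurable K" "integrable K (\<lambda>u. (h u)\<^sup>2)"
 shows "L2 (\<lambda>z. h (z a))" and "mean (\<lambda>z. h (z a)) = (\<integral>u. h u \<partial>K)"
proof -
 note [measurable] = h(1)
 have c: "distr Q K (\<lambda>z. z a) = K" using a by (intro distr_PiM_component prob_space_axioms)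
 have m: "(\<lambda>z. z a) \<in> measurable Q K" using a by measurable
 have "integrable (distr Q K (\<lambda>z. z a)) (\<lambda>u. (h u)\<^sup>2)" using h(2) by (simp add: c)
 then have "integrable Q (\<lambda>z. (h (z a))\<^sup>2)" using m by (subst (asm) integrable_distr_eq) auto
 then show "L2 (\<lambda>z. h (z a))" unfolding L2_def using measurable_compose[OF m h(1)] by simp
 have "(\<integral>u. h u \<partial>distr Q K (\<lambda>z. z a)) = (\<integral>z. h (z a) \<partial>Q)" using m h(1) by (rule integral_distr)
 then show "mean (\<lambda>z. h (z a)) = (\<integral>u. h u \<partial>K)" by (simp add: c mean_def)
qed

lemma L2_residual: assumes L: "L2 \<phi>" shows "L2 (residual \<phi>)"
 unfolding residual_def[abs_def]
 by (intro L2_diff L L2_const L2_sum L2_component proj_measurable[OF L] proj_square_integrable[OF L])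

lemma mean_residual: assumes L: "L2 \<phi>" shows "mean (residual \<phi>) = 0"
proof -
 interpret Q: prob_space Q by (rule Q_prob)
 have i: "integrable Q (\<lambda>z. proj \<phi> a (z a))" "(\<integral>z. proj \<phi> a (z a) \<partial>Q) = 0" if "a \<in> {1..d}" for a
  using L2_integrable[OF L2_component(1)[OF that proj_measurable[OF L that] proj_square_integrable[OF L that]]]
   L2_component(2)[OF that proj_measurable[OF L that] proj_square_integrable[OF L that]] proj_mean[OF L that]
  by (auto simp: mean_def)
 have "mean (residual \<phi>) = (\<integral>z. \<phi> z - mean \<phi> \<partial>Q) - (\<integral>z. (\<Sum>a\<in>{1..d}. proj \<phi> a (z a)) \<partial>Q)"
  unfolding mean_def[of "residual \<phi>"] residual_def
  by (rule Bochner_Integration.integral_diff[OF L2_integrable[OF L2_diff[OF L L2_const]] Bochner_Integration.integrable_sum[OF i(1)]])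
 also have "(\<integral>z. (\<Sum>a\<in>{1..d}. proj \<phi> a (z a)) \<partial>Q) = (\<Sum>a\<in>{1..d}. \<integral>z. proj \<phi> a (z a) \<partial>Q)"
  by (rule Bochner_Integration.integral_sum[OF i(1)])
 also have "\<dots> = 0" by (rule sum.neutral) (use i(2) in blast)
 finally show ?thesis using mean_diff_const[OF L, of "mean \<phi>"] by (simp add: mean_def)
qed

text \<open>With the a-th argument frozen, the centred kernel averages to its a-th projection; the
  a-th subtracted term equals the same value, and the other terms average to zero.\<close>

lemma degenerate_residual: assumes L: "L2 \<phi>" shows "degenerate (residual \<phi>)"
 unfolding degenerate_def
proof (intro ballI allI)
 fix a j assume a: "a \<in> {1..d}"
 show "AE x in P. (\<integral>y. residual \<phi> ((tup id y)(a := x j)) \<partial>P) = 0"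
  using freeze_integral(1)[OF L2_integrable[OF L] a, of j]
 proof eventually_elim
  case (elim x)
  have comp: "integrable P (\<lambda>y. proj \<phi> b (((tup id y)(a := x j)) b))"
   "(\<integral>y. proj \<phi> b (((tup id y)(a := x j)) b) \<partial>P) = (if b = a then proj \<phi> a (x j) else 0)" if b: "b \<in> {1..d}" for b
  proof -
   have "((tup id y)(a := x j)) b = (if b = a then x j else y b)" for y using b by (simp add: tup_def)
   then have F: "(\<lambda>y. proj \<phi> b (((tup id y)(a := x j)) b)) = (\<lambda>y. proj \<phi> b (if b = a then x j else y b))"
    by (simp only:)
   show "integrable P (\<lambda>y. proj \<phi> b (((tup id y)(a := x j)) b))"
    unfolding F using integrable_coord[OF proj_integrable[OF L b], of b] by (cases "b = a") simp_all
   show "(\<integral>y. proj \<phi> b (((tup id y)(a := x j)) b) \<partial>P) = (if b = a then proj \<phi> a (x j) else 0)"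
    unfolding F using integral_coord[OF proj_measurable[OF L b], of b] proj_mean[OF L b]
    by (cases "b = a") (simp_all add: pp.P.prob_space)
  qed
  have e: "integrable P (\<lambda>y. \<phi> ((tup id y)(a := x j)) - mean \<phi>)" using elim by simp
  have "(\<integral>y. residual \<phi> ((tup id y)(a := x j)) \<partial>P)
    = (\<integral>y. \<phi> ((tup id y)(a := x j)) - mean \<phi> \<partial>P) - (\<integral>y. (\<Sum>b\<in>{1..d}. proj \<phi> b (((tup id y)(a := x j)) b)) \<partial>P)"
   unfolding residual_def
   by (rule Bochner_Integration.integral_diff[OF e Bochner_Integration.integrable_sum[OF comp(1)]])
  also have "(\<integral>y. \<phi> ((tup id y)(a := x j)) - mean \<phi> \<partial>P) = proj \<phi> a (x j)"
   using elim by (simp add: proj_def pp.P.prob_space)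
  also have "(\<integral>y. (\<Sum>b\<in>{1..d}. proj \<phi> b (((tup id y)(a := x j)) b)) \<partial>P) = (\<Sum>b\<in>{1..d}. \<integral>y. proj \<phi> b (((tup id y)(a := x j)) b) \<partial>P)"
   by (rule Bochner_Integration.integral_sum[OF comp(1)])
  also have "(\<Sum>b\<in>{1..d}. \<integral>y. proj \<phi> b (((tup id y)(a := x j)) b) \<partial>P) = (\<Sum>b\<in>{1..d}. if b = a then proj \<phi> a (x j) else 0)"
   by (rule sum.cong[OF refl comp(2)])
  also have "\<dots> = proj \<phi> a (x j)" using a by simp
  finally show ?case by (simp only: diff_self)
 qed
qed

text \<open>Degeneracy removes pairs with exactly one common index in addition to disjoint pairs,
  which gains a factor n over the variance of the full sum.\<close>

lemma projection_error_square:
 assumes L: "L2 \<phi>"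
 shows "integrable P (\<lambda>\<omega>. (\<Sum>i\<in>increasing_tuples d n. residual \<phi> (tup i \<omega>))\<^sup>2)"
  and "(\<integral>\<omega>. (\<Sum>i\<in>increasing_tuples d n. residual \<phi> (tup i \<omega>))\<^sup>2 \<partial>P)
   \<le> real d ^ 4 * real n ^ (2 * d - 2) * (\<integral>z. (residual \<phi> z)\<^sup>2 \<partial>Q)"
proof -
 let ?I = "increasing_tuples d n"
 let ?rel = "\<lambda>i k. \<exists>x y. x \<noteq> y \<and> {x, y} \<subseteq> i ` {1..d} \<inter> k ` {1..d}"
 have orth: "(\<integral>\<omega>. residual \<phi> (tup i \<omega>) * residual \<phi> (tup k \<omega>) \<partial>P) = 0" if "i \<in> ?I" "k \<in> ?I" "\<not> ?rel i k" for i k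
 proof -
  have inj: "inj_on i {1..d}" "inj_on k {1..d}" using that by (auto intro: increasing_tuples_inj)
  show ?thesis
  proof (cases "i ` {1..d} \<inter> k ` {1..d} = {}")
   case True then show ?thesis by (intro orthogonal_disjoint L2_residual L inj mean_residual)
  next
   case False
   define S where "S = i ` {1..d} \<inter> k ` {1..d}"
   have nS: "\<not> (\<exists>x y. x \<noteq> y \<and> {x, y} \<subseteq> S)" using that(3) by (simp only: S_def not_False_eq_True)
   have "S \<noteq> {}" using False by (simp only: S_def not_False_eq_True)
   then obtain x where x: "x \<in> S" by blast
   then have "x \<in> i ` {1..d}" by (simp only: S_def Int_iff)
   then obtain a where a: "a \<in> {1..d}" "x = i a" by (rule imageE)
   have "S = {x}" using nS x by blast
   then have "i ` {1..d} \<inter> k ` {1..d} = {i a}" by (simp only: S_def a(2))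
   then show ?thesis by (intro orthogonal_share_one[OF _ _ inj _ a(1)] L2_residual L degenerate_residual)
  qed
 qed
 note S = sum_square_le[where rel="?rel", OF L2_residual[OF L] increasing_tuples_finite increasing_tuples_inj orth]
 show "integrable P (\<lambda>\<omega>. (\<Sum>i\<in>?I. residual \<phi> (tup i \<omega>))\<^sup>2)" by (rule S(1))
 have "real (card {(i, k) \<in> ?I \<times> ?I. ?rel i k}) \<le> real (d ^ 4 * n ^ (2 * d - 2))"
  by (simp only: of_nat_le_iff card_sharing_two_le)
 then have "real (card {(i, k) \<in> ?I \<times> ?I. ?rel i k}) * (\<integral>z. (residual \<phi> z)\<^sup>2 \<partial>Q) \<le> real (d ^ 4 * n ^ (2 * d - 2)) * (\<integral>z. (residual \<phi> z)\<^sup>2 \<partial>Q)"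
  by (rule mult_right_mono) simp
 with S(2) have "(\<integral>\<omega>. (\<Sum>i\<in>?I. residual \<phi> (tup i \<omega>))\<^sup>2 \<partial>P) \<le> real (d ^ 4 * n ^ (2 * d - 2)) * (\<integral>z. (residual \<phi> z)\<^sup>2 \<partial>Q)"
  by (rule order_trans)
 then show "(\<integral>\<omega>. (\<Sum>i\<in>?I. residual \<phi> (tup i \<omega>))\<^sup>2 \<partial>P) \<le> real d ^ 4 * real n ^ (2 * d - 2) * (\<integral>z. (residual \<phi> z)\<^sup>2 \<partial>Q)"
  by simp
qed

text \<open>The projection terms are regrouped by the value j of the a-th entry, which occurs in
  \<open>weight n a j\<close> tuples.\<close>

lemma projection_decomposition:
 "centered_sum \<phi> n \<omega> = (\<Sum>j\<in>{1..n}. \<Sum>a\<in>{1..d}. weight n a j * proj \<phi> a (\<omega> j))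
   + (\<Sum>i\<in>increasing_tuples d n. residual \<phi> (tup i \<omega>))"
proof -
 let ?I = "increasing_tuples d n"
 have "centered_sum \<phi> n \<omega> = (\<Sum>i\<in>?I. (\<Sum>a\<in>{1..d}. proj \<phi> a (\<omega> (i a))) + residual \<phi> (tup i \<omega>))"
  unfolding centered_sum_def by (intro sum.cong refl) (simp add: residual_def tup_def)
 also have "\<dots> = (\<Sum>a\<in>{1..d}. \<Sum>i\<in>?I. proj \<phi> a (\<omega> (i a))) + (\<Sum>i\<in>?I. residual \<phi> (tup i \<omega>))"
  by (simp add: sum.distrib) (rule sum.swap)
 also have "(\<Sum>a\<in>{1..d}. \<Sum>i\<in>?I. proj \<phi> a (\<omega> (i a))) = (\<Sum>a\<in>{1..d}. \<Sum>j\<in>{1..n}. weight n a j * proj \<phi> a (\<omega> j))"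
 proof (rule sum.cong[OF refl])
  fix a assume a: "a \<in> {1..d}"
  have "(\<Sum>i\<in>?I. proj \<phi> a (\<omega> (i a))) = (\<Sum>j\<in>{1..n}. \<Sum>i\<in>{i\<in>?I. i a = j}. proj \<phi> a (\<omega> (i a)))"
   by (rule sum.group[symmetric]) (use a increasing_tuples_range in auto)
  also have "\<dots> = (\<Sum>j\<in>{1..n}. weight n a j * proj \<phi> a (\<omega> j))"
  proof (rule sum.cong[OF refl])
   fix j assume j: "j \<in> {1..n}"
   have "(\<Sum>i\<in>{i\<in>?I. i a = j}. proj \<phi> a (\<omega> (i a))) = (\<Sum>i\<in>{i\<in>?I. i a = j}. proj \<phi> a (\<omega> j))"
    by (rule sum.cong) auto
   also have "\<dots> = real (card {i\<in>?I. i a = j}) * proj \<phi> a (\<omega> j)" by simp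
   also have "card {i\<in>?I. i a = j} = (j - 1 choose (a - 1)) * (n - j choose (d - a))"
    using card_increasing_tuples_coordinate[of a d j n] a j by simp
   finally show "(\<Sum>i\<in>{i\<in>?I. i a = j}. proj \<phi> a (\<omega> (i a))) = weight n a j * proj \<phi> a (\<omega> j)"
    by (simp add: weight_def)
  qed
  finally show "(\<Sum>i\<in>?I. proj \<phi> a (\<omega> (i a))) = (\<Sum>j\<in>{1..n}. weight n a j * proj \<phi> a (\<omega> j))" .
 qed
 also have "\<dots> = (\<Sum>j\<in>{1..n}. \<Sum>a\<in>{1..d}. weight n a j * proj \<phi> a (\<omega> j))" by (rule sum.swap)
 finally show ?thesis .
qed

end

section \<open>The central limit theorem for weighted sums\<close>

text \<open>One formula for the point mass v = 0 and the Gaussian case, so that later arguments need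
  not distinguish them.\<close>

lemma centered_normal_eq_distr:
 assumes "v \<ge> 0"
 shows "centered_normal v = distr std_normal_distribution borel (\<lambda>x. sqrt v * x)"
proof (cases "v = 0")
 case True
 interpret N: prob_space std_normal_distribution by (rule prob_space_normal_density) simp
 have "distr std_normal_distribution borel (\<lambda>x. 0) = return borel (0::real)"
  by (intro measure_eqI) (auto simp: emeasure_distr N.emeasure_space_1[simplified] indicator_def split: if_splits)
 then show ?thesis using True by (simp add: centered_normal_def)
next
 case False
 then have s: "sqrt v > 0" using assms by simp
 interpret N: prob_space std_normal_distribution by (rule prob_space_normal_density) simp
 have "distributed std_normal_distribution lborel (\<lambda>x. x) std_normal_density"
  unfolding distributed_def
 proof (intro conjI)
  show "distr std_normal_distribution lborel (\<lambda>x. x) = std_normal_distribution" by (rule distr_id2) simp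
 qed measurable
 from N.normal_density_affine[OF this _, of "sqrt v" 0] s
 have "distributed std_normal_distribution lborel (\<lambda>x. sqrt v * x) (normal_density 0 (sqrt v))" by simp
 then have "distr std_normal_distribution lborel (\<lambda>x. sqrt v * x) = density lborel (normal_density 0 (sqrt v))"
  by (rule distributed_distr_eq_density)
 then show ?thesis using False by (simp add: centered_normal_def cong: distr_cong)
qed

lemma real_distribution_centered_normal: "v \<ge> 0 \<Longrightarrow> real_distribution (centered_normal v)"
proof -
 interpret N: real_distribution std_normal_distribution by (rule real_dist_normal_dist)
 show "v \<ge> 0 \<Longrightarrow> real_distribution (centered_normal v)"
  unfolding centered_normal_eq_distr by (rule N.real_distribution_distr) simp
qed

lemma char_centered_normal:
 assumes "v \<ge> 0" shows "char (centered_normal v) t = complex_of_real (exp (- (t\<^sup>2 * v / 2)))"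
proof -
 have "char (centered_normal v) t = char std_normal_distribution (sqrt v * t)"
  unfolding centered_normal_eq_distr[OF assms] char_def by (subst integral_distr) (auto simp: algebra_simps)
 then show ?thesis using assms by (simp add: char_std_normal_distribution power_mult_distrib mult.commute)
qed

lemma abs_exp_minus_linear_le: fixes u :: real assumes "u \<ge> 0" shows "\<bar>exp (- u) - (1 - u)\<bar> \<le> u\<^sup>2"
proof -
 have 1: "1 - u \<le> exp (- u)" using exp_ge_add_one_self[of "- u"] by simp
 have "exp (- u) \<le> 1 / (1 + u)" using exp_ge_add_one_self[of u] assms by (simp add: exp_minus divide_simps)
 also have "\<dots> \<le> 1 - u + u\<^sup>2" using assms by (simp add: divide_simps power2_eq_square algebra_simps)
 finally show ?thesis using 1 by simp
qed

context iid_space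
begin

lemma indep_coordinates: "pp.P.indep_vars (\<lambda>_. K) (\<lambda>i \<omega>. \<omega> i) UNIV"
proof -
 have e: "(\<lambda>x::nat \<Rightarrow> 's. \<lambda>i\<in>UNIV. x i) = (\<lambda>x. x)" by (simp add: fun_eq_iff)
 show ?thesis by (subst pp.P.indep_vars_iff_distr_eq_PiM') (auto simp: e distr_coord distr_id2)
qed

text \<open>A single square integrable \<open>H\<close> dominates all summands and takes the place
  of Lindeberg's condition: the remainder of the expanded characteristic functions is uniform in j
  and tends to 0 by dominated convergence. Only the averaged variances have to converge.\<close>

theorem weighted_clt:
 fixes \<xi> :: "nat \<Rightarrow> nat \<Rightarrow> 's \<Rightarrow> real" and m :: "nat \<Rightarrow> nat"
 assumes m: "filterlim m at_top sequentially" and \<xi> [measurable]: "\<And>k j. \<xi> k j \<in> borel_measurable K"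
  and H [measurable]: "H \<in> borel_measurable K" and H2: "integrable K (\<lambda>s. (H s)\<^sup>2)"
  and le: "\<And>k j s. \<bar>\<xi> k j s\<bar> \<le> H s" and mean: "\<And>k j. (\<integral>s. \<xi> k j s \<partial>K) = 0"
  and v: "(\<lambda>k. (\<Sum>j\<in>{1..m k}. \<integral>s. (\<xi> k j s)\<^sup>2 \<partial>K) / m k) \<longlonglongrightarrow> v"
 shows "v \<ge> 0"
  and "weak_conv_m (\<lambda>k. distr P borel (\<lambda>\<omega>. (\<Sum>j\<in>{1..m k}. \<xi> k j (\<omega> j)) / sqrt (m k))) (centered_normal v)"
proof -
 show v0: "v \<ge> 0" by (rule LIMSEQ_le_const[OF v]) (auto intro!: sum_nonneg divide_nonneg_nonneg)
 have H0: "H s \<ge> 0" for s using le[of 0 0 s] by linarith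
 have sq: "(\<xi> k j s)\<^sup>2 \<le> (H s)\<^sup>2" for k j s using power_mono[OF le[of k j s], of 2] by simp
 have i2: "integrable K (\<lambda>s. (\<xi> k j s)\<^sup>2)" for k j
 proof (rule Bochner_Integration.integrable_bound[OF H2])
  show "AE s in K. norm ((\<xi> k j s)\<^sup>2) \<le> norm ((H s)\<^sup>2)" using sq by (intro AE_I2) simp
 qed measurable
 have i1: "integrable K (\<xi> k j)" for k j by (rule square_integrable_imp_integrable[OF \<xi> i2])
 define \<sigma> where "\<sigma> k j = (\<integral>s. (\<xi> k j s)\<^sup>2 \<partial>K)" for k j
 define M2 where "M2 = (\<integral>s. (H s)\<^sup>2 \<partial>K)"
 have \<sigma>: "0 \<le> \<sigma> k j" "\<sigma> k j \<le> M2" for k j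
  unfolding \<sigma>_def M2_def using sq by (auto intro!: integral_mono i2 H2)
 define D where "D k j = distr K borel (\<xi> k j)" for k j
 have D: "real_distribution (D k j)" for k j unfolding D_def by (rule real_distribution_distr) simp
 show "weak_conv_m (\<lambda>k. distr P borel (\<lambda>\<omega>. (\<Sum>j\<in>{1..m k}. \<xi> k j (\<omega> j)) / sqrt (m k))) (centered_normal v)"
 proof (rule levy_continuity)
  show "real_distribution (distr P borel (\<lambda>\<omega>. (\<Sum>j\<in>{1..m k}. \<xi> k j (\<omega> j)) / sqrt (m k)))" for k
   by (rule pp.P.real_distribution_distr) measurable
  show "real_distribution (centered_normal v)" by (rule real_distribution_centered_normal[OF v0])
  fix t :: real
  define \<tau> where "\<tau> k = t / sqrt (m k)" for k
  have char_eq: "char (distr P borel (\<lambda>\<omega>. (\<Sum>j\<in>{1..m k}. \<xi> k j (\<omega> j)) / sqrt (m k))) t = (\<Prod>j\<in>{1..m k}. char (D k j) (\<tau> k))" for k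
  proof -
   have "char (distr P borel (\<lambda>\<omega>. (\<Sum>j\<in>{1..m k}. \<xi> k j (\<omega> j)) / sqrt (m k))) t
     = char (distr P borel (\<lambda>\<omega>. \<Sum>j\<in>{1..m k}. \<xi> k j (\<omega> j))) (\<tau> k)"
    unfolding char_def \<tau>_def by (simp add: integral_distr mult.commute)
   also have "\<dots> = (\<Prod>j\<in>{1..m k}. char (distr P borel (\<lambda>\<omega>. \<xi> k j (\<omega> j))) (\<tau> k))"
   proof (rule pp.P.char_distr_sum)
    have "pp.P.indep_vars (\<lambda>_. K) (\<lambda>i \<omega>. \<omega> i) {1..m k}"
     by (rule pp.P.indep_vars_subset[OF indep_coordinates]) simp
    then show "pp.P.indep_vars (\<lambda>_. borel) (\<lambda>j \<omega>. \<xi> k j (\<omega> j)) {1..m k}"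
     by (rule pp.P.indep_vars_compose2) measurable
   qed
   also have "\<dots> = (\<Prod>j\<in>{1..m k}. char (D k j) (\<tau> k))"
   proof (rule prod.cong[OF refl])
    fix j
    have "distr P borel (\<lambda>\<omega>. \<xi> k j (\<omega> j)) = distr (distr P K (\<lambda>\<omega>. \<omega> j)) borel (\<xi> k j)"
     by (subst distr_distr) (auto simp: comp_def)
    then show "char (distr P borel (\<lambda>\<omega>. \<xi> k j (\<omega> j))) (\<tau> k) = char (D k j) (\<tau> k)"
     by (simp add: distr_coord D_def)
   qed
   finally show ?thesis .
  qed
  \<comment> \<open>The third-order remainder of a characteristic function with \<open>H\<close> in
    place of the summand, hence a bound common to all j.\<close>
  define q where "q k = (\<integral>s. min (6 * (H s)\<^sup>2) (\<bar>\<tau> k\<bar> * H s ^ 3) \<partial>K)" for k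
  have qi: "integrable K (\<lambda>s. min (6 * (H s)\<^sup>2) (\<bar>\<tau> k\<bar> * H s ^ 3))" for k
  proof (rule Bochner_Integration.integrable_bound)
   show "integrable K (\<lambda>s. 6 * (H s)\<^sup>2)" using H2 by simp
   show "AE s in K. norm (min (6 * (H s)\<^sup>2) (\<bar>\<tau> k\<bar> * H s ^ 3)) \<le> norm (6 * (H s)\<^sup>2)"
    using H0 by (intro AE_I2) (simp add: abs_of_nonneg)
  qed measurable
  have approx: "cmod (char (D k j) (\<tau> k) - (1 - (\<tau> k)\<^sup>2 * \<sigma> k j / 2)) \<le> (\<tau> k)\<^sup>2 / 6 * q k" for k j
  proof -
   have var: "variance (\<xi> k j) = \<sigma> k j" by (simp add: mean \<sigma>_def)
   have "cmod (char (D k j) (\<tau> k) - (1 - (\<tau> k)\<^sup>2 * \<sigma> k j / 2)) \<le> (\<tau> k)\<^sup>2 / 6 * (\<integral>s. min (6 * (\<xi> k j s)\<^sup>2) (\<bar>\<tau> k\<bar> * \<bar>\<xi> k j s\<bar> ^ 3) \<partial>K)"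
    using char_approx3'[OF \<xi> i1 i2 mean var D_def, of "\<tau> k"] by simp
   also have "\<dots> \<le> (\<tau> k)\<^sup>2 / 6 * q k"
   proof -
    have pt: "min (6 * (\<xi> k j s)\<^sup>2) (\<bar>\<tau> k\<bar> * \<bar>\<xi> k j s\<bar> ^ 3) \<le> min (6 * (H s)\<^sup>2) (\<bar>\<tau> k\<bar> * H s ^ 3)" for s
     using sq[of k j s] power_mono[OF le[of k j s], of 3] by (intro min.mono mult_left_mono) auto
    have "(\<integral>s. min (6 * (\<xi> k j s)\<^sup>2) (\<bar>\<tau> k\<bar> * \<bar>\<xi> k j s\<bar> ^ 3) \<partial>K) \<le> q k"
     unfolding q_def
    proof (rule integral_mono[OF _ qi pt])
     show "integrable K (\<lambda>s. min (6 * (\<xi> k j s)\<^sup>2) (\<bar>\<tau> k\<bar> * \<bar>\<xi> k j s\<bar> ^ 3))"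
     proof (rule Bochner_Integration.integrable_bound[OF qi[of k]])
      show "AE s in K. norm (min (6 * (\<xi> k j s)\<^sup>2) (\<bar>\<tau> k\<bar> * \<bar>\<xi> k j s\<bar> ^ 3)) \<le> norm (min (6 * (H s)\<^sup>2) (\<bar>\<tau> k\<bar> * H s ^ 3))"
      proof (rule AE_I2)
       fix s
       have "0 \<le> min (6 * (\<xi> k j s)\<^sup>2) (\<bar>\<tau> k\<bar> * \<bar>\<xi> k j s\<bar> ^ 3)" by simp
       with pt[of s] show "norm (min (6 * (\<xi> k j s)\<^sup>2) (\<bar>\<tau> k\<bar> * \<bar>\<xi> k j s\<bar> ^ 3)) \<le> norm (min (6 * (H s)\<^sup>2) (\<bar>\<tau> k\<bar> * H s ^ 3))"
        by (simp only: real_norm_def abs_of_nonneg)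
      qed
     qed measurable
    qed
    then show ?thesis by (intro mult_left_mono) auto
   qed
   finally show ?thesis .
  qed
  \<comment> \<open>Sum of m remainders \<open>\<tau>^2 * q / 6\<close> and of m errors of the
    exponential against its linear part, with \<tau>^2 = t^2 / m.\<close>
  define E where "E k = t\<^sup>2 / 6 * q k + (t\<^sup>2 * M2 / 2)\<^sup>2 * (1 / real (m k))" for k
  have diff: "cmod ((\<Prod>j\<in>{1..m k}. char (D k j) (\<tau> k)) - (\<Prod>j\<in>{1..m k}. complex_of_real (exp (- ((\<tau> k)\<^sup>2 * \<sigma> k j / 2))))) \<le> E k" if mk: "m k > 0" for k
  proof -
   have \<tau>2: "(\<tau> k)\<^sup>2 = t\<^sup>2 / m k" by (simp add: \<tau>_def power_divide)
   \<comment> \<open>Products of numbers of modulus at most 1 differ by at most the sum of the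
     differences of the factors.\<close>
   have "cmod ((\<Prod>j\<in>{1..m k}. char (D k j) (\<tau> k)) - (\<Prod>j\<in>{1..m k}. complex_of_real (exp (- ((\<tau> k)\<^sup>2 * \<sigma> k j / 2)))))
     \<le> (\<Sum>j\<in>{1..m k}. cmod (char (D k j) (\<tau> k) - complex_of_real (exp (- ((\<tau> k)\<^sup>2 * \<sigma> k j / 2)))))"
    by (rule norm_prod_diff) (use real_distribution.cmod_char_le_1[OF D] \<sigma> in auto)
   also have "\<dots> \<le> (\<Sum>j\<in>{1..m k}. (\<tau> k)\<^sup>2 / 6 * q k + ((\<tau> k)\<^sup>2 * M2 / 2)\<^sup>2)"
   proof (rule sum_mono)
    fix j
    define u where "u = (\<tau> k)\<^sup>2 * \<sigma> k j / 2"
    have u: "u \<ge> 0" "u \<le> (\<tau> k)\<^sup>2 * M2 / 2" unfolding u_def using \<sigma>[of k j] by (auto intro!: mult_left_mono)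
    have "cmod (char (D k j) (\<tau> k) - complex_of_real (exp (- u)))
      \<le> cmod (char (D k j) (\<tau> k) - complex_of_real (1 - u)) + cmod (complex_of_real (1 - u) - complex_of_real (exp (- u)))"
     by (rule norm_triangle_ineq4[THEN order_trans[rotated]] norm_diff_triangle_ineq[THEN order_trans[rotated]] | simp add: norm_triangle_sub norm_diff_triangle_le)+
    also have "cmod (complex_of_real (1 - u) - complex_of_real (exp (- u))) = \<bar>exp (- u) - (1 - u)\<bar>"
     by (simp only: of_real_diff[symmetric] norm_of_real abs_minus_commute)
    finally have "cmod (char (D k j) (\<tau> k) - complex_of_real (exp (- u))) \<le> cmod (char (D k j) (\<tau> k) - complex_of_real (1 - u)) + u\<^sup>2"
     using abs_exp_minus_linear_le[OF u(1)] by linarith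
    moreover have "cmod (char (D k j) (\<tau> k) - complex_of_real (1 - u)) \<le> (\<tau> k)\<^sup>2 / 6 * q k"
     using approx[of k j] by (simp add: u_def)
    moreover have "u\<^sup>2 \<le> ((\<tau> k)\<^sup>2 * M2 / 2)\<^sup>2" using u by (intro power_mono)
    ultimately show "cmod (char (D k j) (\<tau> k) - complex_of_real (exp (- ((\<tau> k)\<^sup>2 * \<sigma> k j / 2)))) \<le> (\<tau> k)\<^sup>2 / 6 * q k + ((\<tau> k)\<^sup>2 * M2 / 2)\<^sup>2"
     unfolding u_def[symmetric] by linarith
   qed
   also have "\<dots> = E k" using mk unfolding \<tau>2 E_def by (simp add: field_simps power2_eq_square)
   finally show ?thesis .
  qed
  have prod_exp: "(\<Prod>j\<in>{1..m k}. complex_of_real (exp (- ((\<tau> k)\<^sup>2 * \<sigma> k j / 2)))) = complex_of_real (exp (- (t\<^sup>2 * ((\<Sum>j\<in>{1..m k}. \<sigma> k j) / m k) / 2)))" for k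
  proof -
   have "(\<Prod>j\<in>{1..m k}. exp (- ((\<tau> k)\<^sup>2 * \<sigma> k j / 2))) = exp (\<Sum>j\<in>{1..m k}. - ((\<tau> k)\<^sup>2 * \<sigma> k j / 2))"
    by (simp add: exp_sum)
   also have "(\<Sum>j\<in>{1..m k}. - ((\<tau> k)\<^sup>2 * \<sigma> k j / 2)) = - (t\<^sup>2 * ((\<Sum>j\<in>{1..m k}. \<sigma> k j) / m k) / 2)"
    by (simp add: \<tau>_def power_divide sum_negf sum_distrib_left[symmetric] sum_divide_distrib[symmetric])
   finally show ?thesis by (simp only: of_real_prod[symmetric])
  qed
  have m': "filterlim (\<lambda>k. real (m k)) at_top sequentially"
   by (rule filterlim_compose[OF filterlim_real_sequentially m])
  have \<tau>0: "\<tau> \<longlonglongrightarrow> 0" unfolding \<tau>_def[abs_def]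
   by (intro tendsto_divide_0[OF tendsto_const] filterlim_at_top_imp_at_infinity filterlim_compose[OF sqrt_at_top m'])
  have "q \<longlonglongrightarrow> (\<integral>s. 0 \<partial>K)"
   unfolding q_def[abs_def]
  proof (rule integral_dominated_convergence[where w="\<lambda>s. 6 * (H s)\<^sup>2"])
   show "AE s in K. (\<lambda>k. min (6 * (H s)\<^sup>2) (\<bar>\<tau> k\<bar> * H s ^ 3)) \<longlonglongrightarrow> 0"
   proof (rule AE_I2)
    fix s
    have "(\<lambda>k. min (6 * (H s)\<^sup>2) (\<bar>\<tau> k\<bar> * H s ^ 3)) \<longlonglongrightarrow> min (6 * (H s)\<^sup>2) (\<bar>0\<bar> * H s ^ 3)"
     by (intro tendsto_intros \<tau>0)
    then show "(\<lambda>k. min (6 * (H s)\<^sup>2) (\<bar>\<tau> k\<bar> * H s ^ 3)) \<longlonglongrightarrow> 0" by (simp add: min_absorb2)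
   qed
   show "AE s in K. norm (min (6 * (H s)\<^sup>2) (\<bar>\<tau> k\<bar> * H s ^ 3)) \<le> 6 * (H s)\<^sup>2" for k
    using H0 by (intro AE_I2) (simp add: abs_of_nonneg)
  qed (use H2 in auto)
  then have q0: "q \<longlonglongrightarrow> 0" by simp
  have "(\<lambda>k. 1 / real (m k)) \<longlonglongrightarrow> 0"
   by (intro tendsto_divide_0[OF tendsto_const] filterlim_at_top_imp_at_infinity m')
  then have E0: "E \<longlonglongrightarrow> 0" unfolding E_def[abs_def] by (intro tendsto_add_zero tendsto_mult_right_zero q0)
  have lim: "(\<lambda>k. complex_of_real (exp (- (t\<^sup>2 * ((\<Sum>j\<in>{1..m k}. \<sigma> k j) / m k) / 2)))) \<longlonglongrightarrow> char (centered_normal v) t"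
   unfolding char_centered_normal[OF v0] using v[folded \<sigma>_def] by (intro tendsto_intros) auto
  have mpos: "\<forall>\<^sub>F k in sequentially. m k > 0" using filterlim_at_top[THEN iffD1, OF m, rule_format, of 1] by eventually_elim linarith
  show "(\<lambda>k. char (distr P borel (\<lambda>\<omega>. (\<Sum>j\<in>{1..m k}. \<xi> k j (\<omega> j)) / sqrt (m k))) t) \<longlonglongrightarrow> char (centered_normal v) t"
   unfolding char_eq
  proof (rule Lim_transform[OF lim])
   show "(\<lambda>k. (\<Prod>j\<in>{1..m k}. char (D k j) (\<tau> k)) - complex_of_real (exp (- (t\<^sup>2 * ((\<Sum>j\<in>{1..m k}. \<sigma> k j) / m k) / 2)))) \<longlonglongrightarrow> 0"
   proof (rule Lim_null_comparison[OF _ E0])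
    show "\<forall>\<^sub>F k in sequentially. cmod ((\<Prod>j\<in>{1..m k}. char (D k j) (\<tau> k)) - complex_of_real (exp (- (t\<^sup>2 * ((\<Sum>j\<in>{1..m k}. \<sigma> k j) / m k) / 2)))) \<le> E k"
     using mpos by eventually_elim (use diff prod_exp in simp)
   qed
  qed
 qed
qed

end

section \<open>Binomial weights\<close>

text \<open>Normalised so that it is close to \<open>(m / n) ^ r / fact r\<close> for m \<le> n, as
  \<open>scaled_binomial_approx\<close> makes precise.\<close>

definition scaled_binomial :: "nat \<Rightarrow> nat \<Rightarrow> nat \<Rightarrow> real" where
 "scaled_binomial n m r = real (m choose r) / real n ^ r"

lemma scaled_binomial_bounds:
 assumes "m \<le> n" "n \<ge> 1" shows "0 \<le> scaled_binomial n m r" "scaled_binomial n m r \<le> 1"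
proof -
 have "m choose r \<le> n ^ r"
 proof (cases "r \<le> m")
  case True
  then have "m choose r \<le> m ^ r" by (rule binomial_le_pow)
  also have "\<dots> \<le> n ^ r" using assms by (intro power_mono) auto
  finally show ?thesis .
 qed (simp add: binomial_eq_0)
 then have "real (m choose r) \<le> real n ^ r" by (simp flip: of_nat_power)
 then show "0 \<le> scaled_binomial n m r" "scaled_binomial n m r \<le> 1" using assms by (auto simp: scaled_binomial_def divide_le_eq)
qed

text \<open>Induction via (r + 1) C(m, r + 1) = C(m, r) (m - r): a step adds an error of at most r /
  n, and r^2 + r \<le> (r + 1)^2.\<close>

lemma scaled_binomial_approx:
 assumes mn: "m \<le> n" and n: "n \<ge> 1"
 shows "\<bar>scaled_binomial n m r - (real m / real n) ^ r / fact r\<bar> \<le> (real r)\<^sup>2 / real n"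
proof (induction r)
 case 0 show ?case by (simp add: scaled_binomial_def)
next
 case (Suc r)
 define c where "c = scaled_binomial n m r"
 define u where "u = real m / real n"
 define p where "p = u ^ r / fact r"
 have u: "0 \<le> u" "u \<le> 1" using mn n by (auto simp: u_def divide_le_eq)
 have c: "0 \<le> c" "c \<le> 1" unfolding c_def using scaled_binomial_bounds[OF mn n] by auto
 have "real (Suc r) * real (m choose Suc r) = real (m choose r) * (real m - real r)"
 proof (cases "r \<le> m")
  case True
  have "Suc r * (m choose Suc r) = (m choose r) * (m - r)" using binomial_absorb_comp[of m r] binomial_absorption[of r m]
   by (metis Suc_times_binomial_eq binomial_absorb_comp diff_Suc_Suc mult.commute True Suc_times_binomial times_binomial_minus1_eq)
  then have "real (Suc r * (m choose Suc r)) = real ((m choose r) * (m - r))" by simp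
  then show ?thesis using True by (simp add: of_nat_diff algebra_simps)
 qed (simp add: binomial_eq_0)
 then have "real (m choose Suc r) = real (m choose r) * (real m - real r) / real (Suc r)" by (simp add: field_simps)
 then have s: "scaled_binomial n m (Suc r) = c * (u - real r / real n) / real (Suc r)"
 proof -
  have "u - real r / real n = (real m - real r) / real n" by (simp add: u_def diff_divide_distrib)
  then show ?thesis using \<open>real (m choose Suc r) = _\<close> by (simp add: scaled_binomial_def c_def mult.commute)
 qed
 have t: "(real m / real n) ^ Suc r / fact (Suc r) = p * u / real (Suc r)"
  by (simp add: p_def u_def ac_simps)
 have "\<bar>c * (u - real r / real n) - p * u\<bar> \<le> (real r)\<^sup>2 / real n + real r / real n"
 proof -
  have "c * (u - real r / real n) - p * u = (c - p) * u - c * (real r / real n)" by algebra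
  also have "\<bar>\<dots>\<bar> \<le> \<bar>c - p\<bar> * \<bar>u\<bar> + \<bar>c\<bar> * \<bar>real r / real n\<bar>"
   by (rule order_trans[OF abs_triangle_ineq4]) (simp add: abs_mult)
  also have "\<dots> \<le> (real r)\<^sup>2 / real n * 1 + 1 * (real r / real n)"
   using Suc.IH u c by (intro add_mono mult_mono) (auto simp: c_def p_def u_def)
  finally show ?thesis by simp
 qed
 also have "\<dots> \<le> (real (Suc r))\<^sup>2 / real n" using n by (simp add: divide_simps power2_eq_square algebra_simps)
 finally have "\<bar>c * (u - real r / real n) - p * u\<bar> / real (Suc r) \<le> (real (Suc r))\<^sup>2 / real n / 1"
  by (intro frac_le) auto
 then show ?case unfolding s t by (simp add: diff_divide_distrib[symmetric])
qed

lemma abs_mult_diff_le: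
 fixes x y :: real
 assumes "\<bar>x\<bar> \<le> 1" "\<bar>y'\<bar> \<le> 1"
 shows "\<bar>x * y - x' * y'\<bar> \<le> \<bar>x - x'\<bar> + \<bar>y - y'\<bar>"
proof -
 have "x * y - x' * y' = x * (y - y') + (x - x') * y'" by algebra
 then have "\<bar>x * y - x' * y'\<bar> \<le> \<bar>x\<bar> * \<bar>y - y'\<bar> + \<bar>x - x'\<bar> * \<bar>y'\<bar>"
  by (metis abs_mult abs_triangle_ineq)
 also have "\<dots> \<le> 1 * \<bar>y - y'\<bar> + \<bar>x - x'\<bar> * 1" using assms by (intro add_mono mult_mono) auto
 finally show ?thesis by simp
qed

lemma scaled_binomial_tendsto: "(\<lambda>n. scaled_binomial n n r) \<longlonglongrightarrow> 1 / fact r"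
proof -
 have "(\<lambda>n. scaled_binomial n n r - 1 / fact r) \<longlonglongrightarrow> 0"
 proof (rule Lim_null_comparison)
  show "\<forall>\<^sub>F n in sequentially. norm (scaled_binomial n n r - 1 / fact r) \<le> (real r)\<^sup>2 / real n"
   using eventually_ge_at_top[of 1]
  proof eventually_elim
   case (elim n) then show ?case using scaled_binomial_approx[of n n r] by simp
  qed
  show "(\<lambda>n. (real r)\<^sup>2 / real n) \<longlonglongrightarrow> 0" by (rule lim_const_over_n)
 qed
 then show ?thesis by (rule Lim_null[THEN iffD2])
qed

text \<open>Increasing (r + s + 1)-tuples counted by the value of their (r + 1)-th entry.\<close>

lemma sum_binomial_product: "(\<Sum>j\<in>{1..n}. (j - 1 choose r) * (n - j choose s)) = n choose (r + s + 1)"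
proof -
 have "(\<Sum>j\<in>{1..n}. (j - 1 choose r) * (n - j choose s)) = (\<Sum>j\<in>{1..n}. card {i \<in> increasing_tuples (r + s + 1) n. i (r + 1) = j})"
  by (intro sum.cong refl) (simp add: card_increasing_tuples_coordinate)
 also have "\<dots> = card (increasing_tuples (r + s + 1) n)"
 proof -
  have "(\<Sum>j\<in>{1..n}. \<Sum>i\<in>{i \<in> increasing_tuples (r + s + 1) n. i (r + 1) = j}. 1) = (\<Sum>i\<in>increasing_tuples (r + s + 1) n. (1::nat))"
   by (rule sum.group) (use increasing_tuples_range[of _ "r + s + 1" n "r + 1"] in auto)
  then show ?thesis by simp
 qed
 finally show ?thesis by (simp add: card_increasing_tuples)
qed

context iid_kernel
begin

lemma weight_scaled:
 assumes a: "a \<in> {1..d}"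
 shows "weight n a j / real n ^ (d - 1) = scaled_binomial n (j - 1) (a - 1) * scaled_binomial n (n - j) (d - a)"
proof -
 have "d - 1 = (a - 1) + (d - a)" using a by auto
 then show ?thesis by (simp add: weight_def scaled_binomial_def power_add)
qed

lemma weight_bounds:
 assumes a: "a \<in> {1..d}" and j: "j \<in> {1..n}"
 shows "0 \<le> weight n a j / real n ^ (d - 1)" "weight n a j / real n ^ (d - 1) \<le> 1"
proof -
 have n: "n \<ge> 1" "j - 1 \<le> n" "n - j \<le> n" using j by auto
 note s = scaled_binomial_bounds[OF n(2) n(1), of "a - 1"] scaled_binomial_bounds[OF n(3) n(1), of "d - a"]
 show "0 \<le> weight n a j / real n ^ (d - 1)" "weight n a j / real n ^ (d - 1) \<le> 1"
  unfolding weight_scaled[OF a] using s by (auto intro: mult_le_one)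
qed

lemma sum_weight_tendsto:
 assumes a: "a \<in> {1..d}"
 shows "(\<lambda>n. (\<Sum>j\<in>{1..n}. weight n a j / real n ^ (d - 1)) / real n) \<longlonglongrightarrow> 1 / fact d"
proof -
 have "(\<Sum>j\<in>{1..n}. weight n a j / real n ^ (d - 1)) / real n = scaled_binomial n n d" for n
 proof -
  have "(\<Sum>j\<in>{1..n}. weight n a j) = real (n choose d)"
   using sum_binomial_product[where n=n and r="a - 1" and s="d - a"] a unfolding weight_def of_nat_sum[symmetric] by simp
  moreover have "real n ^ d = real n ^ (d - 1) * real n" using d_pos by (metis Suc_diff_1 less_le_trans power_Suc2 zero_less_one)
  ultimately show ?thesis by (simp add: scaled_binomial_def flip: sum_divide_distrib)
 qed
 then show ?thesis using scaled_binomial_tendsto[of d] by simp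
qed

text \<open>The limit is a beta integral, but no Riemann sum has to be evaluated. Up to a constant
  factor \<rho> and an error of order 1/n, a product of two weights is a single weight with added
  exponents, and those weights sum exactly to a binomial coefficient.\<close>

lemma sum_weight_product_tendsto:
 assumes a: "a \<in> {1..d}" and c: "c \<in> {1..d}"
 shows "(\<lambda>n. (\<Sum>j\<in>{1..n}. (weight n a j / real n ^ (d - 1)) * (weight n c j / real n ^ (d - 1))) / real n) \<longlonglongrightarrow>
  fact (a + c - 2) * fact (2 * d - a - c) / (fact (a - 1) * fact (c - 1) * fact (d - a) * fact (d - c) * fact (2 * d - 1))"
proof -
 define r where "r = a + c - 2"
 define s where "s = 2 * d - a - c"
 have rs: "r = (a - 1) + (c - 1)" "s = (d - a) + (d - c)" "r + s + 1 = 2 * d - 1" using a c by (auto simp: r_def s_def)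
 \<comment> \<open>\<open>W\<close> and \<open>Z\<close> approximate the same monomial in (j - 1) /
   n and (n - j) / n with different factorials below; \<rho> is the quotient.\<close>
 define \<rho> :: real where "\<rho> = fact r * fact s / (fact (a - 1) * fact (c - 1) * fact (d - a) * fact (d - c))"
 define W where "W n j = (weight n a j / real n ^ (d - 1)) * (weight n c j / real n ^ (d - 1))" for n j
 define Z where "Z n j = scaled_binomial n (j - 1) r * scaled_binomial n (n - j) s" for n j
 \<comment> \<open>Errors of the four factors of \<open>W\<close> and, multiplied by \<rho>, of the
   two factors of \<open>Z\<close>.\<close>
 define C where "C = real (a - 1)^2 + real (d - a)^2 + real (c - 1)^2 + real (d - c)^2 + \<bar>\<rho>\<bar> * (real r ^ 2 + real s ^ 2)"
 have pt: "\<bar>W n j - \<rho> * Z n j\<bar> \<le> C / real n" if j: "j \<in> {1..n}" for n j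
 proof -
  have n: "n \<ge> 1" "j - 1 \<le> n" "n - j \<le> n" using j by auto
  define u where "u = real (j - 1) / real n"
  define w where "w = real (n - j) / real n"
  have uw: "0 \<le> u" "u \<le> 1" "0 \<le> w" "w \<le> 1" using j by (auto simp: u_def w_def divide_le_eq)
  have pw: "0 \<le> u ^ k / fact k \<and> u ^ k / fact k \<le> 1" "0 \<le> w ^ k / fact k \<and> w ^ k / fact k \<le> 1" for k
  proof -
   have "u ^ k \<le> fact k" "w ^ k \<le> fact k" using power_le_one[OF uw(1,2), of k] power_le_one[OF uw(3,4), of k] fact_ge_1[of k, where ?'a=real] by linarith+
   then show "0 \<le> u ^ k / fact k \<and> u ^ k / fact k \<le> 1" "0 \<le> w ^ k / fact k \<and> w ^ k / fact k \<le> 1" using uw by (auto simp: divide_le_eq)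
  qed
  note su = scaled_binomial_approx[OF n(2,1), folded u_def] and sw = scaled_binomial_approx[OF n(3,1), folded w_def]
  note bu = scaled_binomial_bounds[OF n(2,1)] and bw = scaled_binomial_bounds[OF n(3,1)]
  have two: "\<bar>scaled_binomial n (j - 1) k * scaled_binomial n (n - j) l - u ^ k / fact k * (w ^ l / fact l)\<bar> \<le> (real k)\<^sup>2 / real n + (real l)\<^sup>2 / real n" for k l
  proof (rule order_trans[OF abs_mult_diff_le add_mono[OF su sw]])
   show "\<bar>scaled_binomial n (j - 1) k\<bar> \<le> 1" using bu[of k] by simp
   show "\<bar>w ^ l / fact l\<bar> \<le> 1" using pw(2)[of l] by (metis abs_of_nonneg)
  qed
  have prod1: "\<bar>scaled_binomial n (j - 1) (a - 1) * scaled_binomial n (n - j) (d - a)\<bar> \<le> 1"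
   using bu[of "a - 1"] bw[of "d - a"] by (simp add: abs_mult mult_le_one)
  have prod2: "\<bar>u ^ (c - 1) / fact (c - 1) * (w ^ (d - c) / fact (d - c))\<bar> \<le> 1"
   using pw(1)[of "c - 1"] pw(2)[of "d - c"] by (metis abs_of_nonneg mult_le_one mult_nonneg_nonneg)
  let ?T = "u ^ (a - 1) / fact (a - 1) * (w ^ (d - a) / fact (d - a)) * (u ^ (c - 1) / fact (c - 1) * (w ^ (d - c) / fact (d - c)))"
  have 1: "\<bar>W n j - ?T\<bar> \<le> (real (a - 1))\<^sup>2 / real n + (real (d - a))\<^sup>2 / real n + ((real (c - 1))\<^sup>2 / real n + (real (d - c))\<^sup>2 / real n)"
   unfolding W_def weight_scaled[OF a] weight_scaled[OF c]
   by (rule order_trans[OF abs_mult_diff_le[OF prod1 prod2] add_mono[OF two two]])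
  have T: "?T = \<rho> * (u ^ r / fact r * (w ^ s / fact s))"
   by (simp add: \<rho>_def rs(1,2) power_add ac_simps)
  have "\<bar>\<rho> * (u ^ r / fact r * (w ^ s / fact s)) - \<rho> * Z n j\<bar> = \<bar>\<rho>\<bar> * \<bar>Z n j - u ^ r / fact r * (w ^ s / fact s)\<bar>"
   by (simp only: right_diff_distrib[symmetric] abs_mult abs_minus_commute)
  also have "\<dots> \<le> \<bar>\<rho>\<bar> * ((real r)\<^sup>2 / real n + (real s)\<^sup>2 / real n)" unfolding Z_def by (intro mult_left_mono two) simp
  finally have 2: "\<bar>?T - \<rho> * Z n j\<bar> \<le> \<bar>\<rho>\<bar> * ((real r)\<^sup>2 / real n + (real s)\<^sup>2 / real n)" unfolding T .
  have "C / real n = (real (a - 1))\<^sup>2 / real n + (real (d - a))\<^sup>2 / real n + ((real (c - 1))\<^sup>2 / real n + (real (d - c))\<^sup>2 / real n)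
    + \<bar>\<rho>\<bar> * ((real r)\<^sup>2 / real n + (real s)\<^sup>2 / real n)"
   unfolding C_def by (simp add: add_divide_distrib distrib_left)
  with 1 2 show ?thesis by linarith
 qed
 have sumZ: "(\<Sum>j\<in>{1..n}. Z n j) / real n = scaled_binomial n n (r + s + 1)" for n
 proof -
  have "(\<Sum>j\<in>{1..n}. Z n j) = (\<Sum>j\<in>{1..n}. real ((j - 1 choose r) * (n - j choose s))) / real n ^ (r + s)"
   by (simp add: Z_def scaled_binomial_def power_add sum_divide_distrib)
  also have "(\<Sum>j\<in>{1..n}. real ((j - 1 choose r) * (n - j choose s))) = real (n choose (r + s + 1))"
   unfolding of_nat_sum[symmetric] sum_binomial_product ..
  finally show ?thesis by (simp add: scaled_binomial_def power_add)
 qed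
 have "(\<lambda>n. (\<Sum>j\<in>{1..n}. W n j) / real n - \<rho> * scaled_binomial n n (r + s + 1)) \<longlonglongrightarrow> 0"
 proof (rule Lim_null_comparison)
  show "\<forall>\<^sub>F n in sequentially. norm ((\<Sum>j\<in>{1..n}. W n j) / real n - \<rho> * scaled_binomial n n (r + s + 1)) \<le> C / real n"
   using eventually_ge_at_top[of 1]
  proof eventually_elim
   case (elim n)
   have "(\<Sum>j\<in>{1..n}. W n j) / real n - \<rho> * scaled_binomial n n (r + s + 1) = (\<Sum>j\<in>{1..n}. W n j - \<rho> * Z n j) / real n"
    unfolding sumZ[symmetric] by (simp add: sum_subtractf sum_distrib_left diff_divide_distrib)
   also have "norm \<dots> \<le> (\<Sum>j\<in>{1..n}. \<bar>W n j - \<rho> * Z n j\<bar>) / real n"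
    by (simp add: divide_right_mono sum_abs)
   also have "\<dots> \<le> (\<Sum>j\<in>{1..n}. C / real n) / real n" by (intro divide_right_mono sum_mono pt) auto
   also have "\<dots> = C / real n" using elim by simp
   finally show ?case .
  qed
  show "(\<lambda>n. C / real n) \<longlonglongrightarrow> 0" by (rule lim_const_over_n)
 qed
 from tendsto_add[OF this tendsto_mult[OF tendsto_const[of \<rho>] scaled_binomial_tendsto[of "r + s + 1"]]]
 have "(\<lambda>n. (\<Sum>j\<in>{1..n}. W n j) / real n) \<longlonglongrightarrow> \<rho> * (1 / fact (r + s + 1))" by simp
 then show ?thesis unfolding W_def \<rho>_def rs(3) by (simp add: r_def s_def)
qed

end

section \<open>Convergence to zero in probability\<close>

context iid_space
begin

text \<open>Convergence to 0 in probability, in its metric form; the truncation at 1 makes the mean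
  exist for every measurable \<open>Z\<close>.\<close>

definition vanishes :: "(nat \<Rightarrow> (nat \<Rightarrow> 's) \<Rightarrow> real) \<Rightarrow> bool" where
 "vanishes Z \<longleftrightarrow> (\<forall>k. Z k \<in> borel_measurable P) \<and> (\<lambda>k. \<integral>\<omega>. min 1 \<bar>Z k \<omega>\<bar> \<partial>P) \<longlonglongrightarrow> 0"

lemma vanishesD: "vanishes Z \<Longrightarrow> Z k \<in> borel_measurable P" "vanishes Z \<Longrightarrow> (\<lambda>k. \<integral>\<omega>. min 1 \<bar>Z k \<omega>\<bar> \<partial>P) \<longlonglongrightarrow> 0"
 by (auto simp: vanishes_def)

lemma min_integrable: "Z \<in> borel_measurable P \<Longrightarrow> integrable P (\<lambda>\<omega>. min 1 \<bar>Z \<omega> :: real\<bar>)"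
 by (rule pp.P.integrable_const_bound[where B=1]) auto

lemma vanishes_bound:
 assumes Y: "\<And>k. Y k \<in> borel_measurable P"
  and bound: "\<forall>\<^sub>F k in sequentially. (\<integral>\<omega>. min 1 \<bar>Y k \<omega>\<bar> \<partial>P) \<le> e k" and e: "e \<longlonglongrightarrow> 0"
 shows "vanishes Y"
 unfolding vanishes_def
proof (intro conjI allI Y)
 show "(\<lambda>k. \<integral>\<omega>. min 1 \<bar>Y k \<omega>\<bar> \<partial>P) \<longlonglongrightarrow> 0"
 proof (rule tendsto_sandwich[OF _ bound tendsto_const e])
  show "\<forall>\<^sub>F k in sequentially. 0 \<le> (\<integral>\<omega>. min 1 \<bar>Y k \<omega>\<bar> \<partial>P)" by simp
 qed
qed

text \<open>Outside the events \<open>\<bar>W k\<bar> \<ge> 1\<close>, which have vanishing probability, \<open>Z\<close> dominates \<open>Y\<close>.\<close>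

lemma vanishes_dominated:
 assumes Y: "\<And>k. Y k \<in> borel_measurable P" and Z: "vanishes Z" and W: "vanishes W"
  and le: "\<forall>\<^sub>F k in sequentially. AE \<omega> in P. \<bar>W k \<omega>\<bar> < 1 \<longrightarrow> \<bar>Y k \<omega>\<bar> \<le> \<bar>Z k \<omega>\<bar>"
 shows "vanishes Y"
proof (rule vanishes_bound[OF Y])
 show "\<forall>\<^sub>F k in sequentially. (\<integral>\<omega>. min 1 \<bar>Y k \<omega>\<bar> \<partial>P) \<le> (\<integral>\<omega>. min 1 \<bar>Z k \<omega>\<bar> \<partial>P) + (\<integral>\<omega>. min 1 \<bar>W k \<omega>\<bar> \<partial>P)"
  using le
 proof eventually_elim
  case (elim k)
  have "(\<integral>\<omega>. min 1 \<bar>Y k \<omega>\<bar> \<partial>P) \<le> (\<integral>\<omega>. min 1 \<bar>Z k \<omega>\<bar> + min 1 \<bar>W k \<omega>\<bar> \<partial>P)"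
  proof (rule integral_mono_AE)
   show "AE \<omega> in P. min 1 \<bar>Y k \<omega>\<bar> \<le> min 1 \<bar>Z k \<omega>\<bar> + min 1 \<bar>W k \<omega>\<bar>"
    using elim by eventually_elim (auto simp: min_def)
  qed (intro Bochner_Integration.integrable_add min_integrable Y vanishesD(1)[OF Z] vanishesD(1)[OF W])+
  also have "\<dots> = (\<integral>\<omega>. min 1 \<bar>Z k \<omega>\<bar> \<partial>P) + (\<integral>\<omega>. min 1 \<bar>W k \<omega>\<bar> \<partial>P)"
   by (intro Bochner_Integration.integral_add min_integrable vanishesD(1)[OF Z] vanishesD(1)[OF W])
  finally show ?case .
 qed
 show "(\<lambda>k. (\<integral>\<omega>. min 1 \<bar>Z k \<omega>\<bar> \<partial>P) + (\<integral>\<omega>. min 1 \<bar>W k \<omega>\<bar> \<partial>P)) \<longlonglongrightarrow> 0"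
  by (intro tendsto_add_zero vanishesD(2) Z W)
qed

lemma vanishes_const: "c \<longlonglongrightarrow> 0 \<Longrightarrow> vanishes (\<lambda>k \<omega>. c k)"
proof (rule vanishes_bound)
 assume "c \<longlonglongrightarrow> 0"
 then show "(\<lambda>k. \<bar>c k\<bar>) \<longlonglongrightarrow> 0" by (rule tendsto_rabs_zero)
qed (auto simp: pp.P.prob_space)

lemma vanishes_add: assumes Z: "vanishes Z" and W: "vanishes W" shows "vanishes (\<lambda>k \<omega>. Z k \<omega> + W k \<omega>)"
proof (rule vanishes_bound)
 show "(\<lambda>\<omega>. Z k \<omega> + W k \<omega>) \<in> borel_measurable P" for k
  by (intro borel_measurable_add vanishesD(1)[OF Z] vanishesD(1)[OF W])
 show "\<forall>\<^sub>F k in sequentially. (\<integral>\<omega>. min 1 \<bar>Z k \<omega> + W k \<omega>\<bar> \<partial>P) \<le> (\<integral>\<omega>. min 1 \<bar>Z k \<omega>\<bar> \<partial>P) + (\<integral>\<omega>. min 1 \<bar>W k \<omega>\<bar> \<partial>P)"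
 proof (intro always_eventually allI)
  fix k
  have "(\<integral>\<omega>. min 1 \<bar>Z k \<omega> + W k \<omega>\<bar> \<partial>P) \<le> (\<integral>\<omega>. min 1 \<bar>Z k \<omega>\<bar> + min 1 \<bar>W k \<omega>\<bar> \<partial>P)"
   by (intro integral_mono Bochner_Integration.integrable_add min_integrable borel_measurable_add vanishesD(1)[OF Z] vanishesD(1)[OF W])
     (auto simp: min_def)
  also have "\<dots> = (\<integral>\<omega>. min 1 \<bar>Z k \<omega>\<bar> \<partial>P) + (\<integral>\<omega>. min 1 \<bar>W k \<omega>\<bar> \<partial>P)"
   by (intro Bochner_Integration.integral_add min_integrable vanishesD(1)[OF Z] vanishesD(1)[OF W])
  finally show "(\<integral>\<omega>. min 1 \<bar>Z k \<omega> + W k \<omega>\<bar> \<partial>P) \<le> (\<integral>\<omega>. min 1 \<bar>Z k \<omega>\<bar> \<partial>P) + (\<integral>\<omega>. min 1 \<bar>W k \<omega>\<bar> \<partial>P)" .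
 qed
 show "(\<lambda>k. (\<integral>\<omega>. min 1 \<bar>Z k \<omega>\<bar> \<partial>P) + (\<integral>\<omega>. min 1 \<bar>W k \<omega>\<bar> \<partial>P)) \<longlonglongrightarrow> 0"
  by (intro tendsto_add_zero vanishesD(2) Z W)
qed

lemma vanishes_mult_bounded:
 assumes Z: "vanishes Z" and c: "\<forall>\<^sub>F k in sequentially. \<bar>c k\<bar> \<le> C"
 shows "vanishes (\<lambda>k \<omega>. c k * Z k \<omega>)"
proof (rule vanishes_bound)
 note [measurable] = vanishesD(1)[OF Z]
 show "(\<lambda>\<omega>. c k * Z k \<omega>) \<in> borel_measurable P" for k by measurable
 show "\<forall>\<^sub>F k in sequentially. (\<integral>\<omega>. min 1 \<bar>c k * Z k \<omega>\<bar> \<partial>P) \<le> max 1 C * (\<integral>\<omega>. min 1 \<bar>Z k \<omega>\<bar> \<partial>P)"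
  using c
 proof eventually_elim
  case (elim k)
  have pt: "min 1 \<bar>c k * Z k \<omega>\<bar> \<le> max 1 C * min 1 \<bar>Z k \<omega>\<bar>" for \<omega>
  proof (cases "\<bar>Z k \<omega>\<bar> \<le> 1")
   case True
   have "\<bar>c k * Z k \<omega>\<bar> \<le> max 1 C * \<bar>Z k \<omega>\<bar>" unfolding abs_mult using elim by (intro mult_right_mono) auto
   then show ?thesis using True by (simp add: min_absorb2 min.coboundedI2)
  qed (simp add: min_absorb1 min.coboundedI1)
  have "(\<integral>\<omega>. min 1 \<bar>c k * Z k \<omega>\<bar> \<partial>P) \<le> (\<integral>\<omega>. max 1 C * min 1 \<bar>Z k \<omega>\<bar> \<partial>P)"
   using pt by (intro integral_mono integrable_mult_right min_integrable) auto
  then show ?case by simp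
 qed
 show "(\<lambda>k. max 1 C * (\<integral>\<omega>. min 1 \<bar>Z k \<omega>\<bar> \<partial>P)) \<longlonglongrightarrow> 0"
  by (intro tendsto_mult_right_zero vanishesD(2) Z)
qed

text \<open>By Jensen the truncated mean is at most the root of the second moment.\<close>

lemma vanishes_L2:
 assumes Z: "\<And>k. Z k \<in> borel_measurable P" "\<And>k. integrable P (\<lambda>\<omega>. (Z k \<omega>)\<^sup>2)"
  and bound: "\<forall>\<^sub>F k in sequentially. (\<integral>\<omega>. (Z k \<omega>)\<^sup>2 \<partial>P) \<le> e k" and e: "e \<longlonglongrightarrow> 0"
 shows "vanishes Z"
proof (rule vanishes_bound[OF Z(1)])
 show "\<forall>\<^sub>F k in sequentially. (\<integral>\<omega>. min 1 \<bar>Z k \<omega>\<bar> \<partial>P) \<le> sqrt (e k)"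
  using bound
 proof eventually_elim
  case (elim k)
  note [measurable] = Z(1)[of k]
  have "(\<integral>\<omega>. min 1 \<bar>Z k \<omega>\<bar> \<partial>P)\<^sup>2 \<le> (\<integral>\<omega>. (min 1 \<bar>Z k \<omega>\<bar>)\<^sup>2 \<partial>P)"
  proof (rule pp.P.square_integral_le[OF min_integrable])
   show "integrable P (\<lambda>\<omega>. (min 1 \<bar>Z k \<omega>\<bar>)\<^sup>2)"
    by (rule pp.P.integrable_const_bound[where B=1]) (auto simp: power_le_one)
  qed measurable
  also have "\<dots> \<le> (\<integral>\<omega>. (Z k \<omega>)\<^sup>2 \<partial>P)"
  proof (rule integral_mono'[OF Z(2)])
   show "(min 1 \<bar>Z k \<omega>\<bar>)\<^sup>2 \<le> (Z k \<omega>)\<^sup>2" for \<omega>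
    using power_mono[of "min 1 \<bar>Z k \<omega>\<bar>" "\<bar>Z k \<omega>\<bar>" 2] by simp
  qed simp
  finally have "(\<integral>\<omega>. min 1 \<bar>Z k \<omega>\<bar> \<partial>P)\<^sup>2 \<le> e k" using elim by linarith
  then show ?case by (rule real_le_rsqrt)
 qed
 show "(\<lambda>k. sqrt (e k)) \<longlonglongrightarrow> 0" using tendsto_real_sqrt[OF e] by simp
qed

end

section \<open>Uniform control of increments over a window of indices\<close>

context iid_kernel
begin

lemma increasing_tuples_card_diff:
 assumes "n \<le> m" shows "real (m choose d) - real (n choose d) \<le> real d * real (m - n) * real m ^ (d - 1)"
proof -
 have "real (m choose d) - real (n choose d) = real (card (increasing_tuples d m - increasing_tuples d n))"
  using card_mono[OF increasing_tuples_finite increasing_tuples_mono[OF assms], of d]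
  by (simp add: card_Diff_subset increasing_tuples_mono[OF assms] card_increasing_tuples of_nat_diff)
 also have "\<dots> \<le> real (d * (m - n) * m ^ (d - 1))" by (simp only: of_nat_le_iff card_increasing_tuples_diff_le)
 finally show ?thesis by simp
qed

text \<open>For a nonnegative kernel the uncentred sums are monotone in \<open>n\<close>, so that it suffices to
 control the increments at the points of a grid of mesh \<open>p\<^sup>2\<close> of the window of length \<open>2 p\<^sup>3\<close>.\<close>

lemma window_nonneg:
 fixes n p :: "nat \<Rightarrow> nat"
 assumes L: "L2 \<phi>" and pos: "\<And>z. \<phi> z \<ge> 0"
  and lim: "(\<lambda>k. real (p k) ^ 4 / real (n k + 2 * p k ^ 3)) \<longlonglongrightarrow> 0"
 shows "\<exists>Z. vanishes Z \<and> (\<forall>k \<omega> m. n k \<le> m \<and> m \<le> n k + 2 * p k ^ 3 \<longrightarrow>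
   \<bar>centered_sum \<phi> m \<omega> - centered_sum \<phi> (n k) \<omega>\<bar> \<le> real (n k + 2 * p k ^ 3) ^ (d - 1) * sqrt (real (n k + 2 * p k ^ 3)) * Z k \<omega>)"
proof -
 define M where "M k = n k + 2 * p k ^ 3" for k
 define gr where "gr k i = n k + i * p k ^ 2" for k i
 \<comment> \<open>A sum of squares over the grid dominates the maximum over the grid; the price is
   the number 2 p + 1 of grid points.\<close>
 define \<Theta> where "\<Theta> k \<omega> = (\<Sum>i\<in>{0..2 * p k}. (centered_sum \<phi> (gr k i) \<omega> - centered_sum \<phi> (n k) \<omega>)\<^sup>2)" for k \<omega>
 define s where "s k = real (M k) ^ (d - 1) * sqrt (real (M k))" for k
 define Z1 where "Z1 k \<omega> = sqrt (\<Theta> k \<omega>) / s k" for k \<omega>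
 \<comment> \<open>Over one mesh the mean of the uncentred sum grows by at most
   \<open>mean \<phi>\<close> times d p^2 M^(d-1); \<open>c k\<close> is this bound divided by the
   normalisation.\<close>
 define c where "c k = mean \<phi> * real d * (real (p k) ^ 2 / sqrt (real (M k)))" for k
 have mean0: "mean \<phi> \<ge> 0" unfolding mean_def using pos by simp
 have \<Theta>0: "\<Theta> k \<omega> \<ge> 0" for k \<omega> unfolding \<Theta>_def by (intro sum_nonneg) simp
 note [measurable] = centered_sum_measurable[OF L]
 have gr_le: "gr k i \<le> M k" if "i \<le> 2 * p k" for k i
 proof -
  have "i * p k ^ 2 \<le> 2 * p k * p k ^ 2" using that by (rule mult_right_mono) simp
  then show ?thesis by (simp add: gr_def M_def power2_eq_square power3_eq_cube)
 qed
 have \<Theta>i: "integrable P (\<Theta> k)" for k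
  unfolding \<Theta>_def by (intro Bochner_Integration.integrable_sum centered_increment_square(1)[OF L]) (simp add: gr_def)
 define V where "V = (\<integral>z. (\<phi> z - mean \<phi>)\<^sup>2 \<partial>Q)"
 have V0: "V \<ge> 0" by (simp add: V_def)
 \<comment> \<open>About 2 p grid points, each with a second moment of order p^3 M^(2d-2): this is
   where p^4 comes from.\<close>
 have \<Theta>E: "(\<integral>\<omega>. \<Theta> k \<omega> \<partial>P) \<le> 6 * (V * real d ^ 3) * (real (p k) ^ 4 * real (M k) ^ (2 * d - 2))" for k
 proof -
  have "(\<integral>\<omega>. \<Theta> k \<omega> \<partial>P) = (\<Sum>i\<in>{0..2 * p k}. \<integral>\<omega>. (centered_sum \<phi> (gr k i) \<omega> - centered_sum \<phi> (n k) \<omega>)\<^sup>2 \<partial>P)"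
   unfolding \<Theta>_def by (intro Bochner_Integration.integral_sum centered_increment_square(1)[OF L]) (simp add: gr_def)
  also have "\<dots> \<le> (\<Sum>i\<in>{0..2 * p k}. V * (real d ^ 3 * real (2 * p k ^ 3) * real (M k) ^ (2 * d - 2)))"
  proof (rule sum_mono)
   fix i assume i: "i \<in> {0..2 * p k}"
   have "(\<integral>\<omega>. (centered_sum \<phi> (gr k i) \<omega> - centered_sum \<phi> (n k) \<omega>)\<^sup>2 \<partial>P) \<le> V * (real d ^ 3 * real (gr k i - n k) * real (gr k i) ^ (2 * d - 2))"
    unfolding V_def by (rule centered_increment_square(2)[OF L]) (simp add: gr_def)
   also have "\<dots> \<le> V * (real d ^ 3 * real (2 * p k ^ 3) * real (M k) ^ (2 * d - 2))"
   proof -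
    have "gr k i \<le> M k" using gr_le[of i k] i by simp
    then have "real (gr k i - n k) \<le> real (2 * p k ^ 3)" "real (gr k i) \<le> real (M k)" by (simp_all only: of_nat_le_iff M_def)
    then show ?thesis using V0 by (intro mult_left_mono mult_mono power_mono) auto
   qed
   finally show "(\<integral>\<omega>. (centered_sum \<phi> (gr k i) \<omega> - centered_sum \<phi> (n k) \<omega>)\<^sup>2 \<partial>P) \<le> V * (real d ^ 3 * real (2 * p k ^ 3) * real (M k) ^ (2 * d - 2))" .
  qed
  also have "\<dots> = (2 * real (p k) + 1) * (2 * real (p k) ^ 3) * (V * real d ^ 3 * real (M k) ^ (2 * d - 2))"
   by (simp add: algebra_simps)
  also have "\<dots> \<le> 6 * real (p k) ^ 4 * (V * real d ^ 3 * real (M k) ^ (2 * d - 2))"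
  proof (rule mult_right_mono)
   show "(2 * real (p k) + 1) * (2 * real (p k) ^ 3) \<le> 6 * real (p k) ^ 4"
   proof (cases "p k = 0")
    case False
    then have "2 * real (p k) + 1 \<le> 3 * real (p k)" by simp
    then have "(2 * real (p k) + 1) * (2 * real (p k) ^ 3) \<le> 3 * real (p k) * (2 * real (p k) ^ 3)" by (rule mult_right_mono) simp
    then show ?thesis by (simp add: power4_eq_xxxx power3_eq_cube)
   qed simp
  qed (use V0 in simp)
  finally show ?thesis by (simp add: ac_simps)
 qed
 have "vanishes Z1"
 proof (rule vanishes_L2)
  show "Z1 k \<in> borel_measurable P" for k unfolding Z1_def[abs_def] \<Theta>_def by measurable
  have sq: "(Z1 k \<omega>)\<^sup>2 = \<Theta> k \<omega> / (real (M k) ^ (2 * d - 2) * real (M k))" for k \<omega>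
  proof -
   have "(real (M k) ^ (d - 1))\<^sup>2 = real (M k) ^ (2 * d - 2)" by (simp add: power_mult[symmetric] diff_mult_distrib mult.commute)
   then show ?thesis using \<Theta>0[of k \<omega>] by (simp add: Z1_def s_def power_divide power_mult_distrib)
  qed
  show "integrable P (\<lambda>\<omega>. (Z1 k \<omega>)\<^sup>2)" for k unfolding sq using \<Theta>i[of k] by simp
  show "\<forall>\<^sub>F k in sequentially. (\<integral>\<omega>. (Z1 k \<omega>)\<^sup>2 \<partial>P) \<le> 6 * (V * real d ^ 3) * (real (p k) ^ 4 / real (M k))"
  proof (intro always_eventually allI)
   fix k
   show "(\<integral>\<omega>. (Z1 k \<omega>)\<^sup>2 \<partial>P) \<le> 6 * (V * real d ^ 3) * (real (p k) ^ 4 / real (M k))"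
   proof (cases "M k = 0")
    case True then show ?thesis unfolding sq by simp
   next
    case False
    have "(\<integral>\<omega>. (Z1 k \<omega>)\<^sup>2 \<partial>P) = (\<integral>\<omega>. \<Theta> k \<omega> \<partial>P) / (real (M k) ^ (2 * d - 2) * real (M k))" unfolding sq by simp
    also have "\<dots> \<le> 6 * (V * real d ^ 3) * (real (p k) ^ 4 * real (M k) ^ (2 * d - 2)) / (real (M k) ^ (2 * d - 2) * real (M k))"
     by (rule divide_right_mono[OF \<Theta>E]) simp
    also have "\<dots> = 6 * (V * real d ^ 3) * (real (p k) ^ 4 / real (M k))" using False by simp
    finally show ?thesis .
   qed
  qed
  show "(\<lambda>k. 6 * (V * real d ^ 3) * (real (p k) ^ 4 / real (M k))) \<longlonglongrightarrow> 0"
   using lim unfolding M_def by (rule tendsto_mult_right_zero)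
 qed
 moreover have "vanishes (\<lambda>k \<omega>. c k)"
 proof (rule vanishes_const)
  have "(\<lambda>k. sqrt (real (p k) ^ 4 / real (M k))) \<longlonglongrightarrow> 0" using tendsto_real_sqrt[OF lim] by (simp add: M_def)
  moreover have "sqrt (real (p k) ^ 4 / real (M k)) = real (p k) ^ 2 / sqrt (real (M k))" for k
  proof -
   have "real (p k) ^ 4 = ((real (p k))\<^sup>2)\<^sup>2" by simp
   then show ?thesis by (simp only: real_sqrt_divide real_sqrt_abs abs_power2)
  qed
  ultimately show "c \<longlonglongrightarrow> 0" unfolding c_def[abs_def] by (intro tendsto_mult_right_zero) simp
 qed
 ultimately have van: "vanishes (\<lambda>k \<omega>. Z1 k \<omega> + c k)" by (rule vanishes_add)
 have s0: "s k \<ge> 0" for k by (simp add: s_def)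
 have "\<bar>centered_sum \<phi> m \<omega> - centered_sum \<phi> (n k) \<omega>\<bar> \<le> s k * (Z1 k \<omega> + c k)" if m: "n k \<le> m" "m \<le> M k" for k \<omega> m
 proof (cases "p k = 0")
  case True
  then have "m = n k" using m by (simp add: M_def)
  moreover have "0 \<le> Z1 k \<omega> + c k" unfolding Z1_def c_def using \<Theta>0[of k \<omega>] s0[of k] mean0 by simp
  ultimately show ?thesis using s0[of k] by simp
 next
  case False
  have Mpos: "M k > 0" using False by (simp add: M_def)
  have spos: "s k > 0" using Mpos by (simp add: s_def)
  have sZ: "s k * Z1 k \<omega> = sqrt (\<Theta> k \<omega>)" using spos by (simp add: Z1_def)
  have sc: "s k * c k = mean \<phi> * (real d * real (p k ^ 2) * real (M k) ^ (d - 1))"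
   using Mpos by (simp add: s_def c_def)
  define A where "A r = (\<Sum>i\<in>increasing_tuples d r. \<phi> (tup i \<omega>))" for r
  have BA: "centered_sum \<phi> r \<omega> = A r - mean \<phi> * real (r choose d)" for r
   by (simp add: centered_sum_def A_def sum_subtractf card_increasing_tuples mult.commute)
  have Amono: "A r \<le> A r'" if "r \<le> r'" for r r'
   unfolding A_def using increasing_tuples_mono[OF that] pos by (intro sum_mono2) auto
  have grid: "\<bar>centered_sum \<phi> (gr k i) \<omega> - centered_sum \<phi> (n k) \<omega>\<bar> \<le> sqrt (\<Theta> k \<omega>)" if "i \<le> 2 * p k" for i
  proof -
   have "(centered_sum \<phi> (gr k i) \<omega> - centered_sum \<phi> (n k) \<omega>)\<^sup>2 \<le> \<Theta> k \<omega>"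
    unfolding \<Theta>_def by (rule member_le_sum[of i]) (use that in auto)
   then have "\<bar>centered_sum \<phi> (gr k i) \<omega> - centered_sum \<phi> (n k) \<omega>\<bar>\<^sup>2 \<le> \<Theta> k \<omega>" by simp
   then show ?thesis by (rule real_le_rsqrt)
  qed
  \<comment> \<open>The right end of the window is the last grid point; division by the mesh would
    assign it to a cell beyond the window, hence the separate case.\<close>
  have "\<exists>i<2 * p k. gr k i \<le> m \<and> m \<le> gr k (Suc i)"
  proof -
   define i where "i = (m - n k) div p k ^ 2"
   have p2: "p k ^ 2 > 0" using False by simp
   have le: "i * p k ^ 2 \<le> m - n k" unfolding i_def by (rule div_times_less_eq_dividend)
   have lt: "m - n k < Suc i * p k ^ 2" unfolding i_def using dividend_less_times_div[OF p2, of "m - n k"] by (simp add: algebra_simps)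
   show ?thesis
   proof (cases "i < 2 * p k")
    case True then show ?thesis using le lt m by (intro exI[of _ i]) (auto simp: gr_def)
   next
    case False
    have "2 * p k * p k ^ 2 \<le> i * p k ^ 2" using False by (intro mult_right_mono) auto
    moreover have "2 * p k * p k ^ 2 = 2 * p k ^ 3" by (simp add: power2_eq_square power3_eq_cube)
    ultimately have "m = n k + 2 * p k * p k ^ 2" using le m unfolding M_def by linarith
    moreover have "Suc (2 * p k - 1) = 2 * p k" using \<open>p k \<noteq> 0\<close> by simp
    ultimately show ?thesis using \<open>p k \<noteq> 0\<close>
     by (intro exI[of _ "2 * p k - 1"]) (auto simp: gr_def intro: mult_right_mono)
   qed
  qed
  then obtain i where i: "i < 2 * p k" "gr k i \<le> m" "m \<le> gr k (Suc i)" by blast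
  have dC: "real (gr k (Suc i) choose d) - real (gr k i choose d) \<le> real d * real (p k ^ 2) * real (M k) ^ (d - 1)"
  proof -
   have "real (gr k (Suc i) choose d) - real (gr k i choose d) \<le> real d * real (gr k (Suc i) - gr k i) * real (gr k (Suc i)) ^ (d - 1)"
    by (rule increasing_tuples_card_diff) (simp add: gr_def)
   also have "\<dots> \<le> real d * real (p k ^ 2) * real (M k) ^ (d - 1)"
   proof -
    have "gr k (Suc i) \<le> M k" using gr_le[of "Suc i" k] i(1) by simp
    then have "real (gr k (Suc i)) \<le> real (M k)" by (simp only: of_nat_le_iff)
    moreover have "gr k (Suc i) - gr k i = p k ^ 2" by (simp add: gr_def)
    ultimately show ?thesis by (intro mult_mono power_mono) auto
   qed
   finally show ?thesis .
  qed
  have C: "real (gr k i choose d) \<le> real (m choose d)" "real (m choose d) \<le> real (gr k (Suc i) choose d)"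
   using card_mono[OF increasing_tuples_finite increasing_tuples_mono[OF i(2)], of d]
    card_mono[OF increasing_tuples_finite increasing_tuples_mono[OF i(3)], of d] by (simp_all add: card_increasing_tuples)
  \<comment> \<open>Between neighbouring grid points the uncentred sum lies between its values
    there, and the centring moves by at most one mesh.\<close>
  have up: "centered_sum \<phi> m \<omega> \<le> centered_sum \<phi> (gr k (Suc i)) \<omega> + mean \<phi> * (real (gr k (Suc i) choose d) - real (gr k i choose d))"
   unfolding BA using Amono[OF i(3)] mult_left_mono[OF C(1) mean0] by (simp add: algebra_simps)
  have lo: "centered_sum \<phi> (gr k i) \<omega> - mean \<phi> * (real (gr k (Suc i) choose d) - real (gr k i choose d)) \<le> centered_sum \<phi> m \<omega>"
   unfolding BA using Amono[OF i(2)] mult_left_mono[OF C(2) mean0] by (simp add: algebra_simps)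
  have "\<bar>centered_sum \<phi> m \<omega> - centered_sum \<phi> (n k) \<omega>\<bar> \<le> sqrt (\<Theta> k \<omega>) + s k * c k"
   using up lo grid[of i] grid[of "Suc i"] i(1) mult_left_mono[OF dC mean0] unfolding sc by linarith
  then show ?thesis using sZ by (simp add: distrib_left)
 qed
 with van show ?thesis unfolding M_def s_def by blast
qed

text \<open>Positive and negative part of the kernel are nonnegative kernels; \<open>part\<close>
  handles both through the sign c, and the two window bounds are added.\<close>

lemma window:
 fixes n p :: "nat \<Rightarrow> nat"
 assumes L: "L2 \<phi>"
  and lim: "(\<lambda>k. real (p k) ^ 4 / real (n k + 2 * p k ^ 3)) \<longlonglongrightarrow> 0"
 shows "\<exists>Z. vanishes Z \<and> (\<forall>k \<omega> m. n k \<le> m \<and> m \<le> n k + 2 * p k ^ 3 \<longrightarrow>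
   \<bar>centered_sum \<phi> m \<omega> - centered_sum \<phi> (n k) \<omega>\<bar> \<le> real (n k + 2 * p k ^ 3) ^ (d - 1) * sqrt (real (n k + 2 * p k ^ 3)) * Z k \<omega>)"
proof -
 have part: "L2 (\<lambda>z. max 0 (c * \<phi> z))" if "\<bar>c\<bar> = 1" for c
 proof -
  have [measurable]: "\<phi> \<in> borel_measurable Q" by (rule L2_measurable[OF L])
  have "integrable Q (\<lambda>z. (max 0 (c * \<phi> z))\<^sup>2)"
  proof (rule Bochner_Integration.integrable_bound)
   show "integrable Q (\<lambda>z. (\<phi> z)\<^sup>2)" using L by (simp add: L2_def)
   show "AE z in Q. norm ((max 0 (c * \<phi> z))\<^sup>2) \<le> norm ((\<phi> z)\<^sup>2)"
   proof (rule AE_I2)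
    fix z
    have "\<bar>max 0 (c * \<phi> z)\<bar> \<le> \<bar>\<phi> z\<bar>" using abs_mult[of c "\<phi> z"] that by auto
    then have "\<bar>max 0 (c * \<phi> z)\<bar>\<^sup>2 \<le> \<bar>\<phi> z\<bar>\<^sup>2" by (rule power_mono) simp
    then show "norm ((max 0 (c * \<phi> z))\<^sup>2) \<le> norm ((\<phi> z)\<^sup>2)" by simp
   qed
  qed measurable
  then show ?thesis by (simp add: L2_def)
 qed
 obtain Z1 where Z1: "vanishes Z1" "\<And>k \<omega> m. n k \<le> m \<Longrightarrow> m \<le> n k + 2 * p k ^ 3 \<Longrightarrow>
   \<bar>centered_sum (\<lambda>z. max 0 (1 * \<phi> z)) m \<omega> - centered_sum (\<lambda>z. max 0 (1 * \<phi> z)) (n k) \<omega>\<bar> \<le> real (n k + 2 * p k ^ 3) ^ (d - 1) * sqrt (real (n k + 2 * p k ^ 3)) * Z1 k \<omega>"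
  using window_nonneg[OF part[of 1] _ lim] by fastforce
 obtain Z2 where Z2: "vanishes Z2" "\<And>k \<omega> m. n k \<le> m \<Longrightarrow> m \<le> n k + 2 * p k ^ 3 \<Longrightarrow>
   \<bar>centered_sum (\<lambda>z. max 0 (-1 * \<phi> z)) m \<omega> - centered_sum (\<lambda>z. max 0 (-1 * \<phi> z)) (n k) \<omega>\<bar> \<le> real (n k + 2 * p k ^ 3) ^ (d - 1) * sqrt (real (n k + 2 * p k ^ 3)) * Z2 k \<omega>"
  using window_nonneg[OF part[of "-1"] _ lim] by fastforce
 have split: "centered_sum \<phi> m \<omega> = centered_sum (\<lambda>z. max 0 (1 * \<phi> z)) m \<omega> - centered_sum (\<lambda>z. max 0 (-1 * \<phi> z)) m \<omega>" for m \<omega>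
 proof -
  have e: "\<phi> z = max 0 (1 * \<phi> z) - max 0 (-1 * \<phi> z)" for z by auto
  have "mean \<phi> = (\<integral>z. max 0 (1 * \<phi> z) - max 0 (-1 * \<phi> z) \<partial>Q)" unfolding mean_def using e by (rule arg_cong[where f="integral\<^sup>L Q", OF ext])
  also have "\<dots> = mean (\<lambda>z. max 0 (1 * \<phi> z)) - mean (\<lambda>z. max 0 (-1 * \<phi> z))"
   unfolding mean_def by (rule Bochner_Integration.integral_diff) (intro L2_integrable part; simp)+
  finally have me: "mean \<phi> = mean (\<lambda>z. max 0 (1 * \<phi> z)) - mean (\<lambda>z. max 0 (-1 * \<phi> z))" .
  have "centered_sum (\<lambda>z. max 0 (1 * \<phi> z)) m \<omega> - centered_sum (\<lambda>z. max 0 (-1 * \<phi> z)) m \<omega>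
    = (\<Sum>i\<in>increasing_tuples d m. (max 0 (1 * \<phi> (tup i \<omega>)) - mean (\<lambda>z. max 0 (1 * \<phi> z))) - (max 0 (-1 * \<phi> (tup i \<omega>)) - mean (\<lambda>z. max 0 (-1 * \<phi> z))))"
   unfolding centered_sum_def by (rule sum_subtractf[symmetric])
  also have "\<dots> = centered_sum \<phi> m \<omega>" unfolding centered_sum_def
  proof (rule sum.cong[OF refl])
   fix i show "(max 0 (1 * \<phi> (tup i \<omega>)) - mean (\<lambda>z. max 0 (1 * \<phi> z))) - (max 0 (-1 * \<phi> (tup i \<omega>)) - mean (\<lambda>z. max 0 (-1 * \<phi> z))) = \<phi> (tup i \<omega>) - mean \<phi>"
    using e[of "tup i \<omega>"] me by linarith
  qed
  finally show ?thesis by simp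
 qed
 show ?thesis
 proof (intro exI[of _ "\<lambda>k \<omega>. Z1 k \<omega> + Z2 k \<omega>"] conjI allI impI vanishes_add Z1(1) Z2(1))
  fix k \<omega> m assume m: "n k \<le> m \<and> m \<le> n k + 2 * p k ^ 3"
  show "\<bar>centered_sum \<phi> m \<omega> - centered_sum \<phi> (n k) \<omega>\<bar> \<le> real (n k + 2 * p k ^ 3) ^ (d - 1) * sqrt (real (n k + 2 * p k ^ 3)) * (Z1 k \<omega> + Z2 k \<omega>)"
   unfolding split[of m] split[of "n k"] distrib_left
   using Z1(2)[of k m \<omega>] Z2(2)[of k m \<omega>] m by linarith
 qed
qed

end

section \<open>Replacing the random index\<close>

text \<open>Multiplied out by t^2 so that t = 0 is no exception. The remainder for the next exponent
  is a times the old one plus d t^(d-1) (a - t)^2, which drives the induction.\<close>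

lemma power_taylor_le:
 fixes a t :: real
 assumes a: "0 \<le> a" "a \<le> 2 * t"
 shows "\<bar>a ^ d - t ^ d - real d * t ^ (d - 1) * (a - t)\<bar> * t\<^sup>2 \<le> (real d)\<^sup>2 * (2 * t) ^ d * (a - t)\<^sup>2"
proof (induction d)
 case (Suc d)
 have t: "t \<ge> 0" using a by linarith
 define e where "e = a ^ d - t ^ d - real d * t ^ (d - 1) * (a - t)"
 have td: "real d * t ^ d = real d * (t ^ (d - 1) * t)" by (cases d) auto
 have "a ^ Suc d - t ^ Suc d - real (Suc d) * t ^ (Suc d - 1) * (a - t)
   = a * e + (a * (real d * t ^ (d - 1)) * (a - t) - (real d * t ^ d) * (a - t))"
  by (simp add: e_def algebra_simps)
 also have "\<dots> = a * e + real d * t ^ (d - 1) * (a - t)\<^sup>2" unfolding td by (simp add: power2_eq_square algebra_simps)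
 finally have eq: "a ^ Suc d - t ^ Suc d - real (Suc d) * t ^ (Suc d - 1) * (a - t) = a * e + real d * t ^ (d - 1) * (a - t)\<^sup>2" .
 have "\<bar>a * e + real d * t ^ (d - 1) * (a - t)\<^sup>2\<bar> \<le> a * \<bar>e\<bar> + real d * t ^ (d - 1) * (a - t)\<^sup>2"
  using abs_triangle_ineq[of "a * e" "real d * t ^ (d - 1) * (a - t)\<^sup>2"] a t by (simp add: abs_mult)
 then have "\<bar>a * e + real d * t ^ (d - 1) * (a - t)\<^sup>2\<bar> * t\<^sup>2 \<le> (a * \<bar>e\<bar> + real d * t ^ (d - 1) * (a - t)\<^sup>2) * t\<^sup>2"
  by (rule mult_right_mono) simp
 also have "\<dots> = a * (\<bar>e\<bar> * t\<^sup>2) + (real d * t ^ d) * t * (a - t)\<^sup>2"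
  unfolding td by (simp add: power2_eq_square algebra_simps)
 also have "\<dots> \<le> (2 * t) * ((real d)\<^sup>2 * (2 * t) ^ d * (a - t)\<^sup>2) + real d * (2 * t) ^ d * (2 * t) * (a - t)\<^sup>2"
 proof (rule add_mono)
  show "a * (\<bar>e\<bar> * t\<^sup>2) \<le> (2 * t) * ((real d)\<^sup>2 * (2 * t) ^ d * (a - t)\<^sup>2)"
   unfolding e_def by (rule mult_mono[OF a(2) Suc.IH]) (use t in auto)
  have "t ^ d \<le> (2 * t) ^ d" using t by (intro power_mono) auto
  then have "(real d * t ^ d) * t \<le> (real d * (2 * t) ^ d) * (2 * t)" using t by (intro mult_mono) auto
  then show "(real d * t ^ d) * t * (a - t)\<^sup>2 \<le> real d * (2 * t) ^ d * (2 * t) * (a - t)\<^sup>2"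
   by (rule mult_right_mono[OF _ zero_le_power2])
 qed
 also have "\<dots> = ((real d)\<^sup>2 + real d) * ((2 * t) ^ Suc d * (a - t)\<^sup>2)" by (simp add: algebra_simps)
 also have "\<dots> \<le> (real (Suc d))\<^sup>2 * ((2 * t) ^ Suc d * (a - t)\<^sup>2)"
 proof (rule mult_right_mono)
  show "(real d)\<^sup>2 + real d \<le> (real (Suc d))\<^sup>2" by (simp add: power2_eq_square algebra_simps)
  show "0 \<le> (2 * t) ^ Suc d * (a - t)\<^sup>2" using t by (intro mult_nonneg_nonneg zero_le_power zero_le_power2) simp
 qed
 finally show ?case unfolding eq by (simp add: mult.assoc)
qed simp

text \<open>Two errors: replacing the binomial coefficient by its leading power costs order t^(d-1),
  and the Taylor expansion of that power at t costs the quadratic term.\<close>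

lemma binomial_expansion:
 assumes d: "d \<ge> 1" and t: "t \<ge> 1" and N: "real N \<le> 2 * t"
 shows "\<bar>real (N choose d) - t ^ d / fact d - t ^ (d - 1) * (real N - t) / fact (d - 1)\<bar>
  \<le> ((real d)\<^sup>2 * 2 ^ d) * (t ^ (d - 1) * (1 + (real N - t)\<^sup>2 / t))"
proof -
 have tt: "t ^ d = t ^ (d - 1) * t" using d by (metis power_minus_mult mult.commute zero_less_one less_le_trans)
 have 1: "\<bar>real (N choose d) - real N ^ d / fact d\<bar> \<le> ((real d)\<^sup>2 * 2 ^ d) * t ^ (d - 1)"
 proof (cases "N = 0")
  case True then show ?thesis using d t by (cases d) auto
 next
  case False
  then have N1: "N \<ge> 1" by simp
  have NN: "real N ^ d = real N ^ (d - 1) * real N" using d by (metis power_minus_mult mult.commute zero_less_one less_le_trans)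
  have "\<bar>scaled_binomial N N d - (real N / real N) ^ d / fact d\<bar> \<le> (real d)\<^sup>2 / real N" by (rule scaled_binomial_approx) (use N1 in auto)
  then have "\<bar>real (N choose d) / real N ^ d - 1 / fact d\<bar> * real N ^ d \<le> (real d)\<^sup>2 / real N * real N ^ d"
   using False by (intro mult_right_mono) (simp_all add: scaled_binomial_def)
  moreover have "\<bar>real (N choose d) / real N ^ d - 1 / fact d\<bar> * real N ^ d = \<bar>real (N choose d) - real N ^ d / fact d\<bar>"
  proof -
   have "\<bar>real (N choose d) / real N ^ d - 1 / fact d\<bar> * real N ^ d = \<bar>(real (N choose d) / real N ^ d - 1 / fact d) * real N ^ d\<bar>"
    by (simp only: abs_mult abs_of_nonneg zero_le_power of_nat_0_le_iff)
   then show ?thesis using False by (simp add: left_diff_distrib)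
  qed
  moreover have "(real d)\<^sup>2 / real N * real N ^ d = (real d)\<^sup>2 * real N ^ (d - 1)" unfolding NN using False by simp
  moreover have "(real d)\<^sup>2 * real N ^ (d - 1) \<le> (real d)\<^sup>2 * (2 * t) ^ (d - 1)" using N by (intro mult_left_mono power_mono) auto
  moreover have "(real d)\<^sup>2 * (2 * t) ^ (d - 1) \<le> ((real d)\<^sup>2 * 2 ^ d) * t ^ (d - 1)"
   unfolding power_mult_distrib mult.assoc[symmetric] using t by (intro mult_right_mono mult_left_mono power_increasing) auto
  ultimately show ?thesis by linarith
 qed
 have 2: "\<bar>real N ^ d - t ^ d - real d * t ^ (d - 1) * (real N - t)\<bar> \<le> ((real d)\<^sup>2 * 2 ^ d) * (t ^ (d - 1) * ((real N - t)\<^sup>2 / t))"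
 proof -
  have "\<bar>real N ^ d - t ^ d - real d * t ^ (d - 1) * (real N - t)\<bar> \<le> (real d)\<^sup>2 * (2 * t) ^ d * (real N - t)\<^sup>2 / t\<^sup>2"
   using power_taylor_le[of "real N" t d] N t by (simp add: pos_le_divide_eq)
  also have "\<dots> = ((real d)\<^sup>2 * 2 ^ d) * (t ^ (d - 1) * ((real N - t)\<^sup>2 / t))"
   unfolding power_mult_distrib tt using t by (simp add: power2_eq_square field_simps)
  finally show ?thesis .
 qed
 have fd: "(fact d :: real) = real d * fact (d - 1)" using d by (simp add: fact_reduce)
 have f1: "(1::real) \<le> fact d" by (rule fact_ge_1)
 have d0: "real d > 0" using d by simp
 have c: "real (N choose d) - t ^ d / fact d - t ^ (d - 1) * (real N - t) / fact (d - 1)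
   = (real (N choose d) - real N ^ d / fact d) + (real N ^ d - t ^ d - real d * t ^ (d - 1) * (real N - t)) / fact d"
  unfolding fd using d0 by (simp add: diff_divide_distrib)
 have "\<bar>y / fact d\<bar> \<le> \<bar>y\<bar>" for y :: real
  using divide_left_mono[OF f1, of "\<bar>y\<bar>"] by (simp add: abs_divide)
 from this[of "real N ^ d - t ^ d - real d * t ^ (d - 1) * (real N - t)"] 1 2
 show ?thesis unfolding c distrib_left mult_1_right
  by (intro order_trans[OF abs_triangle_ineq]) linarith
qed

text \<open>The exponent 1/5 puts the half-width, the third power, at order t^(3/5), above sqrt t,
  while the fourth power, the cost of the grid, stays of smaller order than t.\<close>

definition window_mesh :: "real \<Rightarrow> nat" where "window_mesh t = nat \<lfloor>t powr (1/5)\<rfloor>"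
definition window_start :: "real \<Rightarrow> nat" where "window_start t = nat \<lfloor>t\<rfloor> - window_mesh t ^ 3"
definition window_end :: "real \<Rightarrow> nat" where "window_end t = window_start t + 2 * window_mesh t ^ 3"

text \<open>From t = 32 = 2^5 on, the fifth root is at least 2: rounding down loses at most half of
  it, and the subtraction in the start index is not truncated.\<close>

lemma window_bounds:
 assumes t: "t \<ge> 32"
 defines "s \<equiv> t powr (1/5)" and "p \<equiv> real (window_mesh t)"
 shows "s \<ge> 2" "s ^ 5 = t" "s / 2 \<le> p" "p \<le> s" "p \<ge> 2" "p ^ 3 \<le> s ^ 3" "s ^ 3 \<le> t / 4"
  "t - 1 - p ^ 3 \<le> real (window_start t)" "real (window_start t) \<le> t - p ^ 3"
  "t - 1 + p ^ 3 \<le> real (window_end t)" "real (window_end t) \<le> t + p ^ 3" "real (window_end t) \<le> 2 * t"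
proof -
 have "2 = (32::real) powr (1/5)"
 proof -
  have "(32::real) = 2 powr 5" by simp
  then show ?thesis by (simp only: powr_powr) simp
 qed
 also have "\<dots> \<le> s" unfolding s_def using t by (intro powr_mono2) auto
 finally show s2: "s \<ge> 2" .
 have "s ^ 5 = s powr 5" using s2 by simp
 also have "\<dots> = t" unfolding s_def powr_powr using t by simp
 finally show s5: "s ^ 5 = t" .
 have f: "2 \<le> \<lfloor>s\<rfloor>" using s2 by (simp add: le_floor_iff)
 have p: "p = of_int \<lfloor>s\<rfloor>" using f by (simp add: p_def window_mesh_def s_def)
 show ps: "p \<le> s" "p \<ge> 2" "s / 2 \<le> p" unfolding p using f s2 by linarith+
 show p3: "p ^ 3 \<le> s ^ 3" using ps by (intro power_mono) auto
 have "4 * s ^ 3 \<le> s\<^sup>2 * s ^ 3" using s2 power_mono[of 2 s 2] by (intro mult_right_mono) auto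
 also have "\<dots> = s ^ 5" by (simp flip: power_add)
 finally show s3: "s ^ 3 \<le> t / 4" unfolding s5 by simp
 have le: "window_mesh t ^ 3 \<le> nat \<lfloor>t\<rfloor>"
 proof -
  have "real (window_mesh t ^ 3) \<le> t - 1" using p3 s3 t by (simp add: p_def)
  then show ?thesis using t by (simp add: le_nat_floor)
 qed
 have st: "real (window_start t) = of_int \<lfloor>t\<rfloor> - p ^ 3" unfolding window_start_def using le t by (simp add: of_nat_diff p_def)
 show "t - 1 - p ^ 3 \<le> real (window_start t)" "real (window_start t) \<le> t - p ^ 3" unfolding st by linarith+
 have en: "real (window_end t) = of_int \<lfloor>t\<rfloor> + p ^ 3" unfolding window_end_def by (simp add: st p_def)
 show "t - 1 + p ^ 3 \<le> real (window_end t)" "real (window_end t) \<le> t + p ^ 3" unfolding en by linarith+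
 show "real (window_end t) \<le> 2 * t" unfolding en using p3 s3 t by linarith
qed

text \<open>In turn: the grid cost is negligible; fluctuations of order sqrt t are small against the
  half-width of the window; the quadratic error of the binomial expansion vanishes; the window
  starts asymptotically at t.\<close>

lemma window_limits:
 "((\<lambda>t. real (window_mesh t) ^ 4 / real (window_end t)) \<longlongrightarrow> 0) at_top"
 "((\<lambda>t. real (window_end t) / real (window_mesh t) ^ 6) \<longlongrightarrow> 0) at_top"
 "((\<lambda>t. (real (window_mesh t) ^ 3 + 1)\<^sup>2 / t / sqrt t) \<longlongrightarrow> 0) at_top"
 "((\<lambda>t. real (window_start t) / t) \<longlongrightarrow> 1) at_top"
proof -
 have ev: "\<forall>\<^sub>F t::real in at_top. t \<ge> 32" by (rule eventually_ge_at_top)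
 show "((\<lambda>t. real (window_mesh t) ^ 4 / real (window_end t)) \<longlongrightarrow> 0) at_top"
 proof (rule Lim_null_comparison)
  show "\<forall>\<^sub>F t in at_top. norm (real (window_mesh t) ^ 4 / real (window_end t)) \<le> (t powr (1/5)) ^ 4 / (t - 1)"
   using ev
  proof eventually_elim
   case (elim t)
   note w = window_bounds[OF elim]
   have "real (window_mesh t) ^ 4 / real (window_end t) \<le> (t powr (1/5)) ^ 4 / (t - 1)"
   proof (intro frac_le power_mono)
    show "t - 1 \<le> real (window_end t)" using w(10) zero_le_power[of "real (window_mesh t)" 3] by linarith
   qed (use w(4) elim in auto)
   then show ?case by simp
  qed
  show "((\<lambda>t::real. (t powr (1/5)) ^ 4 / (t - 1)) \<longlongrightarrow> 0) at_top" by real_asymp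
 qed
 show "((\<lambda>t. real (window_end t) / real (window_mesh t) ^ 6) \<longlongrightarrow> 0) at_top"
 proof (rule Lim_null_comparison)
  show "\<forall>\<^sub>F t in at_top. norm (real (window_end t) / real (window_mesh t) ^ 6) \<le> 2 * t / (t powr (1/5) / 2) ^ 6"
   using ev
  proof eventually_elim
   case (elim t)
   note w = window_bounds[OF elim]
   have "real (window_end t) / real (window_mesh t) ^ 6 \<le> 2 * t / (t powr (1/5) / 2) ^ 6"
    using w elim by (intro frac_le power_mono zero_less_power) auto
   then show ?case by simp
  qed
  show "((\<lambda>t::real. 2 * t / (t powr (1/5) / 2) ^ 6) \<longlongrightarrow> 0) at_top" by real_asymp
 qed
 show "((\<lambda>t. (real (window_mesh t) ^ 3 + 1)\<^sup>2 / t / sqrt t) \<longlongrightarrow> 0) at_top"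
 proof (rule Lim_null_comparison)
  show "\<forall>\<^sub>F t in at_top. norm ((real (window_mesh t) ^ 3 + 1)\<^sup>2 / t / sqrt t) \<le> ((t powr (1/5)) ^ 3 + 1)\<^sup>2 / t / sqrt t"
   using ev
  proof eventually_elim
   case (elim t)
   note w = window_bounds[OF elim]
   have "(real (window_mesh t) ^ 3 + 1)\<^sup>2 / t / sqrt t \<le> ((t powr (1/5)) ^ 3 + 1)\<^sup>2 / t / sqrt t"
    using w elim by (intro divide_right_mono power_mono) auto
   then show ?case using elim by simp
  qed
  show "((\<lambda>t::real. ((t powr (1/5)) ^ 3 + 1)\<^sup>2 / t / sqrt t) \<longlongrightarrow> 0) at_top" by real_asymp
 qed
 have "((\<lambda>t. real (window_start t) / t - 1) \<longlongrightarrow> 0) at_top"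
 proof (rule Lim_null_comparison)
  show "\<forall>\<^sub>F t in at_top. norm (real (window_start t) / t - 1) \<le> (1 + (t powr (1/5)) ^ 3) / t"
   using ev
  proof eventually_elim
   case (elim t)
   note w = window_bounds[OF elim]
   have "real (window_start t) / t - 1 = (real (window_start t) - t) / t" using elim by (simp add: diff_divide_distrib)
   then have "norm (real (window_start t) / t - 1) = \<bar>real (window_start t) - t\<bar> / t" using elim by simp
   also have "\<dots> \<le> (1 + (t powr (1/5)) ^ 3) / t"
    using w(6,8,9) zero_le_power[of "real (window_mesh t)" 3] elim by (intro divide_right_mono) linarith+
   finally show ?case .
  qed
  show "((\<lambda>t::real. (1 + (t powr (1/5)) ^ 3) / t) \<longlongrightarrow> 0) at_top" by real_asymp
 qed
 then show "((\<lambda>t. real (window_start t) / t) \<longlongrightarrow> 1) at_top" by (rule Lim_null[THEN iffD2])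
qed

context renewal_process
begin

text \<open>Renewal sums are U-statistics of order 1, so the window estimate covers them as
  well.\<close>

interpretation F: iid_kernel K 1 by standard simp

lemma f_kernel_L2: "F.L2 (\<lambda>z. f (z 1))" and f_kernel_mean: "F.mean (\<lambda>z. f (z 1)) = \<mu>"
 using F.L2_component[of 1 f] f_square by (auto simp: \<mu>_def)

lemma f_kernel_centered_sum: "F.centered_sum (\<lambda>z. f (z 1)) n \<omega> = U n \<omega> - \<mu> * n"
proof -
 have "F.centered_sum (\<lambda>z. f (z 1)) n \<omega> = (\<Sum>i\<in>increasing_tuples 1 n. f (\<omega> (i 1)) - \<mu>)"
  unfolding F.centered_sum_def f_kernel_mean by (simp add: F.tup_def)
 also have "\<dots> = (\<Sum>j\<in>{1..n}. \<Sum>i\<in>{i\<in>increasing_tuples 1 n. i 1 = j}. f (\<omega> (i 1)) - \<mu>)"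
  by (rule sum.group[symmetric]) (use increasing_tuples_range[of _ 1 n 1] in auto)
 also have "\<dots> = (\<Sum>j\<in>{1..n}. f (\<omega> j) - \<mu>)"
 proof (rule sum.cong[OF refl])
  fix j assume j: "j \<in> {1..n}"
  have "(\<Sum>i\<in>{i\<in>increasing_tuples 1 n. i 1 = j}. f (\<omega> (i 1)) - \<mu>) = (\<Sum>i\<in>{i\<in>increasing_tuples 1 n. i 1 = j}. f (\<omega> j) - \<mu>)"
   by (rule sum.cong) auto
  also have "\<dots> = real (card {i\<in>increasing_tuples 1 n. i 1 = j}) * (f (\<omega> j) - \<mu>)" by simp
  also have "card {i\<in>increasing_tuples 1 n. i 1 = j} = 1"
   using card_increasing_tuples_coordinate[of 1 1 j n] j by simp
  finally show "(\<Sum>i\<in>{i\<in>increasing_tuples 1 n. i 1 = j}. f (\<omega> (i 1)) - \<mu>) = f (\<omega> j) - \<mu>" by simp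
 qed
 finally show ?thesis by (simp add: renewal_sum_def sum_subtractf mult.commute)
qed

lemma sum_window:
 fixes n p :: "nat \<Rightarrow> nat"
 assumes "(\<lambda>k. real (p k) ^ 4 / real (n k + 2 * p k ^ 3)) \<longlonglongrightarrow> 0"
 shows "\<exists>Z. vanishes Z \<and> (\<forall>k \<omega> m. n k \<le> m \<and> m \<le> n k + 2 * p k ^ 3 \<longrightarrow>
   \<bar>(U m \<omega> - \<mu> * m) - (U (n k) \<omega> - \<mu> * n k)\<bar> \<le> sqrt (real (n k + 2 * p k ^ 3)) * Z k \<omega>)"
 using F.window[OF f_kernel_L2 assms] unfolding f_kernel_centered_sum by simp

text \<open>Measurability is required on the whole space, hence also on paths where the supremum
  runs over an infinite or an empty set.\<close>

lemma Nm_measurable [measurable]: "Nm x \<in> measurable P (count_space UNIV)"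
proof -
 \<comment> \<open>On \<open>nat\<close>, \<open>Sup\<close> is 0 for the empty set and
   \<open>Max\<close> otherwise, and \<open>Max\<close> of an infinite set is
   \<open>the None\<close>. For finite sets the least index after which no sum is at most x gives
   the supremum, with value 0 for the empty set.\<close>
 have "Nm x \<omega> = (if \<forall>B. \<exists>n\<ge>B. U n \<omega> \<le> x then the None else (LEAST n. \<forall>m>n. \<not> U m \<omega> \<le> x))" for \<omega>
 proof -
  define S where "S = {n. U n \<omega> \<le> x}"
  have inf: "infinite S \<longleftrightarrow> (\<forall>B. \<exists>n\<ge>B. U n \<omega> \<le> x)"
   unfolding S_def infinite_nat_iff_unbounded_le by blast
  show ?thesis
  proof (cases "infinite S")
   case True
   then have "S \<noteq> {}" by auto
   then have "Nm x \<omega> = the None" using True by (simp add: N_minus_def Sup_nat_def S_def[symmetric] Max.infinite)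
   then show ?thesis using True inf by simp
  next
   case fin: False
   have L: "(LEAST n. \<forall>m>n. \<not> U m \<omega> \<le> x) = Nm x \<omega>"
   proof (cases "S = {}")
    case True
    have "(LEAST n. \<forall>m>n. \<not> U m \<omega> \<le> x) = 0" by (rule Least_equality) (use True in \<open>auto simp: S_def\<close>)
    then show ?thesis using True by (simp add: N_minus_def S_def[symmetric] Sup_nat_def)
   next
    case ne: False
    have mem: "Max S \<in> S" using fin ne by (intro Max_in) auto
    have "(LEAST n. \<forall>m>n. \<not> U m \<omega> \<le> x) = Max S"
    proof (rule Least_equality)
     show "\<forall>m>Max S. \<not> U m \<omega> \<le> x"
     proof (intro allI impI notI)
      fix m assume m: "Max S < m" "U m \<omega> \<le> x"
      then have "m \<le> Max S" using fin by (intro Max_ge) (auto simp: S_def)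
      then show False using m by simp
     qed
     fix y assume "\<forall>m>y. \<not> U m \<omega> \<le> x"
     then show "Max S \<le> y" using mem by (auto simp: S_def not_less[symmetric])
    qed
    then show ?thesis using ne by (simp add: N_minus_def S_def[symmetric] Sup_nat_def)
   qed
   have "\<not> (\<forall>B. \<exists>n\<ge>B. U n \<omega> \<le> x)" using fin inf by blast
   then show ?thesis using L by (simp only: if_False)
  qed
 qed
 then have e: "Nm x = (\<lambda>\<omega>. if \<forall>B. \<exists>n\<ge>B. U n \<omega> \<le> x then the None else (LEAST n. \<forall>m>n. \<not> U m \<omega> \<le> x))" by (rule ext)
 show ?thesis unfolding e by measurable
qed

lemma Np_measurable' [measurable]: "Np x \<in> measurable P (count_space UNIV)"
 using measurable_Pair2[OF Np_measurable, of x] by simp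

end

section \<open>The stopped statistic compared with a statistic at the start of the window\<close>

locale ustat_renewal = renewal_process K f + iid_kernel K d for K :: "'s measure" and f d +
 fixes g :: "(nat \<Rightarrow> 's) \<Rightarrow> real"
 assumes g_L2: "L2 g"
begin

text \<open>The statistic of the theorem with the mean of the kernel split off, so that the centring
  is compared with a binomial coefficient alone.\<close>

definition Vst :: "(real \<Rightarrow> (nat \<Rightarrow> 's) \<Rightarrow> nat) \<Rightarrow> real \<Rightarrow> (nat \<Rightarrow> 's) \<Rightarrow> real" where
 "Vst N x \<omega> = (centered_sum g (N x \<omega>) \<omega> + mean g * (real (N x \<omega> choose d) - (x / \<mu>) ^ d / fact d)) / (x ^ (d - 1) * sqrt x)"

text \<open>\<open>Tst x\<close> depends on the first \<open>window_start (x / \<mu>)\<close> coordinates only.\<close>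

definition Tst :: "real \<Rightarrow> (nat \<Rightarrow> 's) \<Rightarrow> real" where
 "Tst x \<omega> = (let n = window_start (x / \<mu>) in
   (centered_sum g n \<omega> - mean g * (x / \<mu>) ^ (d - 1) * (U n \<omega> - \<mu> * n) / (\<mu> * fact (d - 1))) / (x ^ (d - 1) * sqrt x))"

lemma Tst_measurable [measurable]: "Tst x \<in> borel_measurable P"
proof -
 note [measurable] = centered_sum_measurable[OF g_L2]
 show ?thesis unfolding Tst_def[abs_def] Let_def by measurable
qed

lemma Vst_measurable:
 assumes N [measurable]: "N x \<in> measurable P (count_space UNIV)"
 shows "Vst N x \<in> borel_measurable P"
proof -
 note [measurable] = centered_sum_measurable[OF g_L2]
 have [measurable]: "(\<lambda>\<omega>. centered_sum g (N x \<omega>) \<omega>) \<in> borel_measurable P"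
  by (rule measurable_compose_countable[OF _ N]) measurable
 have [measurable]: "(\<lambda>\<omega>. real (N x \<omega> choose d)) \<in> borel_measurable P"
  by (rule measurable_compose[OF N]) simp
 show ?thesis unfolding Vst_def[abs_def] by measurable
qed

text \<open>A statement about one path. Over the window U_m - \<mu> m is nearly constant, and the
  sums at the two indices around the passage enclose x. Hence x - \<mu> N is close to that constant,
  up to \<mu> because the two indices differ by one.\<close>

lemma stopping_bounds:
 assumes r: "regular \<omega>" and N: "N = Nm \<or> N = Np" and t: "x / \<mu> \<ge> 32"
  and D: "\<bar>U (window_start (x / \<mu>)) \<omega> - \<mu> * window_start (x / \<mu>)\<bar> \<le> \<mu> * real (window_mesh (x / \<mu>)) ^ 3 / 4"
  and z: "z \<le> \<mu> * real (window_mesh (x / \<mu>)) ^ 3 / 4"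
  and win: "\<And>m. window_start (x / \<mu>) \<le> m \<Longrightarrow> m \<le> window_end (x / \<mu>) \<Longrightarrow>
    \<bar>(U m \<omega> - \<mu> * m) - (U (window_start (x / \<mu>)) \<omega> - \<mu> * window_start (x / \<mu>))\<bar> \<le> z"
 shows "window_start (x / \<mu>) \<le> N x \<omega>" "N x \<omega> \<le> window_end (x / \<mu>)"
  "\<bar>x - \<mu> * N x \<omega> - (U (window_start (x / \<mu>)) \<omega> - \<mu> * window_start (x / \<mu>))\<bar> \<le> \<mu> + 3 * z"
proof -
 note w = window_bounds[OF t]
 define n where "n = window_start (x / \<mu>)"
 define L where "L = window_end (x / \<mu>)"
 define q where "q = real (window_mesh (x / \<mu>)) ^ 3"
 have q8: "q \<ge> 8" using power_mono[OF w(5), of 3] by (simp add: q_def)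
 have x: "x = \<mu> * (x / \<mu>)" using \<mu>_pos by simp
 have x0: "x \<ge> 0" using t \<mu>_pos by (simp add: pos_le_divide_eq)
 have nL: "n \<le> L" by (simp add: n_def L_def window_end_def)
 have "\<mu> * n \<le> \<mu> * (x / \<mu> - q)" using w(9) \<mu>_pos by (intro mult_left_mono) (auto simp: n_def q_def)
 then have "\<mu> * n \<le> x - \<mu> * q" using x by (simp add: right_diff_distrib)
 moreover have mq: "\<mu> * q > 0" using \<mu>_pos q8 by simp
 ultimately have Un: "U n \<omega> \<le> x" using D unfolding n_def[symmetric] q_def[symmetric] by linarith
 \<comment> \<open>At the right end the drift exceeds x by at least \<mu> q - \<mu>. The two
   deviations consume at most half of \<mu> q, and q \<ge> 8 leaves enough for the lost
   \<mu>.\<close>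
 have "\<mu> * (x / \<mu> - 1 + q) \<le> \<mu> * L" using w(10) \<mu>_pos by (intro mult_left_mono) (auto simp: L_def q_def)
 then have "x - \<mu> + \<mu> * q \<le> \<mu> * L" using x by (simp add: algebra_simps)
 moreover have "\<mu> * 8 \<le> \<mu> * q" using q8 \<mu>_pos by (intro mult_left_mono) auto
 ultimately have UL: "U L \<omega> > x"
  using win[of L] D z nL \<mu>_pos unfolding n_def[symmetric] q_def[symmetric] L_def[symmetric] by linarith
 have NpL: "Np x \<omega> \<le> L" by (rule Np_props(3)[OF r UL])
 have nNp: "n < Np x \<omega>"
 proof (rule ccontr)
  assume "\<not> n < Np x \<omega>"
  then have "U (Np x \<omega>) \<omega> \<le> U n \<omega>" by (intro regular_mono[OF r]) simp
  then show False using Np_props(1)[OF r, of x] Un by simp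
 qed
 have S: "Suc (Nm x \<omega>) = Np x \<omega>" by (rule Nm_eq[OF r x0])
 have mL: "n \<le> Nm x \<omega>" "Nm x \<omega> \<le> L" using S nNp NpL by auto
 show bN: "window_start (x / \<mu>) \<le> N x \<omega>" "N x \<omega> \<le> window_end (x / \<mu>)"
  unfolding n_def[symmetric] L_def[symmetric] using N mL nNp NpL by auto
 have Um: "U (Nm x \<omega>) \<omega> \<le> x" by (rule Np_props(2)[OF r]) (use S in simp)
 have Up: "U (Np x \<omega>) \<omega> > x" by (rule Np_props(1)[OF r])
 have wm: "\<bar>(U (Nm x \<omega>) \<omega> - \<mu> * Nm x \<omega>) - (U n \<omega> - \<mu> * n)\<bar> \<le> z"
  using win[of "Nm x \<omega>"] mL unfolding n_def L_def by blast
 have wp: "\<bar>(U (Np x \<omega>) \<omega> - \<mu> * Np x \<omega>) - (U n \<omega> - \<mu> * n)\<bar> \<le> z"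
  using win[of "Np x \<omega>"] nNp NpL unfolding n_def L_def by simp
 have "real (Np x \<omega>) = real (Nm x \<omega>) + 1" using S by simp
 then have pm: "\<mu> * real (Np x \<omega>) = \<mu> * real (Nm x \<omega>) + \<mu>" by (simp add: algebra_simps)
 show "\<bar>x - \<mu> * N x \<omega> - (U (window_start (x / \<mu>)) \<omega> - \<mu> * window_start (x / \<mu>))\<bar> \<le> \<mu> + 3 * z"
  unfolding n_def[symmetric] using N
 proof
  assume "N = Nm" then show "\<bar>x - \<mu> * N x \<omega> - (U n \<omega> - \<mu> * n)\<bar> \<le> \<mu> + 3 * z" using Um Up wm wp pm by simp
 next
  assume "N = Np" then show "\<bar>x - \<mu> * N x \<omega> - (U n \<omega> - \<mu> * n)\<bar> \<le> \<mu> + 3 * z" using Um Up wm wp pm by simp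
 qed
qed

text \<open>Again for one path, with three errors: the movement of the centred sum within the window
  (\<open>zg\<close>), the remainder of the binomial expansion, and the error of predicting N - t by
  -(U_n - \<mu> n) / \<mu> (a constant and \<open>zf\<close>).\<close>

lemma Vst_Tst_le:
 assumes r: "regular \<omega>" and N: "N = Nm \<or> N = Np" and t: "x / \<mu> \<ge> 32"
  and D: "\<bar>U (window_start (x / \<mu>)) \<omega> - \<mu> * window_start (x / \<mu>)\<bar> \<le> \<mu> * real (window_mesh (x / \<mu>)) ^ 3 / 4"
  and z: "sqrt (real (window_end (x / \<mu>))) * zf \<le> \<mu> * real (window_mesh (x / \<mu>)) ^ 3 / 4"
  and winf: "\<And>m. window_start (x / \<mu>) \<le> m \<Longrightarrow> m \<le> window_end (x / \<mu>) \<Longrightarrow>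
    \<bar>(U m \<omega> - \<mu> * m) - (U (window_start (x / \<mu>)) \<omega> - \<mu> * window_start (x / \<mu>))\<bar> \<le> sqrt (real (window_end (x / \<mu>))) * zf"
  and wing: "\<And>m. window_start (x / \<mu>) \<le> m \<Longrightarrow> m \<le> window_end (x / \<mu>) \<Longrightarrow>
    \<bar>centered_sum g m \<omega> - centered_sum g (window_start (x / \<mu>)) \<omega>\<bar> \<le> real (window_end (x / \<mu>)) ^ (d - 1) * sqrt (real (window_end (x / \<mu>))) * zg"
 shows "\<bar>Vst N x \<omega> - Tst x \<omega>\<bar> \<le> (2 / \<mu>) ^ (d - 1) * sqrt (2 / \<mu>) * zg
   + \<bar>mean g\<bar> * (1 / \<mu>) ^ (d - 1) * (((real d)\<^sup>2 * 2 ^ d) * (1 / sqrt x + (real (window_mesh (x / \<mu>)) ^ 3 + 1)\<^sup>2 / (x / \<mu>) / sqrt x) + 1 / sqrt x + 3 / \<mu> * sqrt (2 / \<mu>) * zf)"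
proof -
 define t where "t = x / \<mu>"
 define n where "n = window_start t"
 define L where "L = real (window_end t)"
 define p where "p = real (window_mesh t)"
 note w = window_bounds[OF assms(3), folded t_def, folded p_def n_def, folded L_def]
 note sb = stopping_bounds[OF r N assms(3) D z winf, folded t_def, folded n_def]
 define M where "M = N x \<omega>"
 define D0 where "D0 = U n \<omega> - \<mu> * n"
 have t1: "t \<ge> 32" using assms(3) by (simp add: t_def)
 have x: "x = \<mu> * t" using \<mu>_pos by (simp add: t_def)
 have xpos: "x > 0" unfolding x using \<mu>_pos t1 by simp
 have M: "n \<le> M" "M \<le> window_end t" "\<bar>x - \<mu> * M - D0\<bar> \<le> \<mu> + 3 * (sqrt L * zf)"
  using sb unfolding M_def D0_def L_def by auto
 have M2: "real M \<le> L" using M(2) by (simp add: L_def)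
 have p0: "p ^ 3 \<ge> 0" using w(5) by simp
 have Mt: "\<bar>real M - t\<bar> \<le> p ^ 3 + 1" using w(8,11) M2 M(1) by (simp add: n_def[symmetric])
 have Lpos: "L > 0" using w(10) t1 p0 by linarith
 note winf' = winf[folded t_def, folded n_def, folded L_def] and wing' = wing[folded t_def, folded n_def, folded L_def]
 have nL: "n \<le> window_end t" by (simp add: n_def window_end_def)
 \<comment> \<open>At the start index itself the left side of the window bound is 0, so the bound is
   nonnegative.\<close>
 have zf0: "zf \<ge> 0"
 proof -
  have "0 \<le> sqrt L * zf" using winf'[of n] nL by simp
  then show ?thesis using Lpos by (simp add: zero_le_mult_iff)
 qed
 have zg0: "zg \<ge> 0"
 proof -
  have "0 \<le> (L ^ (d - 1) * sqrt L) * zg" using wing'[of n] nL by simp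
  moreover have "L ^ (d - 1) * sqrt L > 0" using Lpos by simp
  ultimately show ?thesis by (simp only: zero_le_mult_iff) linarith
 qed
 define Kd where "Kd = (real d)\<^sup>2 * 2 ^ d"
 define e where "e = real (M choose d) - t ^ d / fact d - t ^ (d - 1) * (real M - t) / fact (d - 1)"
 \<comment> \<open>The error of the linear prediction -D0 / \<mu> for N - t.\<close>
 define h where "h = real M - t + D0 / \<mu>"
 have e: "\<bar>e\<bar> \<le> Kd * (t ^ (d - 1) * (1 + (p ^ 3 + 1)\<^sup>2 / t))"
 proof -
  have "\<bar>e\<bar> \<le> Kd * (t ^ (d - 1) * (1 + (real M - t)\<^sup>2 / t))"
   unfolding e_def Kd_def using M2 w(12) t1 by (intro binomial_expansion d_pos) auto
  also have "\<dots> \<le> Kd * (t ^ (d - 1) * (1 + (p ^ 3 + 1)\<^sup>2 / t))"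
  proof -
   have "(real M - t)\<^sup>2 \<le> (p ^ 3 + 1)\<^sup>2" using power_mono[OF Mt, of 2] by simp
   then show ?thesis using t1 by (intro mult_left_mono add_left_mono divide_right_mono) (auto simp: Kd_def)
  qed
  finally show ?thesis .
 qed
 have h: "\<bar>h\<bar> \<le> 1 + 3 / \<mu> * (sqrt L * zf)"
 proof -
  have "x - \<mu> * M - D0 = - (\<mu> * h)" using \<mu>_pos by (simp add: h_def x algebra_simps)
  then have "\<mu> * \<bar>h\<bar> \<le> \<mu> + 3 * (sqrt L * zf)" using M(3) \<mu>_pos by (simp add: abs_mult)
  then have "\<bar>h\<bar> \<le> (\<mu> + 3 * (sqrt L * zf)) / \<mu>" using \<mu>_pos by (simp add: pos_le_divide_eq mult.commute)
  then show ?thesis using \<mu>_pos by (simp add: add_divide_distrib)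
 qed
 define c where "c = centered_sum g M \<omega> - centered_sum g n \<omega>"
 have c: "\<bar>c\<bar> \<le> L ^ (d - 1) * sqrt L * zg"
  unfolding c_def using wing'[of M] M(1,2) by simp
 define X where "X = x ^ (d - 1) * sqrt x"
 have Xpos: "X > 0" using xpos by (simp add: X_def)
 have num: "Vst N x \<omega> - Tst x \<omega> = (c + mean g * e + mean g * (t ^ (d - 1) * h / fact (d - 1))) / X"
 proof -
  have "Vst N x \<omega> = (centered_sum g M \<omega> + mean g * (real (M choose d) - t ^ d / fact d)) / X"
   by (simp add: Vst_def M_def t_def X_def)
  moreover have "Tst x \<omega> = (centered_sum g n \<omega> - mean g * t ^ (d - 1) * D0 / (\<mu> * fact (d - 1))) / X"
   by (simp add: Tst_def Let_def t_def n_def D0_def X_def)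
  moreover have "t ^ (d - 1) * h / fact (d - 1) = t ^ (d - 1) * (real M - t) / fact (d - 1) + t ^ (d - 1) * D0 / (\<mu> * fact (d - 1))"
   by (simp add: h_def distrib_left add_divide_distrib)
  ultimately show ?thesis unfolding c_def e_def by (simp add: diff_divide_distrib[symmetric] algebra_simps)
 qed
 have f1: "(1::real) \<le> fact (d - 1)" by (rule fact_ge_1)
 have td0: "t ^ (d - 1) \<ge> 0" using t1 by simp
 have "\<bar>c + mean g * e + mean g * (t ^ (d - 1) * h / fact (d - 1))\<bar>
   \<le> \<bar>c\<bar> + \<bar>mean g\<bar> * \<bar>e\<bar> + \<bar>mean g\<bar> * (t ^ (d - 1) * \<bar>h\<bar> / fact (d - 1))"
  using abs_triangle_ineq[of "c + mean g * e" "mean g * (t ^ (d - 1) * h / fact (d - 1))"] abs_triangle_ineq[of c "mean g * e"] td0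
  by (simp add: abs_mult)
 also have "\<dots> \<le> L ^ (d - 1) * sqrt L * zg + \<bar>mean g\<bar> * (Kd * (t ^ (d - 1) * (1 + (p ^ 3 + 1)\<^sup>2 / t))) + \<bar>mean g\<bar> * (t ^ (d - 1) * (1 + 3 / \<mu> * (sqrt L * zf)) / 1)"
  using c e h f1 td0 zf0 Lpos \<mu>_pos by (intro add_mono mult_left_mono frac_le) auto
 finally have "\<bar>Vst N x \<omega> - Tst x \<omega>\<bar> \<le> (L ^ (d - 1) * sqrt L * zg + \<bar>mean g\<bar> * (Kd * (t ^ (d - 1) * (1 + (p ^ 3 + 1)\<^sup>2 / t))) + \<bar>mean g\<bar> * (t ^ (d - 1) * (1 + 3 / \<mu> * (sqrt L * zf)))) / X"
  unfolding num abs_divide using Xpos by (simp add: divide_right_mono)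
 also have "\<dots> = (L ^ (d - 1) * sqrt L / X) * zg + \<bar>mean g\<bar> * (t ^ (d - 1) / X * (Kd * (1 + (p ^ 3 + 1)\<^sup>2 / t) + 1) + t ^ (d - 1) * sqrt L / X * (3 / \<mu> * zf))"
  by (simp add: add_divide_distrib distrib_left algebra_simps)
 also have "\<dots> \<le> ((2 / \<mu>) ^ (d - 1) * sqrt (2 / \<mu>)) * zg + \<bar>mean g\<bar> * ((1 / \<mu>) ^ (d - 1) / sqrt x * (Kd * (1 + (p ^ 3 + 1)\<^sup>2 / t) + 1) + (1 / \<mu>) ^ (d - 1) * sqrt (2 / \<mu>) * (3 / \<mu> * zf))"
 proof -
  \<comment> \<open>The window ends before 2 t = 2 x / \<mu>, which bounds all quotients by the
    normalisation.\<close>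
  have Lx: "L / x \<le> 2 / \<mu>" using w(12) \<mu>_pos t1 by (simp add: x divide_le_eq)
  have 1: "L ^ (d - 1) * sqrt L / X = (L / x) ^ (d - 1) * sqrt (L / x)"
   by (simp add: X_def power_divide real_sqrt_divide)
  have 2: "t ^ (d - 1) / X = (1 / \<mu>) ^ (d - 1) / sqrt x"
   using xpos \<mu>_pos by (simp add: X_def t_def power_divide)
  have 3: "t ^ (d - 1) * sqrt L / X = (1 / \<mu>) ^ (d - 1) * sqrt (L / x)"
   using xpos \<mu>_pos by (simp add: X_def t_def power_divide real_sqrt_divide)
  have "(L / x) ^ (d - 1) * sqrt (L / x) \<le> (2 / \<mu>) ^ (d - 1) * sqrt (2 / \<mu>)"
   using Lx Lpos xpos \<mu>_pos by (intro mult_mono power_mono) auto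
  moreover have "(1 / \<mu>) ^ (d - 1) * sqrt (L / x) \<le> (1 / \<mu>) ^ (d - 1) * sqrt (2 / \<mu>)"
   using Lx \<mu>_pos by (intro mult_left_mono) auto
  moreover have "0 \<le> Kd * (1 + (p ^ 3 + 1)\<^sup>2 / t) + 1" using t1 by (simp add: Kd_def)
  ultimately show ?thesis unfolding 1 2 3 using zg0 zf0 \<mu>_pos
   by (intro add_mono mult_right_mono mult_left_mono) auto
 qed
 finally show ?thesis
  unfolding Kd_def p_def t_def by (simp add: algebra_simps add_divide_distrib)
qed

end

context iid_space
begin

lemma vanishes_abs: "vanishes Z \<Longrightarrow> vanishes (\<lambda>k \<omega>. \<bar>Z k \<omega>\<bar>)"
 by (simp add: vanishes_def borel_measurable_abs)

lemma vanishes_cmult: "vanishes Z \<Longrightarrow> vanishes (\<lambda>k \<omega>. c * Z k \<omega>)"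
 by (rule vanishes_mult_bounded[of Z "\<lambda>_. c" "\<bar>c\<bar>"]) auto

end

context ustat_renewal
begin

lemma filterlim_level: "filterlim x at_top sequentially \<Longrightarrow> filterlim (\<lambda>k. x k / \<mu>) at_top sequentially"
 using filterlim_tendsto_pos_mult_at_top[OF tendsto_const[of "1 / \<mu>"]] \<mu>_pos by simp

text \<open>The factor is such that an absolute value below 1 implies the bound \<open>D\<close> of
  \<open>stopping_bounds\<close>; the variance vanishes because n is small against the sixth power
  of the mesh parameter.\<close>

lemma centered_deviation_vanishes:
 assumes x: "filterlim x at_top sequentially"
 shows "vanishes (\<lambda>k \<omega>. 4 / (\<mu> * real (window_mesh (x k / \<mu>)) ^ 3) * (U (window_start (x k / \<mu>)) \<omega> - \<mu> * window_start (x k / \<mu>)))"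
proof (rule vanishes_L2)
 define n where "n k = window_start (x k / \<mu>)" for k
 define q where "q k = 4 / (\<mu> * real (window_mesh (x k / \<mu>)) ^ 3)" for k
 define v where "v = (\<integral>s. (f s - \<mu>)\<^sup>2 \<partial>K)"
 have D: "U m \<omega> - \<mu> * m = (\<Sum>j\<in>{1..m}. f (\<omega> j) - \<mu>)" for m \<omega> by (simp add: renewal_sum_def sum_subtractf mult.commute)
 note cs = centered_sum_square[of "\<lambda>s. f s - \<mu>", OF _ centered_square finite_atLeastAtMost]
 show "integrable P (\<lambda>\<omega>. (4 / (\<mu> * real (window_mesh (x k / \<mu>)) ^ 3) * (U (window_start (x k / \<mu>)) \<omega> - \<mu> * window_start (x k / \<mu>)))\<^sup>2)" for k
  unfolding D power_mult_distrib by (intro integrable_mult_right cs(1)) measurable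
 have "(\<integral>\<omega>. (q k * (U (n k) \<omega> - \<mu> * n k))\<^sup>2 \<partial>P) \<le> 16 * v / \<mu>\<^sup>2 * (real (window_end (x k / \<mu>)) / real (window_mesh (x k / \<mu>)) ^ 6)" for k
 proof -
  have "(\<integral>\<omega>. (q k * (U (n k) \<omega> - \<mu> * n k))\<^sup>2 \<partial>P) = (q k)\<^sup>2 * (real (n k) * v)"
   unfolding D power_mult_distrib using cs(2)[of 1 "n k"] by (simp add: v_def)
  also have "\<dots> \<le> (q k)\<^sup>2 * (real (window_end (x k / \<mu>)) * v)"
   by (intro mult_left_mono mult_right_mono) (auto simp: n_def window_end_def v_def)
  also have "(q k)\<^sup>2 = 16 / (\<mu>\<^sup>2 * real (window_mesh (x k / \<mu>)) ^ 6)"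
   by (simp add: q_def power_divide power_mult_distrib flip: power_mult)
  finally show ?thesis by (simp add: ac_simps)
 qed
 then show "\<forall>\<^sub>F k in sequentially. (\<integral>\<omega>. (4 / (\<mu> * real (window_mesh (x k / \<mu>)) ^ 3) * (U (window_start (x k / \<mu>)) \<omega> - \<mu> * window_start (x k / \<mu>)))\<^sup>2 \<partial>P)
   \<le> 16 * v / \<mu>\<^sup>2 * (real (window_end (x k / \<mu>)) / real (window_mesh (x k / \<mu>)) ^ 6)"
  unfolding q_def n_def by (rule always_eventually[OF allI])
 show "(\<lambda>k. 16 * v / \<mu>\<^sup>2 * (real (window_end (x k / \<mu>)) / real (window_mesh (x k / \<mu>)) ^ 6)) \<longlonglongrightarrow> 0"
  by (rule tendsto_mult_right_zero[OF filterlim_compose[OF window_limits(2) filterlim_level[OF x]]])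
qed measurable

lemma Vst_Tst_vanishes:
 assumes x: "filterlim x at_top sequentially" and N: "N = Nm \<or> N = Np"
 shows "vanishes (\<lambda>k \<omega>. Vst N (x k) \<omega> - Tst (x k) \<omega>)"
proof -
 define t where "t k = x k / \<mu>" for k
 have t: "filterlim t at_top sequentially" unfolding t_def[abs_def] by (rule filterlim_level[OF x])
 define p where "p k = real (window_mesh (t k))" for k
 define L where "L k = real (window_end (t k))" for k
 have lim: "(\<lambda>k. real (window_mesh (t k)) ^ 4 / real (window_start (t k) + 2 * window_mesh (t k) ^ 3)) \<longlonglongrightarrow> 0"
  using filterlim_compose[OF window_limits(1) t] by (simp add: window_end_def)
 obtain Zf where Zf: "vanishes Zf" "\<And>k \<omega> m. window_start (t k) \<le> m \<Longrightarrow> m \<le> window_end (t k) \<Longrightarrow>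
   \<bar>(U m \<omega> - \<mu> * m) - (U (window_start (t k)) \<omega> - \<mu> * window_start (t k))\<bar> \<le> sqrt (real (window_end (t k))) * Zf k \<omega>"
  using sum_window[OF lim] unfolding window_end_def[symmetric] by blast
 obtain Zg where Zg: "vanishes Zg" "\<And>k \<omega> m. window_start (t k) \<le> m \<Longrightarrow> m \<le> window_end (t k) \<Longrightarrow>
   \<bar>centered_sum g m \<omega> - centered_sum g (window_start (t k)) \<omega>\<bar> \<le> real (window_end (t k)) ^ (d - 1) * sqrt (real (window_end (t k))) * Zg k \<omega>"
  using window[OF g_L2 lim] unfolding window_end_def[symmetric] by blast
 \<comment> \<open>Absolute values of \<open>W1\<close> and \<open>W2\<close> below 1 give the two
   quarter bounds under which the pathwise comparison applies.\<close>
 define W1 where "W1 k \<omega> = 4 / (\<mu> * p k ^ 3) * (U (window_start (t k)) \<omega> - \<mu> * window_start (t k))" for k \<omega>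
 define W2 where "W2 k \<omega> = 4 * sqrt (L k) / (\<mu> * p k ^ 3) * Zf k \<omega>" for k \<omega>
 have v1: "vanishes W1" using centered_deviation_vanishes[OF x] unfolding W1_def[abs_def] p_def t_def .
 have v2: "vanishes W2"
  unfolding W2_def
 proof (rule vanishes_mult_bounded[OF Zf(1)])
  have "(\<lambda>k. sqrt (L k / p k ^ 6)) \<longlonglongrightarrow> 0"
   using tendsto_real_sqrt[OF filterlim_compose[OF window_limits(2) t]] by (simp add: L_def p_def)
  then have "(\<lambda>k. 4 / \<mu> * sqrt (L k / p k ^ 6)) \<longlonglongrightarrow> 0" by (rule tendsto_mult_right_zero)
  moreover have "4 / \<mu> * sqrt (L k / p k ^ 6) = 4 * sqrt (L k) / (\<mu> * p k ^ 3)" for k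
  proof -
   have "p k ^ 6 = (p k ^ 3)\<^sup>2" by (simp flip: power_mult)
   have "sqrt (p k ^ 6) = p k ^ 3" unfolding \<open>p k ^ 6 = _\<close> by (rule real_sqrt_unique[OF refl]) (simp add: p_def)
   then show ?thesis by (simp add: real_sqrt_divide)
  qed
  ultimately have "(\<lambda>k. 4 * sqrt (L k) / (\<mu> * p k ^ 3)) \<longlonglongrightarrow> 0" by simp
  from tendstoD[OF this, of 1] show "\<forall>\<^sub>F k in sequentially. \<bar>4 * sqrt (L k) / (\<mu> * p k ^ 3)\<bar> \<le> 1"
   by (auto elim: eventually_mono simp: dist_real_def)
 qed
 define Kd where "Kd = (real d)\<^sup>2 * 2 ^ d"
 define Cd where "Cd = \<bar>mean g\<bar> * (1 / \<mu>) ^ (d - 1)"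
 define C1 where "C1 = (2 / \<mu>) ^ (d - 1) * sqrt (2 / \<mu>)"
 define C2 where "C2 = 3 / \<mu> * sqrt (2 / \<mu>)"
 define c where "c k = Cd * (Kd * (1 / sqrt (x k) + (p k ^ 3 + 1)\<^sup>2 / t k / sqrt (x k)) + 1 / sqrt (x k))" for k
 have c0: "c \<longlonglongrightarrow> 0"
 proof -
  have s: "(\<lambda>k. 1 / sqrt (x k)) \<longlonglongrightarrow> 0"
   by (intro tendsto_divide_0[OF tendsto_const] filterlim_at_top_imp_at_infinity filterlim_compose[OF sqrt_at_top x])
  have "(\<lambda>k. 1 / sqrt \<mu> * ((p k ^ 3 + 1)\<^sup>2 / t k / sqrt (t k))) \<longlonglongrightarrow> 0"
   unfolding p_def by (rule tendsto_mult_right_zero[OF filterlim_compose[OF window_limits(3) t]])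
  moreover have "1 / sqrt \<mu> * ((p k ^ 3 + 1)\<^sup>2 / t k / sqrt (t k)) = (p k ^ 3 + 1)\<^sup>2 / t k / sqrt (x k)" for k
   using \<mu>_pos by (simp add: t_def real_sqrt_divide)
  ultimately have s2: "(\<lambda>k. (p k ^ 3 + 1)\<^sup>2 / t k / sqrt (x k)) \<longlonglongrightarrow> 0" by (simp only:)
  show ?thesis unfolding c_def[abs_def] by (intro tendsto_mult_right_zero tendsto_add_zero s s2)
 qed
 show ?thesis
 proof (rule vanishes_dominated)
  have Nmeas: "N y \<in> measurable P (count_space UNIV)" for y using N Nm_measurable Np_measurable' by auto
  show "(\<lambda>\<omega>. Vst N (x k) \<omega> - Tst (x k) \<omega>) \<in> borel_measurable P" for k
   by (intro borel_measurable_diff Vst_measurable Nmeas Tst_measurable)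
  show "vanishes (\<lambda>k \<omega>. C1 * Zg k \<omega> + (c k + (Cd * C2) * Zf k \<omega>))"
   by (intro vanishes_add vanishes_cmult vanishes_const c0 Zf(1) Zg(1))
  show "vanishes (\<lambda>k \<omega>. \<bar>W1 k \<omega>\<bar> + \<bar>W2 k \<omega>\<bar>)" by (intro vanishes_add vanishes_abs v1 v2)
  have "\<forall>\<^sub>F k in sequentially. t k \<ge> 32" using t by (simp add: filterlim_at_top)
  then show "\<forall>\<^sub>F k in sequentially. AE \<omega> in P. \<bar>\<bar>W1 k \<omega>\<bar> + \<bar>W2 k \<omega>\<bar>\<bar> < 1 \<longrightarrow>
    \<bar>Vst N (x k) \<omega> - Tst (x k) \<omega>\<bar> \<le> \<bar>C1 * Zg k \<omega> + (c k + (Cd * C2) * Zf k \<omega>)\<bar>"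
  proof eventually_elim
   case tk: (elim k)
   note w = window_bounds[OF tk]
   have pp: "\<mu> * p k ^ 3 > 0" using w(5) \<mu>_pos by (simp add: p_def)
   show ?case using AE_regular
   proof eventually_elim
    case (elim \<omega>)
    show ?case
    proof
     assume "\<bar>\<bar>W1 k \<omega>\<bar> + \<bar>W2 k \<omega>\<bar>\<bar> < 1"
     then have W: "\<bar>W1 k \<omega>\<bar> < 1" "\<bar>W2 k \<omega>\<bar> < 1" by auto
     have "\<bar>U (window_start (t k)) \<omega> - \<mu> * window_start (t k)\<bar> = \<mu> * p k ^ 3 / 4 * \<bar>W1 k \<omega>\<bar>"
     proof -
      have "\<bar>y\<bar> = q / 4 * \<bar>4 / q * y\<bar>" if "q > 0" for q y :: real using that by (simp add: abs_mult)
      then show ?thesis unfolding W1_def using pp by blast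
     qed
     also have "\<dots> \<le> \<mu> * p k ^ 3 / 4 * 1" using W(1) pp by (intro mult_left_mono) auto
     finally have D: "\<bar>U (window_start (t k)) \<omega> - \<mu> * window_start (t k)\<bar> \<le> \<mu> * p k ^ 3 / 4" by simp
     have "sqrt (L k) * Zf k \<omega> = \<mu> * p k ^ 3 / 4 * W2 k \<omega>"
     proof -
      have "u * z = q / 4 * (4 * u / q * z)" if "q > 0" for q u z :: real using that by simp
      then show ?thesis unfolding W2_def using pp by blast
     qed
     also have "\<dots> \<le> \<mu> * p k ^ 3 / 4 * 1" using W(2) pp by (intro mult_left_mono) auto
     finally have z: "sqrt (L k) * Zf k \<omega> \<le> \<mu> * p k ^ 3 / 4" by simp
     have "\<bar>Vst N (x k) \<omega> - Tst (x k) \<omega>\<bar> \<le> C1 * Zg k \<omega> + Cd * (Kd * (1 / sqrt (x k) + (p k ^ 3 + 1)\<^sup>2 / t k / sqrt (x k)) + 1 / sqrt (x k) + C2 * Zf k \<omega>)"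
      using Vst_Tst_le[OF elim N tk[unfolded t_def] D[unfolded t_def p_def] z[unfolded t_def p_def L_def] Zf(2)[unfolded t_def] Zg(2)[unfolded t_def]]
      unfolding C1_def Cd_def Kd_def C2_def p_def t_def by simp
     also have "\<dots> = C1 * Zg k \<omega> + (c k + (Cd * C2) * Zf k \<omega>)" by (simp add: c_def algebra_simps)
     finally show "\<bar>Vst N (x k) \<omega> - Tst (x k) \<omega>\<bar> \<le> \<bar>C1 * Zg k \<omega> + (c k + (Cd * C2) * Zf k \<omega>)\<bar>" by linarith
    qed
   qed
  qed
 qed
qed

section \<open>The linear statistic and its central limit theorem\<close>

definition rate_g :: "real \<Rightarrow> real" where
 "rate_g x = sqrt (window_start (x / \<mu>)) * real (window_start (x / \<mu>)) ^ (d - 1) / (x ^ (d - 1) * sqrt x)"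

definition rate_f :: "real \<Rightarrow> real" where
 "rate_f x = sqrt (window_start (x / \<mu>)) * (mean g * (x / \<mu>) ^ (d - 1) / (\<mu> * fact (d - 1))) / (x ^ (d - 1) * sqrt x)"

text \<open>Set to 0 for j outside {1..n}, where the scaled weights need not be at most 1, so that
  one function dominates every term.\<close>

definition lin_term :: "real \<Rightarrow> nat \<Rightarrow> 's \<Rightarrow> real" where
 "lin_term x j s = (let n = window_start (x / \<mu>) in
   if j \<in> {1..n} then rate_g x * (\<Sum>a\<in>{1..d}. weight n a j / real n ^ (d - 1) * proj g a s) - rate_f x * (f s - \<mu>) else 0)"

definition Lst :: "real \<Rightarrow> (nat \<Rightarrow> 's) \<Rightarrow> real" where
 "Lst x \<omega> = (\<Sum>j\<in>{1..window_start (x / \<mu>)}. lin_term x j (\<omega> j)) / sqrt (window_start (x / \<mu>))"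

definition rate_g_limit :: real where "rate_g_limit = (1 / \<mu>) ^ (d - 1) * sqrt (1 / \<mu>)"
definition rate_f_limit :: real where "rate_f_limit = sqrt (1 / \<mu>) * (mean g * (1 / \<mu>) ^ (d - 1) / (\<mu> * fact (d - 1)))"

text \<open>The form in which the variance arises; \<open>gamma_sq_eq\<close> recovers the constant
  of the theorem from it.\<close>

definition limit_variance :: real where
 "limit_variance = rate_g_limit\<^sup>2 * (\<Sum>a\<in>{1..d}. \<Sum>c\<in>{1..d}.
   fact (a + c - 2) * fact (2 * d - a - c) / (fact (a - 1) * fact (c - 1) * fact (d - a) * fact (d - c) * fact (2 * d - 1)) * (\<integral>s. proj g a s * proj g c s \<partial>K))
  - 2 * (rate_g_limit * rate_f_limit) * (\<Sum>a\<in>{1..d}. 1 / fact d * (\<integral>s. (f s - \<mu>) * proj g a s \<partial>K))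
  + rate_f_limit\<^sup>2 * (\<integral>s. (f s - \<mu>)\<^sup>2 \<partial>K)"

lemma start_ratio: "filterlim x at_top sequentially \<Longrightarrow> (\<lambda>k. real (window_start (x k / \<mu>)) / x k) \<longlonglongrightarrow> 1 / \<mu>"
proof -
 assume x: "filterlim x at_top sequentially"
 have "(\<lambda>k. real (window_start (x k / \<mu>)) / (x k / \<mu>) * (1 / \<mu>)) \<longlonglongrightarrow> 1 * (1 / \<mu>)"
  by (intro tendsto_intros filterlim_compose[OF window_limits(4) filterlim_level[OF x]])
 then show ?thesis using \<mu>_pos by simp
qed

lemma start_at_top: assumes x: "filterlim x at_top sequentially" shows "filterlim (\<lambda>k. window_start (x k / \<mu>)) at_top sequentially"
proof -
 have "filterlim (\<lambda>k. real (window_start (x k / \<mu>)) / x k * x k) at_top sequentially"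
  by (rule filterlim_tendsto_pos_mult_at_top[OF start_ratio[OF x] _ x]) (use \<mu>_pos in simp)
 moreover have "\<forall>\<^sub>F k in sequentially. real (window_start (x k / \<mu>)) / x k * x k = real (window_start (x k / \<mu>))"
  using x[unfolded filterlim_at_top_dense, rule_format, of 0] by eventually_elim simp
 ultimately have "filterlim (\<lambda>k. real (window_start (x k / \<mu>))) at_top sequentially"
  by (subst (asm) filterlim_cong[OF refl refl])
 then show ?thesis by (simp only: filterlim_sequentially_iff_filterlim_real)
qed

lemma rate_limits:
 assumes x: "filterlim x at_top sequentially"
 shows "(\<lambda>k. rate_g (x k)) \<longlonglongrightarrow> rate_g_limit" "(\<lambda>k. rate_f (x k)) \<longlonglongrightarrow> rate_f_limit"
proof -
 note r = start_ratio[OF x]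
 have g: "rate_g y = (real (window_start (y / \<mu>)) / y) ^ (d - 1) * sqrt (real (window_start (y / \<mu>)) / y)" for y
  by (simp add: rate_g_def power_divide real_sqrt_divide)
 show "(\<lambda>k. rate_g (x k)) \<longlonglongrightarrow> rate_g_limit" unfolding g rate_g_limit_def by (intro tendsto_intros r)
 have ev: "\<forall>\<^sub>F k in sequentially. sqrt (real (window_start (x k / \<mu>)) / x k) * (mean g * (1 / \<mu>) ^ (d - 1) / (\<mu> * fact (d - 1))) = rate_f (x k)"
  using x[unfolded filterlim_at_top_dense, rule_format, of 0]
  by eventually_elim (simp add: rate_f_def power_divide real_sqrt_divide)
 show "(\<lambda>k. rate_f (x k)) \<longlonglongrightarrow> rate_f_limit"
  by (rule Lim_transform_eventually[OF _ ev]) (unfold rate_f_limit_def, intro tendsto_intros r)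
qed

lemma lin_term_measurable [measurable]: "lin_term x j \<in> borel_measurable K"
proof -
 have [measurable]: "proj g a \<in> borel_measurable K" if "a \<in> {1..d}" for a by (rule proj_measurable[OF g_L2 that])
 show ?thesis unfolding lin_term_def[abs_def] Let_def by measurable
qed

lemma Lst_measurable [measurable]: "Lst x \<in> borel_measurable P"
 unfolding Lst_def[abs_def] by measurable

lemma Tst_decomposition:
 "Tst x \<omega> = Lst x \<omega> + (\<Sum>i\<in>increasing_tuples d (window_start (x / \<mu>)). residual g (tup i \<omega>)) / (x ^ (d - 1) * sqrt x)"
proof (cases "window_start (x / \<mu>) = 0")
 case True
 then show ?thesis by (simp add: Tst_def Let_def Lst_def projection_decomposition)
next
 case False
 define n where "n = window_start (x / \<mu>)"
 define X where "X = x ^ (d - 1) * sqrt x"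
 have n: "real n > 0" using False by (simp add: n_def)
 have "Lst x \<omega> = (\<Sum>j\<in>{1..n}. (\<Sum>a\<in>{1..d}. weight n a j * proj g a (\<omega> j)) / X - mean g * (x / \<mu>) ^ (d - 1) / (\<mu> * fact (d - 1)) / X * (f (\<omega> j) - \<mu>))"
 proof (subst (1) Lst_def, subst (1) sum_divide_distrib, unfold n_def[symmetric], rule sum.cong[OF refl])
  fix j assume j: "j \<in> {1..n}"
  have 1: "rate_g x * (\<Sum>a\<in>{1..d}. weight n a j / real n ^ (d - 1) * proj g a (\<omega> j)) = sqrt n * ((\<Sum>a\<in>{1..d}. weight n a j * proj g a (\<omega> j)) / X)"
  proof -
   have "(\<Sum>a\<in>{1..d}. weight n a j / real n ^ (d - 1) * proj g a (\<omega> j)) = (\<Sum>a\<in>{1..d}. weight n a j * proj g a (\<omega> j)) / real n ^ (d - 1)"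
    by (simp add: sum_divide_distrib)
   then show ?thesis using n by (simp add: rate_g_def n_def[symmetric] X_def[symmetric])
  qed
  have 2: "rate_f x = sqrt n * (mean g * (x / \<mu>) ^ (d - 1) / (\<mu> * fact (d - 1)) / X)"
   by (simp add: rate_f_def n_def[symmetric] X_def[symmetric])
  have "lin_term x j (\<omega> j) = sqrt n * ((\<Sum>a\<in>{1..d}. weight n a j * proj g a (\<omega> j)) / X - mean g * (x / \<mu>) ^ (d - 1) / (\<mu> * fact (d - 1)) / X * (f (\<omega> j) - \<mu>))"
   using j unfolding lin_term_def Let_def n_def[symmetric] 1 2 by (simp add: right_diff_distrib)
  then show "lin_term x j (\<omega> j) / sqrt n = (\<Sum>a\<in>{1..d}. weight n a j * proj g a (\<omega> j)) / X - mean g * (x / \<mu>) ^ (d - 1) / (\<mu> * fact (d - 1)) / X * (f (\<omega> j) - \<mu>)"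
   using n by simp
 qed
 also have "\<dots> = (\<Sum>j\<in>{1..n}. \<Sum>a\<in>{1..d}. weight n a j * proj g a (\<omega> j)) / X - mean g * (x / \<mu>) ^ (d - 1) / (\<mu> * fact (d - 1)) / X * (U n \<omega> - \<mu> * n)"
 proof -
  have "U n \<omega> - \<mu> * n = (\<Sum>j\<in>{1..n}. f (\<omega> j) - \<mu>)" by (simp add: renewal_sum_def sum_subtractf mult.commute)
  then show ?thesis by (simp only: sum_subtractf[of "\<lambda>j. _ j / X"] sum_divide_distrib[symmetric] sum_distrib_left[symmetric])
 qed
 finally show ?thesis
  unfolding Tst_def Let_def n_def[symmetric] X_def[symmetric] projection_decomposition
  by (simp add: add_divide_distrib diff_divide_distrib)
qed

text \<open>The second moment of the degenerate part has order n^(2d-2), against the squared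
  normalisation x^(2d-1).\<close>

lemma Tst_Lst_vanishes:
 assumes x: "filterlim x at_top sequentially"
 shows "vanishes (\<lambda>k \<omega>. Tst (x k) \<omega> - Lst (x k) \<omega>)"
proof -
 define n where "n k = window_start (x k / \<mu>)" for k
 define v where "v = (\<integral>z. (residual g z)\<^sup>2 \<partial>Q)"
 have eq: "Tst (x k) \<omega> - Lst (x k) \<omega> = (\<Sum>i\<in>increasing_tuples d (n k). residual g (tup i \<omega>)) / (x k ^ (d - 1) * sqrt (x k))" for k \<omega>
  unfolding Tst_decomposition n_def by simp
 note pe = projection_error_square[OF g_L2]
 show ?thesis
 proof (rule vanishes_L2)
  show "(\<lambda>\<omega>. Tst (x k) \<omega> - Lst (x k) \<omega>) \<in> borel_measurable P" for k by measurable
  show "integrable P (\<lambda>\<omega>. (Tst (x k) \<omega> - Lst (x k) \<omega>)\<^sup>2)" for k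
   unfolding eq power_divide by (intro integrable_divide pe(1))
  show "\<forall>\<^sub>F k in sequentially. (\<integral>\<omega>. (Tst (x k) \<omega> - Lst (x k) \<omega>)\<^sup>2 \<partial>P) \<le> real d ^ 4 * v * ((real (n k) / x k) ^ (2 * d - 2) * (1 / x k))"
   using x[unfolded filterlim_at_top_dense, rule_format, of 0]
  proof eventually_elim
   case (elim k)
   have X: "(x k ^ (d - 1) * sqrt (x k))\<^sup>2 = x k ^ (2 * d - 2) * x k"
   proof -
    have "(x k ^ (d - 1))\<^sup>2 = x k ^ (2 * d - 2)" by (simp add: power_mult[symmetric] diff_mult_distrib mult.commute)
    then show ?thesis using elim by (simp add: power_mult_distrib)
   qed
   have "(\<integral>\<omega>. (Tst (x k) \<omega> - Lst (x k) \<omega>)\<^sup>2 \<partial>P) = (\<integral>\<omega>. (\<Sum>i\<in>increasing_tuples d (n k). residual g (tup i \<omega>))\<^sup>2 \<partial>P) / (x k ^ (2 * d - 2) * x k)"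
    unfolding eq power_divide X by simp
   also have "\<dots> \<le> (real d ^ 4 * real (n k) ^ (2 * d - 2) * v) / (x k ^ (2 * d - 2) * x k)"
    unfolding v_def using elim by (intro divide_right_mono pe(2)) simp
   also have "\<dots> = real d ^ 4 * v * ((real (n k) / x k) ^ (2 * d - 2) * (1 / x k))" by (simp add: power_divide)
   finally show ?case .
  qed
  have "(\<lambda>k. (real (n k) / x k) ^ (2 * d - 2) * (1 / x k)) \<longlonglongrightarrow> (1 / \<mu>) ^ (2 * d - 2) * 0"
   unfolding n_def by (intro tendsto_intros start_ratio[OF x] tendsto_divide_0[OF tendsto_const] filterlim_at_top_imp_at_infinity x)
  then show "(\<lambda>k. real d ^ 4 * v * ((real (n k) / x k) ^ (2 * d - 2) * (1 / x k))) \<longlonglongrightarrow> 0"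
   by (intro tendsto_mult_right_zero) simp
 qed
qed

text \<open>The third claim, a second moment bound uniform in k, later serves to cut off large
  values of \<open>Lst\<close>.\<close>

theorem Lst_clt:
 assumes x: "filterlim x at_top sequentially"
 shows "limit_variance \<ge> 0"
  and "weak_conv_m (\<lambda>k. distr P borel (Lst (x k))) (centered_normal limit_variance)"
  and "\<exists>M. \<forall>k. integrable P (\<lambda>\<omega>. (Lst (x k) \<omega>)\<^sup>2) \<and> (\<integral>\<omega>. (Lst (x k) \<omega>)\<^sup>2 \<partial>P) \<le> M"
proof -
 define n where "n k = window_start (x k / \<mu>)" for k
 have nlim: "filterlim n at_top sequentially" unfolding n_def[abs_def] by (rule start_at_top[OF x])
 obtain Cg where Cg: "\<And>k. \<bar>rate_g (x k)\<bar> \<le> Cg"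
  using convergent_imp_Bseq[OF convergentI[OF rate_limits(1)[OF x]]] unfolding Bseq_def by auto
 obtain Cf where Cf: "\<And>k. \<bar>rate_f (x k)\<bar> \<le> Cf"
  using convergent_imp_Bseq[OF convergentI[OF rate_limits(2)[OF x]]] unfolding Bseq_def by auto
 have Cg0: "Cg \<ge> 0" and Cf0: "Cf \<ge> 0" using order_trans[OF abs_ge_zero Cg[of 0]] order_trans[OF abs_ge_zero Cf[of 0]] .
 note pm = proj_measurable[OF g_L2] and pi = proj_square_integrable[OF g_L2] and p0 = proj_mean[OF g_L2]
 have fm: "(\<lambda>s. f s - \<mu>) \<in> borel_measurable K" by measurable
 have prodi: "integrable K (\<lambda>s. u s * w s)" if "u \<in> borel_measurable K" "integrable K (\<lambda>s. (u s)\<^sup>2)" "w \<in> borel_measurable K" "integrable K (\<lambda>s. (w s)\<^sup>2)" for u w :: "'s \<Rightarrow> real"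
 proof (rule Bochner_Integration.integrable_bound)
  show "integrable K (\<lambda>s. (u s)\<^sup>2 + (w s)\<^sup>2)" using that by simp
  show "AE s in K. norm (u s * w s) \<le> norm ((u s)\<^sup>2 + (w s)\<^sup>2)"
  proof (rule AE_I2)
   fix s
   have "2 * (\<bar>u s\<bar> * \<bar>w s\<bar>) \<le> (u s)\<^sup>2 + (w s)\<^sup>2" using sum_squares_bound[of "\<bar>u s\<bar>" "\<bar>w s\<bar>"] by simp
   moreover have "0 \<le> \<bar>u s\<bar> * \<bar>w s\<bar>" by simp
   moreover have "norm ((u s)\<^sup>2 + (w s)\<^sup>2) = (u s)\<^sup>2 + (w s)\<^sup>2" by simp
   moreover have "norm (u s * w s) = \<bar>u s\<bar> * \<bar>w s\<bar>" by (simp add: abs_mult)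
   ultimately show "norm (u s * w s) \<le> norm ((u s)\<^sup>2 + (w s)\<^sup>2)" by linarith
  qed
 qed (use that in measurable)
 \<comment> \<open>Scaled weights are at most 1 and the convergent rates are bounded, so
   \<open>H\<close> dominates all terms for all k.\<close>
 define H where "H s = Cg * (\<Sum>a\<in>{1..d}. \<bar>proj g a s\<bar>) + Cf * \<bar>f s - \<mu>\<bar>" for s
 have H: "H \<in> borel_measurable K"
 proof -
  have [measurable]: "proj g a \<in> borel_measurable K" if "a \<in> {1..d}" for a by (rule pm[OF that])
  show ?thesis unfolding H_def[abs_def] by measurable
 qed
 have H2: "integrable K (\<lambda>s. (H s)\<^sup>2)"
 proof -
  have e: "(H s)\<^sup>2 = Cg\<^sup>2 * (\<Sum>a\<in>{1..d}. \<Sum>c\<in>{1..d}. \<bar>proj g a s\<bar> * \<bar>proj g c s\<bar>) + 2 * Cg * Cf * (\<Sum>a\<in>{1..d}. \<bar>proj g a s\<bar> * \<bar>f s - \<mu>\<bar>) + Cf\<^sup>2 * (f s - \<mu>)\<^sup>2" for s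
  proof -
   define S where "S = (\<Sum>a\<in>{1..d}. \<bar>proj g a s\<bar>)"
   have SS: "(\<Sum>a\<in>{1..d}. \<Sum>c\<in>{1..d}. \<bar>proj g a s\<bar> * \<bar>proj g c s\<bar>) = S\<^sup>2"
    by (simp add: S_def power2_eq_square sum_product)
   have Sf: "(\<Sum>a\<in>{1..d}. \<bar>proj g a s\<bar> * \<bar>f s - \<mu>\<bar>) = S * \<bar>f s - \<mu>\<bar>"
    by (simp add: S_def sum_distrib_right)
   show ?thesis unfolding SS Sf H_def S_def[symmetric] by (simp add: power2_sum power_mult_distrib ac_simps)
  qed
  show ?thesis unfolding e
   by (intro Bochner_Integration.integrable_add integrable_mult_right Bochner_Integration.integrable_sum prodi centered_square(1))
     (auto intro!: pm pi borel_measurable_abs centered_square(1) fm)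
 qed
 have le: "\<bar>lin_term (x k) j s\<bar> \<le> H s" for k j s
 proof (cases "j \<in> {1..n k}")
  case False
  then have "lin_term (x k) j s = 0" unfolding n_def lin_term_def Let_def by (rule if_not_P)
  moreover have "H s \<ge> 0" unfolding H_def using Cg0 Cf0 by (intro add_nonneg_nonneg mult_nonneg_nonneg sum_nonneg) auto
  ultimately show ?thesis by simp
 next
  case True
  have "\<bar>\<Sum>a\<in>{1..d}. weight (n k) a j / real (n k) ^ (d - 1) * proj g a s\<bar> \<le> (\<Sum>a\<in>{1..d}. \<bar>proj g a s\<bar>)"
  proof (rule order_trans[OF sum_abs sum_mono])
   fix a assume a: "a \<in> {1..d}"
   show "\<bar>weight (n k) a j / real (n k) ^ (d - 1) * proj g a s\<bar> \<le> \<bar>proj g a s\<bar>"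
    using weight_bounds[OF a True] by (simp only: abs_mult abs_of_nonneg mult_left_le_one_le abs_ge_zero)
  qed
  then have "\<bar>rate_g (x k)\<bar> * \<bar>\<Sum>a\<in>{1..d}. weight (n k) a j / real (n k) ^ (d - 1) * proj g a s\<bar> \<le> Cg * (\<Sum>a\<in>{1..d}. \<bar>proj g a s\<bar>)"
   using Cg[of k] Cg0 by (intro mult_mono) auto
  moreover have "\<bar>rate_f (x k)\<bar> * \<bar>f s - \<mu>\<bar> \<le> Cf * \<bar>f s - \<mu>\<bar>" using Cf[of k] by (intro mult_right_mono) auto
  moreover have "\<bar>lin_term (x k) j s\<bar> \<le> \<bar>rate_g (x k)\<bar> * \<bar>\<Sum>a\<in>{1..d}. weight (n k) a j / real (n k) ^ (d - 1) * proj g a s\<bar> + \<bar>rate_f (x k)\<bar> * \<bar>f s - \<mu>\<bar>"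
   using True unfolding lin_term_def Let_def n_def[symmetric] abs_mult[symmetric] by (simp add: abs_triangle_ineq4)
  ultimately show ?thesis unfolding H_def by linarith
 qed
 have mean0: "(\<integral>s. lin_term (x k) j s \<partial>K) = 0" for k j
 proof (cases "j \<in> {1..n k}")
  case True
  have "(\<integral>s. lin_term (x k) j s \<partial>K) = (\<integral>s. rate_g (x k) * (\<Sum>a\<in>{1..d}. weight (n k) a j / real (n k) ^ (d - 1) * proj g a s) - rate_f (x k) * (f s - \<mu>) \<partial>K)"
   using True unfolding lin_term_def Let_def n_def[symmetric] by simp
  also have "\<dots> = (\<integral>s. rate_g (x k) * (\<Sum>a\<in>{1..d}. weight (n k) a j / real (n k) ^ (d - 1) * proj g a s) \<partial>K) - (\<integral>s. rate_f (x k) * (f s - \<mu>) \<partial>K)"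
   using f_integrable by (intro Bochner_Integration.integral_diff integrable_mult_right Bochner_Integration.integrable_sum proj_integrable[OF g_L2]) auto
  also have "(\<integral>s. rate_g (x k) * (\<Sum>a\<in>{1..d}. weight (n k) a j / real (n k) ^ (d - 1) * proj g a s) \<partial>K) = rate_g (x k) * (\<Sum>a\<in>{1..d}. weight (n k) a j / real (n k) ^ (d - 1) * (\<integral>s. proj g a s \<partial>K))"
   using proj_integrable[OF g_L2] by (simp add: Bochner_Integration.integral_sum)
  also have "\<dots> = 0" using p0 by simp
  finally show ?thesis using centered_square(2) by simp
 next
  case False
  then have "lin_term (x k) j s = 0" for s unfolding n_def lin_term_def Let_def by (rule if_not_P)
  then show ?thesis by simp
 qed
 have sq: "(\<integral>s. (lin_term (x k) j s)\<^sup>2 \<partial>K)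
   = (rate_g (x k))\<^sup>2 * (\<Sum>a\<in>{1..d}. \<Sum>c\<in>{1..d}. (weight (n k) a j / real (n k) ^ (d - 1)) * (weight (n k) c j / real (n k) ^ (d - 1)) * (\<integral>s. proj g a s * proj g c s \<partial>K))
    - 2 * (rate_g (x k) * rate_f (x k)) * (\<Sum>a\<in>{1..d}. weight (n k) a j / real (n k) ^ (d - 1) * (\<integral>s. (f s - \<mu>) * proj g a s \<partial>K))
    + (rate_f (x k))\<^sup>2 * (\<integral>s. (f s - \<mu>)\<^sup>2 \<partial>K)" if j: "j \<in> {1..n k}" for k j
 proof -
  define b where "b a = weight (n k) a j / real (n k) ^ (d - 1)" for a
  have e: "(lin_term (x k) j s)\<^sup>2 = (rate_g (x k))\<^sup>2 * (\<Sum>a\<in>{1..d}. \<Sum>c\<in>{1..d}. b a * b c * (proj g a s * proj g c s))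
    - 2 * (rate_g (x k) * rate_f (x k)) * (\<Sum>a\<in>{1..d}. b a * ((f s - \<mu>) * proj g a s)) + (rate_f (x k))\<^sup>2 * (f s - \<mu>)\<^sup>2" for s
  proof -
   define B where "B = (\<Sum>a\<in>{1..d}. b a * proj g a s)"
   have BB: "B\<^sup>2 = (\<Sum>a\<in>{1..d}. \<Sum>c\<in>{1..d}. b a * b c * (proj g a s * proj g c s))"
    by (simp add: B_def power2_eq_square sum_product ac_simps)
   have Bf: "B * (f s - \<mu>) = (\<Sum>a\<in>{1..d}. b a * ((f s - \<mu>) * proj g a s))"
    unfolding B_def sum_distrib_right by (intro sum.cong refl) (simp only: ac_simps)
   have "lin_term (x k) j s = rate_g (x k) * B - rate_f (x k) * (f s - \<mu>)"
    using j unfolding lin_term_def Let_def n_def[symmetric] B_def b_def by simp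
   then have "(lin_term (x k) j s)\<^sup>2 = (rate_g (x k))\<^sup>2 * B\<^sup>2 - 2 * (rate_g (x k) * rate_f (x k)) * (B * (f s - \<mu>)) + (rate_f (x k))\<^sup>2 * (f s - \<mu>)\<^sup>2"
    by (simp add: power2_diff power_mult_distrib)
   then show ?thesis unfolding BB Bf .
  qed
  have i1: "integrable K (\<lambda>s. proj g a s * proj g c s)" if "a \<in> {1..d}" "c \<in> {1..d}" for a c
   using that by (intro prodi pm pi)
  have i2: "integrable K (\<lambda>s. (f s - \<mu>) * proj g a s)" if "a \<in> {1..d}" for a
   using that by (intro prodi pm pi centered_square(1) fm)
  have I1: "integrable K (\<lambda>s. \<Sum>a\<in>{1..d}. \<Sum>c\<in>{1..d}. b a * b c * (proj g a s * proj g c s))"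
   by (intro Bochner_Integration.integrable_sum integrable_mult_right i1)
  have I2: "integrable K (\<lambda>s. \<Sum>a\<in>{1..d}. b a * ((f s - \<mu>) * proj g a s))"
   by (intro Bochner_Integration.integrable_sum integrable_mult_right i2)
  have J1: "(\<integral>s. (\<Sum>a\<in>{1..d}. \<Sum>c\<in>{1..d}. b a * b c * (proj g a s * proj g c s)) \<partial>K) = (\<Sum>a\<in>{1..d}. \<Sum>c\<in>{1..d}. b a * b c * (\<integral>s. proj g a s * proj g c s \<partial>K))"
  proof -
   have "(\<integral>s. (\<Sum>a\<in>{1..d}. \<Sum>c\<in>{1..d}. b a * b c * (proj g a s * proj g c s)) \<partial>K) = (\<Sum>a\<in>{1..d}. \<integral>s. (\<Sum>c\<in>{1..d}. b a * b c * (proj g a s * proj g c s)) \<partial>K)"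
    by (intro Bochner_Integration.integral_sum Bochner_Integration.integrable_sum integrable_mult_right i1)
   also have "\<dots> = (\<Sum>a\<in>{1..d}. \<Sum>c\<in>{1..d}. \<integral>s. b a * b c * (proj g a s * proj g c s) \<partial>K)"
    by (intro sum.cong refl Bochner_Integration.integral_sum integrable_mult_right i1)
   finally show ?thesis by simp
  qed
  have J2: "(\<integral>s. (\<Sum>a\<in>{1..d}. b a * ((f s - \<mu>) * proj g a s)) \<partial>K) = (\<Sum>a\<in>{1..d}. b a * (\<integral>s. (f s - \<mu>) * proj g a s \<partial>K))"
  proof -
   have "(\<integral>s. (\<Sum>a\<in>{1..d}. b a * ((f s - \<mu>) * proj g a s)) \<partial>K) = (\<Sum>a\<in>{1..d}. \<integral>s. b a * ((f s - \<mu>) * proj g a s) \<partial>K)"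
    by (intro Bochner_Integration.integral_sum integrable_mult_right i2)
   then show ?thesis by simp
  qed
  have "(\<integral>s. (lin_term (x k) j s)\<^sup>2 \<partial>K) = (rate_g (x k))\<^sup>2 * (\<integral>s. (\<Sum>a\<in>{1..d}. \<Sum>c\<in>{1..d}. b a * b c * (proj g a s * proj g c s)) \<partial>K)
    - 2 * (rate_g (x k) * rate_f (x k)) * (\<integral>s. (\<Sum>a\<in>{1..d}. b a * ((f s - \<mu>) * proj g a s)) \<partial>K) + (rate_f (x k))\<^sup>2 * (\<integral>s. (f s - \<mu>)\<^sup>2 \<partial>K)"
   unfolding e using I1 I2 centered_square(1) by simp
  then show ?thesis unfolding J1 J2 unfolding b_def .
 qed
 define Cpp where "Cpp a c = (\<integral>s. proj g a s * proj g c s \<partial>K)" for a c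
 define Cfp where "Cfp a = (\<integral>s. (f s - \<mu>) * proj g a s \<partial>K)" for a
 define vf where "vf = (\<integral>s. (f s - \<mu>)\<^sup>2 \<partial>K)"
 define A where "A m a c = (\<Sum>j\<in>{1..m}. (weight m a j / real m ^ (d - 1)) * (weight m c j / real m ^ (d - 1))) / real m" for m a c
 define E where "E m a = (\<Sum>j\<in>{1..m}. weight m a j / real m ^ (d - 1)) / real m" for m a
 \<comment> \<open>Exchanging the sums confines j to averages of weights and of their products,
   whose limits are known.\<close>
 have avg: "(\<Sum>j\<in>{1..n k}. \<integral>s. (lin_term (x k) j s)\<^sup>2 \<partial>K) / n k = (rate_g (x k))\<^sup>2 * (\<Sum>a\<in>{1..d}. \<Sum>c\<in>{1..d}. A (n k) a c * Cpp a c)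
   - 2 * (rate_g (x k) * rate_f (x k)) * (\<Sum>a\<in>{1..d}. E (n k) a * Cfp a) + (rate_f (x k))\<^sup>2 * vf" if nk: "n k > 0" for k
 proof -
  let ?b = "\<lambda>a j. weight (n k) a j / real (n k) ^ (d - 1)"
  have "(\<Sum>j\<in>{1..n k}. \<integral>s. (lin_term (x k) j s)\<^sup>2 \<partial>K) = (\<Sum>j\<in>{1..n k}. (rate_g (x k))\<^sup>2 * (\<Sum>a\<in>{1..d}. \<Sum>c\<in>{1..d}. ?b a j * ?b c j * Cpp a c)
    - 2 * (rate_g (x k) * rate_f (x k)) * (\<Sum>a\<in>{1..d}. ?b a j * Cfp a) + (rate_f (x k))\<^sup>2 * vf)"
   unfolding Cpp_def Cfp_def vf_def by (rule sum.cong[OF refl sq])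
  also have "\<dots> = (rate_g (x k))\<^sup>2 * (\<Sum>j\<in>{1..n k}. \<Sum>a\<in>{1..d}. \<Sum>c\<in>{1..d}. ?b a j * ?b c j * Cpp a c)
    - 2 * (rate_g (x k) * rate_f (x k)) * (\<Sum>j\<in>{1..n k}. \<Sum>a\<in>{1..d}. ?b a j * Cfp a) + real (n k) * ((rate_f (x k))\<^sup>2 * vf)"
   by (simp only: sum.distrib sum_subtractf sum_distrib_left[symmetric] sum_constant card_atLeastAtMost) simp
  also have "(\<Sum>j\<in>{1..n k}. \<Sum>a\<in>{1..d}. \<Sum>c\<in>{1..d}. ?b a j * ?b c j * Cpp a c) = real (n k) * (\<Sum>a\<in>{1..d}. \<Sum>c\<in>{1..d}. A (n k) a c * Cpp a c)"
  proof -
   have "(\<Sum>j\<in>{1..n k}. \<Sum>a\<in>{1..d}. \<Sum>c\<in>{1..d}. ?b a j * ?b c j * Cpp a c) = (\<Sum>a\<in>{1..d}. \<Sum>c\<in>{1..d}. \<Sum>j\<in>{1..n k}. ?b a j * ?b c j * Cpp a c)"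
    by (subst sum.swap) (intro sum.cong refl sum.swap)
   also have "\<dots> = (\<Sum>a\<in>{1..d}. \<Sum>c\<in>{1..d}. real (n k) * (A (n k) a c * Cpp a c))"
    using nk by (intro sum.cong refl) (simp add: A_def sum_distrib_right)
   finally show ?thesis by (simp only: sum_distrib_left)
  qed
  also have "(\<Sum>j\<in>{1..n k}. \<Sum>a\<in>{1..d}. ?b a j * Cfp a) = real (n k) * (\<Sum>a\<in>{1..d}. E (n k) a * Cfp a)"
  proof -
   have "(\<Sum>j\<in>{1..n k}. \<Sum>a\<in>{1..d}. ?b a j * Cfp a) = (\<Sum>a\<in>{1..d}. \<Sum>j\<in>{1..n k}. ?b a j * Cfp a)" by (rule sum.swap)
   also have "\<dots> = (\<Sum>a\<in>{1..d}. real (n k) * (E (n k) a * Cfp a))"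
    using nk by (intro sum.cong refl) (simp add: E_def sum_distrib_right)
   finally show ?thesis by (simp only: sum_distrib_left)
  qed
  finally show ?thesis using nk by (simp add: add_divide_distrib diff_divide_distrib)
 qed
 have conv: "(\<lambda>k. (\<Sum>j\<in>{1..n k}. \<integral>s. (lin_term (x k) j s)\<^sup>2 \<partial>K) / n k) \<longlonglongrightarrow> limit_variance"
 proof (rule Lim_transform_eventually)
  have "(\<lambda>k. (rate_g (x k))\<^sup>2 * (\<Sum>a\<in>{1..d}. \<Sum>c\<in>{1..d}. A (n k) a c * Cpp a c)
   - 2 * (rate_g (x k) * rate_f (x k)) * (\<Sum>a\<in>{1..d}. E (n k) a * Cfp a) + (rate_f (x k))\<^sup>2 * vf)
   \<longlonglongrightarrow> rate_g_limit\<^sup>2 * (\<Sum>a\<in>{1..d}. \<Sum>c\<in>{1..d}.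
   fact (a + c - 2) * fact (2 * d - a - c) / (fact (a - 1) * fact (c - 1) * fact (d - a) * fact (d - c) * fact (2 * d - 1)) * Cpp a c)
   - 2 * (rate_g_limit * rate_f_limit) * (\<Sum>a\<in>{1..d}. 1 / fact d * Cfp a) + rate_f_limit\<^sup>2 * vf"
   unfolding A_def E_def
   by (intro tendsto_add tendsto_diff tendsto_mult tendsto_power tendsto_const rate_limits[OF x] tendsto_sum
     filterlim_compose[OF sum_weight_product_tendsto nlim] filterlim_compose[OF sum_weight_tendsto nlim])
  then show "(\<lambda>k. (rate_g (x k))\<^sup>2 * (\<Sum>a\<in>{1..d}. \<Sum>c\<in>{1..d}. A (n k) a c * Cpp a c)
   - 2 * (rate_g (x k) * rate_f (x k)) * (\<Sum>a\<in>{1..d}. E (n k) a * Cfp a) + (rate_f (x k))\<^sup>2 * vf) \<longlonglongrightarrow> limit_variance"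
   unfolding limit_variance_def Cpp_def Cfp_def vf_def .
  have "\<forall>\<^sub>F k in sequentially. n k \<ge> 1" using nlim unfolding filterlim_at_top by blast
  then show "\<forall>\<^sub>F k in sequentially. (rate_g (x k))\<^sup>2 * (\<Sum>a\<in>{1..d}. \<Sum>c\<in>{1..d}. A (n k) a c * Cpp a c)
   - 2 * (rate_g (x k) * rate_f (x k)) * (\<Sum>a\<in>{1..d}. E (n k) a * Cfp a) + (rate_f (x k))\<^sup>2 * vf = (\<Sum>j\<in>{1..n k}. \<integral>s. (lin_term (x k) j s)\<^sup>2 \<partial>K) / n k"
   by eventually_elim (rule avg[symmetric], simp)
 qed
 note clt = weighted_clt[OF nlim _ H H2 le mean0 conv]
 show "limit_variance \<ge> 0" by (rule clt(1)) measurable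
 show "weak_conv_m (\<lambda>k. distr P borel (Lst (x k))) (centered_normal limit_variance)"
  using clt(2) unfolding Lst_def[abs_def] n_def by (simp add: lin_term_measurable)
 have second: "integrable P (\<lambda>\<omega>. (Lst (x k) \<omega>)\<^sup>2) \<and> (\<integral>\<omega>. (Lst (x k) \<omega>)\<^sup>2 \<partial>P) \<le> (\<integral>s. (H s)\<^sup>2 \<partial>K)" for k
 proof -
  have li: "integrable K (\<lambda>s. (lin_term (x k) j s)\<^sup>2)" for j
  proof (rule Bochner_Integration.integrable_bound[OF H2])
   show "AE s in K. norm ((lin_term (x k) j s)\<^sup>2) \<le> norm ((H s)\<^sup>2)"
    using power_mono[OF le abs_ge_zero, of _ _ _ 2] by (intro AE_I2) simp
  qed measurable
  have e: "(Lst (x k) \<omega>)\<^sup>2 = (\<Sum>i\<in>{1..n k}. \<Sum>j\<in>{1..n k}. lin_term (x k) i (\<omega> i) * lin_term (x k) j (\<omega> j)) / n k" for \<omega>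
   by (simp add: Lst_def n_def power_divide power2_eq_square sum_product)
  have i: "integrable P (\<lambda>\<omega>. lin_term (x k) i (\<omega> i) * lin_term (x k) j (\<omega> j))" for i j
   by (rule integral_coord_mult(1)[OF lin_term_measurable li lin_term_measurable li])
  have "(\<integral>\<omega>. (Lst (x k) \<omega>)\<^sup>2 \<partial>P) = (\<Sum>i\<in>{1..n k}. \<Sum>j\<in>{1..n k}. \<integral>\<omega>. lin_term (x k) i (\<omega> i) * lin_term (x k) j (\<omega> j) \<partial>P) / n k"
   unfolding e using i by (simp add: Bochner_Integration.integral_sum)
  also have "\<dots> = (\<Sum>i\<in>{1..n k}. \<Sum>j\<in>{1..n k}. if i = j then \<integral>s. (lin_term (x k) i s)\<^sup>2 \<partial>K else 0) / n k"
  proof (intro arg_cong[where f="\<lambda>z. z / real (n k)"] sum.cong refl)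
   fix i j
   show "(\<integral>\<omega>. lin_term (x k) i (\<omega> i) * lin_term (x k) j (\<omega> j) \<partial>P) = (if i = j then \<integral>s. (lin_term (x k) i s)\<^sup>2 \<partial>K else 0)"
    using integral_coord_mult(2)[OF lin_term_measurable li lin_term_measurable li, of i j] mean0
     integral_coord[of "\<lambda>s. (lin_term (x k) i s)\<^sup>2" i] by (auto simp: power2_eq_square)
  qed
  also have "\<dots> = (\<Sum>i\<in>{1..n k}. \<integral>s. (lin_term (x k) i s)\<^sup>2 \<partial>K) / n k" by simp
  also have "\<dots> \<le> (\<Sum>i\<in>{1..n k}. \<integral>s. (H s)\<^sup>2 \<partial>K) / n k"
  proof (intro divide_right_mono sum_mono integral_mono li H2)
   show "(lin_term (x k) i s)\<^sup>2 \<le> (H s)\<^sup>2" for i s using power_mono[OF le abs_ge_zero, of k i s 2] by simp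
  qed simp
  also have "\<dots> \<le> (\<integral>s. (H s)\<^sup>2 \<partial>K)" by simp
  finally show ?thesis unfolding e using i by simp
 qed
 then show "\<exists>M. \<forall>k. integrable P (\<lambda>\<omega>. (Lst (x k) \<omega>)\<^sup>2) \<and> (\<integral>\<omega>. (Lst (x k) \<omega>)\<^sup>2 \<partial>P) \<le> M" by blast
qed

end

section \<open>From Lipschitz to continuous test functions\<close>

text \<open>For bounded \<Phi> and m \<ge> 0 this is its largest m-Lipschitz minorant, the
  Pasch-Hausdorff envelope.\<close>

definition inf_convolution :: "('a::metric_space \<Rightarrow> real) \<Rightarrow> real \<Rightarrow> 'a \<Rightarrow> real" where
 "inf_convolution \<Phi> m z = (INF w. \<Phi> w + m * dist z w)"

context
 fixes \<Phi> :: "'a::metric_space \<Rightarrow> real" and B :: real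
 assumes bd: "\<And>z. \<bar>\<Phi> z\<bar> \<le> B"
begin

lemma inf_convolution_bdd: assumes "m \<ge> 0" shows "bdd_below (range (\<lambda>w. \<Phi> w + m * dist z w))"
proof (rule bdd_belowI2[where m="- B"])
 fix w show "- B \<le> \<Phi> w + m * dist z w"
  using bd[of w] mult_nonneg_nonneg[OF assms zero_le_dist[of z w]] by linarith
qed

lemma inf_convolution_le: "m \<ge> 0 \<Longrightarrow> inf_convolution \<Phi> m z \<le> \<Phi> w + m * dist z w"
 unfolding inf_convolution_def by (rule cINF_lower[OF inf_convolution_bdd]) auto

lemma inf_convolution_ge: "m \<ge> 0 \<Longrightarrow> (\<And>w. c \<le> \<Phi> w + m * dist z w) \<Longrightarrow> c \<le> inf_convolution \<Phi> m z"
 unfolding inf_convolution_def by (rule cINF_greatest) auto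

lemma inf_convolution_abs_le: assumes "m \<ge> 0" shows "\<bar>inf_convolution \<Phi> m z\<bar> \<le> B"
proof -
 have "inf_convolution \<Phi> m z \<le> \<Phi> z" using inf_convolution_le[OF assms, of z z] by simp
 moreover have "- B \<le> inf_convolution \<Phi> m z"
 proof (rule inf_convolution_ge[OF assms])
  fix w show "- B \<le> \<Phi> w + m * dist z w" using bd[of w] mult_nonneg_nonneg[OF assms zero_le_dist[of z w]] by linarith
 qed
 ultimately show ?thesis using bd[of z] by linarith
qed

lemma inf_convolution_lipschitz: assumes m: "m \<ge> 0" shows "\<bar>inf_convolution \<Phi> m z - inf_convolution \<Phi> m z'\<bar> \<le> m * dist z z'"
proof -
 have "inf_convolution \<Phi> m u - m * dist u v \<le> inf_convolution \<Phi> m v" for u v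
 proof (rule inf_convolution_ge[OF m])
  fix w
  have "m * dist u w \<le> m * (dist u v + dist v w)" using m by (intro mult_left_mono dist_triangle)
  then show "inf_convolution \<Phi> m u - m * dist u v \<le> \<Phi> w + m * dist v w"
   using inf_convolution_le[OF m, of u w] by (simp add: distrib_left)
 qed
 from this[of z z'] this[of z' z] show ?thesis by (simp add: dist_commute)
qed

text \<open>Points at distance at least \<delta> cannot lower the infimum once m \<delta> reaches 2
  B, and nearer points have nearly the value at z.\<close>

lemma inf_convolution_tendsto:
 assumes "isCont \<Phi> z" shows "(\<lambda>m. inf_convolution \<Phi> (real m) z) \<longlonglongrightarrow> \<Phi> z"
proof (rule tendstoI)
 fix e :: real assume e: "e > 0"
 then obtain \<delta> where \<delta>: "\<delta> > 0" "\<And>w. dist w z < \<delta> \<Longrightarrow> dist (\<Phi> w) (\<Phi> z) < e / 2"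
  using assms[unfolded continuous_at_eps_delta, rule_format, of "e / 2"] by auto
 obtain m0 :: nat where m0: "2 * B / \<delta> < real m0" using reals_Archimedean2 by blast
 show "\<forall>\<^sub>F m in sequentially. dist (inf_convolution \<Phi> (real m) z) (\<Phi> z) < e"
  using eventually_ge_at_top[of m0]
 proof eventually_elim
  case (elim m)
  have m: "2 * B \<le> real m * \<delta>"
  proof -
   have "2 * B / \<delta> \<le> real m" using m0 elim by simp
   then show ?thesis using \<delta>(1) by (simp add: divide_le_eq)
  qed
  have "\<Phi> z - e / 2 \<le> inf_convolution \<Phi> (real m) z"
  proof (rule inf_convolution_ge)
   fix w
   show "\<Phi> z - e / 2 \<le> \<Phi> w + real m * dist z w"
   proof (cases "dist w z < \<delta>")
    case True
    have "0 \<le> real m * dist z w" by simp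
    then show ?thesis using \<delta>(2)[OF True] unfolding dist_real_def by linarith
   next
    case False
    then have "real m * \<delta> \<le> real m * dist z w" by (intro mult_left_mono) (auto simp: dist_commute)
    then show ?thesis using m bd[of z] bd[of w] e by linarith
   qed
  qed simp
  moreover have "inf_convolution \<Phi> (real m) z \<le> \<Phi> z" using inf_convolution_le[of "real m" z z] by simp
  ultimately show ?case using e unfolding dist_real_def by linarith
 qed
qed

end

lemma lipschitz_borel:
 fixes \<Phi> :: "'a::metric_space \<Rightarrow> real"
 assumes L: "\<And>z w. \<bar>\<Phi> z - \<Phi> w\<bar> \<le> L * dist z w"
 shows "continuous_on UNIV \<Phi>" "\<Phi> \<in> borel_measurable borel"
proof -
 have "(max 0 L)-lipschitz_on UNIV \<Phi>"
 proof (rule lipschitz_onI)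
  fix z w :: 'a
  have "L * dist z w \<le> max 0 L * dist z w" by (rule mult_right_mono) auto
  then show "dist (\<Phi> z) (\<Phi> w) \<le> max 0 L * dist z w" using L[of z w] unfolding dist_real_def by linarith
 qed simp
 then show c: "continuous_on UNIV \<Phi>" by (rule lipschitz_on_continuous_on)
 then show "\<Phi> \<in> borel_measurable borel" by (rule borel_measurable_continuous_onI)
qed

text \<open>Lipschitz minorants bound the expectations from below; the same for -\<Phi> bounds them
  from above.\<close>

lemma convergence_from_lipschitz:
 fixes Z :: "nat \<Rightarrow> 'w \<Rightarrow> 'a::metric_space" and \<Phi> :: "'a \<Rightarrow> real"
 assumes "prob_space M" "prob_space \<nu>" and sets: "sets \<nu> = sets borel"
  and Z: "\<And>k. Z k \<in> borel_measurable M"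
  and lip: "\<And>\<Psi> B L. (\<And>z::'a. \<bar>\<Psi> z\<bar> \<le> B) \<Longrightarrow> (\<And>z w. \<bar>\<Psi> z - \<Psi> w\<bar> \<le> L * dist z w) \<Longrightarrow>
    (\<lambda>k. \<integral>\<omega>. \<Psi> (Z k \<omega>) \<partial>M) \<longlonglongrightarrow> (\<integral>z. \<Psi> z \<partial>\<nu>)"
  and cont: "continuous_on UNIV \<Phi>" and B: "\<And>z. \<bar>\<Phi> z\<bar> \<le> B"
 shows "(\<lambda>k. \<integral>\<omega>. \<Phi> (Z k \<omega>) \<partial>M) \<longlonglongrightarrow> (\<integral>z. \<Phi> z \<partial>\<nu>)"
proof -
 interpret M: prob_space M by fact
 interpret \<nu>: prob_space \<nu> by fact
 have lower: "\<forall>\<^sub>F k in sequentially. (\<integral>z. \<Phi> z \<partial>\<nu>) - e < (\<integral>\<omega>. \<Phi> (Z k \<omega>) \<partial>M)"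
  if cont: "continuous_on UNIV \<Phi>" and B: "\<And>z. \<bar>\<Phi> z\<bar> \<le> B" and e: "e > 0" for \<Phi> :: "'a \<Rightarrow> real" and e :: real
 proof -
  define \<Psi> where "\<Psi> m = inf_convolution \<Phi> (real m)" for m
  have \<Psi>B: "\<bar>\<Psi> m z\<bar> \<le> B" for m z unfolding \<Psi>_def by (rule inf_convolution_abs_le[OF B]) simp
  have \<Psi>L: "\<bar>\<Psi> m z - \<Psi> m w\<bar> \<le> real m * dist z w" for m z w unfolding \<Psi>_def by (rule inf_convolution_lipschitz[OF B]) simp
  have \<Phi>m: "\<Phi> \<in> borel_measurable borel" by (rule borel_measurable_continuous_onI[OF cont])
  have m\<nu>: "h \<in> borel_measurable \<nu>" if "h \<in> borel_measurable borel" for h :: "'a \<Rightarrow> real"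
   using that measurable_cong_sets[OF sets refl] by blast
  have "(\<lambda>m. \<integral>z. \<Psi> m z \<partial>\<nu>) \<longlonglongrightarrow> (\<integral>z. \<Phi> z \<partial>\<nu>)"
  proof (rule integral_dominated_convergence[where w="\<lambda>_. B"])
   show "AE z in \<nu>. (\<lambda>m. \<Psi> m z) \<longlonglongrightarrow> \<Phi> z"
    unfolding \<Psi>_def using cont by (intro AE_I2 inf_convolution_tendsto[OF B]) (simp add: continuous_on_eq_continuous_at)
   show "AE z in \<nu>. norm (\<Psi> m z) \<le> B" for m using \<Psi>B by simp
  qed (auto intro: m\<nu> \<Phi>m lipschitz_borel(2)[OF \<Psi>L])
  then have "\<forall>\<^sub>F m in sequentially. (\<integral>z. \<Phi> z \<partial>\<nu>) - e / 2 < (\<integral>z. \<Psi> m z \<partial>\<nu>)"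
   by (rule order_tendstoD) (use e in simp)
  then obtain m where m: "(\<integral>z. \<Phi> z \<partial>\<nu>) - e / 2 < (\<integral>z. \<Psi> m z \<partial>\<nu>)" by (auto simp: eventually_sequentially)
  have "\<forall>\<^sub>F k in sequentially. (\<integral>z. \<Psi> m z \<partial>\<nu>) - e / 2 < (\<integral>\<omega>. \<Psi> m (Z k \<omega>) \<partial>M)"
   using lip[OF \<Psi>B \<Psi>L] by (rule order_tendstoD) (use e in simp)
  then show ?thesis
  proof eventually_elim
   case (elim k)
   have "(\<integral>\<omega>. \<Psi> m (Z k \<omega>) \<partial>M) \<le> (\<integral>\<omega>. \<Phi> (Z k \<omega>) \<partial>M)"
   proof (rule integral_mono)
    show "integrable M (\<lambda>\<omega>. \<Psi> m (Z k \<omega>))"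
     by (rule M.integrable_const_bound[where B=B]) (use \<Psi>B in simp, rule measurable_compose[OF Z lipschitz_borel(2)[OF \<Psi>L]])
    show "integrable M (\<lambda>\<omega>. \<Phi> (Z k \<omega>))"
     by (rule M.integrable_const_bound[where B=B]) (use B in simp, rule measurable_compose[OF Z \<Phi>m])
    show "\<Psi> m (Z k \<omega>) \<le> \<Phi> (Z k \<omega>)" for \<omega>
     unfolding \<Psi>_def using inf_convolution_le[where \<Phi>=\<Phi> and B=B and m="real m" and z="Z k \<omega>" and w="Z k \<omega>", OF B] by simp
   qed
   then show ?case using elim m by linarith
  qed
 qed
 show ?thesis
 proof (rule tendstoI)
  fix e :: real assume e: "e > 0"
  have "\<forall>\<^sub>F k in sequentially. (\<integral>z. - \<Phi> z \<partial>\<nu>) - e < (\<integral>\<omega>. - \<Phi> (Z k \<omega>) \<partial>M)"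
   by (rule lower[OF _ _ e]) (use cont B in \<open>auto intro: continuous_on_minus\<close>)
  then show "\<forall>\<^sub>F k in sequentially. dist (\<integral>\<omega>. \<Phi> (Z k \<omega>) \<partial>M) (\<integral>z. \<Phi> z \<partial>\<nu>) < e"
   using lower[OF cont B e]
  proof eventually_elim
   case (elim k)
   then have "(\<integral>z. \<Phi> z \<partial>\<nu>) - e < (\<integral>\<omega>. \<Phi> (Z k \<omega>) \<partial>M)" "- (\<integral>z. \<Phi> z \<partial>\<nu>) - e < - (\<integral>\<omega>. \<Phi> (Z k \<omega>) \<partial>M)" by simp_all
   then show ?case unfolding dist_real_def by linarith
  qed
 qed
qed

section \<open>The joint limit\<close>

context ustat_renewal
begin

lemma Lst_splice: "Lst x (splice {window_start (x / \<mu>)<..} \<pi> u v) = Lst x u"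
 unfolding Lst_def by (intro arg_cong[where f="\<lambda>s. s / _"] sum.cong refl) (simp add: splice_def)

text \<open>Statistic and overshoot may refer to different levels x and y at bounded distance, which
  the conditional statements require. The set A of admissible levels is later the line or the
  lattice; \<open>inv\<close> keeps the level that remains after n steps in A.\<close>

theorem joint_limit_lipschitz:
 fixes x y :: "nat \<Rightarrow> real" and A :: "real set" and \<Phi> :: "real \<times> real \<Rightarrow> real"
 assumes \<rho>: "real_distribution \<rho>"
  and lim: "\<And>\<psi> B L. (\<And>r. \<bar>\<psi> r\<bar> \<le> B) \<Longrightarrow> (\<And>r r'. \<bar>\<psi> r - \<psi> r'\<bar> \<le> L * \<bar>r - r'\<bar>) \<Longrightarrow>
    ((\<lambda>z. \<integral>\<omega>. \<psi> (R z \<omega>) \<partial>P) \<longlongrightarrow> (\<integral>r. \<psi> r \<partial>\<rho>)) (at_top \<sqinter> principal A)"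
  and inv: "\<And>z n. z \<in> A \<Longrightarrow> AE \<omega> in P. z - U n \<omega> \<in> A"
  and x: "filterlim x at_top sequentially" and yA: "\<And>k. y k \<in> A" and yx: "\<And>k. \<bar>y k - x k\<bar> \<le> C"
  and N: "N = Nm \<or> N = Np"
  and B: "\<And>z. \<bar>\<Phi> z\<bar> \<le> B" and L: "\<And>z w. \<bar>\<Phi> z - \<Phi> w\<bar> \<le> L * dist z w"
 shows "(\<lambda>k. \<integral>\<omega>. \<Phi> (Vst N (x k) \<omega>, R (y k) \<omega>) \<partial>P) \<longlonglongrightarrow> (\<integral>z. \<Phi> z \<partial>(centered_normal limit_variance \<Otimes>\<^sub>M \<rho>))"
proof -
 interpret \<rho>: real_distribution \<rho> by (rule \<rho>)
 have rv: "real_distribution (centered_normal limit_variance)"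
  by (rule real_distribution_centered_normal[OF Lst_clt(1)[OF x]])
 interpret G: real_distribution "centered_normal limit_variance" by (rule rv)
 interpret G\<rho>: pair_prob_space "centered_normal limit_variance" \<rho> ..
 have L0: "L \<ge> 0" using L[of "(1, 0)" "(0, 0)"] by (simp add: dist_Pair_Pair)
 have B0: "B \<ge> 0" using order_trans[OF abs_ge_zero B] .
 have \<Phi>m [measurable]: "\<Phi> \<in> borel_measurable (borel \<Otimes>\<^sub>M borel)"
  using lipschitz_borel(2)[OF L] by (simp add: borel_prod)
 have L1: "\<bar>\<Phi> (a, r) - \<Phi> (b, r)\<bar> \<le> L * \<bar>a - b\<bar>" for a b r using L[of "(a, r)" "(b, r)"] by (simp add: dist_Pair_Pair dist_real_def)
 have L2: "\<bar>\<Phi> (a, r) - \<Phi> (a, r')\<bar> \<le> L * \<bar>r - r'\<bar>" for a r r' using L[of "(a, r)" "(a, r')"] by (simp add: dist_Pair_Pair dist_real_def)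
 have Nmeas: "N z \<in> measurable P (count_space UNIV)" for z using N Nm_measurable Np_measurable' by auto
 have [measurable]: "Vst N z \<in> borel_measurable P" for z by (rule Vst_measurable[OF Nmeas])
 have int: "integrable P (\<lambda>\<omega>. \<Phi> (h \<omega>, h' \<omega>))" if [measurable]: "h \<in> borel_measurable P" "h' \<in> borel_measurable P" for h h'
  using B by (intro pp.P.integrable_const_bound[where B=B]) auto
 \<comment> \<open>The expectation with the statistic frozen at t and level z still to be passed;
   \<open>w'\<close> is its limit in z.\<close>
 define w where "w t z = (\<integral>\<omega>. \<Phi> (t, R z \<omega>) \<partial>P)" for t z
 define w' where "w' t = (\<integral>r. \<Phi> (t, r) \<partial>\<rho>)" for t
 have \<rho>int: "integrable \<rho> (\<lambda>r. \<Phi> (t, r))" for t using B by (intro \<rho>.integrable_const_bound[where B=B]) auto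
 have w'B: "\<bar>w' t\<bar> \<le> B" for t
 proof -
  have "\<bar>w' t\<bar> \<le> (\<integral>r. \<bar>\<Phi> (t, r)\<bar> \<partial>\<rho>)" unfolding w'_def by (rule integral_abs_bound)
  also have "\<dots> \<le> (\<integral>r. B \<partial>\<rho>)" using B \<rho>int by (intro integral_mono integrable_abs) auto
  finally show ?thesis using \<rho>.prob_space by simp
 qed
 have wL: "\<bar>w s z - w t z\<bar> \<le> L * \<bar>s - t\<bar>" for s t z
 proof -
  have "w s z - w t z = (\<integral>\<omega>. \<Phi> (s, R z \<omega>) - \<Phi> (t, R z \<omega>) \<partial>P)"
   unfolding w_def by (intro Bochner_Integration.integral_diff[symmetric] int) measurable
  also have "\<bar>\<dots>\<bar> \<le> (\<integral>\<omega>. \<bar>\<Phi> (s, R z \<omega>) - \<Phi> (t, R z \<omega>)\<bar> \<partial>P)" by (rule integral_abs_bound)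
  also have "\<dots> \<le> (\<integral>\<omega>. L * \<bar>s - t\<bar> \<partial>P)"
   using L1 by (intro integral_mono integrable_abs Bochner_Integration.integrable_diff int) auto
  finally show ?thesis by (simp add: pp.P.prob_space)
 qed
 have w'L: "\<bar>w' s - w' t\<bar> \<le> L * \<bar>s - t\<bar>" for s t
 proof -
  have "w' s - w' t = (\<integral>r. \<Phi> (s, r) - \<Phi> (t, r) \<partial>\<rho>)"
   unfolding w'_def by (intro Bochner_Integration.integral_diff[symmetric] \<rho>int)
  also have "\<bar>\<dots>\<bar> \<le> (\<integral>r. \<bar>\<Phi> (s, r) - \<Phi> (t, r)\<bar> \<partial>\<rho>)" by (rule integral_abs_bound)
  also have "\<dots> \<le> (\<integral>r. L * \<bar>s - t\<bar> \<partial>\<rho>)"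
   using L1 by (intro integral_mono integrable_abs Bochner_Integration.integrable_diff \<rho>int) auto
  finally show ?thesis using \<rho>.prob_space by simp
 qed
 have w'cont: "continuous_on UNIV w'" and w'm [measurable]: "w' \<in> borel_measurable borel"
  using lipschitz_borel[of w' L] w'L by (auto simp: dist_real_def)
 \<comment> \<open>For a single t this is the overshoot limit; a finite grid of values t and the
   common Lipschitz constant make it uniform on bounded sets.\<close>
 have unif: "\<forall>\<^sub>F z in at_top \<sqinter> principal A. \<forall>t. \<bar>t\<bar> \<le> c \<longrightarrow> \<bar>w t z - w' t\<bar> \<le> e" if e: "e > 0" for c e
 proof -
  define \<delta> where "\<delta> = e / (3 * (L + 1))"
  have \<delta>: "\<delta> > 0" "L * \<delta> \<le> e / 3" using e L0 by (auto simp: \<delta>_def field_simps)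
  define m where "m = \<lceil>c / \<delta>\<rceil>"
  have "\<forall>\<^sub>F z in at_top \<sqinter> principal A. \<forall>i\<in>{- m - 1..m}. \<bar>w (of_int i * \<delta>) z - w' (of_int i * \<delta>)\<bar> < e / 3"
  proof (rule eventually_ball_finite)
   show "\<forall>i\<in>{- m - 1..m}. \<forall>\<^sub>F z in at_top \<sqinter> principal A. \<bar>w (of_int i * \<delta>) z - w' (of_int i * \<delta>)\<bar> < e / 3"
   proof
    fix i
    have "((\<lambda>z. w (of_int i * \<delta>) z) \<longlongrightarrow> w' (of_int i * \<delta>)) (at_top \<sqinter> principal A)"
     unfolding w_def w'_def by (rule lim[of "\<lambda>r. \<Phi> (of_int i * \<delta>, r)" B L, OF B L2])
    then show "\<forall>\<^sub>F z in at_top \<sqinter> principal A. \<bar>w (of_int i * \<delta>) z - w' (of_int i * \<delta>)\<bar> < e / 3"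
     using e by (auto dest!: tendstoD[where e="e / 3"] simp: dist_real_def)
   qed
  qed simp
  then show ?thesis
  proof eventually_elim
   case (elim z)
   show ?case
   proof (intro allI impI)
    fix t assume t: "\<bar>t\<bar> \<le> c"
    define i where "i = \<lfloor>t / \<delta>\<rfloor>"
    have "\<bar>t / \<delta>\<bar> \<le> c / \<delta>" using t \<delta>(1) by (simp add: divide_right_mono)
    then have i: "i \<in> {- m - 1..m}" unfolding i_def m_def abs_le_iff atLeastAtMost_iff by linarith
    have "of_int i * \<delta> \<le> (t / \<delta>) * \<delta>" "(t / \<delta>) * \<delta> \<le> (of_int i + 1) * \<delta>"
     unfolding i_def using \<delta>(1) by (intro mult_right_mono; linarith)+
    then have "\<bar>t - of_int i * \<delta>\<bar> \<le> \<delta>" using \<delta>(1) by (simp add: algebra_simps)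
    then have Ld: "L * \<bar>t - of_int i * \<delta>\<bar> \<le> e / 3" using mult_left_mono[OF _ L0] \<delta>(2) by (meson order_trans)
    from elim i have "\<bar>w (of_int i * \<delta>) z - w' (of_int i * \<delta>)\<bar> < e / 3" by blast
    then show "\<bar>w t z - w' t\<bar> \<le> e" using wL[of t z "of_int i * \<delta>"] w'L[of t "of_int i * \<delta>"] Ld by linarith
   qed
  qed
 qed
 have v1: "vanishes (\<lambda>k \<omega>. Vst N (x k) \<omega> - Lst (x k) \<omega>)"
  using vanishes_add[OF Vst_Tst_vanishes[OF x N] Tst_Lst_vanishes[OF x]] by simp
 \<comment> \<open>A bounded Lipschitz test function turns the difference of the two statistics,
   which vanishes in probability, into a vanishing difference of expectations.\<close>
 have S1: "(\<lambda>k. (\<integral>\<omega>. \<Phi> (Vst N (x k) \<omega>, R (y k) \<omega>) \<partial>P) - (\<integral>\<omega>. \<Phi> (Lst (x k) \<omega>, R (y k) \<omega>) \<partial>P)) \<longlonglongrightarrow> 0"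
 proof (rule Lim_null_comparison[OF always_eventually[OF allI]])
  fix k
  have pt: "\<bar>\<Phi> (a, r) - \<Phi> (b, r)\<bar> \<le> (2 * B + L) * min 1 \<bar>a - b\<bar>" for a b r
  proof (cases "\<bar>a - b\<bar> \<le> 1")
   case True
   have "L * \<bar>a - b\<bar> \<le> (2 * B + L) * \<bar>a - b\<bar>" using B0 by (intro mult_right_mono) auto
   then show ?thesis using L1[of a r b] True by (simp add: min_absorb2)
  next
   case False
   then show ?thesis using B[of "(a, r)"] B[of "(b, r)"] L0 by (simp add: min_absorb1)
  qed
  define D where "D \<omega> = \<Phi> (Vst N (x k) \<omega>, R (y k) \<omega>) - \<Phi> (Lst (x k) \<omega>, R (y k) \<omega>)" for \<omega>
  have D: "integrable P D" unfolding D_def[abs_def] by (intro Bochner_Integration.integrable_diff int) measurable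
  have "(\<integral>\<omega>. \<Phi> (Vst N (x k) \<omega>, R (y k) \<omega>) \<partial>P) - (\<integral>\<omega>. \<Phi> (Lst (x k) \<omega>, R (y k) \<omega>) \<partial>P) = (\<integral>\<omega>. D \<omega> \<partial>P)"
   unfolding D_def by (intro Bochner_Integration.integral_diff[symmetric] int) measurable
  moreover have "\<bar>\<integral>\<omega>. D \<omega> \<partial>P\<bar> \<le> (\<integral>\<omega>. \<bar>D \<omega>\<bar> \<partial>P)" by (rule integral_abs_bound)
  moreover have "(\<integral>\<omega>. \<bar>D \<omega>\<bar> \<partial>P) \<le> (\<integral>\<omega>. (2 * B + L) * min 1 \<bar>Vst N (x k) \<omega> - Lst (x k) \<omega>\<bar> \<partial>P)"
  proof (rule integral_mono)
   show "integrable P (\<lambda>\<omega>. (2 * B + L) * min 1 \<bar>Vst N (x k) \<omega> - Lst (x k) \<omega>\<bar>)"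
    by (intro integrable_mult_right min_integrable) measurable
   show "\<bar>D \<omega>\<bar> \<le> (2 * B + L) * min 1 \<bar>Vst N (x k) \<omega> - Lst (x k) \<omega>\<bar>" for \<omega> unfolding D_def by (rule pt)
  qed (rule integrable_abs[OF D])
  moreover have "(\<integral>\<omega>. (2 * B + L) * min 1 \<bar>Vst N (x k) \<omega> - Lst (x k) \<omega>\<bar> \<partial>P) = (2 * B + L) * (\<integral>\<omega>. min 1 \<bar>Vst N (x k) \<omega> - Lst (x k) \<omega>\<bar> \<partial>P)"
   by (rule integral_mult_right_zero)
  ultimately show "norm ((\<integral>\<omega>. \<Phi> (Vst N (x k) \<omega>, R (y k) \<omega>) \<partial>P) - (\<integral>\<omega>. \<Phi> (Lst (x k) \<omega>, R (y k) \<omega>) \<partial>P)) \<le> (2 * B + L) * (\<integral>\<omega>. min 1 \<bar>Vst N (x k) \<omega> - Lst (x k) \<omega>\<bar> \<partial>P)"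
   unfolding real_norm_def by linarith
 next
  show "(\<lambda>k. (2 * B + L) * (\<integral>\<omega>. min 1 \<bar>Vst N (x k) \<omega> - Lst (x k) \<omega>\<bar> \<partial>P)) \<longlonglongrightarrow> 0"
   by (rule tendsto_mult_right_zero[OF vanishesD(2)[OF v1]])
 qed
 obtain M where M: "\<And>k. integrable P (\<lambda>\<omega>. (Lst (x k) \<omega>)\<^sup>2)" "\<And>k. (\<integral>\<omega>. (Lst (x k) \<omega>)\<^sup>2 \<partial>P) \<le> M"
  using Lst_clt(3)[OF x] by blast
 define W where "W k \<omega> = 4 / (\<mu> * real (window_mesh (x k / \<mu>)) ^ 3) * (U (window_start (x k / \<mu>)) \<omega> - \<mu> * window_start (x k / \<mu>))" for k \<omega>
 have W: "vanishes W" unfolding W_def[abs_def] by (rule centered_deviation_vanishes[OF x])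
 have S2: "(\<lambda>k. (\<integral>\<omega>. \<Phi> (Lst (x k) \<omega>, R (y k) \<omega>) \<partial>P) - (\<integral>\<omega>. w' (Lst (x k) \<omega>) \<partial>P)) \<longlonglongrightarrow> 0"
 proof (rule tendstoI)
  fix e :: real assume e: "e > 0"
  \<comment> \<open>By Markov's inequality with the second moment bound M, values of
    \<open>Lst\<close> beyond c contribute at most e / 4.\<close>
  define c where "c = sqrt (8 * (B + 1) * (\<bar>M\<bar> + 1) / e)"
  have c2: "c\<^sup>2 = 8 * (B + 1) * (\<bar>M\<bar> + 1) / e" unfolding c_def using e B0 by simp
  have cpos: "c\<^sup>2 > 0" unfolding c2 using e B0 by (intro divide_pos_pos mult_pos_pos) auto
  from unif[of "e / 4" c] e have "\<forall>\<^sub>F z in at_top. z \<in> A \<longrightarrow> (\<forall>t. \<bar>t\<bar> \<le> c \<longrightarrow> \<bar>w t z - w' t\<bar> \<le> e / 4)"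
   by (simp add: eventually_inf_principal)
  then obtain z0 where z0: "\<And>z t. z \<ge> z0 \<Longrightarrow> z \<in> A \<Longrightarrow> \<bar>t\<bar> \<le> c \<Longrightarrow> \<bar>w t z - w' t\<bar> \<le> e / 4"
   unfolding eventually_at_top_linorder by blast
  have tk: "filterlim (\<lambda>k. x k / \<mu>) at_top sequentially" by (rule filterlim_level[OF x])
  have ev1: "\<forall>\<^sub>F k in sequentially. x k / \<mu> \<ge> 32" using tk by (simp add: filterlim_at_top)
  \<comment> \<open>Ensures that after n typical steps the remaining level still exceeds z0,
    although y may differ from x by C.\<close>
  have ev2: "\<forall>\<^sub>F k in sequentially. \<mu> / 4 * (x k / \<mu>) powr (1/5) \<ge> \<bar>z0\<bar> + \<bar>C\<bar>"
  proof -
   have "filterlim (\<lambda>t::real. m / 4 * t powr (1/5)) at_top at_top" if "m > 0" for m :: real using that by real_asymp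
   from filterlim_compose[OF this[OF \<mu>_pos] tk] show ?thesis unfolding filterlim_at_top by blast
  qed
  have ev3: "\<forall>\<^sub>F k in sequentially. 2 * B * (\<integral>\<omega>. min 1 \<bar>W k \<omega>\<bar> \<partial>P) < e / 4"
   using tendsto_mult_right_zero[OF vanishesD(2)[OF W], of "2 * B"] by (rule order_tendstoD) (use e in simp)
  from ev1 ev2 ev3 show "\<forall>\<^sub>F k in sequentially. dist ((\<integral>\<omega>. \<Phi> (Lst (x k) \<omega>, R (y k) \<omega>) \<partial>P) - (\<integral>\<omega>. w' (Lst (x k) \<omega>) \<partial>P)) 0 < e"
  proof eventually_elim
   case (elim k)
   define n where "n = window_start (x k / \<mu>)"
   define I where "I u = (\<integral>v. \<Phi> (Lst (x k) u, R (y k) (splice {n<..} (\<lambda>j. j - n) u v)) \<partial>P)" for u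
   have inj: "inj_on (\<lambda>j. j - n) {n<..}" by (auto simp: inj_on_def)
   have hi: "integrable P (\<lambda>\<omega>. \<Phi> (Lst (x k) \<omega>, R (y k) \<omega>))" by (rule int) measurable
   have Lsp: "Lst (x k) (splice {n<..} (\<lambda>j. j - n) u v) = Lst (x k) u" for u v unfolding n_def by (rule Lst_splice)
   note sp = integral_splice[OF inj hi, unfolded Lsp]
   have Ii: "integrable P I" unfolding I_def[abs_def] using PP.integrable_fst[OF sp(1)] .
   have eq: "(\<integral>\<omega>. \<Phi> (Lst (x k) \<omega>, R (y k) \<omega>) \<partial>P) = (\<integral>u. I u \<partial>P)" unfolding I_def by (rule sp(2))
   have IB: "\<bar>I u\<bar> \<le> B" if u: "u \<in> space P" for u
   proof -
    have [measurable]: "splice {n<..} (\<lambda>j. j - n) u \<in> measurable P P" by (rule measurable_splice_snd[OF u])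
    have i: "integrable P (\<lambda>v. \<Phi> (Lst (x k) u, R (y k) (splice {n<..} (\<lambda>j. j - n) u v)))" by (rule int) measurable
    have "\<bar>I u\<bar> \<le> (\<integral>v. \<bar>\<Phi> (Lst (x k) u, R (y k) (splice {n<..} (\<lambda>j. j - n) u v))\<bar> \<partial>P)" unfolding I_def by (rule integral_abs_bound)
    also have "\<dots> \<le> (\<integral>v. B \<partial>P)" using B by (intro integral_mono integrable_abs i) auto
    finally show ?thesis by (simp add: pp.P.prob_space)
   qed
   have w'i: "integrable P (\<lambda>u. w' (Lst (x k) u))" using w'B by (intro pp.P.integrable_const_bound[where B=B]) auto
   have key: "AE u in P. \<bar>I u - w' (Lst (x k) u)\<bar> \<le> e / 4 + 2 * B * ((Lst (x k) u)\<^sup>2 / c\<^sup>2) + 2 * B * min 1 \<bar>W k u\<bar>"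
    using AE_regular inv[OF yA[of k], of n] AE_space
   proof eventually_elim
    case u: (elim u)
    have t1: "0 \<le> 2 * B * ((Lst (x k) u)\<^sup>2 / c\<^sup>2)" and t2: "0 \<le> 2 * B * min 1 \<bar>W k u\<bar>" using B0 by auto
    have triv: "\<bar>I u - w' (Lst (x k) u)\<bar> \<le> 2 * B" using IB[OF u(3)] w'B[of "Lst (x k) u"] by linarith
    \<comment> \<open>An atypical sum at time n, a large linear statistic, or the main case; the
      first two are absorbed by the last two terms of the bound.\<close>
    consider "\<bar>W k u\<bar> \<ge> 1" | "\<bar>Lst (x k) u\<bar> > \<bar>c\<bar>" | "\<bar>W k u\<bar> < 1" "\<bar>Lst (x k) u\<bar> \<le> \<bar>c\<bar>" by linarith
    then show ?case
    proof cases
     case 1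
     then have "min 1 \<bar>W k u\<bar> = 1" by simp
     then show ?thesis using triv t1 e by (simp only: mult_1_right)
    next
     case 2
     then have "\<bar>c\<bar>\<^sup>2 \<le> \<bar>Lst (x k) u\<bar>\<^sup>2" by (intro power_mono) auto
     then have "1 \<le> (Lst (x k) u)\<^sup>2 / c\<^sup>2" using cpos by (simp add: le_divide_eq)
     then have "2 * B * 1 \<le> 2 * B * ((Lst (x k) u)\<^sup>2 / c\<^sup>2)" using B0 by (intro mult_left_mono) auto
     then show ?thesis using triv t2 e by linarith
    next
     case 3
     note wb = window_bounds[OF elim(1)]
     define q where "q = real (window_mesh (x k / \<mu>)) ^ 3"
     have q: "\<mu> * q > 0" using wb(5) \<mu>_pos by (simp add: q_def)
     have "\<bar>y'\<bar> \<le> r / 4" if "\<bar>4 / r * y'\<bar> < 1" "r > 0" for r y' :: real using that by (simp add: abs_mult field_simps)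
     from this[OF 3(1)[unfolded W_def, folded q_def] q]
     have D: "\<bar>U n u - \<mu> * n\<bar> \<le> \<mu> * q / 4" by (simp add: n_def)
     have "\<mu> * n \<le> \<mu> * (x k / \<mu> - q)" using wb(9) \<mu>_pos by (intro mult_left_mono) (auto simp: n_def q_def)
     then have "\<mu> * n \<le> x k - \<mu> * q" using \<mu>_pos by (simp add: right_diff_distrib)
     then have Un: "U n u \<le> x k - 3 / 4 * (\<mu> * q)" using D by linarith
     have "(x k / \<mu>) powr (1/5) / 2 \<le> q"
     proof -
      have "real (window_mesh (x k / \<mu>)) \<le> real (window_mesh (x k / \<mu>)) ^ 3" using wb(5) by (intro self_le_power) auto
      then show ?thesis using wb(3) unfolding q_def by linarith
     qed
     then have "\<mu> * ((x k / \<mu>) powr (1/5) / 2) \<le> \<mu> * q" using \<mu>_pos by (intro mult_left_mono) auto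
     then have "\<mu> * q \<ge> 2 * (\<bar>z0\<bar> + \<bar>C\<bar>)" using elim(2) by (simp add: mult.commute)
     moreover have "x k - \<bar>C\<bar> \<le> y k" using yx[of k] by linarith
     moreover have "a \<le> y1 - U1" if "2 * (a + c1) \<le> q1" "x1 - c1 \<le> y1" "U1 \<le> x1 - 3 / 4 * q1" "0 \<le> a" "0 \<le> c1" for a c1 q1 x1 y1 U1 :: real
      using that by (simp add: field_simps)
     ultimately have far: "\<bar>z0\<bar> \<le> y k - U n u" using Un by (meson abs_ge_zero)
     \<comment> \<open>The level is not passed before time n, so the overshoot is that of the fresh
       walk over the remaining level.\<close>
     have below: "U m u \<le> y k" if "m < n" for m
      using regular_mono[OF u(1), of m n] that far by linarith
     have [measurable]: "splice {n<..} (\<lambda>j. j - n) u \<in> measurable P P" by (rule measurable_splice_snd[OF u(3)])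
     have "I u = w (Lst (x k) u) (y k - U n u)"
      unfolding I_def w_def
     proof (rule integral_cong_AE)
      show "AE v in P. \<Phi> (Lst (x k) u, R (y k) (splice {n<..} (\<lambda>j. j - n) u v)) = \<Phi> (Lst (x k) u, R (y k - U n u) v)"
       using AE_regular by eventually_elim (simp add: R_split[OF below])
     qed measurable
     moreover have "\<bar>w (Lst (x k) u) (y k - U n u) - w' (Lst (x k) u)\<bar> \<le> e / 4"
     proof (rule z0)
      show "z0 \<le> y k - U n u" using far by linarith
      have "0 \<le> c" unfolding c_def using e B0 by simp
      then show "\<bar>Lst (x k) u\<bar> \<le> c" using 3(2) by simp
     qed (rule u(2))
     ultimately have "\<bar>I u - w' (Lst (x k) u)\<bar> \<le> e / 4" by (simp only:)
     then show ?thesis using t1 t2 by linarith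
    qed
   qed
   have Wi: "integrable P (\<lambda>u. min 1 \<bar>W k u\<bar>)" by (rule min_integrable[OF vanishesD(1)[OF W]])
   have "2 * B * ((\<integral>u. (Lst (x k) u)\<^sup>2 \<partial>P) / c\<^sup>2) \<le> 2 * (B + 1) * ((\<bar>M\<bar> + 1) / c\<^sup>2)"
    using B0 M(2)[of k] by (intro mult_mono divide_right_mono) auto
   also have "\<dots> = e / 4"
   proof -
    have "2 * b * (m / (8 * b * m / e)) = e / 4" if "b > 0" "m > 0" for b m :: real using that e by (simp add: field_simps)
    from this[of "B + 1" "\<bar>M\<bar> + 1"] show ?thesis unfolding c2 using B0 by simp
   qed
   finally have c3: "2 * B * ((\<integral>u. (Lst (x k) u)\<^sup>2 \<partial>P) / c\<^sup>2) \<le> e / 4" .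
   have "(\<integral>u. I u \<partial>P) - (\<integral>u. w' (Lst (x k) u) \<partial>P) = (\<integral>u. I u - w' (Lst (x k) u) \<partial>P)"
    by (rule Bochner_Integration.integral_diff[symmetric, OF Ii w'i])
   moreover have "\<bar>\<integral>u. I u - w' (Lst (x k) u) \<partial>P\<bar> \<le> (\<integral>u. \<bar>I u - w' (Lst (x k) u)\<bar> \<partial>P)" by (rule integral_abs_bound)
   moreover have "(\<integral>u. \<bar>I u - w' (Lst (x k) u)\<bar> \<partial>P) \<le> (\<integral>u. e / 4 + 2 * B * ((Lst (x k) u)\<^sup>2 / c\<^sup>2) + 2 * B * min 1 \<bar>W k u\<bar> \<partial>P)"
    by (rule integral_mono_AE[OF _ _ key])
     (intro integrable_abs Bochner_Integration.integrable_diff Ii w'i Bochner_Integration.integrable_add integrable_mult_right integrable_divide M(1) Wi pp.P.integrable_const)+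
   moreover have "(\<integral>u. e / 4 + 2 * B * ((Lst (x k) u)\<^sup>2 / c\<^sup>2) + 2 * B * min 1 \<bar>W k u\<bar> \<partial>P) = e / 4 + 2 * B * ((\<integral>u. (Lst (x k) u)\<^sup>2 \<partial>P) / c\<^sup>2) + 2 * B * (\<integral>u. min 1 \<bar>W k u\<bar> \<partial>P)"
    using M(1)[of k] Wi by (simp add: pp.P.prob_space)
   ultimately show ?case unfolding eq dist_real_def using c3 elim(3) e by linarith
  qed
 qed
 have Lr: "real_distribution (distr P borel (Lst (x k)))" for k by (intro pp.P.real_distribution_distr) measurable
 have "(\<lambda>k. \<integral>t. w' t \<partial>distr P borel (Lst (x k))) \<longlonglongrightarrow> (\<integral>t. w' t \<partial>centered_normal limit_variance)"
  by (rule weak_conv_imp_integral_bdd_continuous_conv[OF Lr rv Lst_clt(2)[OF x]])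
   (use w'cont w'B in \<open>auto simp: continuous_on_eq_continuous_at\<close>)
 then have S3: "(\<lambda>k. \<integral>\<omega>. w' (Lst (x k) \<omega>) \<partial>P) \<longlonglongrightarrow> (\<integral>t. w' t \<partial>centered_normal limit_variance)"
  by (simp add: integral_distr)
 have "integrable (centered_normal limit_variance \<Otimes>\<^sub>M \<rho>) \<Phi>"
 proof (rule G\<rho>.integrable_const_bound[where B=B])
  show "AE z in centered_normal limit_variance \<Otimes>\<^sub>M \<rho>. norm (\<Phi> z) \<le> B" using B by simp
  show "\<Phi> \<in> borel_measurable (centered_normal limit_variance \<Otimes>\<^sub>M \<rho>)"
   using \<Phi>m by (simp cong: measurable_cong_sets add: measurable_cong_sets[OF sets_pair_measure_cong[OF G.events_eq_borel \<rho>.events_eq_borel] refl])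
 qed
 then have "(\<integral>t. w' t \<partial>centered_normal limit_variance) = (\<integral>z. \<Phi> z \<partial>(centered_normal limit_variance \<Otimes>\<^sub>M \<rho>))"
  unfolding w'_def by (rule G\<rho>.integral_fst')
 with tendsto_add[OF tendsto_add[OF S1 S2] S3] show ?thesis by simp
qed

end

text \<open>Failure of convergence yields points of A beyond max(x0, k) for every k, so a real
  parameter reduces to sequences that stay beyond any chosen x0.\<close>

lemma tendsto_at_top_within_sequentially:
 fixes G :: "real \<Rightarrow> 'a::metric_space"
 assumes G: "\<And>x. filterlim x at_top sequentially \<Longrightarrow> (\<And>k. x k \<in> A) \<Longrightarrow> (\<And>k. x k \<ge> x0) \<Longrightarrow> (\<lambda>k. G (x k)) \<longlonglongrightarrow> l"
 shows "(G \<longlongrightarrow> l) (at_top \<sqinter> principal A)"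
proof (rule tendstoI, rule ccontr)
 fix e :: real assume e: "e > 0" and ne: "\<not> (\<forall>\<^sub>F x in at_top \<sqinter> principal A. dist (G x) l < e)"
 have "\<exists>x. x \<ge> max x0 (real k) \<and> x \<in> A \<and> \<not> dist (G x) l < e" for k
  using ne unfolding eventually_inf_principal eventually_at_top_linorder by blast
 then obtain x where x: "\<And>k. x k \<ge> max x0 (real k)" "\<And>k. x k \<in> A" "\<And>k. \<not> dist (G (x k)) l < e" by metis
 have "filterlim x at_top sequentially"
  by (rule filterlim_at_top_mono[OF filterlim_real_sequentially always_eventually]) (use x(1) in auto)
 then have "(\<lambda>k. G (x k)) \<longlonglongrightarrow> l" by (rule G) (use x in auto)
 from tendstoD[OF this e] x(3) show False by simp
qed

lemma exists_point:
 assumes "measure M E > 0" and "AE \<omega> in M. Q \<omega>" shows "\<exists>\<omega>\<in>E. Q \<omega>"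
proof (rule ccontr)
 assume "\<not> (\<exists>\<omega>\<in>E. Q \<omega>)"
 with assms(2) have "AE \<omega> in M. \<omega> \<notin> E" by (auto elim!: eventually_mono)
 moreover have "E \<in> sets M" using assms(1) measure_notin_sets[of E M] by fastforce
 ultimately have "E \<in> null_sets M" by (simp only: AE_iff_null_sets)
 then show False using assms(1) unfolding measure_def by (simp only: null_setsD1 enn2real_0 less_irrefl)
qed

lemma multiples_diff: "a \<in> multiples h \<Longrightarrow> b \<in> multiples h \<Longrightarrow> a - b \<in> multiples h"
proof -
 assume "a \<in> multiples h" "b \<in> multiples h"
 then obtain i j :: int where "a = of_int i * h" "b = of_int j * h" by (auto simp: multiples_def)
 then have "a - b = of_int (i - j) * h" by (simp add: algebra_simps)
 then show ?thesis unfolding multiples_def by (rule range_eqI)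
qed

lemma multiples_of_nat: "real j * h \<in> multiples h"
 unfolding multiples_def by (rule range_eqI[of _ _ "int j"]) simp

lemma multiples_gap: assumes "h > 0" "a \<in> multiples h" "b \<in> multiples h" "a < b" shows "a + h \<le> b"
proof -
 from assms obtain i j :: int where ij: "a = of_int i * h" "b = of_int j * h" by (auto simp: multiples_def)
 with assms have "i + 1 \<le> j" by simp
 then have "of_int (i + 1) * h \<le> of_int j * h" using assms(1) by (intro mult_right_mono) simp_all
 then show ?thesis using ij by (simp add: distrib_right)
qed

section \<open>Continuous test functions, and conditioning on a value of the overshoot\<close>

context ustat_renewal
begin

lemma Vst_stopped_measurable: "N = Nm \<or> N = Np \<Longrightarrow> Vst N z \<in> borel_measurable P"
 by (rule Vst_measurable) (use Nm_measurable Np_measurable' in auto)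

lemma joint_limit_continuous:
 fixes x y :: "nat \<Rightarrow> real" and A :: "real set" and \<Phi> :: "real \<times> real \<Rightarrow> real"
 assumes \<rho>: "real_distribution \<rho>"
  and lim: "\<And>\<psi> B L. (\<And>r. \<bar>\<psi> r\<bar> \<le> B) \<Longrightarrow> (\<And>r r'. \<bar>\<psi> r - \<psi> r'\<bar> \<le> L * \<bar>r - r'\<bar>) \<Longrightarrow>
    ((\<lambda>z. \<integral>\<omega>. \<psi> (R z \<omega>) \<partial>P) \<longlongrightarrow> (\<integral>r. \<psi> r \<partial>\<rho>)) (at_top \<sqinter> principal A)"
  and inv: "\<And>z n. z \<in> A \<Longrightarrow> AE \<omega> in P. z - U n \<omega> \<in> A"
  and x: "filterlim x at_top sequentially" and yA: "\<And>k. y k \<in> A" and yx: "\<And>k. \<bar>y k - x k\<bar> \<le> C"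
  and N: "N = Nm \<or> N = Np"
  and cont: "continuous_on UNIV \<Phi>" and B: "\<And>z. \<bar>\<Phi> z\<bar> \<le> B"
 shows "(\<lambda>k. \<integral>\<omega>. \<Phi> (Vst N (x k) \<omega>, R (y k) \<omega>) \<partial>P) \<longlonglongrightarrow> (\<integral>z. \<Phi> z \<partial>(centered_normal limit_variance \<Otimes>\<^sub>M \<rho>))"
proof (rule convergence_from_lipschitz[where Z="\<lambda>k \<omega>. (Vst N (x k) \<omega>, R (y k) \<omega>)", OF _ _ _ _ _ cont B])
 interpret \<rho>: real_distribution \<rho> by (rule \<rho>)
 interpret G: real_distribution "centered_normal limit_variance"
  by (rule real_distribution_centered_normal[OF Lst_clt(1)[OF x]])
 interpret G\<rho>: pair_prob_space "centered_normal limit_variance" \<rho> ..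
 show "prob_space P" by (rule pp.P.prob_space_axioms)
 show "prob_space (centered_normal limit_variance \<Otimes>\<^sub>M \<rho>)" by (rule G\<rho>.P.prob_space_axioms)
 show "sets (centered_normal limit_variance \<Otimes>\<^sub>M \<rho>) = sets borel"
  unfolding sets_pair_measure_cong[OF G.events_eq_borel \<rho>.events_eq_borel] borel_prod ..
 note [measurable] = Vst_stopped_measurable[OF N]
 show "(\<lambda>\<omega>. (Vst N (x k) \<omega>, R (y k) \<omega>)) \<in> borel_measurable P" for k unfolding borel_prod[symmetric] by measurable
 show "(\<lambda>k. \<integral>\<omega>. \<Psi> (Vst N (x k) \<omega>, R (y k) \<omega>) \<partial>P) \<longlonglongrightarrow> (\<integral>z. \<Psi> z \<partial>(centered_normal limit_variance \<Otimes>\<^sub>M \<rho>))"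
  if "\<And>z. \<bar>\<Psi> z\<bar> \<le> B" "\<And>z w. \<bar>\<Psi> z - \<Psi> w\<bar> \<le> L * dist z w" for \<Psi> :: "real \<times> real \<Rightarrow> real" and B L
  by (rule joint_limit_lipschitz[OF \<rho> lim inv x yA yx N that])
qed

lemma overshoot_limit_lattice_lipschitz:
 assumes h: "h > 0" and lat: "AE s in K. f s \<in> multiples h"
  and max: "\<And>c. c > 0 \<Longrightarrow> AE s in K. f s \<in> multiples c \<Longrightarrow> c \<le> h"
  and "\<And>r. \<bar>\<psi> r\<bar> \<le> B" "\<And>r r'. \<bar>\<psi> r - \<psi> r'\<bar> \<le> L * \<bar>r - r'\<bar>"
 shows "((\<lambda>z. \<integral>\<omega>. \<psi> (R z \<omega>) \<partial>P) \<longlongrightarrow> (\<integral>r. \<psi> r \<partial>lattice_law h)) (at_top \<sqinter> principal (multiples h))"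
 by (rule overshoot_limit_lattice[OF bdd_borel_lipschitz[of \<psi> B L] h lat max]) (use assms(4,5) in auto)

lemma AE_diff_U_lattice:
 assumes lat: "AE s in K. f s \<in> multiples h" and z: "z \<in> multiples h"
 shows "AE \<omega> in P. z - U n \<omega> \<in> multiples h"
 using AE_U_lattice[OF lat] by eventually_elim (simp add: multiples_diff[OF z])

lemma AE_R_lattice:
 assumes lat: "AE s in K. f s \<in> multiples h" and z: "z \<in> multiples h"
 shows "AE \<omega> in P. R z \<omega> \<in> multiples h"
 using AE_U_lattice[OF lat] by eventually_elim (simp add: overshoot_def multiples_diff[OF _ z])

text \<open>From a level y \<ge> 0 the overshoot is at most the step that causes it, so an overshoot
  r of positive probability needs steps of size at least r.\<close>

lemma overshoot_atom_pos:
 assumes y: "y \<ge> 0" and A: "pp.P.prob A > 0" "AE \<omega> in P. \<omega> \<in> A \<longrightarrow> R y \<omega> = r"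
 shows "prob {s \<in> space K. f s \<ge> r} > 0"
proof (rule ccontr)
 assume "\<not> prob {s \<in> space K. f s \<ge> r} > 0"
 then have "prob {s \<in> space K. f s \<ge> r} = 0" by (simp add: not_less measure_le_0_iff)
 then have "AE s in K. \<not> f s \<ge> r" by (subst (asm) prob_eq_0) auto
 then have "AE \<omega> in P. \<forall>i. \<not> f (\<omega> i) \<ge> r" unfolding AE_all_countable
  by (intro allI AE_coord[where Q="\<lambda>s. \<not> f s \<ge> r"])
 then have "AE \<omega> in P. regular \<omega> \<and> (\<omega> \<in> A \<longrightarrow> R y \<omega> = r) \<and> (\<forall>i. \<not> f (\<omega> i) \<ge> r)"
  using AE_regular A(2) by eventually_elim blast
 from exists_point[OF A(1) this] obtain \<omega> where r: "regular \<omega>" and R: "R y \<omega> = r" and lt: "\<And>i. \<not> f (\<omega> i) \<ge> r" by blast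
 obtain n where n: "Np y \<omega> = Suc n" using Np_props(1)[OF r, of y] y by (cases "Np y \<omega>") auto
 have "U n \<omega> \<le> y" using Np_props(2)[OF r, of n y] n by simp
 then show False using R lt[of "Suc n"] unfolding overshoot_def n U_Suc by simp
qed

text \<open>A conditional expectation is a quotient of expectations under the joint law, once the
  conditioning event is an overshoot event at a lattice level. The joint limit is a product, so the
  factor that belongs to the overshoot cancels.\<close>

theorem conditional_limit:
 fixes E :: "real \<Rightarrow> (nat \<Rightarrow> 's) set"
 assumes h: "h > 0" and lat: "AE s in K. f s \<in> multiples h"
  and max: "\<And>c. c > 0 \<Longrightarrow> AE s in K. f s \<in> multiples c \<Longrightarrow> c \<le> h"
  and j: "j \<ge> 1" and N: "N = Nm \<or> N = Np"
  and E: "\<And>x. x \<in> D \<Longrightarrow> E x \<in> sets P" and pos: "\<And>x. x \<in> D \<Longrightarrow> pp.P.prob (E x) > 0"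
  and shift: "\<And>x. x \<in> D \<Longrightarrow> x \<ge> x0 \<Longrightarrow> \<exists>y\<in>multiples h. \<bar>y - x\<bar> \<le> C \<and> (AE \<omega> in P. \<omega> \<in> E x \<longleftrightarrow> R y \<omega> = real j * h)"
  and cont: "continuous_on UNIV \<phi>" and B: "\<And>v. \<bar>\<phi> v\<bar> \<le> B"
 shows "((\<lambda>x. (\<integral>\<omega>. \<phi> (Vst N x \<omega>) * indicator (E x) \<omega> \<partial>P) / pp.P.prob (E x)) \<longlongrightarrow>
  (\<integral>v. \<phi> v \<partial>centered_normal limit_variance)) (at_top \<sqinter> principal D)"
proof (rule tendsto_at_top_within_sequentially[where ?x0.0="max x0 C"])
 fix x :: "nat \<Rightarrow> real"
 assume x: "filterlim x at_top sequentially" and xD: "\<And>k. x k \<in> D" and x0: "\<And>k. x k \<ge> max x0 C"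
 define r where "r = real j * h"
 define \<rho> where "\<rho> = lattice_law h"
 have \<rho>rd: "real_distribution \<rho>" unfolding \<rho>_def by (rule real_distribution_lattice_law)
 interpret \<rho>: real_distribution \<rho> by (rule \<rho>rd)
 interpret G: real_distribution "centered_normal limit_variance"
  by (rule real_distribution_centered_normal[OF Lst_clt(1)[OF x]])
 interpret G\<rho>: pair_prob_space "centered_normal limit_variance" \<rho> ..
 have "\<exists>y. y \<in> multiples h \<and> \<bar>y - x k\<bar> \<le> C \<and> (AE \<omega> in P. \<omega> \<in> E (x k) \<longleftrightarrow> R y \<omega> = r)" for k
  unfolding r_def Bex_def[symmetric] by (rule shift[OF xD]) (use x0[of k] in simp)
 then have "\<exists>y. \<forall>k. y k \<in> multiples h \<and> \<bar>y k - x k\<bar> \<le> C \<and> (AE \<omega> in P. \<omega> \<in> E (x k) \<longleftrightarrow> R (y k) \<omega> = r)"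
  by (intro choice allI)
 then obtain y where y0: "\<forall>k. y k \<in> multiples h \<and> \<bar>y k - x k\<bar> \<le> C \<and> (AE \<omega> in P. \<omega> \<in> E (x k) \<longleftrightarrow> R (y k) \<omega> = r)" ..
 note y = y0[rule_format, THEN conjunct1] y0[rule_format, THEN conjunct2, THEN conjunct1] y0[rule_format, THEN conjunct2, THEN conjunct2]
 note [measurable] = Vst_stopped_measurable[OF N] borel_measurable_continuous_onI[OF cont]
 \<comment> \<open>A continuous function that agrees with the indicator of {r} on the lattice, as
   the joint limit admits only continuous test functions.\<close>
 define tent where "tent s = max 0 (1 - \<bar>s - r\<bar> / h)" for s
 have tent_cont: "continuous_on UNIV tent" unfolding tent_def[abs_def] by (intro continuous_intros) (use h in auto)
 have tent_bd: "0 \<le> tent s" "tent s \<le> 1" for s unfolding tent_def using h by auto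
 have tent_lattice: "tent s = indicator {r} s" if "s \<in> multiples h" for s
 proof (cases "s = r")
  case False
  have "h \<le> \<bar>s - r\<bar>"
   using multiples_gap[OF h that multiples_of_nat[of j h]] multiples_gap[OF h multiples_of_nat[of j h] that] False unfolding r_def by linarith
  then show ?thesis using h False by (simp add: tent_def)
 qed (simp add: tent_def)
 have [measurable]: "tent \<in> borel_measurable borel" by (rule borel_measurable_continuous_onI[OF tent_cont])
 have tent_int: "integrable \<rho> tent" by (rule \<rho>.integrable_const_bound[where B=1]) (use tent_bd in auto)
 define \<tau> where "\<tau> = (\<integral>s. tent s \<partial>\<rho>)"
 have key: "(\<lambda>k. \<integral>\<omega>. \<phi> (Vst N (x k) \<omega>) * indicator (E (x k)) \<omega> \<partial>P) \<longlonglongrightarrow> (\<integral>v. \<phi> v \<partial>centered_normal limit_variance) * \<tau>"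
  if cont: "continuous_on UNIV \<phi>" and B: "\<And>v. \<bar>\<phi> v\<bar> \<le> B" for \<phi> :: "real \<Rightarrow> real" and B
 proof -
  have [measurable]: "\<phi> \<in> borel_measurable borel" by (rule borel_measurable_continuous_onI[OF cont])
  have bd: "\<bar>\<phi> (fst z) * tent (snd z)\<bar> \<le> B" for z
  proof -
   have "\<bar>\<phi> (fst z)\<bar> * \<bar>tent (snd z)\<bar> \<le> B * 1" using B tent_bd order_trans[OF abs_ge_zero B] by (intro mult_mono) auto
   then show ?thesis by (simp add: abs_mult)
  qed
  have "(\<lambda>k. \<integral>\<omega>. \<phi> (fst (Vst N (x k) \<omega>, R (y k) \<omega>)) * tent (snd (Vst N (x k) \<omega>, R (y k) \<omega>)) \<partial>P) \<longlonglongrightarrow>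
    (\<integral>z. \<phi> (fst z) * tent (snd z) \<partial>(centered_normal limit_variance \<Otimes>\<^sub>M \<rho>))"
  proof (rule joint_limit_continuous[OF \<rho>rd _ AE_diff_U_lattice[OF lat] x y(1,2) N _ bd])
   show "((\<lambda>z. \<integral>\<omega>. \<psi> (R z \<omega>) \<partial>P) \<longlongrightarrow> (\<integral>r. \<psi> r \<partial>\<rho>)) (at_top \<sqinter> principal (multiples h))"
    if "\<And>r. \<bar>\<psi> r\<bar> \<le> B" "\<And>r r'. \<bar>\<psi> r - \<psi> r'\<bar> \<le> L * \<bar>r - r'\<bar>" for \<psi> B L
    unfolding \<rho>_def by (rule overshoot_limit_lattice_lipschitz[OF h lat max that])
   show "continuous_on UNIV (\<lambda>z. \<phi> (fst z) * tent (snd z))"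
    by (intro continuous_intros continuous_on_compose2[OF cont] continuous_on_compose2[OF tent_cont]) auto
  qed
  moreover have "(\<integral>z. \<phi> (fst z) * tent (snd z) \<partial>(centered_normal limit_variance \<Otimes>\<^sub>M \<rho>)) = (\<integral>v. \<phi> v \<partial>centered_normal limit_variance) * \<tau>"
  proof -
   have sets: "sets (centered_normal limit_variance \<Otimes>\<^sub>M \<rho>) = sets (borel \<Otimes>\<^sub>M borel)"
    by (rule sets_pair_measure_cong[OF G.events_eq_borel \<rho>.events_eq_borel])
   have "integrable (centered_normal limit_variance \<Otimes>\<^sub>M \<rho>) (\<lambda>z. \<phi> (fst z) * tent (snd z))"
   proof (rule G\<rho>.P.integrable_const_bound[where B=B])
    show "(\<lambda>z. \<phi> (fst z) * tent (snd z)) \<in> borel_measurable (centered_normal limit_variance \<Otimes>\<^sub>M \<rho>)"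
     unfolding measurable_cong_sets[OF sets refl] by measurable
   qed (use bd in simp)
   from G\<rho>.integral_fst'[OF this] show ?thesis by (simp add: \<tau>_def)
  qed
  moreover have "(\<integral>\<omega>. \<phi> (fst (Vst N (x k) \<omega>, R (y k) \<omega>)) * tent (snd (Vst N (x k) \<omega>, R (y k) \<omega>)) \<partial>P) = (\<integral>\<omega>. \<phi> (Vst N (x k) \<omega>) * indicator (E (x k)) \<omega> \<partial>P)" for k
  proof (rule integral_cong_AE)
   show "AE \<omega> in P. \<phi> (fst (Vst N (x k) \<omega>, R (y k) \<omega>)) * tent (snd (Vst N (x k) \<omega>, R (y k) \<omega>)) = \<phi> (Vst N (x k) \<omega>) * indicator (E (x k)) \<omega>"
    using AE_R_lattice[OF lat y(1)[of k]] y(3)[of k]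
   proof eventually_elim
    case (elim \<omega>)
    then show ?case by (simp add: tent_lattice indicator_def)
   qed
   show "(\<lambda>\<omega>. \<phi> (Vst N (x k) \<omega>) * indicator (E (x k)) \<omega>) \<in> borel_measurable P" using E[OF xD] by measurable
  qed measurable
  ultimately show ?thesis by simp
 qed
 \<comment> \<open>One conditioning event of positive probability suffices: it forces the limit law
   to charge r, so the denominators have a positive limit.\<close>
 have "y 0 \<ge> 0" using y(2)[of 0] x0[of 0] by linarith
 then have "prob {s \<in> space K. f s \<ge> r} > 0"
  by (rule overshoot_atom_pos[OF _ pos[OF xD[of 0]]]) (use y(3)[of 0] in eventually_elim, simp)
 then have "measure \<rho> {r} > 0"
  unfolding r_def \<rho>_def measure_lattice_law[OF h lat j] using h \<mu>_pos by simp
 also have "measure \<rho> {r} = (\<integral>s. indicator {r} s \<partial>\<rho>)" by simp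
 also have "\<dots> \<le> \<tau>" unfolding \<tau>_def
 proof (rule integral_mono[OF _ tent_int])
  show "integrable \<rho> (\<lambda>s. indicator {r} s :: real)" by (rule \<rho>.integrable_const_bound[where B=1]) (auto simp del: indicator_simps split: split_indicator)
  show "indicator {r} s \<le> tent s" for s by (cases "s = r") (simp_all add: tent_bd(1), simp add: tent_def)
 qed
 finally have \<tau>: "\<tau> > 0" .
 have "pp.P.prob (E (x k)) = (\<integral>\<omega>. 1 * indicator (E (x k)) \<omega> \<partial>P)" for k using E[OF xD] by simp
 then have "(\<lambda>k. pp.P.prob (E (x k))) \<longlonglongrightarrow> (\<integral>v. 1 \<partial>centered_normal limit_variance) * \<tau>"
  using key[of "\<lambda>_. 1" 1] by (simp del: mult_1)
 then have "(\<lambda>k. pp.P.prob (E (x k))) \<longlonglongrightarrow> \<tau>" using G.prob_space by simp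
 from tendsto_divide[OF key[OF cont B] this] \<tau>
 show "(\<lambda>k. (\<integral>\<omega>. \<phi> (Vst N (x k) \<omega>) * indicator (E (x k)) \<omega> \<partial>P) / pp.P.prob (E (x k))) \<longlonglongrightarrow> (\<integral>v. \<phi> v \<partial>centered_normal limit_variance)"
  by simp
qed

end

section \<open>Lattice steps\<close>

context renewal_process
begin

text \<open>A nonzero atom of the step is, up to sign, a positive multiple of every admissible h, so
  those h that are at least c are among finitely many quotients of it and a largest one
  exists.\<close>

lemma span_exists:
 assumes c: "c > 0" and lat: "AE s in K. f s \<in> multiples c"
 obtains h where "h > 0" "AE s in K. f s \<in> multiples h" "\<And>c. c > 0 \<Longrightarrow> AE s in K. f s \<in> multiples c \<Longrightarrow> c \<le> h"
proof -
 define G where "G = {h. h > 0 \<and> (AE s in K. f s \<in> multiples h)}"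
 have "\<exists>i::int. i \<noteq> 0 \<and> prob {s \<in> space K. f s = of_int i * c} > 0"
 proof (rule ccontr)
  assume "\<not> (\<exists>i::int. i \<noteq> 0 \<and> prob {s \<in> space K. f s = of_int i * c} > 0)"
  then have "prob {s \<in> space K. f s = of_int i * c} = 0" if "i \<noteq> 0" for i :: int
   using that by (auto simp: zero_less_measure_iff)
  then have "AE s in K. f s \<noteq> of_int i * c" if "i \<noteq> 0" for i :: int
   using that by (subst (asm) prob_eq_0) auto
  then have "AE s in K. \<forall>i::int. i \<noteq> 0 \<longrightarrow> f s \<noteq> of_int i * c"
   unfolding AE_all_countable by auto
  with lat have "AE s in K. f s = 0"
  proof eventually_elim
   case (elim s)
   then obtain i :: int where "f s = of_int i * c" by (auto simp: multiples_def)
   with elim(2) show ?case by (cases "i = 0") auto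
  qed
  then have "(\<integral>s. f s \<partial>K) = 0" by (rule integral_eq_zero_AE)
  with f_mean_pos show False by simp
 qed
 then obtain i :: int where i: "i \<noteq> 0" "prob {s \<in> space K. f s = of_int i * c} > 0" by blast
 define v where "v = \<bar>of_int i\<bar> * c"
 have v: "v > 0" using i(1) c by (simp add: v_def)
 have G: "\<exists>k::nat. k \<ge> 1 \<and> v = real k * h" if "h \<in> G" for h
 proof -
  have h: "h > 0" "AE s in K. f s \<in> multiples h" using that by (auto simp: G_def)
  obtain s where "f s = of_int i * c" "f s \<in> multiples h" using exists_point[OF i(2) h(2)] by auto
  then obtain l :: int where l: "of_int i * c = of_int l * h" by (auto simp: multiples_def)
  then have "v = \<bar>of_int l * h\<bar>" using c by (simp add: v_def abs_mult flip: l)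
  then have "v = real (nat \<bar>l\<bar>) * h" using h(1) by (simp add: abs_mult)
  moreover from this have "nat \<bar>l\<bar> \<ge> 1" using v by (cases "nat \<bar>l\<bar>") auto
  ultimately show ?thesis by blast
 qed
 have "{h \<in> G. h \<ge> c} \<subseteq> (\<lambda>k. v / real k) ` {1..nat \<lceil>v / c\<rceil>}"
 proof
  fix h assume "h \<in> {h \<in> G. h \<ge> c}"
  then have h: "h \<in> G" "h \<ge> c" by auto
  obtain k :: nat where k: "k \<ge> 1" "v = real k * h" using G[OF h(1)] by blast
  have "real k * c \<le> v" using h(2) unfolding k(2) by (intro mult_left_mono) auto
  then have "real k \<le> v / c" using c by (simp add: le_divide_eq)
  then have "k \<le> nat \<lceil>v / c\<rceil>" by linarith
  then show "h \<in> (\<lambda>k. v / real k) ` {1..nat \<lceil>v / c\<rceil>}" using k by (intro image_eqI[of _ _ k]) auto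
 qed
 then have fin: "finite {h \<in> G. h \<ge> c}" by (rule finite_subset) simp
 have ne: "c \<in> {h \<in> G. h \<ge> c}" using c lat by (simp add: G_def)
 define h where "h = Max {h \<in> G. h \<ge> c}"
 have hG: "h \<in> {h \<in> G. h \<ge> c}" unfolding h_def using fin ne by (intro Max_in) auto
 show thesis
 proof (rule that[of h])
  show "h > 0" "AE s in K. f s \<in> multiples h" using hG by (auto simp: G_def)
  show "c' \<le> h" if "c' > 0" "AE s in K. f s \<in> multiples c'" for c'
  proof (cases "c' \<ge> c")
   case True
   then show ?thesis unfolding h_def using fin that by (intro Max_ge) (auto simp: G_def)
  qed (use hG in auto)
 qed
qed

text \<open>If h > 1, an integer level x need not be a lattice point. But x + k is one, as the walk
  stands there with positive probability. Going back by j h gives a lattice point y in (x - h, x];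
  since (y, x] contains no lattice point, both levels are passed at the same index.\<close>

lemma overshoot_event_shift:
 assumes h: "h > 0" and lat: "AE s in K. f s \<in> multiples h"
  and pos: "pp.P.prob {\<omega> \<in> space P. R x \<omega> = k} > 0" and j: "k \<le> real j * h" "real j * h < k + h"
 shows "\<exists>y\<in>multiples h. \<bar>y - x\<bar> \<le> h \<and> (AE \<omega> in P. \<omega> \<in> {\<omega> \<in> space P. R x \<omega> = k} \<longleftrightarrow> R y \<omega> = real j * h)"
proof -
 define y where "y = x + k - real j * h"
 obtain \<omega> where "R x \<omega> = k" "\<forall>n. U n \<omega> \<in> multiples h" using exists_point[OF pos AE_U_lattice[OF lat]] by blast
 then have "x + k \<in> multiples h" unfolding overshoot_def by (metis add.commute diff_add_cancel)
 then have y: "y \<in> multiples h" unfolding y_def by (rule multiples_diff) (rule multiples_of_nat)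
 have "AE \<omega> in P. \<omega> \<in> {\<omega> \<in> space P. R x \<omega> = k} \<longleftrightarrow> R y \<omega> = real j * h"
  using AE_U_lattice[OF lat] AE_space
 proof eventually_elim
  case (elim \<omega>)
  have "U n \<omega> > x \<longleftrightarrow> U n \<omega> > y" for n
  proof
   assume "U n \<omega> > y"
   then have "y + h \<le> U n \<omega>" using elim(1) by (intro multiples_gap[OF h y]) auto
   then show "U n \<omega> > x" using j(2) unfolding y_def by linarith
  next
   assume "U n \<omega> > x" then show "U n \<omega> > y" using j(1) unfolding y_def by linarith
  qed
  then have "Np x \<omega> = Np y \<omega>" unfolding N_plus_def by simp
  then show ?case using elim(2) unfolding overshoot_def y_def by auto
 qed
 moreover have "\<bar>y - x\<bar> \<le> h" using j unfolding y_def by linarith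
 ultimately show ?thesis using y by blast
qed

text \<open>The first lattice value above x - h is x, so the walk visits x exactly if its overshoot
  over x - h is h.\<close>

lemma hitting_event_shift:
 assumes h: "h > 0" and lat: "AE s in K. f s \<in> multiples h" and x0: "x \<ge> 0"
  and pos: "pp.P.prob {\<omega> \<in> space P. U (Nm x \<omega>) \<omega> = x} > 0"
 shows "\<exists>y\<in>multiples h. \<bar>y - x\<bar> \<le> h \<and> (AE \<omega> in P. \<omega> \<in> {\<omega> \<in> space P. U (Nm x \<omega>) \<omega> = x} \<longleftrightarrow> R y \<omega> = real 1 * h)"
proof (intro bexI conjI)
 obtain \<omega> where "U (Nm x \<omega>) \<omega> = x" "\<forall>n. U n \<omega> \<in> multiples h" using exists_point[OF pos AE_U_lattice[OF lat]] by blast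
 then have x: "x \<in> multiples h" by metis
 show "x - h \<in> multiples h" using multiples_diff[OF x multiples_of_nat[of 1 h]] by simp
 show "\<bar>x - h - x\<bar> \<le> h" using h by simp
 show "AE \<omega> in P. \<omega> \<in> {\<omega> \<in> space P. U (Nm x \<omega>) \<omega> = x} \<longleftrightarrow> R (x - h) \<omega> = real 1 * h"
  using AE_U_lattice[OF lat] AE_space AE_regular
 proof eventually_elim
  case (elim \<omega>)
  define n m where "n = Np (x - h) \<omega>" and "m = Nm x \<omega>"
  have m: "Suc m = Np x \<omega>" unfolding m_def by (rule Nm_eq[OF elim(3) x0])
  have Um: "U m \<omega> \<le> x" using Np_props(2)[OF elim(3), of m x] m by simp
  have "x - h + h \<le> U n \<omega>"
   using elim(1) Np_props(1)[OF elim(3), of "x - h"] by (intro multiples_gap[OF h \<open>x - h \<in> multiples h\<close>]) (auto simp: n_def)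
  then have Un: "x \<le> U n \<omega>" by simp
  have "U m \<omega> = x \<longleftrightarrow> U n \<omega> = x"
  proof
   assume "U m \<omega> = x"
   then have "n \<le> m" unfolding n_def using h by (intro Np_props(3)[OF elim(3)]) simp
   then show "U n \<omega> = x" using regular_mono[OF elim(3)] Un Um by (meson order_antisym order_trans)
  next
   assume eq: "U n \<omega> = x"
   have "n \<le> m"
   proof (rule ccontr)
    assume "\<not> n \<le> m"
    then have "U (Np x \<omega>) \<omega> \<le> U n \<omega>" using m by (intro regular_mono[OF elim(3)]) simp
    then show False using Np_props(1)[OF elim(3), of x] eq by simp
   qed
   then show "U m \<omega> = x" using regular_mono[OF elim(3), of n m] Um eq by simp
  qed
  then show ?case using elim(2) unfolding overshoot_def n_def m_def by auto
 qed
qed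

end

section \<open>Transfer to the given sample\<close>

lemma (in prob_space) integral_uniform_measure:
 assumes A: "A \<in> events" "prob A > 0" and \<phi>: "(\<phi> :: 'a \<Rightarrow> real) \<in> borel_measurable M"
 shows "(\<integral>\<omega>. \<phi> \<omega> \<partial>uniform_measure M A) = (\<integral>\<omega>. \<phi> \<omega> * indicator A \<omega> \<partial>M) / prob A"
proof -
 have "uniform_measure M A = density M (\<lambda>\<omega>. ennreal (indicator A \<omega> / prob A))"
  unfolding uniform_measure_def emeasure_eq_measure using A(2)
  by (intro arg_cong[where f="density M"] ext) (auto simp: divide_ennreal indicator_def simp flip: ennreal_1)
 then have "(\<integral>\<omega>. \<phi> \<omega> \<partial>uniform_measure M A) = (\<integral>\<omega>. (indicator A \<omega> / prob A) * \<phi> \<omega> \<partial>M)"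
  using A \<phi> by (simp add: integral_real_density)
 also have "\<dots> = (\<integral>\<omega>. \<phi> \<omega> * indicator A \<omega> / prob A \<partial>M)" by (simp add: mult.commute)
 finally show ?thesis by simp
qed

lemma multiples_borel [measurable]: "multiples h \<in> sets borel"
 unfolding multiples_def by (rule sets.countable) auto

locale ustat_sample =
 fixes M :: "'w measure" and S :: "'s measure" and X :: "nat \<Rightarrow> 'w \<Rightarrow> 's" and d :: nat
  and f :: "'s \<Rightarrow> real" and g :: "(nat \<Rightarrow> 's) \<Rightarrow> real"
 assumes prob_M: "prob_space M"
  and indep: "prob_space.indep_vars M (\<lambda>_. S) X UNIV"
  and same_law: "\<And>i. distr M S (X i) = distr M S (X 0)"
  and d_ge_1: "d \<ge> 1"
  and f_borel: "f \<in> borel_measurable S"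
  and g_borel: "g \<in> borel_measurable (Pi\<^sub>M {1..d} (\<lambda>_. S))"
  and f_L2: "integrable M (\<lambda>\<omega>. (f (X 0 \<omega>))\<^sup>2)"
  and g_square: "integrable M (\<lambda>\<omega>. (g (\<lambda>j\<in>{1..d}. X j \<omega>))\<^sup>2)"
  and mean_f_pos: "mean_f M f X > 0"
  and f_ge_0: "AE \<omega> in M. f (X 0 \<omega>) \<ge> 0"
begin

sublocale M: prob_space M by (rule prob_M)

abbreviation "K \<equiv> distr M S (X 0)"

lemma X_measurable [measurable]: "X i \<in> measurable M S"
 using indep by (simp add: M.indep_vars_def)

text \<open>The sample path as a point of the sequence space. Its law is \<open>P\<close>, so
  results about coordinates transfer to the sample.\<close>

definition T :: "'w \<Rightarrow> nat \<Rightarrow> 's" where "T \<omega> = (\<lambda>i. X i \<omega>)"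

sublocale iid_kernel K d
 by (intro iid_kernel.intro iid_space.intro iid_kernel_axioms.intro M.prob_space_distr X_measurable d_ge_1)

lemma sets_P: "sets P = sets (PiM UNIV (\<lambda>_. S))" by (intro sets_PiM_cong) simp_all

lemma T_measurable [measurable]: "T \<in> measurable M P"
 unfolding T_def[abs_def] by (rule measurable_PiM_single') (auto simp: space_PiM PiE_iff measurable_space[OF X_measurable])

lemma distr_T: "distr M P T = P"
proof -
 have "distr M (PiM UNIV (\<lambda>_. S)) (\<lambda>x. \<lambda>i\<in>UNIV. X i x) = PiM UNIV (\<lambda>i. distr M S (X i))"
  using indep by (subst (asm) M.indep_vars_iff_distr_eq_PiM') auto
 also have "\<dots> = P" by (rule PiM_cong[OF refl same_law])
 finally have "distr M (PiM UNIV (\<lambda>_. S)) T = P" by (simp add: T_def[abs_def] restrict_def)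
 moreover have "distr M P T = distr M (PiM UNIV (\<lambda>_. S)) T" by (rule distr_cong) (simp_all add: sets_P)
 ultimately show ?thesis by simp
qed

lemma T_space: "\<omega> \<in> space M \<Longrightarrow> T \<omega> \<in> space P" by (rule measurable_space[OF T_measurable])

lemma integral_T: assumes h: "h \<in> borel_measurable P" shows "(\<integral>\<omega>. h (T \<omega>) \<partial>M) = (\<integral>\<omega>. (h \<omega> :: real) \<partial>P)"
proof -
 have "(\<integral>\<omega>. h \<omega> \<partial>distr M P T) = (\<integral>\<omega>. h (T \<omega>) \<partial>M)" by (rule integral_distr[OF T_measurable h])
 then show ?thesis by (simp only: distr_T)
qed

lemma prob_T: assumes E: "E \<in> sets P" shows "measure M {\<omega> \<in> space M. T \<omega> \<in> E} = measure P E"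
proof -
 have "measure (distr M P T) E = measure M (T -` E \<inter> space M)" by (rule measure_distr[OF T_measurable E])
 moreover have "T -` E \<inter> space M = {\<omega> \<in> space M. T \<omega> \<in> E}" by auto
 ultimately show ?thesis by (simp only: distr_T)
qed

lemma integral_X: "h \<in> borel_measurable K \<Longrightarrow> (\<integral>\<omega>. h (X 0 \<omega>) \<partial>M) = (\<integral>s. (h s :: real) \<partial>K)"
 by (subst integral_distr) auto

lemma tup_T: "tup id (T \<omega>) = (\<lambda>j\<in>{1..d}. X j \<omega>)" by (simp add: tup_def T_def)

lemma g_measurable: "g \<in> borel_measurable Q"
proof -
 have "sets Q = sets (Pi\<^sub>M {1..d} (\<lambda>_. S))" by (intro sets_PiM_cong) simp_all
 then show ?thesis using g_borel by (simp cong: measurable_cong_sets)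
qed

lemma L2_g: "L2 g"
 unfolding L2_def
proof
 note [measurable] = g_measurable
 have "integrable M (\<lambda>\<omega>. (g (tup id (T \<omega>)))\<^sup>2)" using g_square by (simp add: tup_T)
 then have "integrable (distr M P T) (\<lambda>\<omega>. (g (tup id \<omega>))\<^sup>2)" by (subst integrable_distr_eq) auto
 then have "integrable P (\<lambda>\<omega>. (g (tup id \<omega>))\<^sup>2)" by (simp only: distr_T)
 then have "integrable (distr P Q (tup id)) (\<lambda>z. (g z)\<^sup>2)" by (subst integrable_distr_eq) auto
 then show "integrable Q (\<lambda>z. (g z)\<^sup>2)" by (simp only: distr_tup[OF inj_on_id])
qed (rule g_measurable)

sublocale ustat_renewal K f d g
proof unfold_locales
 show f: "f \<in> borel_measurable K" using f_borel by simp
 show "AE s in K. 0 \<le> f s" using f_ge_0 f_borel by (subst AE_distr_iff) auto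
 show "integrable K (\<lambda>s. (f s)\<^sup>2)" using f_L2 f_borel by (subst integrable_distr_eq) auto
 show "(\<integral>s. f s \<partial>K) > 0" using mean_f_pos integral_X[OF f] by (simp add: mean_f_def)
qed (rule L2_g)

lemma renewal_sum_T: "renewal_sum f X n \<omega> = U n (T \<omega>)" by (simp add: renewal_sum_def T_def)
lemma N_minus_T: "N_minus f X x \<omega> = Nm x (T \<omega>)" by (simp add: N_minus_def renewal_sum_T)
lemma N_plus_T: "N_plus f X x \<omega> = Np x (T \<omega>)" by (simp add: N_plus_def renewal_sum_T)
lemma overshoot_T: "overshoot f X x \<omega> = R x (T \<omega>)" by (simp add: overshoot_def renewal_sum_T N_plus_T)

lemma mean_f_eq: "mean_f M f X = \<mu>"
 unfolding mean_f_def \<mu>_def by (rule integral_X) measurable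

lemma mean_kernel_eq: "mean_kernel M d g X = mean g"
proof -
 note [measurable] = g_measurable
 have "mean_kernel M d g X = (\<integral>\<omega>. g (tup id (T \<omega>)) \<partial>M)" by (simp add: mean_kernel_def tup_T)
 also have "\<dots> = mean g" unfolding mean_def by (subst integral_T) (measurable, rule integral_tup[OF inj_on_id g_measurable])
 finally show ?thesis .
qed

lemma kernel_proj_eq: assumes a: "a \<in> {1..d}" and u: "u \<in> space K" shows "kernel_proj M d g X a u = proj g a u"
proof -
 have [measurable]: "(\<lambda>y. (tup id y)(a := u)) \<in> measurable P Q"
  using measurable_Pair2[OF freeze_measurable[OF a] u] by simp
 note [measurable] = g_measurable
 have "(\<lambda>j\<in>{1..d}. if j = a then u else X j \<omega>) = (tup id (T \<omega>))(a := u)" for \<omega>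
  using a by (auto simp: tup_T)
 then show ?thesis unfolding kernel_proj_def proj_def mean_kernel_eq
  by (simp add: integral_T[of "\<lambda>y. g ((tup id y)(a := u))"])
qed

lemma covar_eq:
 assumes u: "u \<in> borel_measurable K" "(\<integral>s. u s \<partial>K) = m" "\<And>\<omega>. \<omega> \<in> space M \<Longrightarrow> Y \<omega> = u (X 0 \<omega>)"
  and v: "v \<in> borel_measurable K" "(\<integral>s. v s \<partial>K) = m'" "\<And>\<omega>. \<omega> \<in> space M \<Longrightarrow> Z \<omega> = v (X 0 \<omega>)"
 shows "covar M Y Z = (\<integral>s. (u s - m) * (v s - m') \<partial>K)"
proof -
 note [measurable] = u(1) v(1)
 have "(\<integral>\<omega>. Y \<omega> \<partial>M) = m"
  by (rule trans[OF Bochner_Integration.integral_cong[OF refl u(3)] trans[OF integral_X[OF u(1)] u(2)]])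
 moreover have "(\<integral>\<omega>. Z \<omega> \<partial>M) = m'"
  by (rule trans[OF Bochner_Integration.integral_cong[OF refl v(3)] trans[OF integral_X[OF v(1)] v(2)]])
 ultimately have "covar M Y Z = (\<integral>\<omega>. (Y \<omega> - m) * (Z \<omega> - m') \<partial>M)" by (simp only: covar_def)
 also have "\<dots> = (\<integral>\<omega>. (u (X 0 \<omega>) - m) * (v (X 0 \<omega>) - m') \<partial>M)"
  by (rule Bochner_Integration.integral_cong[OF refl]) (simp only: u(3) v(3))
 also have "\<dots> = (\<integral>s. (u s - m) * (v s - m') \<partial>K)" by (rule integral_X) measurable
 finally show ?thesis .
qed

lemma X_space: "\<omega> \<in> space M \<Longrightarrow> X 0 \<omega> \<in> space K" using measurable_space[OF X_measurable] by simp

lemma rate_products: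
 "rate_g_limit\<^sup>2 = \<mu> powi (1 - 2 * int d)"
 "rate_g_limit * rate_f_limit / fact d = \<mu> powi (- 2 * int d) * mean g / (fact (d - 1) * fact d)"
 "rate_f_limit\<^sup>2 = \<mu> powi (- 2 * int d - 1) * (mean g)\<^sup>2 / (fact (d - 1))\<^sup>2"
proof -
 \<comment> \<open>With d = e + 1 the exponents are free of truncated subtraction, and all integer
   powers become powers of 1 / \<mu>.\<close>
 define e where "e = d - 1"
 have d: "int d = int e + 1" and e: "d - 1 = e" using d_ge_1 by (simp_all add: e_def)
 have i: "1 - 2 * int d = - int (2 * e + 1)" "- 2 * int d = - int (2 * e + 2)" "- 2 * int d - 1 = - int (2 * e + 3)" by (simp_all add: d)
 have s: "sqrt (1 / \<mu>) * sqrt (1 / \<mu>) = 1 / \<mu>" "(sqrt (1 / \<mu>))\<^sup>2 = 1 / \<mu>" using \<mu>_pos by (simp_all add: real_sqrt_mult_self)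
 have p: "\<mu> powi (- int n) = (1 / \<mu>) ^ n" for n by (simp add: power_int_minus power_one_over inverse_eq_divide)
 show "rate_g_limit\<^sup>2 = \<mu> powi (1 - 2 * int d)"
  unfolding i p rate_g_limit_def power_mult_distrib s e by (simp add: power_mult[symmetric] mult.commute power_add)
 have "rate_g_limit * rate_f_limit = ((1 / \<mu>) ^ e * (1 / \<mu>) ^ e) * (sqrt (1 / \<mu>) * sqrt (1 / \<mu>)) * (1 / \<mu>) * mean g / fact (d - 1)"
 proof -
  have "b * q * (q * (m * b / (u * F))) = (b * b) * (q * q) * (1 / u) * m / F" for b q m u F :: real
   by (simp add: divide_inverse mult_ac)
  then show ?thesis unfolding rate_g_limit_def rate_f_limit_def e .
 qed
 also have "\<dots> = (1 / \<mu>) ^ (2 * e + 2) * mean g / fact (d - 1)"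
  unfolding s by (simp add: power_add mult_2 power2_eq_square)
 finally show "rate_g_limit * rate_f_limit / fact d = \<mu> powi (- 2 * int d) * mean g / (fact (d - 1) * fact d)"
  unfolding i p by simp
 have "rate_f_limit\<^sup>2 = (sqrt (1 / \<mu>))\<^sup>2 * ((1 / \<mu>) ^ e)\<^sup>2 * (1 / \<mu>)\<^sup>2 * (mean g)\<^sup>2 / (fact (d - 1))\<^sup>2"
  unfolding rate_f_limit_def by (simp add: e power_mult_distrib power_divide)
 also have "\<dots> = (1 / \<mu>) ^ (2 * e + 3) * (mean g)\<^sup>2 / (fact (d - 1))\<^sup>2"
 proof -
  have "(a::real) ^ (2 * e + 3) = a * (a ^ e)\<^sup>2 * a\<^sup>2" for a
   unfolding mult_2 power_add power2_eq_square power3_eq_cube by (simp only: mult_ac)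
  then show ?thesis unfolding s by simp
 qed
 finally show "rate_f_limit\<^sup>2 = \<mu> powi (- 2 * int d - 1) * (mean g)\<^sup>2 / (fact (d - 1))\<^sup>2"
  unfolding i(3) p .
qed

text \<open>The three groups of terms agree one by one; projections have mean zero, so their
  covariances are plain integrals of products.\<close>

lemma gamma_sq_eq: "gamma_sq M d f g X = limit_variance"
proof -
 have gg: "covar M (\<lambda>\<omega>. kernel_proj M d g X i (X 0 \<omega>)) (\<lambda>\<omega>. kernel_proj M d g X j (X 0 \<omega>)) = (\<integral>s. proj g i s * proj g j s \<partial>K)"
  if "i \<in> {1..d}" "j \<in> {1..d}" for i j
  using covar_eq[OF proj_measurable[OF g_L2 that(1)] proj_mean[OF g_L2 that(1)] kernel_proj_eq[OF that(1) X_space]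
    proj_measurable[OF g_L2 that(2)] proj_mean[OF g_L2 that(2)] kernel_proj_eq[OF that(2) X_space]] by simp
 have fg: "covar M (\<lambda>\<omega>. f (X 0 \<omega>)) (\<lambda>\<omega>. kernel_proj M d g X i (X 0 \<omega>)) = (\<integral>s. (f s - \<mu>) * proj g i s \<partial>K)"
  if "i \<in> {1..d}" for i
  using covar_eq[OF f_measurable \<mu>_def[symmetric] refl proj_measurable[OF g_L2 that] proj_mean[OF g_L2 that] kernel_proj_eq[OF that X_space]] by simp
 have ff: "covar M (\<lambda>\<omega>. f (X 0 \<omega>)) (\<lambda>\<omega>. f (X 0 \<omega>)) = (\<integral>s. (f s - \<mu>)\<^sup>2 \<partial>K)"
  unfolding power2_eq_square by (rule covar_eq[OF f_measurable \<mu>_def[symmetric] refl f_measurable \<mu>_def[symmetric] refl])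
 have 1: "(\<Sum>i=1..d. \<Sum>j=1..d. fact (i + j - 2) * fact (2 * d - i - j) / (fact (i - 1) * fact (j - 1) * fact (d - i) * fact (d - j) * fact (2 * d - 1)) *
   covar M (\<lambda>\<omega>. kernel_proj M d g X i (X 0 \<omega>)) (\<lambda>\<omega>. kernel_proj M d g X j (X 0 \<omega>))) =
  (\<Sum>a\<in>{1..d}. \<Sum>c\<in>{1..d}. fact (a + c - 2) * fact (2 * d - a - c) / (fact (a - 1) * fact (c - 1) * fact (d - a) * fact (d - c) * fact (2 * d - 1)) * (\<integral>s. proj g a s * proj g c s \<partial>K))"
  by (intro sum.cong refl) (simp only: gg)
 have 2: "(\<Sum>i=1..d. covar M (\<lambda>\<omega>. f (X 0 \<omega>)) (\<lambda>\<omega>. kernel_proj M d g X i (X 0 \<omega>))) = (\<Sum>a\<in>{1..d}. \<integral>s. (f s - \<mu>) * proj g a s \<partial>K)"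
  by (intro sum.cong refl fg)
 have 3: "2 * (rate_g_limit * rate_f_limit) * (\<Sum>a\<in>{1..d}. 1 / fact d * (\<integral>s. (f s - \<mu>) * proj g a s \<partial>K)) =
   2 * (rate_g_limit * rate_f_limit / fact d) * (\<Sum>a\<in>{1..d}. \<integral>s. (f s - \<mu>) * proj g a s \<partial>K)"
  by (simp add: sum_divide_distrib[symmetric])
 show ?thesis
  unfolding gamma_sq_def Let_def mean_f_eq mean_kernel_eq limit_variance_def 1 2 3 ff rate_products ..
qed

text \<open>Positivity of x turns the real power with exponent d - 1/2 into
  \<open>x ^ (d - 1) * sqrt x\<close>.\<close>

lemma V_stat_eq:
 assumes N: "N x \<omega> = N' x (T \<omega>)" and x: "x > 0"
 shows "V_stat M d f g X N x \<omega> = Vst N' x (T \<omega>)"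
proof -
 define n where "n = N' x (T \<omega>)"
 have "ustat d g X n \<omega> = (\<Sum>i\<in>increasing_tuples d n. g (tup i (T \<omega>)))"
  by (simp add: ustat_def tup_def T_def)
 also have "\<dots> = centered_sum g n (T \<omega>) + mean g * real (n choose d)"
  unfolding centered_sum_def by (simp add: sum_subtractf card_increasing_tuples)
 finally have u: "ustat d g X n \<omega> = centered_sum g n (T \<omega>) + mean g * real (n choose d)" .
 have "real d - 1 / 2 = real (d - 1) + 1 / 2" using d_ge_1 by (simp add: of_nat_diff)
 then have xp: "x powr (real d - 1 / 2) = x ^ (d - 1) * sqrt x"
  using x by (simp only: powr_add powr_realpow powr_half_sqrt[OF less_imp_le])
 have P: "\<mu> powi (- int d) * mean g / fact d * x ^ d = mean g * ((x / \<mu>) ^ d / fact d)"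
  by (simp add: power_int_minus power_divide inverse_eq_divide)
 show ?thesis
  unfolding V_stat_def Vst_def N n_def[symmetric] u xp mean_f_eq mean_kernel_eq P
  by (rule arg_cong[where f="\<lambda>s. s / _"]) (simp add: right_diff_distrib)
qed

end

section \<open>The assertions for the given sample\<close>

context ustat_sample
begin

lemma stopping_index_cases:
 assumes "N = N_minus f X \<or> N = N_plus f X"
 obtains N' where "N' = Nm \<or> N' = Np" "\<And>x \<omega>. N x \<omega> = N' x (T \<omega>)"
 using assms
proof
 assume "N = N_minus f X" then show thesis by (intro that[of Nm]) (auto simp: N_minus_T)
next
 assume "N = N_plus f X" then show thesis by (intro that[of Np]) (auto simp: N_plus_T)
qed

lemma centered_normal_limit: "real_distribution (centered_normal limit_variance)"
 by (rule real_distribution_centered_normal[OF Lst_clt(1)[OF filterlim_real_sequentially]])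

text \<open>The witness for the joint law is the product measure, in which the two limits are
  independent. Restricting to x \<ge> 1 makes both forms of the statistic agree.\<close>

lemma joint_conv_sample:
 assumes N: "N = N_minus f X \<or> N = N_plus f X"
  and \<rho>: "real_distribution \<rho>" "Good \<rho>"
  and lim: "\<And>\<psi> B L. (\<And>r. \<bar>\<psi> r\<bar> \<le> B) \<Longrightarrow> (\<And>r r'. \<bar>\<psi> r - \<psi> r'\<bar> \<le> L * \<bar>r - r'\<bar>) \<Longrightarrow>
    ((\<lambda>z. \<integral>\<omega>. \<psi> (R z \<omega>) \<partial>P) \<longlongrightarrow> (\<integral>r. \<psi> r \<partial>\<rho>)) (at_top \<sqinter> principal A)"
  and inv: "\<And>z n. z \<in> A \<Longrightarrow> AE \<omega> in P. z - U n \<omega> \<in> A"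
 shows "joint_conv M (V_stat M d f g X N) (overshoot f X) (centered_normal (gamma_sq M d f g X)) Good (at_top \<sqinter> principal A)"
proof -
 interpret \<rho>: real_distribution \<rho> by (rule \<rho>(1))
 interpret G: real_distribution "centered_normal limit_variance" by (rule centered_normal_limit)
 interpret G\<rho>: pair_prob_space "centered_normal limit_variance" \<rho> ..
 obtain N' where N': "N' = Nm \<or> N' = Np" "\<And>x \<omega>. N x \<omega> = N' x (T \<omega>)" using stopping_index_cases[OF N] by blast
 note [measurable] = Vst_stopped_measurable[OF N'(1)]
 define \<nu> where "\<nu> = centered_normal limit_variance \<Otimes>\<^sub>M \<rho>"
 have "prob_space \<nu>" unfolding \<nu>_def by (rule G\<rho>.P.prob_space_axioms)
 moreover have "sets \<nu> = sets borel"
  unfolding \<nu>_def sets_pair_measure_cong[OF G.events_eq_borel \<rho>.events_eq_borel] borel_prod ..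
 moreover have "distr \<nu> borel fst = centered_normal limit_variance"
 proof -
  have "distr \<nu> borel fst = distr \<nu> (centered_normal limit_variance) fst" by (rule distr_cong) simp_all
  also have "\<dots> = centered_normal limit_variance" unfolding \<nu>_def by (rule \<rho>.distr_pair_fst)
  finally show ?thesis .
 qed
 moreover have "distr \<nu> borel snd = \<rho>"
 proof -
  have "distr \<nu> borel snd = distr \<nu> \<rho> snd" by (rule distr_cong) simp_all
  also have "\<dots> = \<rho>"
  proof (rule measure_eqI)
   fix B assume "B \<in> sets (distr \<nu> \<rho> snd)"
   then have B: "B \<in> sets \<rho>" by simp
   have "snd -` B \<inter> space \<nu> = space (centered_normal limit_variance) \<times> B"
    using sets.sets_into_space[OF B] by (auto simp: \<nu>_def space_pair_measure)
   moreover have "emeasure \<nu> (space (centered_normal limit_variance) \<times> B) = 1 * emeasure \<rho> B"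
    unfolding \<nu>_def G.emeasure_space_1[symmetric] by (rule \<rho>.emeasure_pair_measure_Times[OF sets.top B])
   moreover have "emeasure (distr \<nu> \<rho> snd) B = emeasure \<nu> (snd -` B \<inter> space \<nu>)"
    by (rule emeasure_distr[OF _ B]) (simp add: \<nu>_def)
   ultimately show "emeasure (distr \<nu> \<rho> snd) B = emeasure \<rho> B" by simp
  qed simp
  finally show ?thesis .
 qed
 moreover have "weak_conv_along (\<lambda>x. distr M borel (\<lambda>\<omega>. (V_stat M d f g X N x \<omega>, overshoot f X x \<omega>))) \<nu> (at_top \<sqinter> principal A)"
  unfolding weak_conv_along_def
 proof (intro allI impI, elim conjE)
  fix \<phi> :: "real \<times> real \<Rightarrow> real" assume cont: "continuous_on UNIV \<phi>" and "bounded (range \<phi>)"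
  then obtain B where B: "\<And>z. \<bar>\<phi> z\<bar> \<le> B" by (auto simp: bounded_iff)
  have [measurable]: "\<phi> \<in> borel_measurable (borel \<Otimes>\<^sub>M borel)"
   unfolding borel_prod by (rule borel_measurable_continuous_onI[OF cont])
  have eq: "(\<integral>z. \<phi> z \<partial>distr M borel (\<lambda>\<omega>. (V_stat M d f g X N x \<omega>, overshoot f X x \<omega>))) = (\<integral>\<omega>. \<phi> (Vst N' x \<omega>, R x \<omega>) \<partial>P)"
   if x: "x \<ge> 1" for x
  proof -
   have V: "V_stat M d f g X N x = (\<lambda>\<omega>. Vst N' x (T \<omega>))" using V_stat_eq[of N x _ N'] N'(2) x by auto
   have "(\<integral>z. \<phi> z \<partial>distr M borel (\<lambda>\<omega>. (V_stat M d f g X N x \<omega>, overshoot f X x \<omega>))) = (\<integral>\<omega>. \<phi> (Vst N' x (T \<omega>), R x (T \<omega>)) \<partial>M)"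
    unfolding V overshoot_T borel_prod[symmetric] by (rule integral_distr) measurable
   also have "\<dots> = (\<integral>\<omega>. \<phi> (Vst N' x \<omega>, R x \<omega>) \<partial>P)" by (rule integral_T) measurable
   finally show ?thesis .
  qed
  show "((\<lambda>x. \<integral>z. \<phi> z \<partial>distr M borel (\<lambda>\<omega>. (V_stat M d f g X N x \<omega>, overshoot f X x \<omega>))) \<longlongrightarrow> (\<integral>z. \<phi> z \<partial>\<nu>)) (at_top \<sqinter> principal A)"
  proof (rule tendsto_at_top_within_sequentially[where ?x0.0=1])
   fix x :: "nat \<Rightarrow> real" assume x: "filterlim x at_top sequentially" "\<And>k. x k \<in> A" "\<And>k. x k \<ge> 1"
   have "(\<lambda>k. \<integral>\<omega>. \<phi> (Vst N' (x k) \<omega>, R (x k) \<omega>) \<partial>P) \<longlonglongrightarrow> (\<integral>z. \<phi> z \<partial>\<nu>)"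
    unfolding \<nu>_def
   proof (rule joint_limit_continuous[OF \<rho>(1) _ inv x(1,2) _ N'(1) cont B])
    show "((\<lambda>z. \<integral>\<omega>. \<psi> (R z \<omega>) \<partial>P) \<longlongrightarrow> (\<integral>r. \<psi> r \<partial>\<rho>)) (at_top \<sqinter> principal A)"
     if "\<And>r. \<bar>\<psi> r\<bar> \<le> B" "\<And>r r'. \<bar>\<psi> r - \<psi> r'\<bar> \<le> L * \<bar>r - r'\<bar>" for \<psi> B L by (rule lim[OF that])
    show "\<bar>x k - x k\<bar> \<le> 0" for k by simp
   qed
   then show "(\<lambda>k. \<integral>z. \<phi> z \<partial>distr M borel (\<lambda>\<omega>. (V_stat M d f g X N (x k) \<omega>, overshoot f X (x k) \<omega>))) \<longlonglongrightarrow> (\<integral>z. \<phi> z \<partial>\<nu>)"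
    by (simp only: eq[OF x(3)])
  qed
 qed
 ultimately show ?thesis unfolding joint_conv_def gamma_sq_eq using \<rho>(2) by (intro exI[of _ \<nu>]) simp
qed

lemma cond_conv_sample:
 assumes N: "N = N_minus f X \<or> N = N_plus f X"
  and h: "h > 0" and lat: "AE s in K. f s \<in> multiples h"
  and max: "\<And>c. c > 0 \<Longrightarrow> AE s in K. f s \<in> multiples c \<Longrightarrow> c \<le> h"
  and j: "j \<ge> 1" and E: "\<And>x. E x \<in> sets P" and A: "\<And>x. A x = {\<omega> \<in> space M. T \<omega> \<in> E x}"
  and shift: "\<And>x. x \<ge> 0 \<Longrightarrow> pp.P.prob (E x) > 0 \<Longrightarrow> \<exists>y\<in>multiples h. \<bar>y - x\<bar> \<le> h \<and> (AE \<omega> in P. \<omega> \<in> E x \<longleftrightarrow> R y \<omega> = real j * h)"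
 shows "cond_conv_integers M (V_stat M d f g X N) A (centered_normal (gamma_sq M d f g X))"
 unfolding cond_conv_integers_def weak_conv_along_def gamma_sq_eq
proof (intro allI impI, elim conjE)
 fix \<phi> :: "real \<Rightarrow> real" assume cont: "continuous_on UNIV \<phi>" and "bounded (range \<phi>)"
 then obtain B where B: "\<And>z. \<bar>\<phi> z\<bar> \<le> B" by (auto simp: bounded_iff)
 obtain N' where N': "N' = Nm \<or> N' = Np" "\<And>x \<omega>. N x \<omega> = N' x (T \<omega>)" using stopping_index_cases[OF N] by blast
 note [measurable] = Vst_stopped_measurable[OF N'(1)] borel_measurable_continuous_onI[OF cont] E
 define D where "D = {x \<in> \<int>. measure M (A x) > 0}"
 have prob_A: "measure M (A x) = pp.P.prob (E x)" for x unfolding A by (rule prob_T[OF E])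
 have "((\<lambda>x. (\<integral>\<omega>. \<phi> (Vst N' x \<omega>) * indicator (E x) \<omega> \<partial>P) / pp.P.prob (E x)) \<longlongrightarrow>
  (\<integral>v. \<phi> v \<partial>centered_normal limit_variance)) (at_top \<sqinter> principal D)"
 proof (rule conditional_limit[where ?x0.0=0 and C=h, OF h lat max j N'(1) E _ _ cont B])
  show "pp.P.prob (E x) > 0" if "x \<in> D" for x using that by (simp add: D_def prob_A)
  show "\<exists>y\<in>multiples h. \<bar>y - x\<bar> \<le> h \<and> (AE \<omega> in P. \<omega> \<in> E x \<longleftrightarrow> R y \<omega> = real j * h)" if "x \<in> D" "x \<ge> 0" for x
   by (rule shift[OF that(2)]) (use that(1) in \<open>simp add: D_def prob_A\<close>)
 qed
 moreover have "\<forall>\<^sub>F x in at_top \<sqinter> principal D.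
   (\<integral>\<omega>. \<phi> (Vst N' x \<omega>) * indicator (E x) \<omega> \<partial>P) / pp.P.prob (E x) = (\<integral>v. \<phi> v \<partial>distr (uniform_measure M (A x)) borel (V_stat M d f g X N x))"
  unfolding eventually_inf_principal using eventually_ge_at_top[of 1]
 proof (eventually_elim, intro impI)
  case (elim x)
  assume xD: "x \<in> D"
  have V: "V_stat M d f g X N x = (\<lambda>\<omega>. Vst N' x (T \<omega>))" using V_stat_eq[of N x _ N'] N'(2) elim by auto
  have Am: "A x \<in> sets M" unfolding A using E[of x] by measurable
  have "(\<integral>v. \<phi> v \<partial>distr (uniform_measure M (A x)) borel (V_stat M d f g X N x)) = (\<integral>\<omega>. \<phi> (Vst N' x (T \<omega>)) \<partial>uniform_measure M (A x))"
   unfolding V by (rule integral_distr) measurable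
  also have "\<dots> = (\<integral>\<omega>. \<phi> (Vst N' x (T \<omega>)) * indicator (A x) \<omega> \<partial>M) / measure M (A x)"
   by (rule M.integral_uniform_measure[OF Am]) (use xD in \<open>simp add: D_def\<close>, measurable)
  also have "(\<integral>\<omega>. \<phi> (Vst N' x (T \<omega>)) * indicator (A x) \<omega> \<partial>M) = (\<integral>\<omega>. \<phi> (Vst N' x (T \<omega>)) * indicator (E x) (T \<omega>) \<partial>M)"
   by (rule Bochner_Integration.integral_cong[OF refl]) (simp add: A indicator_def)
  also have "\<dots> = (\<integral>\<omega>. \<phi> (Vst N' x \<omega>) * indicator (E x) \<omega> \<partial>P)"
   by (rule integral_T[of "\<lambda>\<omega>. \<phi> (Vst N' x \<omega>) * indicator (E x) \<omega>"]) measurable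
  finally show "(\<integral>\<omega>. \<phi> (Vst N' x \<omega>) * indicator (E x) \<omega> \<partial>P) / pp.P.prob (E x) = (\<integral>v. \<phi> v \<partial>distr (uniform_measure M (A x)) borel (V_stat M d f g X N x))"
   unfolding prob_A by (rule sym)
 qed
 ultimately show "((\<lambda>x. \<integral>v. \<phi> v \<partial>distr (uniform_measure M (A x)) borel (V_stat M d f g X N x)) \<longlongrightarrow> (\<integral>v. \<phi> v \<partial>centered_normal limit_variance)) (at_top \<sqinter> principal {x \<in> \<int>. measure M (A x) > 0})"
  unfolding D_def[symmetric] by (rule Lim_transform_eventually)
qed

lemma AE_multiples_iff: "(AE s in K. f s \<in> multiples h) \<longleftrightarrow> (AE \<omega> in M. f (X 0 \<omega>) \<in> multiples h)"
 by (subst AE_distr_iff) (use f_borel in measurable)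

lemma has_span_iff:
 "has_span M (\<lambda>\<omega>. f (X 0 \<omega>)) h \<longleftrightarrow> h > 0 \<and> (AE s in K. f s \<in> multiples h) \<and> (\<forall>c>0. (AE s in K. f s \<in> multiples c) \<longrightarrow> c \<le> h)"
 unfolding has_span_def AE_multiples_iff ..

lemma prob_f_X: "B \<in> sets borel \<Longrightarrow> prob {s \<in> space K. f s \<in> B} = measure M {\<omega> \<in> space M. f (X 0 \<omega>) \<in> B}"
proof -
 assume [measurable]: "B \<in> sets borel"
 have "{s \<in> space K. f s \<in> B} \<in> sets S" using f_borel by simp
 then have "prob {s \<in> space K. f s \<in> B} = measure M (X 0 -` {s \<in> space K. f s \<in> B} \<inter> space M)" by (simp add: measure_distr)
 also have "X 0 -` {s \<in> space K. f s \<in> B} \<inter> space M = {\<omega> \<in> space M. f (X 0 \<omega>) \<in> B}"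
  using measurable_space[OF X_measurable, of _ 0] by auto
 finally show ?thesis .
qed

lemma joint_conv_nonarithmetic:
 assumes N: "N = N_minus f X \<or> N = N_plus f X" and non: "nonarithmetic M (\<lambda>\<omega>. f (X 0 \<omega>))"
 shows "joint_conv M (V_stat M d f g X N) (overshoot f X) (centered_normal (gamma_sq M d f g X)) (overshoot_limit_nonarith M f X) at_top"
proof -
 \<comment> \<open>If the step lived on any lattice, \<open>span_exists\<close> would produce a
   maximal one, contrary to nonarithmeticity.\<close>
 have na: "\<not> (AE s in K. f s \<in> multiples c)" if "c > 0" for c
 proof
  assume "AE s in K. f s \<in> multiples c"
  from span_exists[OF that this] show False using non unfolding nonarithmetic_def has_span_iff by metis
 qed
 have "overshoot_limit_nonarith M f X density_law"
  unfolding overshoot_limit_nonarith_def mean_f_eq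
  using real_distribution_density_law cdf_density_law prob_f_X[of "{s<..}" for s] by simp
 then have "joint_conv M (V_stat M d f g X N) (overshoot f X) (centered_normal (gamma_sq M d f g X)) (overshoot_limit_nonarith M f X) (at_top \<sqinter> principal UNIV)"
 proof (rule joint_conv_sample[OF N real_distribution_density_law])
  show "((\<lambda>z. \<integral>\<omega>. \<psi> (R z \<omega>) \<partial>P) \<longlongrightarrow> (\<integral>r. \<psi> r \<partial>density_law)) (at_top \<sqinter> principal UNIV)"
   if "\<And>r. \<bar>\<psi> r\<bar> \<le> B" "\<And>r r'. \<bar>\<psi> r - \<psi> r'\<bar> \<le> L * \<bar>r - r'\<bar>" for \<psi> B L
   unfolding top_eq_principal_UNIV[symmetric] inf_top_right by (rule overshoot_limit_nonarithmetic[OF that na])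
 qed simp
 then show ?thesis by simp
qed

lemma joint_conv_span:
 assumes N: "N = N_minus f X \<or> N = N_plus f X" and span: "has_span M (\<lambda>\<omega>. f (X 0 \<omega>)) h"
 shows "joint_conv M (V_stat M d f g X N) (overshoot f X) (centered_normal (gamma_sq M d f g X)) (overshoot_limit_span M f X h) (at_top \<sqinter> principal (multiples h))"
proof -
 have h: "h > 0" and lat: "AE s in K. f s \<in> multiples h" and max: "\<And>c. c > 0 \<Longrightarrow> AE s in K. f s \<in> multiples c \<Longrightarrow> c \<le> h"
  using span unfolding has_span_iff by auto
 have "overshoot_limit_span M f X h (lattice_law h)"
  unfolding overshoot_limit_span_def mean_f_eq
  using real_distribution_lattice_law measure_lattice_law[OF h lat] prob_f_X[of "{s..}" for s] by simp
 then show ?thesis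
  by (rule joint_conv_sample[OF N real_distribution_lattice_law])
   (rule overshoot_limit_lattice_lipschitz[OF h lat max], assumption+, rule AE_diff_U_lattice[OF lat])
qed

lemma cond_conv_integer_steps:
 assumes N: "N = N_minus f X \<or> N = N_plus f X" and int: "AE \<omega> in M. f (X 0 \<omega>) \<in> \<int>"
 shows "k \<ge> 1 \<Longrightarrow> cond_conv_integers M (V_stat M d f g X N) (\<lambda>x. {\<omega> \<in> space M. overshoot f X x \<omega> = real k}) (centered_normal (gamma_sq M d f g X))"
  and "cond_conv_integers M (V_stat M d f g X N) (\<lambda>x. {\<omega> \<in> space M. renewal_sum f X (N_minus f X x \<omega>) \<omega> = x}) (centered_normal (gamma_sq M d f g X))"
proof -
 have "multiples 1 = \<int>" by (simp add: multiples_def Ints_def)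
 then have "AE \<omega> in M. f (X 0 \<omega>) \<in> multiples 1" using int by simp
 then have "AE s in K. f s \<in> multiples 1" unfolding AE_multiples_iff .
 \<comment> \<open>The span of an integer-valued step may exceed 1, so the integers x need not be
   lattice points.\<close>
 from span_exists[OF zero_less_one this] obtain h where h: "h > 0" and lat: "AE s in K. f s \<in> multiples h"
  and max: "\<And>c. c > 0 \<Longrightarrow> AE s in K. f s \<in> multiples c \<Longrightarrow> c \<le> h" by blast
 show "cond_conv_integers M (V_stat M d f g X N) (\<lambda>x. {\<omega> \<in> space M. overshoot f X x \<omega> = real k}) (centered_normal (gamma_sq M d f g X))" if k: "k \<ge> 1"
 \<comment> \<open>Rounding k / h up gives the multiple of h in [k, k + h) that
   \<open>overshoot_event_shift\<close> asks for.\<close>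
 proof (rule cond_conv_sample[OF N h lat max, where E="\<lambda>x. {\<omega> \<in> space P. R x \<omega> = real k}" and j="nat \<lceil>real k / h\<rceil>"])
  have "0 < real k / h" using k h by simp
  then show "1 \<le> nat \<lceil>real k / h\<rceil>" by linarith
  have "real k / h \<le> real (nat \<lceil>real k / h\<rceil>)" "real (nat \<lceil>real k / h\<rceil>) < real k / h + 1"
   using \<open>0 < real k / h\<close> by linarith+
  moreover have "real k \<le> r * h \<and> r * h < real k + h" if "real k / h \<le> r" "r < real k / h + 1" for r
   using that h by (simp add: field_simps)
  ultimately have "real k \<le> real (nat \<lceil>real k / h\<rceil>) * h" "real (nat \<lceil>real k / h\<rceil>) * h < real k + h" by blast+
  then show "\<exists>y\<in>multiples h. \<bar>y - x\<bar> \<le> h \<and> (AE \<omega> in P. (\<omega> \<in> {\<omega> \<in> space P. R x \<omega> = real k}) = (R y \<omega> = real (nat \<lceil>real k / h\<rceil>) * h))"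
   if "0 < pp.P.prob {\<omega> \<in> space P. R x \<omega> = real k}" for x
   by (rule overshoot_event_shift[OF h lat that])
  show "{\<omega> \<in> space P. R x \<omega> = real k} \<in> sets P" for x by measurable
  show "{\<omega> \<in> space M. overshoot f X x \<omega> = real k} = {\<omega> \<in> space M. T \<omega> \<in> {\<omega> \<in> space P. R x \<omega> = real k}}" for x
   using T_space by (auto simp: overshoot_T)
 qed
 show "cond_conv_integers M (V_stat M d f g X N) (\<lambda>x. {\<omega> \<in> space M. renewal_sum f X (N_minus f X x \<omega>) \<omega> = x}) (centered_normal (gamma_sq M d f g X))"
 proof (rule cond_conv_sample[OF N h lat max, where E="\<lambda>x. {\<omega> \<in> space P. U (Nm x \<omega>) \<omega> = x}" and j=1])
  have "(\<lambda>\<omega>. U (Nm x \<omega>) \<omega>) \<in> borel_measurable P" for x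
   by (rule measurable_compose_countable[OF _ Nm_measurable]) measurable
  then show "{\<omega> \<in> space P. U (Nm x \<omega>) \<omega> = x} \<in> sets P" for x by measurable
  show "{\<omega> \<in> space M. renewal_sum f X (N_minus f X x \<omega>) \<omega> = x} = {\<omega> \<in> space M. T \<omega> \<in> {\<omega> \<in> space P. U (Nm x \<omega>) \<omega> = x}}" for x
   using T_space by (auto simp: renewal_sum_T N_minus_T)
  show "\<exists>y\<in>multiples h. \<bar>y - x\<bar> \<le> h \<and> (AE \<omega> in P. (\<omega> \<in> {\<omega> \<in> space P. U (Nm x \<omega>) \<omega> = x}) = (R y \<omega> = real 1 * h))"
   if "x \<ge> 0" "0 < pp.P.prob {\<omega> \<in> space P. U (Nm x \<omega>) \<omega> = x}" for x
   by (rule hitting_event_shift[OF h lat that])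
 qed simp_all
qed

end

theorem theorem3p13:
  fixes M :: "'w measure" and S :: "'s measure"
    and X :: "nat \<Rightarrow> 'w \<Rightarrow> 's"
    and d :: nat
    and f :: "'s \<Rightarrow> real" and g :: "(nat \<Rightarrow> 's) \<Rightarrow> real"
    and N :: "real \<Rightarrow> 'w \<Rightarrow> nat"
  assumes "prob_space M"
    and "prob_space.indep_vars M (\<lambda>_. S) X UNIV"
    and "\<And>i. distr M S (X i) = distr M S (X 0)"
    and "d \<ge> 1"
    and "f \<in> borel_measurable S"
    and "g \<in> borel_measurable (Pi\<^sub>M {1..d} (\<lambda>_. S))"
    and "integrable M (\<lambda>\<omega>. (f (X 0 \<omega>))\<^sup>2)"
    and "integrable M (\<lambda>\<omega>. (g (\<lambda>j\<in>{1..d}. X j \<omega>))\<^sup>2)"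
    and "mean_f M f X > 0"
    and "AE \<omega> in M. f (X 0 \<omega>) \<ge> 0"
    and "N = N_minus f X \<or> N = N_plus f X"
  shows
    "(nonarithmetic M (\<lambda>\<omega>. f (X 0 \<omega>)) \<longrightarrow>
       joint_conv M (V_stat M d f g X N) (overshoot f X)
         (centered_normal (gamma_sq M d f g X)) (overshoot_limit_nonarith M f X) at_top)
     \<and>
     (\<forall>h. has_span M (\<lambda>\<omega>. f (X 0 \<omega>)) h \<longrightarrow>
       joint_conv M (V_stat M d f g X N) (overshoot f X)
         (centered_normal (gamma_sq M d f g X)) (overshoot_limit_span M f X h)
         (at_top \<sqinter> principal (multiples h)))
     \<and>
     ((AE \<omega> in M. f (X 0 \<omega>) \<in> \<int>) \<longrightarrow>
       (\<forall>k::nat. k \<ge> 1 \<longrightarrow>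
          cond_conv_integers M (V_stat M d f g X N)
            (\<lambda>x. {\<omega> \<in> space M. overshoot f X x \<omega> = real k})
            (centered_normal (gamma_sq M d f g X))) \<and>
       cond_conv_integers M (V_stat M d f g X N)
         (\<lambda>x. {\<omega> \<in> space M. renewal_sum f X (N_minus f X x \<omega>) \<omega> = x})
         (centered_normal (gamma_sq M d f g X)))"
proof -
  interpret ustat_sample M S X d f g by (rule ustat_sample.intro) (fact assms)+
  show ?thesis
    using joint_conv_nonarithmetic[OF assms(11)] joint_conv_span[OF assms(11)] cond_conv_integer_steps[OF assms(11)] by blast
qed

end
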